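(* Let $m,n\ge 0$ be integers, $\lambda\subset m^n$ a partition, and $a,b,q,t\in\mathbb C^*$ generic. Let $c,d\in\mathbb C^*$ be chosen so that $q^mt^{n-1}abcd=p$. Then $$ D^{(n)}(a,b,c,d;q,t;p)\,P^{*(m,n)}_{\lambda}(;\sqrt q\,a,\sqrt q\,b;q,t;p) = \prod_{1\le i\le n}\theta(ab q^m t^{n-i},\,ac q^{\lambda_i}t^{n-i},\,bc q^{m-\lambda_i}t^{i-1};p)\; P^{*(m,n)}_{\lambda}(;a,b;q,t;p). $$
   Context: Fix $p\in\mathbb C$, $0<|p|<1$, and a square root $\sqrt q=q^{1/2}$ of $q$, used throughout. $\theta(x;p)=\prod_{k\ge 0}(1-p^kx)(1-p^{k+1}/x)$. Several arguments before the first semicolon mean the product over the arguments. Partitions are identified with diagrams $\{(i,j):1\le j\le\lambda_i\}$; $m^n$ is the partition with $n$ parts equal to $m$; for $\lambda\subset m^n$, $(m^n-\lambda)_i=m-\lambda_{n+1-i}$. $C^0_\lambda(x;q,t;p)=\prod_{(i,j)\in\lambda}\theta(q^{j-1}t^{1-i}x;p)$. Difference operator: acting on $BC_n$-symmetric meromorphic functions on $(\mathbb C^* )^n$ (invariant under permutations of the variables and each $x_i\mapsto 1/x_i$), $$(D^{(n)}(a,b,c,d;q,t;p)f)(x_1,\dots,x_n)=\sum_{\sigma\in\{\pm1\}^n}\prod_{1\le i\le n}\frac{\theta(ax_i^{\sigma_i},bx_i^{\sigma_i},cx_i^{\sigma_i},dx_i^{\sigma_i};p)}{\theta(x_i^{2\sigma_i};p)}\prod_{1\le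 i<j\le n}\frac{\theta(tx_i^{\sigma_i}x_j^{\sigma_j};p)}{\theta(x_i^{\sigma_i}x_j^{\sigma_j};p)}f(\dots q^{\sigma_i/2}x_i\dots).$$ Interpolation theta functions: a $BC_n$-symmetric theta function of degree $m$ is a holomorphic $f$ on $(\mathbb C^* )^n$ invariant under permutations of the $x_i$ and under each $x_i\mapsto1/x_i$, with $f(px_1,x_2,\dots,x_n)=(px_1^2)^{-m}f(x_1,\dots,x_n)$. For $\lambda\subset m^n$ and generic $a,b,q,t$, $P^{*(m,n)}_\lambda(x_1,\dots,x_n;a,b;q,t;p)$ is the unique $BC_n$-symmetric theta function of degree $m$ such that: (i) for every $\mu\subset m^n$, $\mu\ne\lambda$, it vanishes at the point with $x_i=bq^{m-\mu_i}t^{i-1}$ for $1\le i\le l$ and $x_i=aq^{\mu_i}t^{n-i}$ for $l<i\le n$, where $l_0$ is the largest index with $\mu_{l_0}\ne\lambda_{l_0}$, $l_1$ is the largest index with $\mu_{l_1}=m$ ($0$ if none), and $l=l_1$ if $\mu_{l_0}<\lambda_{l_0}$, $l=l_0$ otherwise; (ii) at $x_i=vt^{n-i}$ its value is $C^0_\lambda(t^{n-1}av,a/v;q,t;p)\,C^0_{m^n-\lambda}(t^{n-1}bv,b/v;q,t;p)$, for a generic $v\in\mathbb C^*$ (the function does not depend on $v$, which is therefore omitted from the notation). *)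

theory Defs
  imports "HOL-Analysis.Analysis" "HOL-Combinatorics.Permutations"
begin

definition theta :: "complex \<Rightarrow> complex \<Rightarrow> complex" where
  "theta x p = (\<Prod>k. (1 - p ^ k * x) * (1 - p ^ (k + 1) / x))"

text \<open>A partition with at most \<open>n\<close> parts is the function \<open>i \<mapsto> \<lambda> i\<close> on the indices \<open>1, \<dots>, n\<close>, extended
  by zero to all other indices (including the unused index \<open>0\<close>), so that distinct partitions are
  distinct functions.\<close>

definition partitions_in :: "nat \<Rightarrow> nat \<Rightarrow> (nat \<Rightarrow> nat) set" where
  "partitions_in m n =
    {l. (\<forall>i. i \<notin> {1..n} \<longrightarrow> l i = 0) \<and>
        (\<forall>i\<in>{1..n}. l i \<le> m) \<and>
        (\<forall>i j. 1 \<le> i \<and> i \<le> j \<and> j \<le> n \<longrightarrow> l j \<le> l i)}"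

definition diagram :: "(nat \<Rightarrow> nat) \<Rightarrow> (nat \<times> nat) set" where
  "diagram l = {(i, j). 1 \<le> i \<and> 1 \<le> j \<and> j \<le> l i}"

definition compl_part :: "nat \<Rightarrow> nat \<Rightarrow> (nat \<Rightarrow> nat) \<Rightarrow> nat \<Rightarrow> nat" where
  "compl_part m n l = (\<lambda>i. if i \<in> {1..n} then m - l (n + 1 - i) else 0)"

definition C0 :: "(nat \<Rightarrow> nat) \<Rightarrow> complex \<Rightarrow> complex \<Rightarrow> complex \<Rightarrow> complex \<Rightarrow> complex" where
  "C0 l x q t p =
    (\<Prod>(i, j)\<in>diagram l. theta (q powi (int j - 1) * t powi (1 - int i) * x) p)"

text \<open>The variables are \<open>x 1, \<dots>, x n\<close>. Points are extensional, so that \<open>torus n\<close> is a copy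
  of $(\mathbb{C}^*)^n$, also as a topological space; it is a single point for \<open>n = 0\<close>.\<close>

definition torus :: "nat \<Rightarrow> (nat \<Rightarrow> complex) set" where
  "torus n = {1..n} \<rightarrow>\<^sub>E (- {0})"

text \<open>Holomorphy in several variables: joint continuity and holomorphy in each variable.\<close>

definition holomorphic_on_torus :: "nat \<Rightarrow> ((nat \<Rightarrow> complex) \<Rightarrow> complex) \<Rightarrow> bool" where
  "holomorphic_on_torus n f \<longleftrightarrow>
    continuous_on (torus n) f \<and>
    (\<forall>x\<in>torus n. \<forall>i\<in>{1..n}. (\<lambda>z. f (x(i := z))) holomorphic_on (- {0}))"

definition BC_symmetric :: "nat \<Rightarrow> ((nat \<Rightarrow> complex) \<Rightarrow> complex) \<Rightarrow> bool" where
  "BC_symmetric n f \<longleftrightarrow>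
    (\<forall>x\<in>torus n.
      (\<forall>\<pi>. \<pi> permutes {1..n} \<longrightarrow> f (x \<circ> \<pi>) = f x) \<and>
      (\<forall>i\<in>{1..n}. f (x(i := 1 / x i)) = f x))"

text \<open>The functions are extensional, so that the definite description in
  \<open>interp_theta\<close> below can denote.\<close>

definition BC_theta :: "nat \<Rightarrow> nat \<Rightarrow> complex \<Rightarrow> ((nat \<Rightarrow> complex) \<Rightarrow> complex) set" where
  "BC_theta m n p =
    {f. f \<in> extensional (torus n) \<and> holomorphic_on_torus n f \<and> BC_symmetric n f \<and>
        (1 \<le> n \<longrightarrow> (\<forall>x\<in>torus n.
          f (x(1 := p * x 1)) = (p * (x 1)\<^sup>2) powi (- int m) * f x))}"

definition vanishing_length :: "nat \<Rightarrow> nat \<Rightarrow> (nat \<Rightarrow> nat) \<Rightarrow> (nat \<Rightarrow> nat) \<Rightarrow> nat" where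
  "vanishing_length m n l \<mu> =
    (let l0 = Max {i \<in> {1..n}. \<mu> i \<noteq> l i};
         l1 = Max (insert 0 {i \<in> {1..n}. \<mu> i = m})
     in if \<mu> l0 < l l0 then l1 else l0)"

definition vanishing_point ::
  "nat \<Rightarrow> nat \<Rightarrow> (nat \<Rightarrow> nat) \<Rightarrow> (nat \<Rightarrow> nat) \<Rightarrow> complex \<Rightarrow> complex \<Rightarrow> complex \<Rightarrow> complex \<Rightarrow>
    nat \<Rightarrow> complex" where
  "vanishing_point m n l \<mu> a b q t =
    (\<lambda>i\<in>{1..n}. if i \<le> vanishing_length m n l \<mu>
       then b * q ^ (m - \<mu> i) * t ^ (i - 1)
       else a * q ^ \<mu> i * t ^ (n - i))"

definition is_interp_theta ::
  "nat \<Rightarrow> nat \<Rightarrow> (nat \<Rightarrow> nat) \<Rightarrow> complex \<Rightarrow> complex \<Rightarrow> complex \<Rightarrow> complex \<Rightarrow> complex \<Rightarrow>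
    ((nat \<Rightarrow> complex) \<Rightarrow> complex) \<Rightarrow> bool" where
  "is_interp_theta m n l a b q t p f \<longleftrightarrow>
    f \<in> BC_theta m n p \<and>
    (\<forall>\<mu>\<in>partitions_in m n. \<mu> \<noteq> l \<longrightarrow> f (vanishing_point m n l \<mu> a b q t) = 0) \<and>
    (\<forall>v. v \<noteq> 0 \<longrightarrow>
      f (\<lambda>i\<in>{1..n}. v * t ^ (n - i)) =
        C0 l (t powi (int n - 1) * a * v) q t p * C0 l (a / v) q t p *
        C0 (compl_part m n l) (t powi (int n - 1) * b * v) q t p *
        C0 (compl_part m n l) (b / v) q t p)"

definition interp_theta ::
  "nat \<Rightarrow> nat \<Rightarrow> (nat \<Rightarrow> nat) \<Rightarrow> complex \<Rightarrow> complex \<Rightarrow> complex \<Rightarrow> complex \<Rightarrow> complex \<Rightarrow>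
    (nat \<Rightarrow> complex) \<Rightarrow> complex" where
  "interp_theta m n l a b q t p = (THE f. is_interp_theta m n l a b q t p f)"

text \<open>Genericity: \<open>a, b, q, t\<close> avoid countably many hypersurfaces in $(\mathbb{C}^*)^4$, namely those given
  by the multiplicative relations with \<open>p\<close>.\<close>

definition generic_params :: "complex \<Rightarrow> complex \<Rightarrow> complex \<Rightarrow> complex \<Rightarrow> complex \<Rightarrow> bool" where
  "generic_params p a b q t \<longleftrightarrow>
    a \<noteq> 0 \<and> b \<noteq> 0 \<and> q \<noteq> 0 \<and> t \<noteq> 0 \<and>
    (\<forall>h i j k l :: int.
      p powi h * a powi i * b powi j * q powi k * t powi l = 1 \<longrightarrow>
      i = 0 \<and> j = 0 \<and> k = 0 \<and> l = 0)"

definition signs :: "nat \<Rightarrow> (nat \<Rightarrow> int) set" where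
  "signs n = {1..n} \<rightarrow>\<^sub>E {1, -1}"

text \<open>The parameter \<open>sq\<close> is the chosen square root of \<open>q\<close>.\<close>

definition diff_op ::
  "nat \<Rightarrow> complex \<Rightarrow> complex \<Rightarrow> complex \<Rightarrow> complex \<Rightarrow> complex \<Rightarrow> complex \<Rightarrow> complex \<Rightarrow>
    ((nat \<Rightarrow> complex) \<Rightarrow> complex) \<Rightarrow> (nat \<Rightarrow> complex) \<Rightarrow> complex" where
  "diff_op n a b c d sq t p f x =
    (\<Sum>\<sigma>\<in>signs n.
      (\<Prod>i\<in>{1..n}.
        theta (a * x i powi \<sigma> i) p * theta (b * x i powi \<sigma> i) p *
        theta (c * x i powi \<sigma> i) p * theta (d * x i powi \<sigma> i) p /
        theta (x i powi (2 * \<sigma> i)) p) *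
      (\<Prod>(i, j)\<in>{(i, j). 1 \<le> i \<and> i < j \<and> j \<le> n}.
        theta (t * x i powi \<sigma> i * x j powi \<sigma> j) p /
        theta (x i powi \<sigma> i * x j powi \<sigma> j) p) *
      f (\<lambda>i\<in>{1..n}. sq powi \<sigma> i * x i))"

text \<open>The coefficients of the operator are meromorphic; division by zero being total, an identity
  of meromorphic functions involving \<open>diff_op\<close> is to be read on the dense open set where no
  denominator vanishes.\<close>

definition diff_op_regular :: "nat \<Rightarrow> complex \<Rightarrow> (nat \<Rightarrow> complex) \<Rightarrow> bool" where
  "diff_op_regular n p x \<longleftrightarrow>
    (\<forall>\<sigma>\<in>signs n.
      (\<forall>i\<in>{1..n}. theta (x i powi (2 * \<sigma> i)) p \<noteq> 0) \<and>
      (\<forall>i j. 1 \<le> i \<and> i < j \<and> j \<le> n \<longrightarrow> theta (x i powi \<sigma> i * x j powi \<sigma> j) p \<noteq> 0))"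

end

theory Submission
  imports Defs "HOL-Complex_Analysis.Complex_Analysis"
begin

text \<open>A \<open>BC\<^sub>n\<close>-symmetric theta function of degree \<open>m\<close> that vanishes at all the nodes of \<open>\<lambda>\<close>, and also at
  the point attached to \<open>\<lambda>\<close> itself, is zero: restrict to \<open>x\<^sub>n = a\<close> and divide by the product of the
  \<open>\<theta>(a x\<^sub>i, a / x\<^sub>i)\<close>, by induction on \<open>m + n\<close>. So the vanishing conditions leave at most a line,
  and linear algebra with products of theta functions shows that it is a line.

  The operator maps \<open>BC\<^sub>n\<close>-symmetric theta functions to such functions, because the poles of its
  coefficients cancel in pairs. At a node for \<open>(a, b)\<close> only those terms have nonzero coefficients that
  evaluate the function at zeros coming from the parameters \<open>(\<surd>q a, \<surd>q b)\<close>. So the operator maps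
  the one line into the other. Where a single term survives, the scalar can be compared: at
  the point attached to \<open>\<lambda>\<close>, which gives its dependence on \<open>c\<close>, and at \<open>x\<^sub>i = c t\<^bsup>n - i\<^esup>\<close>.

  At these last points the eigenvalue equation becomes a functional equation in \<open>c\<close> for
  \<open>f (v t\<^bsup>n - 1\<^esup>, \<dots>, v)\<close>. It forces the zeros of the normalizing product on this function, so the two are
  proportional, the quotient being invariant under \<open>v \<mapsto> p v\<close>; moreover \<open>f\<close> vanishes identically if it
  vanishes at all these points. This yields the existence and uniqueness of the normalized
  interpolation functions and the remaining constant.\<close>

subsection \<open>The theta function\<close>

text \<open>Genericity says that a monomial in \<open>a\<close>, \<open>b\<close>, \<open>q\<close>,
  \<open>t\<close> is a power of \<open>p\<close> only when all its exponents vanish. Every claim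
  that a coefficient is nonzero, that a point is regular or that zeros are distinct thereby becomes
  a comparison of exponents. Two obstacles shape the rest. Several-variable complex analysis is
  avoided: in each variable a theta function lies in the finite-dimensional space
  \<open>BC1 m\<close>, so it is a finite combination of products of one-variable functions, and
  this yields joint continuity and extension across the poles. And the normalized functions cannot
  be used before they are known to exist. The operator is therefore first applied to arbitrary
  nonzero members of the two lines, with a scalar \<open>K\<close> independent of \<open>c\<close>;
  letting \<open>c\<close> vary produces the functional equation. Zeros are found box by box, each
  box of a row reducing to the preceding one with \<open>a\<close>, \<open>b\<close> replaced by
  \<open>sq * a\<close>, \<open>sq * b\<close>. That nothing nonzero vanishes on the principal
  specialization uses the equation in the other direction, starting from \<open>a / sq\<close>,
  \<open>b / sq\<close>.\<close>

locale nome =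
  fixes p :: complex
  assumes norm_p_pos: "0 < norm p" and norm_p_less_1: "norm p < 1"
begin

abbreviation th :: "complex \<Rightarrow> complex" where "th x \<equiv> theta x p"

text \<open>The infinite Pochhammer symbol with base \<open>p\<close>. Splitting
  \<open>theta\<close> into \<open>qpoch x * qpoch (p / x)\<close> separates an entire function of
  \<open>x\<close> from one of \<open>1 / x\<close>.\<close>

definition qpoch :: "complex \<Rightarrow> complex" where
  "qpoch y = (\<Prod>k. 1 - p ^ k * y)"

text \<open>The zeros of \<open>theta\<close> in the punctured plane. They form a group, so zeros of
  several factors can be compared by multiplying and dividing their arguments.\<close>

definition pz :: "complex set" where
  "pz = range (\<lambda>k::int. p powi k)"

lemma p_nz [simp]: "p \<noteq> 0"
  using norm_p_pos by auto

lemma powi_in_pz [simp]: "p powi k \<in> pz"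
  by (auto simp: pz_def)

lemma one_in_pz [simp]: "1 \<in> pz"
  using powi_in_pz[of 0] by simp

lemma p_in_pz [simp]: "p \<in> pz"
  using powi_in_pz[of 1] by simp

lemma pz_mult: "x \<in> pz \<Longrightarrow> y \<in> pz \<Longrightarrow> x * y \<in> pz"
  by (auto simp: pz_def power_int_add[symmetric])

lemma pz_inverse [simp]: "inverse x \<in> pz \<longleftrightarrow> x \<in> pz"
proof -
  have "inverse x \<in> pz" if "x \<in> pz" for x
    using that unfolding pz_def by (auto simp: power_int_minus[symmetric])
  from this[of x] this[of "inverse x"] show ?thesis by auto
qed

lemma pz_divide: "x \<in> pz \<Longrightarrow> y \<in> pz \<Longrightarrow> x / y \<in> pz"
  by (simp add: divide_inverse pz_mult)

lemma pz_nz: "x \<in> pz \<Longrightarrow> x \<noteq> 0"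
  by (auto simp: pz_def)

lemma countable_pz [simp]: "countable pz"
  by (simp add: pz_def)

lemma pz_mult_left_iff [simp]: "x \<in> pz \<Longrightarrow> x * y \<in> pz \<longleftrightarrow> y \<in> pz"
  using pz_mult[of x y] pz_divide[of "x * y" x] pz_nz[of x] by auto

lemma p_powi_eq_1_iff: "p powi k = 1 \<longleftrightarrow> k = 0"
proof
  assume "p powi k = 1"
  then have *: "norm p powi k = 1"
    by (metis norm_one norm_power_int)
  show "k = 0"
  proof (rule ccontr)
    assume "k \<noteq> 0"
    then consider "k > 0" | "k < 0" by linarith
    then show False
    proof cases
      case 1
      then have "norm p ^ nat k < 1"
        using norm_p_less_1 by (simp add: power_less_one_iff)
      then show False using * 1 by (simp add: power_int_def)
    next
      case 2
      then have "norm p ^ nat (-k) < 1"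
        using norm_p_less_1 by (simp add: power_less_one_iff)
      then show False using * 2 by (simp add: power_int_def power_inverse)
    qed
  qed
qed auto

lemma summable_qpoch: "summable (\<lambda>k. norm (1 - p ^ k * y - 1))"
  using norm_p_less_1 by (auto simp: norm_mult norm_power intro!: summable_mult2 summable_geometric)

lemma convergent_qpoch: "convergent_prod (\<lambda>k. 1 - p ^ k * y)"
proof -
  have "abs_convergent_prod (\<lambda>k. 1 - p ^ k * y)"
    using summable_qpoch[of y] by (simp add: abs_convergent_prod_conv_summable)
  then show ?thesis by (rule abs_convergent_prod_imp_convergent_prod)
qed

lemma theta_eq_qpoch: "th x = qpoch x * qpoch (p / x)"
  unfolding theta_def qpoch_def
  by (subst prodinf_mult[OF convergent_qpoch convergent_qpoch]) (simp add: mult.commute)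

lemma qpoch_eq_0_iff: "qpoch y = 0 \<longleftrightarrow> (\<exists>k. p ^ k * y = 1)"
proof -
  have "(\<lambda>k. 1 - p ^ k * y) has_prod qpoch y"
    unfolding qpoch_def using convergent_qpoch by (rule convergent_prod_has_prod)
  from has_prod_eq_0_iff[OF this] show ?thesis
    unfolding image_iff by (metis UNIV_I eq_iff_diff_eq_0)
qed

lemma qpoch_rec: "qpoch y = (1 - y) * qpoch (p * y)"
\<comment> \<open>Splitting off the first factor divides by it, so the case where it vanishes is
  separate.\<close>
proof (cases "y = 1")
  case True
  then have "qpoch y = 0" by (subst qpoch_eq_0_iff) (auto intro: exI[of _ 0])
  then show ?thesis using True by simp
next
  case False
  then have "(\<Prod>n. 1 - p ^ Suc n * y) = qpoch y / (1 - y)"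
    unfolding qpoch_def
    using prodinf_split_head[OF convergent_qpoch[of y]] by simp
  then show ?thesis using False by (simp add: qpoch_def mult_ac)
qed

text \<open>The partial products converge uniformly on closed unit balls, where
  \<open>norm p ^ n * (norm x + 1)\<close> is a summable majorant.\<close>

lemma holomorphic_qpoch: "qpoch holomorphic_on UNIV"
proof (rule holomorphic_uniform_sequence)
  show "(\<lambda>x. \<Prod>k<n. 1 - p ^ k * x) holomorphic_on UNIV" for n
    by (intro holomorphic_intros)
next
  fix x :: complex
  let ?A = "cball x 1"
  have "uniformly_convergent_on ?A (\<lambda>N x. \<Sum>n<N. norm (1 - p ^ n * x - 1))"
  proof (rule Weierstrass_m_test')
    show "norm (norm (1 - p ^ n * y - 1)) \<le> norm p ^ n * (norm x + 1)" if "y \<in> ?A" for n y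
    proof -
      have "norm y \<le> norm x + 1"
        using that norm_triangle_ineq4[of x "x - y"] by (auto simp: dist_norm)
      then show ?thesis by (simp add: norm_mult norm_power mult_left_mono)
    qed
    show "summable (\<lambda>n. norm p ^ n * (norm x + 1))"
      using norm_p_less_1 by (intro summable_mult2 summable_geometric) auto
  qed
  then have "uniformly_convergent_on ?A (\<lambda>N x. \<Prod>n<N. 1 - p ^ n * x)"
    by (intro uniformly_convergent_on_prod') (auto intro!: continuous_intros)
  then obtain g where g: "uniform_limit ?A (\<lambda>N x. \<Prod>n<N. 1 - p ^ n * x) g sequentially"
    by (auto simp: uniformly_convergent_on_def)
  have "g y = qpoch y" if "y \<in> ?A" for y
  proof -
    have "(\<lambda>N. \<Prod>n<N. 1 - p ^ n * y) \<longlonglongrightarrow> g y"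
      using tendsto_uniform_limitI[OF g that] .
    moreover have "(\<lambda>N. \<Prod>n<N. 1 - p ^ n * y) \<longlonglongrightarrow> qpoch y"
      unfolding qpoch_def
      using convergent_prod_has_prod[OF convergent_qpoch] has_prod_imp_tendsto' by blast
    ultimately show ?thesis using LIMSEQ_unique by blast
  qed
  then have "uniform_limit ?A (\<lambda>N x. \<Prod>n<N. 1 - p ^ n * x) qpoch sequentially"
    using g by (subst uniform_limit_cong'[of _ _ _ qpoch g]) auto
  then show "\<exists>d>0. cball x d \<subseteq> UNIV \<and>
      uniform_limit (cball x d) (\<lambda>n x. \<Prod>k<n. 1 - p ^ k * x) qpoch sequentially"
    by (intro exI[of _ 1]) auto
qed auto

lemma holomorphic_qpoch' [holomorphic_intros]:
  "f holomorphic_on A \<Longrightarrow> (\<lambda>x. qpoch (f x)) holomorphic_on A"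
  using holomorphic_on_compose[OF _ holomorphic_on_subset[OF holomorphic_qpoch]]
  by (auto simp: o_def)

lemma holomorphic_theta [holomorphic_intros]:
  "f holomorphic_on A \<Longrightarrow> (\<And>x. x \<in> A \<Longrightarrow> f x \<noteq> 0) \<Longrightarrow> (\<lambda>x. th (f x)) holomorphic_on A"
  unfolding theta_eq_qpoch by (intro holomorphic_intros) auto

text \<open>The factor \<open>qpoch x\<close> supplies the nonpositive powers of \<open>p\<close>,
  the factor \<open>qpoch (p / x)\<close> the positive ones.\<close>

lemma theta_eq_0_iff:
  assumes "x \<noteq> 0"
  shows "th x = 0 \<longleftrightarrow> x \<in> pz"
proof -
  have 1: "(\<exists>k. p ^ k * x = 1) \<longleftrightarrow> (\<exists>k\<le>0. x = p powi k)"
  proof safe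
    fix k assume "p ^ k * x = 1"
    then have "x = p powi (- int k)"
      by (simp add: power_int_minus field_simps)
    then show "\<exists>k\<le>0. x = p powi k" by (intro exI[of _ "- int k"]) auto
  next
    fix k :: int assume k: "k \<le> 0" and x: "x = p powi k"
    have "p ^ nat (-k) * p powi k = 1"
      using k by (simp add: power_int_def power_inverse[symmetric] power_mult_distrib[symmetric])
    then show "\<exists>ka. p ^ ka * p powi k = 1" by blast
  qed
  have 2: "(\<exists>k. p ^ k * (p / x) = 1) \<longleftrightarrow> (\<exists>k>0. x = p powi k)"
  proof safe
    fix k assume "p ^ k * (p / x) = 1"
    then have "x = p powi (int (Suc k))"
      using assms by (simp add: field_simps power_int_add)
    then show "\<exists>k>0. x = p powi k" by (intro exI[of _ "int (Suc k)"]) auto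
  next
    fix k :: int assume k: "k > 0" and x: "x = p powi k"
    define j where "j = nat (k - 1)"
    have "k = int (Suc j)" using k by (simp add: j_def)
    then have "p powi k = p ^ Suc j"
      by (simp only: power_int_of_nat)
    then have "p ^ j * (p / p powi k) = 1"
      by simp
    then show "\<exists>ka. p ^ ka * (p / p powi k) = 1" by blast
  qed
  have "x \<in> pz \<longleftrightarrow> (\<exists>k\<le>0. x = p powi k) \<or> (\<exists>k>0. x = p powi k)"
    unfolding pz_def by (auto simp: image_iff) (metis linorder_not_less)
  then show ?thesis
    unfolding theta_eq_qpoch using 1 2 by (simp add: qpoch_eq_0_iff)
qed

lemma theta_p_divide [simp]: "th (p / x) = th x"
  by (cases "x = 0") (simp_all add: theta_eq_qpoch)

lemma theta_p_mult:
  assumes "x \<noteq> 0"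
  shows "th (p * x) = - th x / x"
proof -
  have "th (p * x) = qpoch (p * x) * ((1 - 1 / x) * qpoch (p / x))"
    using assms qpoch_rec[of "1/x"] by (simp add: theta_eq_qpoch)
  also have "\<dots> = - ((1 - x) * qpoch (p * x) * qpoch (p / x)) / x"
    using assms by (simp add: field_simps)
  also have "\<dots> = - th x / x"
    by (simp add: theta_eq_qpoch flip: qpoch_rec)
  finally show ?thesis .
qed

lemma theta_div_p:
  assumes "x \<noteq> 0"
  shows "th (x / p) = - (x / p) * th x"
  using theta_p_mult[of "x / p"] assms by (simp add: field_simps)

lemma theta_1 [simp]: "th 1 = 0"
  using theta_eq_0_iff[of 1] by simp

text \<open>The derivative of \<open>theta\<close> at \<open>1\<close>, which enters the residues of
  the coefficients.\<close>

definition theta_prime where "theta_prime = - (qpoch p)\<^sup>2"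

lemma theta_prime_nz: "theta_prime \<noteq> 0"
proof -
  have "qpoch p \<noteq> 0"
    unfolding qpoch_eq_0_iff
  proof safe
    fix k assume "p ^ k * p = 1"
    then have "p powi (int (Suc k)) = 1" by (simp add: power_int_add mult.commute)
    then show False using p_powi_eq_1_iff[of "int (Suc k)"] by simp
  qed
  then show ?thesis by (simp add: theta_prime_def)
qed

lemma isCont_qpoch: "isCont qpoch z"
  using holomorphic_on_imp_continuous_on[OF holomorphic_qpoch]
  by (simp add: continuous_on_eq_continuous_at)

lemma theta_limit_1: "((\<lambda>z. th z / (z - 1)) \<longlongrightarrow> theta_prime) (at 1)"
proof -
  have "((\<lambda>z. - (qpoch (p * z) * qpoch (p / z))) \<longlongrightarrow> - (qpoch (p * 1) * qpoch (p / 1))) (at 1)"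
    by (intro tendsto_intros isCont_tendsto_compose[OF isCont_qpoch]) auto
  moreover have "eventually (\<lambda>z. - (qpoch (p * z) * qpoch (p / z)) = th z / (z - 1)) (at (1::complex))"
  proof -
    have "eventually (\<lambda>z::complex. z \<noteq> 1) (at 1)" by (simp add: eventually_neq_at_within)
    then show ?thesis
    proof eventually_elim
      case (elim z)
      have "th z = (1 - z) * qpoch (p * z) * qpoch (p / z)"
        by (simp add: theta_eq_qpoch flip: qpoch_rec)
      then show ?case using elim by (simp add: field_simps)
    qed
  qed
  ultimately show ?thesis
    using tendsto_cong[of "\<lambda>z. - (qpoch (p * z) * qpoch (p / z))" "\<lambda>z. th z / (z - 1)"]
    by (simp add: theta_prime_def power2_eq_square)
qed

end

subsection \<open>Holomorphic functions on the punctured plane\<close>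

text \<open>The points where \<open>f\<close> and \<open>g\<close> differ form an open set, and a
  nonempty open set is uncountable. This carries identities between quotients over to the zeros of
  their denominators.\<close>

lemma continuous_eq_off_countable:
  fixes f g :: "complex \<Rightarrow> complex"
  assumes "continuous_on (- {0}) f" "continuous_on (- {0}) g" "countable B"
    and eq: "\<And>z. z \<noteq> 0 \<Longrightarrow> z \<notin> B \<Longrightarrow> f z = g z" and "z \<noteq> 0"
  shows "f z = g z"
proof (rule ccontr)
  assume "f z \<noteq> g z"
  let ?U = "(\<lambda>w. f w - g w) -` (- {0}) \<inter> - {0}"
  have "continuous_on (- {0}) (\<lambda>w. f w - g w)"
    by (intro continuous_intros assms)
  then have "open ?U"
    using continuous_on_open_vimage[of "- {0::complex}" "\<lambda>w. f w - g w"] by (metis open_Compl closed_singleton)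
  moreover have "z \<in> ?U" using \<open>z \<noteq> 0\<close> \<open>f z \<noteq> g z\<close> by auto
  ultimately obtain e where e: "e > 0" "ball z e \<subseteq> ?U"
    using open_contains_ball by blast
  have "ball z e \<subseteq> B"
  proof
    fix w assume "w \<in> ball z e"
    then have "w \<in> ?U" using e(2) by blast
    then have "w \<noteq> 0" "f w \<noteq> g w" by auto
    then show "w \<in> B" using eq by blast
  qed
  then show False
    using \<open>countable B\<close> e(1) countable_subset uncountable_ball by blast
qed

text \<open>The singularities are isolated, and the limit condition excludes even a simple pole, so
  Riemann's theorem applies at each point of \<open>Z\<close>.\<close>

lemma removable_singularities_punctured_plane:
  fixes F :: "complex \<Rightarrow> complex"
  assumes iso: "\<And>w. w \<noteq> 0 \<Longrightarrow> eventually (\<lambda>z. z \<notin> Z) (at w)"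
    and holo: "F holomorphic_on (- {0} - Z)"
    and lim: "\<And>w. w \<noteq> 0 \<Longrightarrow> w \<in> Z \<Longrightarrow> ((\<lambda>z. (z - w) * F z) \<longlongrightarrow> 0) (at w)"
  obtains h where "h holomorphic_on - {0}" "\<And>z. z \<noteq> 0 \<Longrightarrow> z \<notin> Z \<Longrightarrow> h z = F z"
proof
  \<comment> \<open>The value at a singular point is the limit there; the local extension
    \<open>g\<close> obtained below shows that this limit exists.\<close>
  define h where "h z = (if z \<in> Z then Lim (at z) F else F z)" for z
  show "h z = F z" if "z \<notin> Z" for z using that by (simp add: h_def)
  have "h field_differentiable at w" if w: "w \<noteq> 0" for w
  proof -
    have "eventually (\<lambda>z. z \<notin> Z \<and> z \<noteq> 0) (at w)"
      using iso[OF that] t1_space_nhds[OF that] by (auto simp: eventually_at_filter elim: eventually_elim2)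
    then obtain r where r: "r > 0" "\<And>z. z \<noteq> w \<Longrightarrow> dist z w < r \<Longrightarrow> z \<notin> Z \<and> z \<noteq> 0"
      by (auto simp: eventually_at)
    let ?U = "ball w r"
    have sub: "x \<noteq> 0 \<and> x \<notin> Z" if "x \<in> ?U - {w}" for x
      using r(2)[of x] that by (auto simp: dist_commute)
    have holU: "F holomorphic_on (?U - {w})"
      by (rule holomorphic_on_subset[OF holo]) (use sub in blast)
    obtain g where g: "g holomorphic_on ?U" "\<And>z. z \<in> ?U \<Longrightarrow> g z = h z"
    proof (cases "w \<in> Z")
      case True
      then obtain g where g: "g holomorphic_on ?U" "\<forall>z\<in>?U - {w}. g z = F z"
        using holomorphic_on_extend_lim[OF holU] lim[OF w] r(1) True by auto
      have "g z = h z" if "z \<in> ?U" for z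
      proof (cases "z = w")
        case False
        then show ?thesis using that g(2) r(2)[of z] by (auto simp: h_def dist_commute)
      next
        case eq: True
        have "isCont g w"
          using g(1) r(1) by (metis centre_in_ball continuous_on_eq_continuous_at holomorphic_on_imp_continuous_on open_ball)
        then have "(g \<longlongrightarrow> g w) (at w)" by (simp add: isCont_def)
        moreover have "eventually (\<lambda>z. g z = F z) (at w)"
          unfolding eventually_at using r(1) g(2) by (intro exI[of _ r]) (auto simp: dist_commute)
        ultimately have "(F \<longlongrightarrow> g w) (at w)"
          by (rule Lim_transform_eventually)
        then have "Lim (at w) F = g w" by (intro tendsto_Lim) auto
        then show ?thesis using eq True by (simp add: h_def)
      qed
      then show ?thesis using that g(1) by blast
    next
      case False
      have "F holomorphic_on ?U"
        by (rule holomorphic_on_subset[OF holo]) (use sub False \<open>w \<noteq> 0\<close> in blast)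
      moreover have "F z = h z" if "z \<in> ?U" for z
        using that r(2)[of z] False by (auto simp: h_def dist_commute)
      ultimately show ?thesis using that by blast
    qed
    have "h holomorphic_on ?U" using g by (metis (no_types, lifting) holomorphic_transform)
    then show ?thesis using r(1) by (simp add: holomorphic_on_imp_differentiable_at)
  qed
  then show "h holomorphic_on - {0}"
    by (auto simp: holomorphic_on_def intro: field_differentiable_at_within)
qed

text \<open>Isolated zeros of order at most one, expressed by a finite limit of
  \<open>(z - w) / E z\<close>: this form passes to products with disjoint zeros and is the one
  needed to remove the singularities of \<open>h z / E z\<close>.\<close>

definition simple_zeros :: "(complex \<Rightarrow> complex) \<Rightarrow> bool" where
  "simple_zeros E \<longleftrightarrow> E holomorphic_on - {0} \<and>
    (\<forall>w. w \<noteq> 0 \<longrightarrow> eventually (\<lambda>z. E z \<noteq> 0) (at w) \<and> (\<exists>r. ((\<lambda>z. (z - w) / E z) \<longlongrightarrow> r) (at w)))"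

lemma holo_punctured_isCont: "E holomorphic_on - {0} \<Longrightarrow> w \<noteq> 0 \<Longrightarrow> isCont E (w::complex)"
  by (metis ComplI continuous_on_eq_continuous_at holomorphic_on_imp_continuous_on open_delete open_UNIV Compl_eq_Diff_UNIV singletonD)

lemma isCont_nz_limits:
  assumes "isCont E w" "E w \<noteq> (0::complex)"
  shows "eventually (\<lambda>z. E z \<noteq> 0) (at w)" "((\<lambda>z. (z - w) / E z) \<longlongrightarrow> 0) (at w)"
proof -
  have *: "(E \<longlongrightarrow> E w) (at w)" using assms by (simp add: isCont_def)
  show "eventually (\<lambda>z. E z \<noteq> 0) (at w)"
    using tendsto_imp_eventually_ne[OF * assms(2)] .
  have "((\<lambda>z. (z - w) / E z) \<longlongrightarrow> (w - w) / E w) (at w)"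
    by (intro tendsto_intros *) (use assms in auto)
  then show "((\<lambda>z. (z - w) / E z) \<longlongrightarrow> 0) (at w)" by simp
qed

lemma DERIV_nz_limits:
  assumes "(E has_field_derivative D) (at w)" "E w = 0" "D \<noteq> (0::complex)"
  shows "eventually (\<lambda>z. E z \<noteq> 0) (at w)" "((\<lambda>z. (z - w) / E z) \<longlongrightarrow> 1 / D) (at w)"
proof -
  have *: "((\<lambda>z. E z / (z - w)) \<longlongrightarrow> D) (at w)"
    using assms by (simp add: has_field_derivative_iff)
  have "eventually (\<lambda>z. E z / (z - w) \<noteq> 0) (at w)"
    using tendsto_imp_eventually_ne[OF * assms(3)] .
  then show "eventually (\<lambda>z. E z \<noteq> 0) (at w)" by eventually_elim auto
  have "((\<lambda>z. 1 / (E z / (z - w))) \<longlongrightarrow> 1 / D) (at w)"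
    by (intro tendsto_intros *) (use assms in auto)
  then show "((\<lambda>z. (z - w) / E z) \<longlongrightarrow> 1 / D) (at w)" by simp
qed

lemma simple_zerosI:
  assumes "E holomorphic_on - {0}"
    and "\<And>w. w \<noteq> 0 \<Longrightarrow> E w = 0 \<Longrightarrow> \<exists>D. (E has_field_derivative D) (at w) \<and> D \<noteq> 0"
  shows "simple_zeros E"
  unfolding simple_zeros_def
proof (intro conjI allI impI assms(1))
  fix w :: complex assume w: "w \<noteq> 0"
  show "eventually (\<lambda>z. E z \<noteq> 0) (at w)"
    using isCont_nz_limits[OF holo_punctured_isCont[OF assms(1) w]] assms(2)[OF w] DERIV_nz_limits
    by (cases "E w = 0") blast+
  show "\<exists>r. ((\<lambda>z. (z - w) / E z) \<longlongrightarrow> r) (at w)"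
    using isCont_nz_limits[OF holo_punctured_isCont[OF assms(1) w]] assms(2)[OF w] DERIV_nz_limits
    by (cases "E w = 0") blast+
qed

lemma simple_zeros_const: "k \<noteq> 0 \<Longrightarrow> simple_zeros (\<lambda>z. k)"
  by (rule simple_zerosI) auto

text \<open>At each point at most one factor vanishes; it provides the finite limit, while the other
  factor has a nonzero limit to divide by.\<close>

lemma simple_zeros_mult:
  assumes E: "simple_zeros E" and F: "simple_zeros F"
    and disj: "\<And>z. z \<noteq> 0 \<Longrightarrow> E z = 0 \<Longrightarrow> F z = 0 \<Longrightarrow> False"
  shows "simple_zeros (\<lambda>z. E z * F z)"
  unfolding simple_zeros_def
proof (intro conjI allI impI)
  show "(\<lambda>z. E z * F z) holomorphic_on - {0}"
    using E F by (auto simp: simple_zeros_def intro!: holomorphic_intros)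
  fix w :: complex assume w: "w \<noteq> 0"
  have "eventually (\<lambda>z. E z \<noteq> 0) (at w)" "eventually (\<lambda>z. F z \<noteq> 0) (at w)"
    using E F w by (auto simp: simple_zeros_def)
  then show "eventually (\<lambda>z. E z * F z \<noteq> 0) (at w)" by eventually_elim auto
  have cont: "(E \<longlongrightarrow> E w) (at w)" "(F \<longlongrightarrow> F w) (at w)"
    using E F holo_punctured_isCont[OF _ w] by (auto simp: simple_zeros_def isCont_def)
  obtain r s where rs: "((\<lambda>z. (z - w) / E z) \<longlongrightarrow> r) (at w)" "((\<lambda>z. (z - w) / F z) \<longlongrightarrow> s) (at w)"
    using E F w unfolding simple_zeros_def by blast
  consider "E w \<noteq> 0" | "F w \<noteq> 0" using disj w by blast
  then show "\<exists>r. ((\<lambda>z. (z - w) / (E z * F z)) \<longlongrightarrow> r) (at w)"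
  proof cases
    case 1
    have "((\<lambda>z. (z - w) / F z / E z) \<longlongrightarrow> s / E w) (at w)"
      by (intro tendsto_intros rs cont 1)
    then show ?thesis by (auto simp: divide_divide_eq_left mult.commute)
  next
    case 2
    have "((\<lambda>z. (z - w) / E z / F z) \<longlongrightarrow> r / F w) (at w)"
      by (intro tendsto_intros rs cont 2)
    then show ?thesis by (auto simp: divide_divide_eq_left mult.commute)
  qed
qed

lemma simple_zeros_prod:
  assumes "finite I" "\<And>i. i \<in> I \<Longrightarrow> simple_zeros (E i)"
    and "\<And>i j z. i \<in> I \<Longrightarrow> j \<in> I \<Longrightarrow> i \<noteq> j \<Longrightarrow> z \<noteq> 0 \<Longrightarrow> E i z = 0 \<Longrightarrow> E j z = 0 \<Longrightarrow> False"
  shows "simple_zeros (\<lambda>z. \<Prod>i\<in>I. E i z)"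
  using assms
proof (induction I)
  case empty
  then show ?case by (simp add: simple_zeros_const)
next
  case (insert i I)
  have "simple_zeros (\<lambda>z. E i z * (\<Prod>i\<in>I. E i z))"
  proof (rule simple_zeros_mult)
    show "simple_zeros (E i)" using insert.prems(1) by simp
    show "simple_zeros (\<lambda>z. \<Prod>i\<in>I. E i z)"
      by (rule insert.IH) (use insert.prems in \<open>blast+\<close>)
    show False if z: "z \<noteq> 0" "E i z = 0" "(\<Prod>i\<in>I. E i z) = 0" for z
    proof -
      obtain j where "j \<in> I" "E j z = 0" using z(3) insert.hyps by auto
      then show False using insert.prems(2)[of i j z] insert.hyps z by auto
    qed
  qed
  then show ?case using insert.hyps by simp
qed

text \<open>Near a zero \<open>w\<close> of \<open>E\<close> the quotient
  \<open>(z - w) / E z\<close> has a finite limit and \<open>h z\<close> tends to \<open>0\<close>,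
  so the singularity of the quotient is removable.\<close>

lemma simple_zeros_divide:
  assumes E: "simple_zeros E" and h: "h holomorphic_on - {0}"
    and zeros: "\<And>z. z \<noteq> 0 \<Longrightarrow> E z = 0 \<Longrightarrow> h z = 0"
  obtains g where "g holomorphic_on - {0}" "\<And>z. z \<noteq> 0 \<Longrightarrow> h z = E z * g z"
proof -
  let ?Z = "{z. E z = 0}"
  have E': "E holomorphic_on - {0}" using E by (simp add: simple_zeros_def)
  obtain g where g: "g holomorphic_on - {0}" "\<And>z. z \<noteq> 0 \<Longrightarrow> z \<notin> ?Z \<Longrightarrow> g z = h z / E z"
  proof (rule removable_singularities_punctured_plane[where Z = ?Z and F = "\<lambda>z. h z / E z"])
    show "eventually (\<lambda>z. z \<notin> ?Z) (at w)" if "w \<noteq> 0" for w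
      using E that by (simp add: simple_zeros_def)
    show "(\<lambda>z. h z / E z) holomorphic_on - {0} - ?Z"
      by (intro holomorphic_intros holomorphic_on_subset[OF h] holomorphic_on_subset[OF E']) auto
    show "((\<lambda>z. (z - w) * (h z / E z)) \<longlongrightarrow> 0) (at w)" if w: "w \<noteq> 0" "w \<in> ?Z" for w
    proof -
      obtain r where r: "((\<lambda>z. (z - w) / E z) \<longlongrightarrow> r) (at w)"
        using E w unfolding simple_zeros_def by blast
      have "(h \<longlongrightarrow> h w) (at w)"
        using holo_punctured_isCont[OF h] that by (simp add: isCont_def)
      from tendsto_mult[OF r this] have "((\<lambda>z. (z - w) / E z * h z) \<longlongrightarrow> r * h w) (at w)" .
      then show ?thesis using zeros[of w] that by (simp add: mult.commute)
    qed
  qed blast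
  show ?thesis
  proof (rule that[OF g(1)])
    show "h z = E z * g z" if "z \<noteq> 0" for z
      using g(2)[OF that] zeros[OF that] by (cases "E z = 0") auto
  qed
qed

context nome
begin


text \<open>At \<open>1\<close> the derivative is \<open>theta_prime\<close>. The relation between
  \<open>th (p * x)\<close> and \<open>th x\<close> carries it to the neighbouring powers of
  \<open>p\<close> in both directions; the derivative of the multiplier drops out because
  \<open>th\<close> vanishes there.\<close>

lemma theta_has_nz_deriv:
  assumes "w \<in> pz"
  shows "\<exists>D. ((\<lambda>x. th x) has_field_derivative D) (at w) \<and> D \<noteq> 0"
proof -
  let ?P = "\<lambda>w. \<exists>D. ((\<lambda>x. th x) has_field_derivative D) (at w) \<and> D \<noteq> 0"
  have 1: "?P (1::complex)"
    using theta_limit_1 theta_prime_nz by (intro exI[of _ theta_prime]) (simp add: has_field_derivative_iff)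
  have up: "?P (p * w)" if P: "?P w" "w \<in> pz" for w
  proof -
    have w: "w \<noteq> 0" "th w = 0" using P(2) pz_nz theta_eq_0_iff by auto
    obtain D where D: "((\<lambda>x. th x) has_field_derivative D) (at w)" "D \<noteq> 0" using P(1) by blast
    have D': "((\<lambda>x. th (x / p)) has_field_derivative D * (1 / p)) (at (p * w))"
      by (rule DERIV_chain2[where f = "\<lambda>x. th x" and g = "\<lambda>x. x / p"]) (use D in \<open>auto intro!: derivative_eq_intros\<close>)
    have "((\<lambda>x. - (p / x) * th (x / p)) has_field_derivative - D / (p * w)) (at (p * w))"
      by (rule derivative_eq_intros D' refl | use w in simp)+
    then have "((\<lambda>x. th x) has_field_derivative - D / (p * w)) (at (p * w))"
    proof (rule has_field_derivative_transform_within_open[where S = "- {0}"])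
      show "- (p / x) * th (x / p) = th x" if "x \<in> - {0}" for x
        using theta_p_mult[of "x / p"] that by simp
    qed (use w in auto)
    then show ?thesis using D w by (intro exI[of _ "- D / (p * w)"]) auto
  qed
  have down: "?P (w / p)" if P: "?P w" "w \<in> pz" for w
  proof -
    have w: "w \<noteq> 0" "th w = 0" using P(2) pz_nz theta_eq_0_iff by auto
    obtain D where D: "((\<lambda>x. th x) has_field_derivative D) (at w)" "D \<noteq> 0" using P(1) by blast
    have D': "((\<lambda>x. th (p * x)) has_field_derivative D * p) (at (w / p))"
      by (rule DERIV_chain2[where f = "\<lambda>x. th x" and g = "\<lambda>x. p * x"]) (use D in \<open>auto intro!: derivative_eq_intros\<close>)
    have "((\<lambda>x. - x * th (p * x)) has_field_derivative - w * D) (at (w / p))"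
      by (rule derivative_eq_intros D' refl | use w in simp)+
    then have "((\<lambda>x. th x) has_field_derivative - w * D) (at (w / p))"
    proof (rule has_field_derivative_transform_within_open[where S = "- {0}"])
      show "- x * th (p * x) = th x" if "x \<in> - {0}" for x
        using theta_p_mult[of x] that by simp
    qed (use w in auto)
    then show ?thesis using D w by (intro exI[of _ "- w * D"]) auto
  qed
  obtain k where k: "w = p powi k" using assms by (auto simp: pz_def)
  have "?P (p powi k)"
  proof (induction k rule: int_induct[where k = 0])
    case base then show ?case using 1 by simp
  next
    case (step1 i)
    then show ?case using up[of "p powi i"] by (simp add: power_int_add mult.commute)
  next
    case (step2 i)
    then show ?case using down[of "p powi i"] by (simp add: power_int_diff)
  qed
  then show ?thesis using k by simp
qed

lemma simple_zeros_theta_compose: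
  assumes "g holomorphic_on - {0}" "\<And>z. z \<noteq> 0 \<Longrightarrow> g z \<noteq> 0"
    and "\<And>z. z \<noteq> 0 \<Longrightarrow> \<exists>D. (g has_field_derivative D) (at z) \<and> D \<noteq> 0"
  shows "simple_zeros (\<lambda>z. th (g z))"
proof (rule simple_zerosI)
  show "(\<lambda>z. th (g z)) holomorphic_on - {0}"
    by (intro holomorphic_intros assms) (use assms in auto)
  fix w :: complex assume w: "w \<noteq> 0" "th (g w) = 0"
  then have "g w \<in> pz" using assms theta_eq_0_iff by blast
  then obtain D where D: "((\<lambda>x. th x) has_field_derivative D) (at (g w))" "D \<noteq> 0"
    using theta_has_nz_deriv by blast
  obtain D' where D': "(g has_field_derivative D') (at w)" "D' \<noteq> 0" using assms w by blast
  have "((\<lambda>z. th (g z)) has_field_derivative D * D') (at w)"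
    using DERIV_chain2[OF D(1) D'(1)] .
  then show "\<exists>D. ((\<lambda>z. th (g z)) has_field_derivative D) (at w) \<and> D \<noteq> 0"
    using D D' by (intro exI[of _ "D * D'"]) auto
qed

lemma simple_zeros_theta_mult: "a \<noteq> 0 \<Longrightarrow> simple_zeros (\<lambda>z. th (a * z))"
  by (rule simple_zeros_theta_compose)
     (auto intro!: holomorphic_intros exI[of _ a] derivative_eq_intros)

lemma simple_zeros_theta_divide: "a \<noteq> 0 \<Longrightarrow> simple_zeros (\<lambda>z. th (a / z))"
proof (rule simple_zeros_theta_compose)
  show "\<exists>D. ((\<lambda>z. a / z) has_field_derivative D) (at z) \<and> D \<noteq> 0" if "a \<noteq> 0" "z \<noteq> 0" for z
    using that by (intro exI[of _ "- a / z\<^sup>2"])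
      (auto intro!: derivative_eq_intros simp: power2_eq_square field_simps)
qed (auto intro!: holomorphic_intros)

text \<open>Writing \<open>h = H \<circ> exp\<close> turns periodicity under multiplication by \<open>p\<close> into boundedness.\<close>

lemma periodic_const:
  assumes h: "h holomorphic_on - {0}" and per: "\<And>z. z \<noteq> 0 \<Longrightarrow> h (p * z) = h z"
  obtains k where "\<And>z. z \<noteq> 0 \<Longrightarrow> h z = k"
proof -
  have pk: "h (p powi k * z) = h z" if "z \<noteq> 0" for k z
  proof (induction k rule: int_induct[where k = 0])
    case (step1 i)
    have "h (p * (p powi i * z)) = h (p powi i * z)" using that by (intro per) auto
    then show ?case using step1 by (simp add: power_int_add mult_ac)
  next
    case (step2 i)
    have "h (p * (p powi (i - 1) * z)) = h (p powi (i - 1) * z)" using that by (intro per) auto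
    then show ?case using step2 by (simp add: power_int_diff mult_ac)
  qed auto
  let ?K = "{z::complex. norm p \<le> norm z \<and> norm z \<le> 1}"
  have "?K = cball 0 1 - ball 0 (norm p)" by auto
  then have "compact ?K" by (simp add: compact_diff)
  moreover have "continuous_on ?K h"
    by (rule continuous_on_subset[OF holomorphic_on_imp_continuous_on[OF h]]) (use norm_p_pos in auto)
  ultimately have "bounded (h ` ?K)" using compact_continuous_image compact_imp_bounded by blast
  moreover have "range (h \<circ> exp) \<subseteq> h ` ?K"
  proof safe
    fix w :: complex
    define L where "L = ln (norm p)"
    have L: "L < 0" using norm_p_less_1 norm_p_pos by (simp add: L_def)
    \<comment> \<open>With this \<open>k\<close> the point \<open>p powi (-k) * exp w\<close> lies
      in the fundamental annulus \<open>?K\<close>, where \<open>h\<close> is bounded by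
      compactness.\<close>
    define k where "k = \<lfloor>Re w / L\<rfloor>"
    have "real_of_int k \<le> Re w / L" "Re w / L < real_of_int k + 1" unfolding k_def by linarith+
    then have k: "real_of_int k * L \<ge> Re w" "Re w > (real_of_int k + 1) * L"
      using L by (simp_all add: field_simps)
    have np: "norm p powi (-k) = exp (- (real_of_int k * L))"
      using norm_p_pos by (simp add: L_def power_int_minus exp_minus powr_real_of_int'[symmetric] powr_def)
    have "norm (p powi (-k) * exp w) = exp (Re w - real_of_int k * L)"
      by (simp only: norm_mult norm_power_int np norm_exp_eq_Re) (simp add: exp_diff exp_minus field_simps)
    moreover have "exp (Re w - real_of_int k * L) \<le> 1" using k by simp
    moreover have "exp L \<le> exp (Re w - real_of_int k * L)" using k by (simp add: algebra_simps)
    then have "norm p \<le> exp (Re w - real_of_int k * L)" using norm_p_pos by (simp add: L_def)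
    ultimately have "p powi (-k) * exp w \<in> ?K" by auto
    then show "(h \<circ> exp) w \<in> h ` ?K"
      using pk[of "exp w" "-k"] by (metis (no_types, lifting) comp_apply exp_not_eq_zero image_eqI)
  qed
  ultimately have "bounded (range (h \<circ> exp))" using bounded_subset by blast
  moreover have "(h \<circ> exp) holomorphic_on UNIV"
    by (rule holomorphic_on_compose[OF holomorphic_on_exp]) (rule holomorphic_on_subset[OF h], auto)
  ultimately have "(h \<circ> exp) constant_on UNIV" by (rule Liouville_theorem[rotated])
  then obtain k where k: "\<And>w. h (exp w) = k" by (auto simp: constant_on_def)
  show ?thesis
  proof
    show "h z = k" if "z \<noteq> 0" for z using k[of "ln z"] that by simp
  qed
qed

subsection \<open>Theta functions of one variable\<close>


text \<open>The product usually written theta(u z, u / z; p): the basic symmetric theta function of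
  degree one, with zeros in the classes of \<open>u\<close> and \<open>1 / u\<close>. It takes the
  place of the linear factors of polynomial interpolation.\<close>

definition thpm :: "complex \<Rightarrow> complex \<Rightarrow> complex" where
  "thpm u z = th (u * z) * th (u / z)"

text \<open>The case of one variable, for functions of a bare complex number; values at
  \<open>0\<close> are left free.\<close>

definition BC1 :: "nat \<Rightarrow> (complex \<Rightarrow> complex) set" where
  "BC1 m = {h. h holomorphic_on - {0} \<and> (\<forall>z. z \<noteq> 0 \<longrightarrow> h (1 / z) = h z) \<and>
    (\<forall>z. z \<noteq> 0 \<longrightarrow> h (p * z) = h z / (p * z\<^sup>2) ^ m)}"

lemma BC1_holo: "h \<in> BC1 m \<Longrightarrow> h holomorphic_on - {0}"
  and BC1_inv: "h \<in> BC1 m \<Longrightarrow> z \<noteq> 0 \<Longrightarrow> h (1 / z) = h z"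
  and BC1_p: "h \<in> BC1 m \<Longrightarrow> z \<noteq> 0 \<Longrightarrow> h (p * z) = h z / (p * z\<^sup>2) ^ m"
  by (auto simp: BC1_def)

lemma thpm_inv: "z \<noteq> 0 \<Longrightarrow> thpm u (1 / z) = thpm u z"
  by (simp add: thpm_def mult.commute)

lemma thpm_p:
  assumes "u \<noteq> 0" "z \<noteq> 0"
  shows "thpm u (p * z) = thpm u z / (p * z\<^sup>2)"
proof -
  have "th (u * (p * z)) = - th (u * z) / (u * z)"
    using theta_p_mult[of "u * z"] assms by (simp add: mult_ac)
  moreover have "th (u / (p * z)) = - (u / z / p) * th (u / z)"
    using theta_div_p[of "u / z"] assms by (simp add: mult.commute)
  ultimately have "thpm u (p * z) = (- th (u * z) / (u * z)) * (- (u / z / p) * th (u / z))"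
    by (simp add: thpm_def)
  then show ?thesis using assms by (simp add: thpm_def field_simps power2_eq_square)
qed

lemma holomorphic_thpm: "u \<noteq> 0 \<Longrightarrow> (\<lambda>z. thpm u z) holomorphic_on - {0}"
  unfolding thpm_def by (intro holomorphic_intros) auto

lemma thpm_eq_0_iff: "u \<noteq> 0 \<Longrightarrow> z \<noteq> 0 \<Longrightarrow> thpm u z = 0 \<longleftrightarrow> u * z \<in> pz \<or> u / z \<in> pz"
  by (simp add: thpm_def theta_eq_0_iff)

lemma thpm_BC1: "u \<noteq> 0 \<Longrightarrow> thpm u \<in> BC1 1"
  using holomorphic_thpm thpm_inv thpm_p by (auto simp: BC1_def)

lemma BC1_mult: "f \<in> BC1 m \<Longrightarrow> g \<in> BC1 k \<Longrightarrow> (\<lambda>z. f z * g z) \<in> BC1 (m + k)"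
  by (auto simp: BC1_def power_add intro!: holomorphic_intros)

lemma BC1_const: "(\<lambda>z. k) \<in> BC1 0"
  by (auto simp: BC1_def)

lemma BC1_prod: "finite I \<Longrightarrow> (\<And>i. i \<in> I \<Longrightarrow> f i \<in> BC1 1) \<Longrightarrow> (\<lambda>z. \<Prod>i\<in>I. f i z) \<in> BC1 (card I)"
  by (induction I rule: finite_induct) (use BC1_const BC1_mult in \<open>force+\<close>)

lemma BC1_scale: "f \<in> BC1 m \<Longrightarrow> (\<lambda>z. k * f z) \<in> BC1 m"
  using BC1_mult[OF BC1_const, of f m k] by simp

lemma BC1_zero: "(\<lambda>z. 0) \<in> BC1 m"
  by (auto simp: BC1_def)

lemma BC1_add: "f \<in> BC1 m \<Longrightarrow> g \<in> BC1 m \<Longrightarrow> (\<lambda>z. f z + g z) \<in> BC1 m"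
  by (auto simp: BC1_def add_divide_distrib intro!: holomorphic_intros)

lemma BC1_diff: "f \<in> BC1 m \<Longrightarrow> g \<in> BC1 m \<Longrightarrow> (\<lambda>z. f z - g z) \<in> BC1 m"
  by (auto simp: BC1_def diff_divide_distrib intro!: holomorphic_intros)

lemma BC1_sum: "(\<And>i. i \<in> I \<Longrightarrow> f i \<in> BC1 m) \<Longrightarrow> (\<lambda>z. \<Sum>i\<in>I. f i z) \<in> BC1 m"
  by (induction I rule: infinite_finite_induct) (use BC1_zero BC1_add in \<open>force+\<close>)

lemma BC1_cong: "f \<in> BC1 m \<Longrightarrow> (\<And>z. z \<noteq> 0 \<Longrightarrow> f z = g z) \<Longrightarrow> g \<in> BC1 m"
  unfolding BC1_def by (auto intro: holomorphic_transform)

lemma BC1_0_const: "h \<in> BC1 0 \<Longrightarrow> \<exists>k. \<forall>z. z \<noteq> 0 \<longrightarrow> h z = k"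
  using periodic_const[of h] by (auto simp: BC1_def)

lemma BC1_periodic_powi_zero:
  assumes h: "h \<in> BC1 m" and "h u = 0" "u \<noteq> 0"
  shows "h (p powi k * u) = 0"
proof (induction k rule: int_induct[where k = 0])
  case (step1 i)
  then show ?case
    using BC1_p[OF h, of "p powi i * u"] assms by (simp add: power_int_add mult_ac)
next
  case (step2 i)
  then show ?case
    using BC1_p[OF h, of "p powi (i - 1) * u"] assms by (simp add: power_int_diff mult_ac)
qed (use assms in auto)

lemma simple_zeros_thpm:
  assumes u: "u \<noteq> 0" "u * u \<notin> pz"
  shows "simple_zeros (thpm u)"
proof -
  have "simple_zeros (\<lambda>z. th (u * z) * th (u / z))"
  proof (rule simple_zeros_mult[OF simple_zeros_theta_mult[OF u(1)] simple_zeros_theta_divide[OF u(1)]])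
    fix z :: complex assume "z \<noteq> 0" "th (u * z) = 0" "th (u / z) = 0"
    then have "u * z \<in> pz" "u / z \<in> pz" using u by (simp_all add: theta_eq_0_iff)
    from pz_mult[OF this] show False using u \<open>z \<noteq> 0\<close> by simp
  qed
  then show ?thesis by (simp add: thpm_def[abs_def])
qed

section \<open>Classes modulo inversion and powers of p, and interpolation in one variable\<close>

definition bad :: "complex \<Rightarrow> complex set" where
  "bad x = {z. x * z \<in> pz \<or> x / z \<in> pz}"

lemma countable_bad [simp]: "x \<noteq> 0 \<Longrightarrow> countable (bad x)"
proof (rule countable_subset)
  assume x: "x \<noteq> 0"
  show "bad x \<subseteq> (\<lambda>w. w / x) ` pz \<union> (\<lambda>w. x / w) ` pz"
  proof
    fix z assume "z \<in> bad x"
    then consider "x * z \<in> pz" | "x / z \<in> pz" by (auto simp: bad_def)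
    then show "z \<in> (\<lambda>w. w / x) ` pz \<union> (\<lambda>w. x / w) ` pz"
    proof cases
      case 1 then show ?thesis using x by (intro UnI1 image_eqI[of _ _ "x * z"]) auto
    next
      case 2 then show ?thesis using x by (intro UnI2 image_eqI[of _ _ "x / z"]) auto
    qed
  qed
qed auto

lemma bad_sym: "x \<noteq> 0 \<Longrightarrow> y \<noteq> 0 \<Longrightarrow> x \<in> bad y \<longleftrightarrow> y \<in> bad x"
  using pz_inverse[of "x / y"] by (auto simp: bad_def mult.commute)

lemma thpm_eq_0_bad: "u \<noteq> 0 \<Longrightarrow> z \<noteq> 0 \<Longrightarrow> thpm u z = 0 \<longleftrightarrow> z \<in> bad u"
  by (simp add: thpm_eq_0_iff bad_def)

text \<open>Symmetry and quasi-periodicity spread the zero at \<open>u\<close> over all zeros of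
  \<open>thpm u\<close>, and these are simple because \<open>u * u\<close> is not a power of
  \<open>p\<close>. The quotient inherits both relations off a countable set, hence everywhere by
  continuity.\<close>

lemma BC1_divide:
  assumes h: "h \<in> BC1 (Suc m)" and u: "u \<noteq> 0" "u * u \<notin> pz" and "h u = 0"
  obtains g where "g \<in> BC1 m" "\<And>z. z \<noteq> 0 \<Longrightarrow> h z = thpm u z * g z"
proof -
  have zeros: "h z = 0" if "z \<noteq> 0" "thpm u z = 0" for z
  proof -
    have "u * z \<in> pz \<or> u / z \<in> pz" using that u thpm_eq_0_iff by blast
    then show ?thesis
    proof
      assume "u * z \<in> pz"
      then obtain k where "u * z = p powi k" by (auto simp: pz_def)
      then have "z = p powi k * (1 / u)" using u by (simp add: field_simps)
      then show ?thesis
        using BC1_periodic_powi_zero[OF h, of "1 / u" k] BC1_inv[OF h, of u] assms by auto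
    next
      assume "u / z \<in> pz"
      then obtain k where "u / z = p powi k" by (auto simp: pz_def)
      then have "z = p powi (-k) * u"
        using that u by (simp add: field_simps power_int_minus)
      then show ?thesis
        using BC1_periodic_powi_zero[OF h, of u "-k"] assms by auto
    qed
  qed
  obtain g where g: "g holomorphic_on - {0}" "\<And>z. z \<noteq> 0 \<Longrightarrow> h z = thpm u z * g z"
    using simple_zeros_divide[OF simple_zeros_thpm[OF u] BC1_holo[OF h] zeros] by blast
  have cont: "continuous_on (- {0}) g" using g(1) holomorphic_on_imp_continuous_on by blast
  have bad: "countable (bad u)" using u by simp
  have inv: "g (1 / z) = g z" if "z \<noteq> 0" for z
  proof (rule continuous_eq_off_countable[where f = "\<lambda>z. g (1 / z)" and g = g, OF _ cont bad _ that])
    show "continuous_on (- {0}) (\<lambda>z. g (1 / z))"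
      by (rule continuous_on_compose2[OF cont]) (auto intro!: continuous_intros)
    fix z :: complex assume z: "z \<noteq> 0" "z \<notin> bad u"
    then have nz: "thpm u z \<noteq> 0" using thpm_eq_0_bad u by simp
    have "thpm u z * g (1 / z) = thpm u z * g z"
      using g(2)[of z] g(2)[of "1 / z"] z BC1_inv[OF h, of z] thpm_inv[of z u] by (metis divide_eq_0_iff one_neq_zero)
    then show "g (1 / z) = g z" using nz by simp
  qed
  have per: "g (p * z) = g z / (p * z\<^sup>2) ^ m" if "z \<noteq> 0" for z
  proof (rule continuous_eq_off_countable[where f = "\<lambda>z. g (p * z)" and g = "\<lambda>z. g z / (p * z\<^sup>2) ^ m", OF _ _ bad _ that])
    show "continuous_on (- {0}) (\<lambda>z. g (p * z))"
      by (rule continuous_on_compose2[OF cont]) (auto intro!: continuous_intros)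
    show "continuous_on (- {0}) (\<lambda>z. g z / (p * z\<^sup>2) ^ m)"
      by (intro continuous_intros cont) auto
    fix z :: complex assume z: "z \<noteq> 0" "z \<notin> bad u"
    then have nz: "thpm u z \<noteq> 0" using thpm_eq_0_bad u by simp
    have "thpm u z / (p * z\<^sup>2) * g (p * z) = thpm u z * g z / ((p * z\<^sup>2) * (p * z\<^sup>2) ^ m)"
      using g(2)[of z] g(2)[of "p * z"] z BC1_p[OF h, of z] thpm_p[of u z] u by simp
    then show "g (p * z) = g z / (p * z\<^sup>2) ^ m" using nz z by (simp add: field_simps)
  qed
  have "g \<in> BC1 m" using g(1) inv per by (auto simp: BC1_def)
  then show ?thesis using that g(2) by blast
qed

text \<open>Representatives of distinct classes under inversion and multiplication by
  \<open>p\<close>, with \<open>x\<close> and \<open>1 / x\<close> never differing by a power of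
  \<open>p\<close>. On such nodes vanishing conditions are independent.\<close>

definition good_set :: "complex set \<Rightarrow> bool" where
  "good_set A \<longleftrightarrow> finite A \<and> 0 \<notin> A \<and> (\<forall>x\<in>A. x * x \<notin> pz) \<and>
    (\<forall>x\<in>A. \<forall>y\<in>A. x \<noteq> y \<longrightarrow> x * y \<notin> pz \<and> x / y \<notin> pz)"

lemma good_set_subset: "good_set A \<Longrightarrow> B \<subseteq> A \<Longrightarrow> good_set B"
  unfolding good_set_def by (meson in_mono finite_subset)

text \<open>Each node removes a factor \<open>thpm u\<close> and lowers the degree by one without
  affecting the other nodes. In degree zero the function is constant, and one node is left to kill
  it.\<close>

lemma BC1_determined:
  assumes "good_set A" "card A = Suc m" "h \<in> BC1 m" "\<And>x. x \<in> A \<Longrightarrow> h x = 0" "z \<noteq> 0"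
  shows "h z = 0"
  using assms
proof (induction m arbitrary: A h)
  case 0
  then obtain x where "A = {x}" by (metis One_nat_def card_1_singletonE)
  moreover obtain k where "\<And>z. z \<noteq> 0 \<Longrightarrow> h z = k" using BC1_0_const 0 by blast
  ultimately show ?case using 0 by (metis good_set_def singletonI)
next
  case (Suc m)
  from Suc.prems(2) obtain u where u: "u \<in> A" by fastforce
  then have u': "u \<noteq> 0" "u * u \<notin> pz" using Suc.prems(1) by (auto simp: good_set_def)
  obtain g where g: "g \<in> BC1 m" "\<And>z. z \<noteq> 0 \<Longrightarrow> h z = thpm u z * g z"
    using BC1_divide[OF Suc.prems(3) u'] Suc.prems(4)[OF u] by blast
  have "g z = 0"
  proof (rule Suc.IH[of "A - {u}"])
    show "good_set (A - {u})" using Suc.prems(1) by (rule good_set_subset) auto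
    show "card (A - {u}) = Suc m" using Suc.prems(1,2) u by (simp add: good_set_def)
    fix x assume x: "x \<in> A - {u}"
    then have "u * x \<notin> pz" "u / x \<notin> pz" "x \<noteq> 0" using Suc.prems(1) u by (auto simp: good_set_def)
    then have "thpm u x \<noteq> 0" using thpm_eq_0_iff u' by blast
    then show "g x = 0" using g(2)[of x] Suc.prems(4)[of x] x \<open>x \<noteq> 0\<close> by auto
  qed (use g Suc.prems in auto)
  then show ?case using g(2)[of z] Suc.prems by simp
qed

text \<open>The Lagrange basis function of the node \<open>u\<close>, with \<open>thpm w\<close> as
  the factor vanishing at \<open>w\<close>.\<close>

definition lagr :: "complex set \<Rightarrow> complex \<Rightarrow> complex \<Rightarrow> complex" where
  "lagr A u z = (\<Prod>w\<in>A - {u}. thpm w z / thpm w u)"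

lemma lagr_BC1:
  assumes "good_set A" "card A = Suc m" "u \<in> A"
  shows "lagr A u \<in> BC1 m"
proof -
  have "(\<lambda>z. \<Prod>w\<in>A - {u}. 1 / thpm w u * thpm w z) \<in> BC1 (card (A - {u}))"
    by (intro BC1_prod BC1_scale thpm_BC1) (use assms in \<open>auto simp: good_set_def\<close>)
  moreover have "card (A - {u}) = m" using assms by (simp add: good_set_def)
  ultimately show ?thesis by (simp add: lagr_def[abs_def])
qed

lemma lagr_delta:
  assumes "good_set A" "u \<in> A" "v \<in> A"
  shows "lagr A u v = (if u = v then 1 else 0)"
proof (cases "u = v")
  case True
  have "thpm w v \<noteq> 0" if "w \<in> A - {v}" for w
    using assms that thpm_eq_0_iff[of w v] by (auto simp: good_set_def)
  then have "lagr A v v = (\<Prod>w\<in>A - {v}. 1)" unfolding lagr_def by (intro prod.cong) auto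
  then show ?thesis using True by simp
next
  case False
  have "v \<noteq> 0" using assms by (auto simp: good_set_def)
  then have "thpm v v = 0" by (simp add: thpm_def)
  moreover have "finite (A - {u})" "v \<in> A - {u}" using assms False by (auto simp: good_set_def)
  ultimately have "lagr A u v = 0" unfolding lagr_def by (intro prod_zero) (auto intro: bexI[of _ v])
  then show ?thesis using False by simp
qed

lemma countable_sqrt: "countable {z::complex. z * z \<in> P}" if "countable P"
proof (rule countable_subset)
  show "{z. z * z \<in> P} \<subseteq> csqrt ` P \<union> (\<lambda>w. - csqrt w) ` P"
  proof
    fix z assume "z \<in> {z. z * z \<in> P}"
    then have P: "z * z \<in> P" by simp
    have "z = csqrt (z * z) \<or> z = - csqrt (z * z)"
      using power2_csqrt[of "z * z"] by (metis power2_eq_iff power2_eq_square)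
    then show "z \<in> csqrt ` P \<union> (\<lambda>w. - csqrt w) ` P" using P by blast
  qed
qed (use that in auto)

lemma good_set_altdef:
  "good_set A \<longleftrightarrow> finite A \<and> 0 \<notin> A \<and> (\<forall>x\<in>A. x * x \<notin> pz) \<and> (\<forall>x\<in>A. \<forall>y\<in>A. x \<noteq> y \<longrightarrow> y \<notin> bad x)"
  by (auto simp: good_set_def bad_def)

lemma ex_not_countable: "countable B \<Longrightarrow> \<exists>z::complex. z \<notin> B"
  using uncountable_UNIV_complex by (metis UNIV_eq_I)

text \<open>Nodes are chosen one after the other; at each stage only countably many points are
  excluded.\<close>

lemma good_set_exists:
  assumes "countable B"
  shows "\<exists>A. good_set A \<and> card A = N \<and> A \<inter> B = {}"
proof (induction N)
  case 0
  then show ?case by (intro exI[of _ "{}"]) (auto simp: good_set_def)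
next
  case (Suc N)
  then obtain A where A: "good_set A" "card A = N" "A \<inter> B = {}" by blast
  have A': "finite A" "0 \<notin> A" using A by (auto simp: good_set_def)
  have "countable (B \<union> {0} \<union> {z. z * z \<in> pz} \<union> A \<union> (\<Union>x\<in>A. bad x))"
    using assms A' countable_sqrt[of pz] by (intro countable_Un countable_UN) (auto simp: countable_finite intro: countable_bad)
  then obtain z where z: "z \<notin> B \<union> {0} \<union> {z. z * z \<in> pz} \<union> A \<union> (\<Union>x\<in>A. bad x)"
    using ex_not_countable by blast
  have "z \<notin> bad x" "x \<notin> bad z" if "x \<in> A" for x
    using z that A' bad_sym[of x z] by auto
  then have "good_set (insert z A)" using A(1) z by (auto simp: good_set_altdef)
  then show ?case using A A' z by (intro exI[of _ "insert z A"]) auto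
qed

end

subsection \<open>Functions of several variables\<close>

lemma torus_upd: "x \<in> torus n \<Longrightarrow> i \<in> {1..n} \<Longrightarrow> z \<noteq> 0 \<Longrightarrow> x(i := z) \<in> torus n"
  unfolding torus_def PiE_def extensional_def Pi_def by (auto split: if_splits)

lemma torus_nz: "x \<in> torus n \<Longrightarrow> i \<in> {1..n} \<Longrightarrow> x i \<noteq> 0"
  by (auto simp: torus_def PiE_def Pi_def)

lemma torusI: "(\<And>i. i \<in> {1..n} \<Longrightarrow> g i \<noteq> 0) \<Longrightarrow> (\<lambda>i\<in>{1..n}. g i) \<in> torus n"
  by (auto simp: torus_def PiE_def)

lemma torus_comp:
  assumes "\<pi> permutes {1..n}" "x \<in> torus n"
  shows "x \<circ> \<pi> \<in> torus n"
proof -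
  have "\<pi> i \<in> {1..n} \<longleftrightarrow> i \<in> {1..n}" for i using permutes_in_image[OF assms(1)] .
  then show ?thesis using assms(2) by (auto simp: torus_def PiE_def extensional_def Pi_def)
qed

lemma fun_upd_comp_permutes:
  assumes "\<pi> permutes S"
  shows "(x(i := z)) \<circ> \<pi> = (x \<circ> \<pi>)(inv \<pi> i := z)"
  using permutes_inverses[OF assms] by (auto simp: fun_eq_iff)

context nome
begin

text \<open>No joint regularity is demanded: \<open>sep_BC1_continuous\<close> derives it from the
  conditions in the single variables.\<close>

definition sep_BC1 :: "nat \<Rightarrow> nat \<Rightarrow> ((nat \<Rightarrow> complex) \<Rightarrow> complex) \<Rightarrow> bool" where
  "sep_BC1 m n f \<longleftrightarrow> (\<forall>x\<in>torus n. \<forall>i\<in>{1..n}. (\<lambda>z. f (x(i := z))) \<in> BC1 m)"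

lemma sep_BC1D: "sep_BC1 m n f \<Longrightarrow> x \<in> torus n \<Longrightarrow> i \<in> {1..n} \<Longrightarrow> (\<lambda>z. f (x(i := z))) \<in> BC1 m"
  by (simp add: sep_BC1_def)

lemma sep_BC1_diff: "sep_BC1 m n f \<Longrightarrow> sep_BC1 m n g \<Longrightarrow> sep_BC1 m n (\<lambda>x. f x - g x)"
  by (auto simp: sep_BC1_def intro: BC1_diff)

lemma sep_BC1_mult: "sep_BC1 m n f \<Longrightarrow> sep_BC1 k n g \<Longrightarrow> sep_BC1 (m + k) n (\<lambda>x. f x * g x)"
  by (auto simp: sep_BC1_def intro: BC1_mult)

lemma sep_BC1_cong:
  assumes "sep_BC1 m n f" "\<And>x. x \<in> torus n \<Longrightarrow> f x = g x"
  shows "sep_BC1 m n g"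
  unfolding sep_BC1_def
proof safe
  fix x i assume xi: "x \<in> torus n" "i \<in> {1..n}"
  show "(\<lambda>z. g (x(i := z))) \<in> BC1 m"
    by (rule BC1_cong[OF sep_BC1D[OF assms(1) xi]]) (use assms(2) torus_upd[OF xi] in simp)
qed

lemma sep_BC1_comp:
  assumes f: "sep_BC1 m n f" and \<pi>: "\<pi> permutes {1..n}"
  shows "sep_BC1 m n (\<lambda>x. f (x \<circ> \<pi>))"
  unfolding sep_BC1_def
proof safe
  fix x i assume x: "x \<in> torus n" and i: "i \<in> {1..n}"
  have "inv \<pi> i \<in> {1..n}" using permutes_in_image[OF permutes_inv[OF \<pi>]] i by blast
  then have "(\<lambda>z. f ((x \<circ> \<pi>)(inv \<pi> i := z))) \<in> BC1 m"
    using sep_BC1D[OF f torus_comp[OF \<pi> x]] by blast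
  then show "(\<lambda>z. f (x(i := z) \<circ> \<pi>)) \<in> BC1 m"
    unfolding fun_upd_comp_permutes[OF \<pi>] .
qed

text \<open>The variables are released from the grids one at a time: with the others fixed,
  \<open>Suc m\<close> nodes determine a function of degree \<open>m\<close>.\<close>

lemma sep_BC1_determined:
  assumes f: "sep_BC1 m n f" and A: "\<And>i. i \<in> {1..n} \<Longrightarrow> good_set (A i) \<and> card (A i) = Suc m"
    and zero: "\<And>x. x \<in> torus n \<Longrightarrow> (\<And>i. i \<in> {1..n} \<Longrightarrow> x i \<in> A i) \<Longrightarrow> f x = 0"
    and x: "x \<in> torus n"
  shows "f x = 0"
proof -
  have "\<forall>x\<in>torus n. (\<forall>i\<in>{1..n}. k < i \<longrightarrow> x i \<in> A i) \<longrightarrow> f x = 0" if "k \<le> n" for k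
    using that
  proof (induction k)
    case 0
    then show ?case using zero by auto
  next
    case (Suc k)
    show ?case
    proof safe
      fix x assume x: "x \<in> torus n" "\<forall>i\<in>{1..n}. Suc k < i \<longrightarrow> x i \<in> A i"
      have i: "Suc k \<in> {1..n}" using Suc.prems by auto
      have "f (x(Suc k := x (Suc k))) = 0"
      proof (rule BC1_determined[where h = "\<lambda>z. f (x(Suc k := z))"])
        show "good_set (A (Suc k))" "card (A (Suc k)) = Suc m" using A i by auto
        show "(\<lambda>z. f (x(Suc k := z))) \<in> BC1 m" using sep_BC1D[OF f x(1) i] .
        show "x (Suc k) \<noteq> 0" using torus_nz x i by blast
        fix z assume z: "z \<in> A (Suc k)"
        then have "z \<noteq> 0" using A[OF i] by (auto simp: good_set_def)
        then have "x(Suc k := z) \<in> torus n" using x i torus_upd by blast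
        then show "f (x(Suc k := z)) = 0" using Suc.IH Suc.prems x z by force
      qed
      then show "f x = 0" by simp
    qed
  qed
  from this[of n] show ?thesis using x by auto
qed

text \<open>The tensor product of the one-variable Lagrange interpolations on the grids
  \<open>A i\<close>, with data \<open>\<phi>\<close>.\<close>

definition tensor :: "nat \<Rightarrow> (nat \<Rightarrow> complex set) \<Rightarrow> ((nat \<Rightarrow> complex) \<Rightarrow> complex) \<Rightarrow> (nat \<Rightarrow> complex) \<Rightarrow> complex" where
  "tensor n A \<phi> x = (\<Sum>y\<in>PiE {1..n} A. \<phi> y * (\<Prod>i\<in>{1..n}. lagr (A i) (y i) (x i)))"

lemma sep_BC1_tensor:
  assumes A: "\<And>i. i \<in> {1..n} \<Longrightarrow> good_set (A i) \<and> card (A i) = Suc m"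
  shows "sep_BC1 m n (tensor n A \<phi>)"
  unfolding sep_BC1_def
proof safe
  fix x i assume x: "x \<in> torus n" and i: "i \<in> {1..n}"
  have "(\<lambda>z. \<phi> y * (\<Prod>j\<in>{1..n}. lagr (A j) (y j) ((x(i := z)) j))) \<in> BC1 m"
    if y: "y \<in> PiE {1..n} A" for y
  proof -
    have "(\<lambda>z. (\<phi> y * (\<Prod>j\<in>{1..n} - {i}. lagr (A j) (y j) (x j))) * lagr (A i) (y i) z) \<in> BC1 m"
      using A[OF i] y i by (intro BC1_scale lagr_BC1) auto
    moreover have "(\<Prod>j\<in>{1..n}. lagr (A j) (y j) ((x(i := z)) j)) =
        lagr (A i) (y i) z * (\<Prod>j\<in>{1..n} - {i}. lagr (A j) (y j) (x j))" for z
      by (subst prod.remove[OF _ i]) (auto intro!: prod.cong)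
    ultimately show ?thesis by (simp add: mult_ac)
  qed
  then show "(\<lambda>z. tensor n A \<phi> (x(i := z))) \<in> BC1 m"
    unfolding tensor_def by (intro BC1_sum) auto
qed

lemma tensor_grid:
  assumes A: "\<And>i. i \<in> {1..n} \<Longrightarrow> good_set (A i)" and x: "x \<in> PiE {1..n} A"
  shows "tensor n A \<phi> x = \<phi> x"
proof -
  have fin: "finite (PiE {1..n} A)"
    using A by (intro finite_PiE) (auto simp: good_set_def)
  have "(\<Prod>i\<in>{1..n}. lagr (A i) (y i) (x i)) = (if y = x then 1 else 0)" if y: "y \<in> PiE {1..n} A" for y
  proof (cases "y = x")
    case True
    have "lagr (A i) (y i) (x i) = 1" if "i \<in> {1..n}" for i
      using lagr_delta[OF A[OF that] PiE_mem[OF x that] PiE_mem[OF x that]] True by simp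
    then show ?thesis using True by simp
  next
    case False
    then obtain i where i: "i \<in> {1..n}" "y i \<noteq> x i" using PiE_ext[OF y x] by blast
    then have "lagr (A i) (y i) (x i) = 0"
      using lagr_delta[OF A[OF i(1)] PiE_mem[OF y i(1)] PiE_mem[OF x i(1)]] by simp
    then show ?thesis using False i(1) by (auto intro!: prod_zero bexI[of _ i])
  qed
  then have "tensor n A \<phi> x = (\<Sum>y\<in>PiE {1..n} A. if x = y then \<phi> y else 0)"
    unfolding tensor_def by (intro sum.cong) auto
  then show ?thesis using x fin by simp
qed

lemma continuous_tensor:
  assumes A: "\<And>i. i \<in> {1..n} \<Longrightarrow> good_set (A i) \<and> card (A i) = Suc m"
  shows "continuous_on (torus n) (tensor n A \<phi>)"
  unfolding tensor_def
proof (intro continuous_intros)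
  fix y i assume y: "y \<in> PiE {1..n} A" and i: "i \<in> {1..n}"
  have "lagr (A i) (y i) \<in> BC1 m" using A[OF i] y i by (intro lagr_BC1) auto
  then have "continuous_on (- {0}) (lagr (A i) (y i))"
    by (metis BC1_holo holomorphic_on_imp_continuous_on)
  then show "continuous_on (torus n) (\<lambda>x. lagr (A i) (y i) (x i))"
    by (rule continuous_on_compose2)
      (use i torus_nz in \<open>auto intro: continuous_on_product_coordinates continuous_on_subset\<close>)
qed

lemma BC1_grid_exists: "\<exists>A. good_set A \<and> card A = Suc m"
  using good_set_exists[of "{}" "Suc m"] by blast

text \<open>Both sides have degree \<open>m\<close> in each variable and agree on the grid.\<close>

lemma sep_BC1_eq_tensor:
  assumes f: "sep_BC1 m n f" and A: "\<And>i. i \<in> {1..n} \<Longrightarrow> good_set (A i) \<and> card (A i) = Suc m"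
    and x: "x \<in> torus n"
  shows "f x = tensor n A f x"
proof -
  have "f x - tensor n A f x = 0"
  proof (rule sep_BC1_determined[where f = "\<lambda>x. f x - tensor n A f x", OF sep_BC1_diff[OF f sep_BC1_tensor] _ _ x])
    fix y assume "y \<in> torus n" "\<And>i. i \<in> {1..n} \<Longrightarrow> y i \<in> A i"
    then have "y \<in> PiE {1..n} A" by (auto simp: torus_def PiE_def)
    then show "f y - tensor n A f y = 0" using tensor_grid A by simp
  qed (use A in auto)
  then show ?thesis by simp
qed

text \<open>The interpolation formula is a finite sum of products of continuous functions of single
  coordinates.\<close>

lemma sep_BC1_continuous:
  assumes "sep_BC1 m n f"
  shows "continuous_on (torus n) f"
proof -
  obtain A where A: "good_set A" "card A = Suc m" using BC1_grid_exists by blast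
  have "continuous_on (torus n) (tensor n (\<lambda>_. A) f)"
    using continuous_tensor[of n "\<lambda>_. A" m f] A by blast
  then show ?thesis
    using sep_BC1_eq_tensor[OF assms, of "\<lambda>_. A"] A by (metis (no_types, lifting) continuous_on_cong)
qed

lemma powi_neg_nat: "(x::complex) powi (- int m) = 1 / x ^ m"
  by (simp add: power_int_minus divide_inverse)

text \<open>The definition asks for quasi-periodicity in the first variable only and for joint
  continuity. Conjugating by a transposition moves the former to any variable; the latter follows
  from the separate conditions.\<close>

lemma BC_theta_iff:
  "f \<in> BC_theta m n p \<longleftrightarrow> f \<in> extensional (torus n) \<and> sep_BC1 m n f \<and>
    (\<forall>x\<in>torus n. \<forall>\<pi>. \<pi> permutes {1..n} \<longrightarrow> f (x \<circ> \<pi>) = f x)"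
proof safe
  assume f: "f \<in> BC_theta m n p"
  then show "f \<in> extensional (torus n)" by (simp add: BC_theta_def)
  have sym: "f (x \<circ> \<pi>) = f x" if "x \<in> torus n" "\<pi> permutes {1..n}" for x \<pi>
    using f that unfolding BC_theta_def BC_symmetric_def by blast
  then show "f (x \<circ> \<pi>) = f x" if "x \<in> torus n" "\<pi> permutes {1..n}" for x \<pi>
    using that .
  have inv: "f (x(i := 1 / x i)) = f x" if "x \<in> torus n" "i \<in> {1..n}" for x i
    using f that unfolding BC_theta_def BC_symmetric_def by blast
  have per1: "f (x(1 := p * x 1)) = f x / (p * (x 1)\<^sup>2) ^ m" if "x \<in> torus n" "1 \<le> n" for x
    using f that unfolding BC_theta_def by (auto simp: powi_neg_nat)
  have holo: "(\<lambda>z. f (x(i := z))) holomorphic_on - {0}" if "x \<in> torus n" "i \<in> {1..n}" for x i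
    using f that unfolding BC_theta_def holomorphic_on_torus_def by blast
  show "sep_BC1 m n f"
    unfolding sep_BC1_def BC1_def
  proof (intro ballI, rule CollectI, intro conjI allI impI)
    fix x i assume x: "x \<in> torus n" and i: "i \<in> {1..n}"
    show "(\<lambda>z. f (x(i := z))) holomorphic_on - {0}" using holo x i .
    fix z :: complex assume z: "z \<noteq> 0"
    have xz: "x(i := z) \<in> torus n" using torus_upd x i z by blast
    show "f (x(i := 1 / z)) = f (x(i := z))" using inv[OF xz i] by simp
    let ?\<pi> = "Transposition.transpose 1 i"
    have \<pi>: "?\<pi> permutes {1..n}" using i by (intro permutes_swap_id) auto
    have xpz: "x(i := p * z) \<in> torus n" using torus_upd x i z by simp
    have "f (x(i := p * z)) = f (x(i := p * z) \<circ> ?\<pi>)" using sym[OF xpz \<pi>] by simp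
    also have "x(i := p * z) \<circ> ?\<pi> = (x(i := z) \<circ> ?\<pi>)(1 := p * (x(i := z) \<circ> ?\<pi>) 1)"
      by (auto simp: fun_eq_iff Transposition.transpose_def)
    also have "f \<dots> = f (x(i := z) \<circ> ?\<pi>) / (p * ((x(i := z) \<circ> ?\<pi>) 1)\<^sup>2) ^ m"
      using per1[OF torus_comp[OF \<pi> xz]] i by simp
    also have "\<dots> = f (x(i := z)) / (p * z\<^sup>2) ^ m"
      using sym[OF xz \<pi>] by simp
    finally show "f (x(i := p * z)) = f (x(i := z)) / (p * z\<^sup>2) ^ m" .
  qed
next
  assume ext: "f \<in> extensional (torus n)" and sep: "sep_BC1 m n f"
    and sym: "\<forall>x\<in>torus n. \<forall>\<pi>. \<pi> permutes {1..n} \<longrightarrow> f (x \<circ> \<pi>) = f x"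
  have "f (x(i := 1 / x i)) = f x" if "x \<in> torus n" "i \<in> {1..n}" for x i
    using BC1_inv[OF sep_BC1D[OF sep that], of "x i"] torus_nz[OF that] by simp
  moreover have "f (x(1 := p * x 1)) = (p * (x 1)\<^sup>2) powi (- int m) * f x" if "x \<in> torus n" "1 \<le> n" for x
    using BC1_p[OF sep_BC1D[OF sep that(1), of 1], of "x 1"] torus_nz[OF that(1), of 1] that(2)
    by (simp add: powi_neg_nat)
  ultimately show "f \<in> BC_theta m n p"
    unfolding BC_theta_def BC_symmetric_def holomorphic_on_torus_def
    using ext sym sep_BC1_continuous[OF sep] BC1_holo[OF sep_BC1D[OF sep]] by blast
qed

lemma BC_theta_sep: "f \<in> BC_theta m n p \<Longrightarrow> sep_BC1 m n f"
  and BC_theta_sym: "f \<in> BC_theta m n p \<Longrightarrow> x \<in> torus n \<Longrightarrow> \<pi> permutes {1..n} \<Longrightarrow> f (x \<circ> \<pi>) = f x"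
  and BC_theta_ext: "f \<in> BC_theta m n p \<Longrightarrow> f \<in> extensional (torus n)"
  by (auto simp: BC_theta_iff)

lemma BC_theta_restrictI:
  assumes "sep_BC1 m n f"
    and "\<And>x \<pi>. x \<in> torus n \<Longrightarrow> \<pi> permutes {1..n} \<Longrightarrow> f (x \<circ> \<pi>) = f x"
  shows "(\<lambda>x\<in>torus n. f x) \<in> BC_theta m n p"
  unfolding BC_theta_iff
  using sep_BC1_cong[OF assms(1), of "\<lambda>x\<in>torus n. f x"] assms(2) by (auto simp: torus_comp)

section \<open>Regular points, and extension of functions defined on them\<close>

definition reg_off :: "complex set \<Rightarrow> nat \<Rightarrow> (nat \<Rightarrow> complex) set" where
  "reg_off B n = {x \<in> torus n. (\<forall>i\<in>{1..n}. x i * x i \<notin> pz \<and> x i \<notin> B) \<and>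
    (\<forall>i\<in>{1..n}. \<forall>j\<in>{1..n}. i \<noteq> j \<longrightarrow> x i \<notin> bad (x j))}"

text \<open>The grids of different coordinates are kept apart so that every point of their product
  is regular and avoids \<open>B\<close>; each choice excludes only countably many values.\<close>

lemma grids_exist:
  fixes n :: nat
  assumes "countable B"
  shows "\<exists>A. (\<forall>i\<in>{1..n}. good_set (A i) \<and> card (A i) = Suc m \<and> A i \<inter> B = {}) \<and>
    (\<forall>i\<in>{1..n}. \<forall>j\<in>{1..n}. i \<noteq> j \<longrightarrow> (\<forall>x\<in>A i. \<forall>y\<in>A j. x \<notin> bad y))"
proof (induction n)
  case (Suc n)
  then obtain A where A: "\<And>i. i \<in> {1..n} \<Longrightarrow> good_set (A i) \<and> card (A i) = Suc m \<and> A i \<inter> B = {}"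
    "\<And>i j x y. i \<in> {1..n} \<Longrightarrow> j \<in> {1..n} \<Longrightarrow> i \<noteq> j \<Longrightarrow> x \<in> A i \<Longrightarrow> y \<in> A j \<Longrightarrow> x \<notin> bad y"
    by blast
  define BB where "BB = B \<union> (\<Union>i\<in>{1..n}. \<Union>x\<in>A i. bad x)"
  have nz: "x \<noteq> 0" if "i \<in> {1..n}" "x \<in> A i" for i x
    using A(1)[OF that(1)] that(2) by (auto simp: good_set_def)
  have "countable (\<Union>x\<in>A i. bad x)" if i: "i \<in> {1..n}" for i
    using A(1)[OF i] nz[OF i] by (intro countable_UN) (auto simp: good_set_def countable_finite)
  then have "countable (\<Union>i\<in>{1..n}. \<Union>x\<in>A i. bad x)"
    by (rule countable_UN[rotated]) auto
  then have "countable BB" unfolding BB_def using assms by (intro countable_Un)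
  from good_set_exists[OF this, of "Suc m"] obtain C
    where C: "good_set C" "card C = Suc m" "C \<inter> BB = {}" by blast
  have nzC: "x \<noteq> 0" if "x \<in> C" for x using C(1) that by (auto simp: good_set_def)
  have 1: "x \<notin> bad y" if "x \<in> C" "i \<in> {1..n}" "y \<in> A i" for x y i
    using C(3) that unfolding BB_def by blast
  have 2: "y \<notin> bad x" if "x \<in> C" "i \<in> {1..n}" "y \<in> A i" for x y i
    using 1[OF that] bad_sym[of x y] nz[OF that(2,3)] nzC[OF that(1)] by blast
  show ?case
  proof (intro exI[of _ "A(Suc n := C)"] conjI ballI impI)
    fix i assume "i \<in> {1..Suc n}"
    then consider "i = Suc n" | "i \<in> {1..n}" by fastforce
    then show "good_set ((A(Suc n := C)) i)" "card ((A(Suc n := C)) i) = Suc m" "(A(Suc n := C)) i \<inter> B = {}"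
      using A(1)[of i] C unfolding BB_def by (cases; auto)+
  next
    fix i j x y assume ij: "i \<in> {1..Suc n}" "j \<in> {1..Suc n}" "i \<noteq> j"
      and xy: "x \<in> (A(Suc n := C)) i" "y \<in> (A(Suc n := C)) j"
    consider "i = Suc n" "j \<in> {1..n}" | "j = Suc n" "i \<in> {1..n}" | "i \<in> {1..n}" "j \<in> {1..n}"
      using ij by fastforce
    then show "x \<notin> bad y"
    proof cases
      case 1 then show ?thesis using 1 xy \<open>\<And>x y i. x \<in> C \<Longrightarrow> i \<in> {1..n} \<Longrightarrow> y \<in> A i \<Longrightarrow> x \<notin> bad y\<close>[of x j y] by auto
    next
      case 2 then show ?thesis using xy \<open>\<And>x y i. x \<in> C \<Longrightarrow> i \<in> {1..n} \<Longrightarrow> y \<in> A i \<Longrightarrow> y \<notin> bad x\<close>[of y i x] by auto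
    next
      case 3 then show ?thesis using A(2)[of i j x y] ij(3) xy by auto
    qed
  qed
qed auto

text \<open>The regular points off \<open>B\<close> contain a full product of grids, which
  determines both functions.\<close>

lemma sep_BC1_eq_on_reg:
  assumes f: "sep_BC1 m n f" and g: "sep_BC1 m n g" and B: "countable B"
    and eq: "\<And>x. x \<in> reg_off B n \<Longrightarrow> f x = g x" and x: "x \<in> torus n"
  shows "f x = g x"
proof -
  from grids_exist[OF B, of n m] obtain A
    where A: "\<And>i. i \<in> {1..n} \<Longrightarrow> good_set (A i) \<and> card (A i) = Suc m \<and> A i \<inter> B = {}"
    "\<And>i j x y. i \<in> {1..n} \<Longrightarrow> j \<in> {1..n} \<Longrightarrow> i \<noteq> j \<Longrightarrow> x \<in> A i \<Longrightarrow> y \<in> A j \<Longrightarrow> x \<notin> bad y"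
    by blast
  have "f x - g x = 0"
  proof (rule sep_BC1_determined[where f = "\<lambda>x. f x - g x" and A = A, OF sep_BC1_diff[OF f g] _ _ x])
    show "good_set (A i) \<and> card (A i) = Suc m" if "i \<in> {1..n}" for i using A(1)[OF that] by blast
    fix y assume y: "y \<in> torus n" "\<And>i. i \<in> {1..n} \<Longrightarrow> y i \<in> A i"
    have "y i * y i \<notin> pz \<and> y i \<notin> B" if "i \<in> {1..n}" for i
      using A(1)[OF that] y(2)[OF that] unfolding good_set_def by blast
    moreover have "y i \<notin> bad (y j)" if "i \<in> {1..n}" "j \<in> {1..n}" "i \<noteq> j" for i j
      using A(2)[OF that] y(2) that by blast
    ultimately have "y \<in> reg_off B n" using y(1) by (simp add: reg_off_def)
    then show "f y - g y = 0" using eq by simp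
  qed
  then show ?thesis by simp
qed

text \<open>The candidate is the interpolation of \<open>F\<close> from one grid \<open>A\<close>.
  It agrees with \<open>F\<close> at regular points in general position to \<open>A\<close>; any
  other regular point is reached through a second grid \<open>C\<close> in general position both to
  \<open>A\<close> and to that point.\<close>

lemma sep_extension:
  assumes B: "countable B"
    and F: "\<And>x i. x \<in> reg_off B n \<Longrightarrow> i \<in> {1..n} \<Longrightarrow>
      \<exists>h\<in>BC1 m. \<forall>z. x(i := z) \<in> reg_off B n \<longrightarrow> F (x(i := z)) = h z"
  obtains G where "sep_BC1 m n G" "\<And>x. x \<in> reg_off B n \<Longrightarrow> G x = F x"
proof -
  define R where "R = reg_off B n"
  \<comment> \<open>By general position every point mixing coordinates of \<open>x\<close> with grid
    coordinates is regular, so the one-variable hypothesis on \<open>F\<close> applies at each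
    exchange of a coordinate.\<close>
  have key: "tensor n A F x = F x"
    if grid: "\<forall>i\<in>{1..n}. good_set (A i) \<and> card (A i) = Suc m \<and> A i \<inter> B = {}"
    "\<forall>i\<in>{1..n}. \<forall>j\<in>{1..n}. i \<noteq> j \<longrightarrow> (\<forall>x\<in>A i. \<forall>y\<in>A j. x \<notin> bad y)"
    and x: "x \<in> R"
    and off: "\<forall>i\<in>{1..n}. \<forall>j\<in>{1..n}. \<forall>y\<in>A j. y \<notin> bad (x i)"
    for A x
  proof -
    have A: "\<And>i. i \<in> {1..n} \<Longrightarrow> good_set (A i) \<and> card (A i) = Suc m \<and> A i \<inter> B = {}"
      "\<And>i j x y. i \<in> {1..n} \<Longrightarrow> j \<in> {1..n} \<Longrightarrow> i \<noteq> j \<Longrightarrow> x \<in> A i \<Longrightarrow> y \<in> A j \<Longrightarrow> x \<notin> bad y"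
      using grid by blast+
    have xA: "y \<notin> bad (x i)" if "i \<in> {1..n}" "j \<in> {1..n}" "y \<in> A j" for i j y
      using off that by blast
    have A': "good_set (A i) \<and> card (A i) = Suc m" if "i \<in> {1..n}" for i using A(1)[OF that] by blast
    have tA: "sep_BC1 m n (tensor n A F)" by (rule sep_BC1_tensor[OF A'])
    have xt: "x \<in> torus n" using x by (simp add: R_def reg_off_def)
    have nzA: "y \<noteq> 0" if "i \<in> {1..n}" "y \<in> A i" for i y
      using A'[OF that(1)] that(2) by (auto simp: good_set_def)
    have inR: "y \<in> R" if y: "y \<in> torus n" "\<And>i. i \<in> {1..n} \<Longrightarrow> y i \<in> A i \<or> y i = x i" for y
      unfolding R_def reg_off_def
    proof (rule CollectI, intro conjI ballI impI y(1))
      fix i assume i: "i \<in> {1..n}"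
      show "y i * y i \<notin> pz" "y i \<notin> B"
        using y(2)[OF i] A(1)[OF i] x i unfolding good_set_def R_def reg_off_def by auto
      fix j assume j: "j \<in> {1..n}" "i \<noteq> j"
      have xx: "x i \<notin> bad (x j)" using x i j by (simp add: R_def reg_off_def)
      have xi: "x i \<noteq> 0" using torus_nz xt i by blast
      show "y i \<notin> bad (y j)"
        using y(2)[OF i] y(2)[OF j(1)] A(2)[OF i j, of "y i" "y j"] xA[OF j(1) i, of "y i"] xx
          xA[OF i j(1), of "y j"] bad_sym[OF xi nzA[OF j(1), of "y j"]] by auto
    qed
    \<comment> \<open>The first \<open>k\<close> coordinates may come from \<open>x\<close>;
      induction on \<open>k\<close> passes from the grid to \<open>x\<close> itself.\<close>
    have "\<forall>y\<in>torus n. (\<forall>i\<in>{1..n}. y i \<in> A i \<or> (i \<le> k \<and> y i = x i)) \<longrightarrow> F y = tensor n A F y" if "k \<le> n" for k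
      using that
    proof (induction k)
      case 0
      show ?case
      proof safe
        fix y assume y: "y \<in> torus n" "\<forall>i\<in>{1..n}. y i \<in> A i \<or> i \<le> 0 \<and> y i = x i"
        then have "y \<in> PiE {1..n} A" by (force simp: torus_def PiE_def)
        then show "F y = tensor n A F y" using tensor_grid[of n A y F] A' by simp
      qed
    next
      case (Suc k)
      let ?i = "Suc k"
      have i: "?i \<in> {1..n}" using Suc.prems by simp
      show ?case
      proof safe
        fix y assume y: "y \<in> torus n" "\<forall>i\<in>{1..n}. y i \<in> A i \<or> i \<le> Suc k \<and> y i = x i"
        show "F y = tensor n A F y"
        proof (cases "y ?i \<in> A ?i")
          case True
          have "y i \<in> A i \<or> i \<le> k \<and> y i = x i" if "i \<in> {1..n}" for i
            using y(2) that True by (cases "i = ?i") (auto simp: le_Suc_eq)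
          then show ?thesis using Suc y(1) by simp
        next
          case False
          have yR: "y \<in> R" using inR y by blast
          then obtain h where h: "h \<in> BC1 m" "\<And>z. y(?i := z) \<in> R \<Longrightarrow> F (y(?i := z)) = h z"
            using F[of y ?i] i unfolding R_def by blast
          have "h (y ?i) - tensor n A F (y(?i := y ?i)) = 0"
          proof (rule BC1_determined[where A = "A ?i" and h = "\<lambda>z. h z - tensor n A F (y(?i := z))" and m = m])
            show "(\<lambda>z. h z - tensor n A F (y(?i := z))) \<in> BC1 m"
              using BC1_diff[OF h(1) sep_BC1D[OF tA y(1) i]] by blast
            show "y ?i \<noteq> 0" using torus_nz[OF y(1) i] .
            fix w assume w: "w \<in> A ?i"
            then have t: "y(?i := w) \<in> torus n" using torus_upd[OF y(1) i] nzA[OF i] by blast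
            have c: "(y(?i := w)) i \<in> A i \<or> i \<le> k \<and> (y(?i := w)) i = x i" if "i \<in> {1..n}" for i
              using y(2) that w by (cases "i = ?i") (auto simp: le_Suc_eq)
            have "y(?i := w) \<in> R" using inR[OF t] c by blast
            then show "h w - tensor n A F (y(?i := w)) = 0"
              using h(2)[of w] Suc.IH Suc.prems c t by auto
          qed (use A'[OF i] in auto)
          moreover have "F y = h (y ?i)" using h(2)[of "y ?i"] yR by simp
          ultimately show ?thesis by simp
        qed
      qed
    qed
    from this[of n] show ?thesis using xt by auto
  qed
  from grids_exist[OF B, of n m] obtain A
    where A: "\<And>i. i \<in> {1..n} \<Longrightarrow> good_set (A i) \<and> card (A i) = Suc m \<and> A i \<inter> B = {}"
    "\<And>i j x y. i \<in> {1..n} \<Longrightarrow> j \<in> {1..n} \<Longrightarrow> i \<noteq> j \<Longrightarrow> x \<in> A i \<Longrightarrow> y \<in> A j \<Longrightarrow> x \<notin> bad y"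
    by blast
  have A': "good_set (A i) \<and> card (A i) = Suc m" if "i \<in> {1..n}" for i using A(1)[OF that] by blast
  have nzA: "y \<noteq> 0" if "i \<in> {1..n}" "y \<in> A i" for i y
    using A'[OF that(1)] that(2) by (auto simp: good_set_def)
  show ?thesis
  proof (rule that)
    show "sep_BC1 m n (tensor n A F)" by (rule sep_BC1_tensor[OF A'])
    fix x assume x: "x \<in> reg_off B n"
    then have xt: "x \<in> torus n" by (simp add: reg_off_def)
    \<comment> \<open>Avoiding \<open>BB\<close> puts \<open>C\<close> in general position to
      \<open>A\<close> and to \<open>x\<close>. The interpolants from \<open>A\<close> and
      \<open>C\<close> then agree on the grid of \<open>C\<close>, hence everywhere, and the one
      from \<open>C\<close> equals \<open>F\<close> at \<open>x\<close>.\<close>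
    define BB where "BB = B \<union> (\<Union>i\<in>{1..n}. \<Union>y\<in>A i. bad y) \<union> (\<Union>i\<in>{1..n}. bad (x i))"
    have "countable (\<Union>x\<in>A i. bad x)" if i: "i \<in> {1..n}" for i
      using A(1)[OF i] nzA[OF i] by (intro countable_UN) (auto simp: good_set_def countable_finite)
    then have "countable (\<Union>i\<in>{1..n}. \<Union>x\<in>A i. bad x)"
      by (rule countable_UN[rotated]) auto
    moreover have "countable (\<Union>i\<in>{1..n}. bad (x i))"
      by (rule countable_UN) (use torus_nz[OF xt] in auto)
    ultimately have "countable BB" unfolding BB_def using B by (intro countable_Un)
    from grids_exist[OF this, of n m] obtain C
      where C: "\<And>i. i \<in> {1..n} \<Longrightarrow> good_set (C i) \<and> card (C i) = Suc m \<and> C i \<inter> BB = {}"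
      "\<And>i j x y. i \<in> {1..n} \<Longrightarrow> j \<in> {1..n} \<Longrightarrow> i \<noteq> j \<Longrightarrow> x \<in> C i \<Longrightarrow> y \<in> C j \<Longrightarrow> x \<notin> bad y"
      by blast
    have C': "good_set (C i) \<and> card (C i) = Suc m" if "i \<in> {1..n}" for i using C(1)[OF that] by blast
    have nzC: "y \<noteq> 0" if "i \<in> {1..n}" "y \<in> C i" for i y
      using C'[OF that(1)] that(2) by (auto simp: good_set_def)
    have CB: "good_set (C i) \<and> card (C i) = Suc m \<and> C i \<inter> B = {}" if "i \<in> {1..n}" for i
      using C(1)[OF that] unfolding BB_def by blast
    have Cx: "y \<notin> bad (x i)" if "i \<in> {1..n}" "j \<in> {1..n}" "y \<in> C j" for i j y
      using C(1)[OF that(2)] that unfolding BB_def by blast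
    have CA: "y \<notin> bad w" if "i \<in> {1..n}" "j \<in> {1..n}" "y \<in> C j" "w \<in> A i" for i j y w
      using C(1)[OF that(2)] that unfolding BB_def by blast
    have "tensor n A F y = tensor n C F y" if y: "y \<in> PiE {1..n} C" for y
    proof -
      have yi: "y i \<in> C i" if "i \<in> {1..n}" for i using y that by auto
      have "y \<in> torus n" using y nzC by (auto simp: torus_def PiE_def Pi_def)
      moreover have "y i * y i \<notin> pz \<and> y i \<notin> B" if "i \<in> {1..n}" for i
        using CB[OF that] yi[OF that] unfolding good_set_def by blast
      moreover have "y i \<notin> bad (y j)" if "i \<in> {1..n}" "j \<in> {1..n}" "i \<noteq> j" for i j
        using C(2)[OF that] yi that by blast
      ultimately have yR: "y \<in> R" by (simp add: R_def reg_off_def)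
      have "w \<notin> bad (y i)" if "i \<in> {1..n}" "j \<in> {1..n}" "w \<in> A j" for i j w
        using CA[OF that(2,1) yi[OF that(1)] that(3)] bad_sym nzA[OF that(2,3)] nzC[OF that(1) yi[OF that(1)]] by blast
      then have "tensor n A F y = F y"
        by (intro key ballI impI yR) (use A in blast)+
      then show ?thesis using tensor_grid[OF _ y] C' by simp
    qed
    then have "tensor n A F x - tensor n C F x = 0"
      using nzC C'
      by (intro sep_BC1_determined[where f = "\<lambda>x. tensor n A F x - tensor n C F x" and A = C,
            OF sep_BC1_diff[OF sep_BC1_tensor[OF A'] sep_BC1_tensor[OF C']] _ _ xt])
        (auto simp: torus_def PiE_def)
    moreover have "tensor n C F x = F x"
      by (intro key ballI impI) (use CB C(2) Cx x in \<open>unfold R_def, blast+\<close>)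
    ultimately show "tensor n A F x = F x" by simp
  qed
qed

lemma reg_off_comp:
  assumes "\<pi> permutes {1..n}" "x \<in> reg_off B n"
  shows "x \<circ> \<pi> \<in> reg_off B n"
proof -
  have "\<pi> i \<in> {1..n}" if "i \<in> {1..n}" for i using permutes_in_image[OF assms(1)] that by blast
  moreover have "\<pi> i \<noteq> \<pi> j" if "i \<noteq> j" for i j using permutes_inj[OF assms(1)] that by (auto dest: injD)
  ultimately show ?thesis
    using assms torus_comp[OF assms(1)] unfolding reg_off_def by auto
qed

text \<open>The extension is determined by its values at regular points, so it inherits the
  permutation symmetry of \<open>F\<close>.\<close>

lemma BC_theta_extension:
  assumes B: "countable B"
    and F: "\<And>x i. x \<in> reg_off B n \<Longrightarrow> i \<in> {1..n} \<Longrightarrow>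
      \<exists>h\<in>BC1 m. \<forall>z. x(i := z) \<in> reg_off B n \<longrightarrow> F (x(i := z)) = h z"
    and sym: "\<And>x \<pi>. x \<in> reg_off B n \<Longrightarrow> \<pi> permutes {1..n} \<Longrightarrow> F (x \<circ> \<pi>) = F x"
  obtains G where "G \<in> BC_theta m n p" "\<And>x. x \<in> reg_off B n \<Longrightarrow> G x = F x"
proof -
  obtain G where G: "sep_BC1 m n G" "\<And>x. x \<in> reg_off B n \<Longrightarrow> G x = F x"
    using sep_extension[OF B F] by blast
  have "G (x \<circ> \<pi>) = G x" if x: "x \<in> torus n" and \<pi>: "\<pi> permutes {1..n}" for x \<pi>
    by (rule sep_BC1_eq_on_reg[where f = "\<lambda>x. G (x \<circ> \<pi>)", OF sep_BC1_comp[OF G(1) \<pi>] G(1) B _ x])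
      (use G(2) sym \<pi> reg_off_comp[OF \<pi>] in simp)
  then have "(\<lambda>x\<in>torus n. G x) \<in> BC_theta m n p"
    using BC_theta_restrictI[OF G(1)] by blast
  then show ?thesis using G(2) by (intro that[of "\<lambda>x\<in>torus n. G x"]) (auto simp: reg_off_def)
qed

end

subsection \<open>Restriction and division\<close>

lemma torus_Suc_upd: "x \<in> torus n \<Longrightarrow> u \<noteq> 0 \<Longrightarrow> x(Suc n := u) \<in> torus (Suc n)"
  unfolding torus_def PiE_def extensional_def Pi_def by (auto split: if_splits)

context nome
begin

lemma BC_theta_restrict:
  assumes f: "f \<in> BC_theta m (Suc n) p" and u: "u \<noteq> 0"
  shows "(\<lambda>x\<in>torus n. f (x(Suc n := u))) \<in> BC_theta m n p"
proof (rule BC_theta_restrictI)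
  show "sep_BC1 m n (\<lambda>x. f (x(Suc n := u)))"
    unfolding sep_BC1_def
  proof safe
    fix x i assume x: "x \<in> torus n" and i: "i \<in> {1..n}"
    have "(\<lambda>z. f ((x(Suc n := u))(i := z))) \<in> BC1 m"
      using sep_BC1D[OF BC_theta_sep[OF f] torus_Suc_upd[OF x u], of i] i by simp
    moreover have "(x(Suc n := u))(i := z) = (x(i := z))(Suc n := u)" for z
      using i by (intro fun_upd_twist) auto
    ultimately show "(\<lambda>z. f (x(i := z, Suc n := u))) \<in> BC1 m" by simp
  qed
next
  fix x \<pi> assume x: "x \<in> torus n" and \<pi>: "\<pi> permutes {1..n}"
  have \<pi>': "\<pi> permutes {1..Suc n}" by (rule permutes_subset[OF \<pi>]) auto
  have fix_Suc: "\<pi> i = Suc n \<longleftrightarrow> i = Suc n" for i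
    using permutes_not_in[OF \<pi>, of "Suc n"] inj_eq[OF permutes_inj[OF \<pi>], of i "Suc n"] by simp
  have "(x \<circ> \<pi>)(Suc n := u) = x(Suc n := u) \<circ> \<pi>"
    using fix_Suc by (auto simp: fun_eq_iff)
  then show "f ((x \<circ> \<pi>)(Suc n := u)) = f (x(Suc n := u))"
    using BC_theta_sym[OF f torus_Suc_upd[OF x u] \<pi>'] by simp
qed

lemma sep_BC1_prod_thpm: "u \<noteq> 0 \<Longrightarrow> sep_BC1 1 n (\<lambda>x. \<Prod>i\<in>{1..n}. thpm u (x i))"
  unfolding sep_BC1_def
proof safe
  fix x i assume u: "u \<noteq> 0" and i: "i \<in> {1..n}"
  have "(\<lambda>z. (\<Prod>j\<in>{1..n} - {i}. thpm u (x j)) * thpm u z) \<in> BC1 1"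
    by (intro BC1_scale thpm_BC1 u)
  moreover have "(\<Prod>j\<in>{1..n}. thpm u ((x(i := z)) j)) = (\<Prod>j\<in>{1..n} - {i}. thpm u (x j)) * thpm u z" for z
    by (subst prod.remove[OF _ i]) (auto simp: mult.commute intro!: prod.cong)
  ultimately show "(\<lambda>z. \<Prod>j\<in>{1..n}. thpm u ((x(i := z)) j)) \<in> BC1 1" by simp
qed

lemma prod_comp_permutes:
  assumes "\<pi> permutes S"
  shows "(\<Prod>i\<in>S. g (\<pi> i)) = prod g S"
  using prod.permute[OF assms, of g] by (simp add: o_def)

text \<open>By symmetry \<open>f\<close> vanishes whenever any coordinate equals \<open>u\<close>,
  so along each line it is divisible by \<open>thpm u\<close>. The quotient is thus known at regular
  points off the zeros of the divisor, and it extends.\<close>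

lemma BC_theta_divide:
  assumes f: "f \<in> BC_theta (Suc m) n p" and u: "u \<noteq> 0" "u * u \<notin> pz" and n: "n \<ge> 1"
    and zero: "\<And>x. x \<in> torus n \<Longrightarrow> x n = u \<Longrightarrow> f x = 0"
  obtains g where "g \<in> BC_theta m n p"
    "\<And>x. x \<in> torus n \<Longrightarrow> f x = (\<Prod>i\<in>{1..n}. thpm u (x i)) * g x"
proof -
  let ?P = "\<lambda>x. \<Prod>i\<in>{1..n}. thpm u (x i)"
  have cB: "countable (bad u)" using u by simp
  have nz: "thpm u (x i) \<noteq> 0" if "x \<in> reg_off (bad u) n" "i \<in> {1..n}" for x i
    using that u torus_nz[of x n i] thpm_eq_0_bad[of u "x i"] by (auto simp: reg_off_def)
  obtain g where g: "g \<in> BC_theta m n p" "\<And>x. x \<in> reg_off (bad u) n \<Longrightarrow> g x = f x / ?P x"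
  proof (rule BC_theta_extension[OF cB])
    fix x i assume x: "x \<in> reg_off (bad u) n" and i: "i \<in> {1..n}"
    have xt: "x \<in> torus n" using x by (simp add: reg_off_def)
    have "f (x(i := u)) = 0"
    proof -
      let ?\<pi> = "Transposition.transpose i n"
      have \<pi>: "?\<pi> permutes {1..n}" using i n by (intro permutes_swap_id) auto
      have t: "x(i := u) \<in> torus n" using torus_upd xt i u by blast
      have "f (x(i := u) \<circ> ?\<pi>) = 0" by (rule zero[OF torus_comp[OF \<pi> t]]) simp
      then show ?thesis using BC_theta_sym[OF f t \<pi>] by simp
    qed
    from BC1_divide[OF sep_BC1D[OF BC_theta_sep[OF f] xt i] u this]
    obtain h where h: "h \<in> BC1 m" "\<And>z. z \<noteq> 0 \<Longrightarrow> f (x(i := z)) = thpm u z * h z" by metis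
    show "\<exists>h\<in>BC1 m. \<forall>z. x(i := z) \<in> reg_off (bad u) n \<longrightarrow> f (x(i := z)) / ?P (x(i := z)) = h z"
    proof (intro bexI[of _ "\<lambda>z. 1 / (\<Prod>j\<in>{1..n} - {i}. thpm u (x j)) * h z"] allI impI BC1_scale h(1))
      fix z assume z: "x(i := z) \<in> reg_off (bad u) n"
      then have "x(i := z) \<in> torus n" by (simp add: reg_off_def)
      then have z0: "z \<noteq> 0" using torus_nz[of "x(i := z)" n i] i by simp
      have "thpm u z \<noteq> 0" using nz[OF z i] by simp
      moreover have "?P (x(i := z)) = thpm u z * (\<Prod>j\<in>{1..n} - {i}. thpm u (x j))"
        by (subst prod.remove[OF _ i]) (auto intro!: prod.cong)
      ultimately show "f (x(i := z)) / ?P (x(i := z)) = 1 / (\<Prod>j\<in>{1..n} - {i}. thpm u (x j)) * h z"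
        using h(2)[OF z0] by simp
    qed
  next
    fix x \<pi> assume x: "x \<in> reg_off (bad u) n" and \<pi>: "\<pi> permutes {1..n}"
    then have "f (x \<circ> \<pi>) = f x" using BC_theta_sym[OF f] by (simp add: reg_off_def)
    moreover have "?P (x \<circ> \<pi>) = ?P x"
      using prod_comp_permutes[OF \<pi>, of "\<lambda>i. thpm u (x i)"] by simp
    ultimately show "f (x \<circ> \<pi>) / ?P (x \<circ> \<pi>) = f x / ?P x" by simp
  qed blast
  show ?thesis
  proof (rule that[OF g(1)])
    fix x assume x: "x \<in> torus n"
    show "f x = ?P x * g x"
    proof (rule sep_BC1_eq_on_reg[where g = "\<lambda>x. ?P x * g x", OF BC_theta_sep[OF f] _ cB _ x])
      show "sep_BC1 (Suc m) n (\<lambda>x. ?P x * g x)"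
        using sep_BC1_mult[OF sep_BC1_prod_thpm[OF u(1)] BC_theta_sep[OF g(1)]] by simp
      fix y assume y: "y \<in> reg_off (bad u) n"
      then have "?P y \<noteq> 0" using nz by simp
      then show "f y = ?P y * g y" using g(2)[OF y] by simp
    qed
  qed
qed

subsection \<open>The difference operator as a sum over sign changes\<close>

text \<open>For symmetric \<open>f\<close> the term of \<open>\<sigma>\<close> in the operator
  depends only on the point with coordinates \<open>x i powi \<sigma> i\<close>; hence the operator
  is a single function \<open>dterm\<close> summed over the sign changes of
  \<open>x\<close>.\<close>

definition sgn_act :: "nat \<Rightarrow> (nat \<Rightarrow> int) \<Rightarrow> (nat \<Rightarrow> complex) \<Rightarrow> nat \<Rightarrow> complex" where
  "sgn_act n \<sigma> x = (\<lambda>i\<in>{1..n}. x i powi \<sigma> i)"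

text \<open>Unordered pairs, on which permutations act by images; \<open>prod_pairs\<close>
  translates products over \<open>i < j\<close> into products over them.\<close>

definition pairs :: "nat \<Rightarrow> nat set set" where
  "pairs n = {e. e \<subseteq> {1..n} \<and> card e = 2}"

definition wt :: "complex \<Rightarrow> complex \<Rightarrow> complex \<Rightarrow> complex \<Rightarrow> complex \<Rightarrow> complex" where
  "wt a b c d y = th (a * y) * th (b * y) * th (c * y) * th (d * y) / th (y\<^sup>2)"

definition ph :: "complex \<Rightarrow> complex \<Rightarrow> complex" where
  "ph t y = th (t * y) / th y"

text \<open>The set \<open>S\<close> of pairs is a parameter, so that the factor carrying a pole can be left out.\<close>

definition dterm ::
  "nat \<Rightarrow> complex \<Rightarrow> complex \<Rightarrow> complex \<Rightarrow> complex \<Rightarrow> complex \<Rightarrow> complex \<Rightarrow>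
    ((nat \<Rightarrow> complex) \<Rightarrow> complex) \<Rightarrow> nat set set \<Rightarrow> (nat \<Rightarrow> complex) \<Rightarrow> complex" where
  "dterm n a b c d sq t f S y =
    (\<Prod>i\<in>{1..n}. wt a b c d (y i)) * (\<Prod>e\<in>S. ph t (\<Prod>k\<in>e. y k)) * f (\<lambda>i\<in>{1..n}. sq * y i)"

lemma signs_cases: "\<sigma> \<in> signs n \<Longrightarrow> i \<in> {1..n} \<Longrightarrow> \<sigma> i = 1 \<or> \<sigma> i = -1"
  by (auto simp: signs_def PiE_def Pi_def)

lemma finite_signs [simp]: "finite (signs n)"
  unfolding signs_def by (intro finite_PiE) auto

lemma finite_pairs [simp]: "finite (pairs n)"
  unfolding pairs_def by simp

lemma sgn_act_torus: "x \<in> torus n \<Longrightarrow> sgn_act n \<sigma> x \<in> torus n"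
  unfolding sgn_act_def by (intro torusI) (auto dest: torus_nz)

lemma sep_BC1_flip:
  assumes f: "sep_BC1 m n f" and x: "x \<in> torus n" and \<sigma>: "\<sigma> \<in> signs n"
  shows "f (sgn_act n \<sigma> x) = f x"
proof -
  have flip: "f (\<lambda>i\<in>{1..n}. if i \<in> S then 1 / x i else x i) = f x" if "finite S" "S \<subseteq> {1..n}" for S
    using that
  proof (induction S rule: finite_induct)
    case empty
    have "(\<lambda>i\<in>{1..n}. x i) = x" using x by (auto simp: torus_def PiE_def extensional_restrict)
    then show ?case by simp
  next
    case (insert j S)
    let ?y = "\<lambda>i\<in>{1..n}. if i \<in> S then 1 / x i else x i"
    have y: "?y \<in> torus n" using torus_nz[OF x] by (intro torusI) auto
    have j: "j \<in> {1..n}" using insert by auto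
    have 1: "(\<lambda>i\<in>{1..n}. if i \<in> insert j S then 1 / x i else x i) = ?y(j := 1 / x j)"
      using j by (auto simp: fun_eq_iff)
    have 2: "f (?y(j := 1 / x j)) = f (?y(j := x j))"
      using BC1_inv[OF sep_BC1D[OF f y j]] torus_nz[OF x j] by simp
    have 3: "?y(j := x j) = ?y" using insert.hyps j by (auto simp: fun_eq_iff)
    show ?case unfolding 1 2 3 using insert.IH insert.prems by blast
  qed
  have "f (\<lambda>i\<in>{1..n}. if i \<in> {i\<in>{1..n}. \<sigma> i = -1} then 1 / x i else x i) = f x"
    by (rule flip) auto
  moreover have "(\<lambda>i\<in>{1..n}. if i \<in> {i\<in>{1..n}. \<sigma> i = -1} then 1 / x i else x i) = sgn_act n \<sigma> x"
  proof (rule ext)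
    fix i
    show "(\<lambda>i\<in>{1..n}. if i \<in> {i\<in>{1..n}. \<sigma> i = -1} then 1 / x i else x i) i = sgn_act n \<sigma> x i"
      using signs_cases[OF \<sigma>, of i]
      by (cases "i \<in> {1..n}") (auto simp: sgn_act_def divide_inverse)
  qed
  ultimately show ?thesis by simp
qed

lemma prod_pairs:
  "(\<Prod>(i, j)\<in>{(i, j). 1 \<le> i \<and> i < j \<and> j \<le> n}. g (y i * y j)) = (\<Prod>e\<in>pairs n. g (\<Prod>k\<in>e. y k :: complex))"
proof (rule prod.reindex_bij_witness[where i = "\<lambda>e. (Min e, Max e)" and j = "\<lambda>(i, j). {i, j}"])
  fix e assume "e \<in> pairs n"
  then obtain i j where e: "e = {i, j}" "i \<noteq> j" "i \<in> {1..n}" "j \<in> {1..n}"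
    unfolding pairs_def by (auto simp: card_2_iff)
  show "(case (Min e, Max e) of (i, j) \<Rightarrow> {i, j}) = e" using e by (auto simp: min_def max_def)
  show "(Min e, Max e) \<in> {(i, j). 1 \<le> i \<and> i < j \<and> j \<le> n}" using e by (auto simp: min_def max_def)
next
  fix ij :: "nat \<times> nat" assume ij: "ij \<in> {(i, j). 1 \<le> i \<and> i < j \<and> j \<le> n}"
  then show "(Min (case ij of (i, j) \<Rightarrow> {i, j}), Max (case ij of (i, j) \<Rightarrow> {i, j})) = ij" by auto
  show "(case ij of (i, j) \<Rightarrow> {i, j}) \<in> pairs n" using ij by (auto simp: pairs_def)
  show "g (\<Prod>k\<in>(case ij of (i, j) \<Rightarrow> {i, j}). y k) = (case ij of (i, j) \<Rightarrow> g (y i * y j))"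
    using ij by auto
qed

lemma diff_op_eq_dterm_sum:
  assumes f: "sep_BC1 m n f" and sq: "sq \<noteq> 0" and x: "x \<in> torus n"
  shows "diff_op n a b c d sq t p f x = (\<Sum>\<sigma>\<in>signs n. dterm n a b c d sq t f (pairs n) (sgn_act n \<sigma> x))"
  unfolding diff_op_def dterm_def
proof (rule sum.cong[OF refl])
  fix \<sigma> assume \<sigma>: "\<sigma> \<in> signs n"
  let ?y = "sgn_act n \<sigma> x"
  have 1: "(\<Prod>i\<in>{1..n}. th (a * x i powi \<sigma> i) * th (b * x i powi \<sigma> i) * th (c * x i powi \<sigma> i) *
      th (d * x i powi \<sigma> i) / th (x i powi (2 * \<sigma> i))) = (\<Prod>i\<in>{1..n}. wt a b c d (?y i))"
    by (intro prod.cong) (auto simp: wt_def sgn_act_def power_int_mult mult.commute[of 2])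
  have 2: "(\<Prod>(i, j)\<in>{(i, j). 1 \<le> i \<and> i < j \<and> j \<le> n}.
        th (t * x i powi \<sigma> i * x j powi \<sigma> j) / th (x i powi \<sigma> i * x j powi \<sigma> j)) =
      (\<Prod>e\<in>pairs n. ph t (\<Prod>k\<in>e. ?y k))"
    unfolding prod_pairs[symmetric]
    by (intro prod.cong) (auto simp: ph_def sgn_act_def mult.assoc)
  \<comment> \<open>Where \<open>\<sigma> i = -1\<close>, inverting
    \<open>sq powi \<sigma> i * x i\<close> gives \<open>sq * x i powi \<sigma> i\<close>, and
    \<open>f\<close> is invariant under the inversion.\<close>
  have "f (\<lambda>i\<in>{1..n}. sq powi \<sigma> i * x i) = f (sgn_act n \<sigma> (\<lambda>i\<in>{1..n}. sq powi \<sigma> i * x i))"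
    by (rule sep_BC1_flip[OF f _ \<sigma>, symmetric]) (intro torusI, use sq torus_nz[OF x] in simp)
  also have "sgn_act n \<sigma> (\<lambda>i\<in>{1..n}. sq powi \<sigma> i * x i) = (\<lambda>i\<in>{1..n}. sq * ?y i)"
  proof (rule ext)
    fix i
    show "sgn_act n \<sigma> (\<lambda>i\<in>{1..n}. sq powi \<sigma> i * x i) i = (\<lambda>i\<in>{1..n}. sq * ?y i) i"
      using signs_cases[OF \<sigma>, of i] by (cases "i \<in> {1..n}") (auto simp: sgn_act_def)
  qed
  finally have 3: "f (\<lambda>i\<in>{1..n}. sq powi \<sigma> i * x i) = f (\<lambda>i\<in>{1..n}. sq * ?y i)" .
  show "(\<Prod>i\<in>{1..n}. th (a * x i powi \<sigma> i) * th (b * x i powi \<sigma> i) * th (c * x i powi \<sigma> i) *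
      th (d * x i powi \<sigma> i) / th (x i powi (2 * \<sigma> i))) *
     (\<Prod>(i, j)\<in>{(i, j). 1 \<le> i \<and> i < j \<and> j \<le> n}.
        th (t * x i powi \<sigma> i * x j powi \<sigma> j) / th (x i powi \<sigma> i * x j powi \<sigma> j)) *
     f (\<lambda>i\<in>{1..n}. sq powi \<sigma> i * x i) =
     (\<Prod>i\<in>{1..n}. wt a b c d (?y i)) * (\<Prod>e\<in>pairs n. ph t (\<Prod>k\<in>e. ?y k)) * f (\<lambda>i\<in>{1..n}. sq * ?y i)"
    unfolding 1 2 3 ..
qed

lemma permutes_image_pairs:
  assumes "\<pi> permutes {1..n}"
  shows "(\<lambda>e. \<pi> ` e) ` pairs n = pairs n"
proof -
  have sub: "\<rho> ` e \<in> pairs n" if "\<rho> permutes {1..n}" "e \<in> pairs n" for \<rho> e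
    using that card_image[OF inj_on_subset[OF permutes_inj[OF that(1)]], of e] permutes_image[OF that(1)]
    unfolding pairs_def by auto
  have "e \<in> (\<lambda>e. \<pi> ` e) ` pairs n" if "e \<in> pairs n" for e
    using sub[OF permutes_inv[OF assms] that] permutes_inverses[OF assms]
    by (intro image_eqI[of _ _ "inv \<pi> ` e"]) (auto simp: image_image)
  then show ?thesis using sub[OF assms] by blast
qed

lemma dterm_comp:
  assumes f: "f \<in> BC_theta m n p" and \<pi>: "\<pi> permutes {1..n}" and S: "(\<lambda>e. \<pi> ` e) ` S = S"
    and y: "y \<in> torus n" and sq: "sq \<noteq> 0"
  shows "dterm n a b c d sq t f S (y \<circ> \<pi>) = dterm n a b c d sq t f S y"
proof -
  have inj: "inj_on (\<lambda>e. \<pi> ` e) S"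
    using permutes_inj[OF \<pi>] by (meson inj_image_eq_iff inj_onI)
  have "(\<Prod>e\<in>S. ph t (\<Prod>k\<in>e. y k)) = (\<Prod>e\<in>(\<lambda>e. \<pi> ` e) ` S. ph t (\<Prod>k\<in>e. y k))" by (simp add: S)
  also have "\<dots> = (\<Prod>e\<in>S. ph t (\<Prod>k\<in>e. y (\<pi> k)))"
    by (subst prod.reindex[OF inj])
      (auto simp: prod.reindex inj_on_subset[OF permutes_inj[OF \<pi>]] o_def intro!: prod.cong)
  finally have 1: "(\<Prod>e\<in>S. ph t (\<Prod>k\<in>e. y (\<pi> k))) = (\<Prod>e\<in>S. ph t (\<Prod>k\<in>e. y k))" ..
  have 2: "(\<Prod>i\<in>{1..n}. wt a b c d (y (\<pi> i))) = (\<Prod>i\<in>{1..n}. wt a b c d (y i))"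
    using prod_comp_permutes[OF \<pi>, of "\<lambda>i. wt a b c d (y i)"] .
  have "(\<lambda>i\<in>{1..n}. sq * y (\<pi> i)) = (\<lambda>i\<in>{1..n}. sq * y i) \<circ> \<pi>"
    using permutes_in_image[OF \<pi>] by (auto simp: fun_eq_iff restrict_def)
  moreover have "(\<lambda>i\<in>{1..n}. sq * y i) \<in> torus n" using sq torus_nz[OF y] by (intro torusI) simp
  ultimately have "f (\<lambda>i\<in>{1..n}. sq * y (\<pi> i)) = f (\<lambda>i\<in>{1..n}. sq * y i)"
    using BC_theta_sym[OF f _ \<pi>] by simp
  then show ?thesis using 1 2 by (simp add: dterm_def)
qed

lemma signs_comp_bij:
  assumes \<pi>: "\<pi> permutes {1..n}"
  shows "bij_betw (\<lambda>\<sigma>. \<sigma> \<circ> \<pi>) (signs n) (signs n)"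
proof (rule bij_betw_byWitness[where f' = "\<lambda>\<sigma>. \<sigma> \<circ> inv \<pi>"])
  have *: "\<sigma> \<circ> \<rho> \<in> signs n" if "\<sigma> \<in> signs n" "\<rho> permutes {1..n}" for \<sigma> \<rho>
  proof -
    have "\<rho> i \<in> {1..n} \<longleftrightarrow> i \<in> {1..n}" for i using permutes_in_image[OF that(2)] .
    then show ?thesis using that(1) by (auto simp: signs_def PiE_def extensional_def Pi_def)
  qed
  show "(\<lambda>\<sigma>. \<sigma> \<circ> \<pi>) ` signs n \<subseteq> signs n" "(\<lambda>\<sigma>. \<sigma> \<circ> inv \<pi>) ` signs n \<subseteq> signs n"
    using * \<pi> permutes_inv[OF \<pi>] by blast+
qed (auto simp: comp_assoc permutes_inv_o[OF \<pi>])

lemma sgn_act_comp: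
  assumes "\<pi> permutes {1..n}"
  shows "sgn_act n (\<sigma> \<circ> \<pi>) (x \<circ> \<pi>) = sgn_act n \<sigma> x \<circ> \<pi>"
proof -
  have "\<pi> i \<in> {1..n} \<longleftrightarrow> i \<in> {1..n}" for i using permutes_in_image[OF assms] .
  then show ?thesis by (auto simp: sgn_act_def fun_eq_iff restrict_def)
qed

lemma dterm_sum_comp:
  assumes f: "f \<in> BC_theta m n p" and \<pi>: "\<pi> permutes {1..n}" and x: "x \<in> torus n" and sq: "sq \<noteq> 0"
  shows "(\<Sum>\<sigma>\<in>signs n. dterm n a b c d sq t f (pairs n) (sgn_act n \<sigma> (x \<circ> \<pi>))) =
    (\<Sum>\<sigma>\<in>signs n. dterm n a b c d sq t f (pairs n) (sgn_act n \<sigma> x))"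
proof -
  have "(\<Sum>\<sigma>\<in>signs n. dterm n a b c d sq t f (pairs n) (sgn_act n \<sigma> (x \<circ> \<pi>))) =
      (\<Sum>\<sigma>\<in>signs n. dterm n a b c d sq t f (pairs n) (sgn_act n (\<sigma> \<circ> \<pi>) (x \<circ> \<pi>)))"
    using sum.reindex_bij_betw[OF signs_comp_bij[OF \<pi>],
        of "\<lambda>\<sigma>. dterm n a b c d sq t f (pairs n) (sgn_act n \<sigma> (x \<circ> \<pi>))"] by simp
  then show ?thesis
    unfolding sgn_act_comp[OF \<pi>]
    using dterm_comp[OF f \<pi> permutes_image_pairs[OF \<pi>] sgn_act_torus[OF x] sq] by simp
qed

end

subsection \<open>The difference operator preserves theta functions\<close>

lemma filterlim_at_isCont:
  assumes "isCont s v" "s v = w" "eventually (\<lambda>z. s z \<noteq> w) (at v)"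
  shows "filterlim s (at w) (at v)"
  using assms by (auto simp: isCont_def intro: filterlim_atI)

text \<open>Applied with \<open>s\<close> an inversion or a multiplication by a power of
  \<open>p\<close>: a symmetry of \<open>F\<close> compares its residues at two points, and
  \<open>c\<close> collects the symmetry factor together with the change of
  \<open>z - v\<close>.\<close>

lemma simple_pole_transfer:
  fixes F :: "complex \<Rightarrow> complex"
  assumes P: "((\<lambda>z. (z - w) * F z) \<longlongrightarrow> r) (at w)"
    and s: "filterlim s (at w) (at v)"
    and ev: "eventually (\<lambda>z. (z - v) * F z = c z * ((s z - w) * F (s z))) (at v)" and c: "(c \<longlongrightarrow> k) (at v)"
  shows "((\<lambda>z. (z - v) * F z) \<longlongrightarrow> k * r) (at v)"
proof -
  have "((\<lambda>z. c z * ((s z - w) * F (s z))) \<longlongrightarrow> k * r) (at v)"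
    by (intro tendsto_mult c filterlim_compose[OF P s])
  moreover have "eventually (\<lambda>z. c z * ((s z - w) * F (s z)) = (z - v) * F z) (at v)"
    using ev by eventually_elim simp
  ultimately show ?thesis by (rule Lim_transform_eventually)
qed

lemma analytic_on_compose_punctured:
  assumes "h holomorphic_on - {0}" "g analytic_on A" "\<And>x. x \<in> A \<Longrightarrow> g x \<noteq> (0::complex)"
  shows "(\<lambda>x. h (g x)) analytic_on A"
proof -
  have "h analytic_on - {0}" using assms(1) by (subst analytic_on_open) auto
  from analytic_on_compose_gen[OF assms(2) this] show ?thesis using assms(3) by (auto simp: o_def)
qed

context nome
begin

lemma signs_upd: "\<sigma> \<in> signs n \<Longrightarrow> i \<in> {1..n} \<Longrightarrow> s \<in> {1, -1} \<Longrightarrow> \<sigma>(i := s) \<in> signs n"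
  unfolding signs_def using PiE_fun_upd[of s "\<lambda>_. {1, -1}" i \<sigma> "{1..n}"] by (simp only: insert_absorb)

lemma holomorphic_th: "(\<lambda>x. th x) holomorphic_on - {0}"
  by (intro holomorphic_intros) auto

lemma analytic_theta:
  assumes "g analytic_on A" "\<And>x. x \<in> A \<Longrightarrow> g x \<noteq> 0"
  shows "(\<lambda>x. th (g x)) analytic_on A"
  using analytic_on_compose_punctured[OF holomorphic_th assms] .

lemma sgn_act_analytic:
  assumes "j \<in> {1..n}" "w \<noteq> 0"
  shows "(\<lambda>z. sgn_act n \<sigma> (x(i := z)) j) analytic_on {w}"
  using assms by (cases "j = i") (auto simp: sgn_act_def intro!: analytic_intros)

lemma sgn_act_upd_torus: "x \<in> torus n \<Longrightarrow> i \<in> {1..n} \<Longrightarrow> z \<noteq> 0 \<Longrightarrow> sgn_act n \<sigma> (x(i := z)) \<in> torus n"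
  by (intro sgn_act_torus torus_upd)

lemma pz_power2: "x \<in> pz \<Longrightarrow> x\<^sup>2 \<in> pz"
  by (simp add: power2_eq_square)

lemma sgn_act_sq_nz:
  assumes "\<sigma> \<in> signs n" "x \<in> torus n" "j \<in> {1..n}" "x j * x j \<notin> pz"
  shows "th ((sgn_act n \<sigma> x j)\<^sup>2) \<noteq> 0"
proof -
  have "x j \<noteq> 0" using assms torus_nz by blast
  moreover have "inverse (x j * x j) \<notin> pz" using assms(4) by (simp del: inverse_mult_distrib)
  ultimately show ?thesis
    using signs_cases[OF assms(1,3)] assms(3,4)
    by (auto simp: sgn_act_def theta_eq_0_iff power2_eq_square)
qed

lemma sgn_act_pair_nz:
  assumes \<sigma>: "\<sigma> \<in> signs n" and x: "x \<in> torus n" and kl: "k \<in> {1..n}" "l \<in> {1..n}"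
    and bad: "x k \<notin> bad (x l)"
  shows "th (sgn_act n \<sigma> x k * sgn_act n \<sigma> x l) \<noteq> 0"
proof -
  have nz: "x k \<noteq> 0" "x l \<noteq> 0" using x kl torus_nz by auto
  have "x l * x k \<notin> pz" "x l / x k \<notin> pz" using bad by (auto simp: bad_def)
  moreover from this have "inverse (x l * x k) \<notin> pz" "inverse (x l / x k) \<notin> pz"
    by (simp_all del: inverse_mult_distrib inverse_divide)
  ultimately show ?thesis
    using signs_cases[OF \<sigma> kl(1)] signs_cases[OF \<sigma> kl(2)] kl nz
    by (auto simp: sgn_act_def theta_eq_0_iff field_simps)
qed

lemma reg_off_empty_iff: "x \<in> reg_off {} n \<longleftrightarrow> x \<in> torus n \<and> diff_op_regular n p x"
proof safe
  assume x: "x \<in> reg_off {} n"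
  then show xt: "x \<in> torus n" by (simp add: reg_off_def)
  show "diff_op_regular n p x"
    unfolding diff_op_regular_def
  proof (intro ballI conjI allI impI)
    fix \<sigma> i assume \<sigma>: "\<sigma> \<in> signs n" and i: "i \<in> {1..n}"
    show "th (x i powi (2 * \<sigma> i)) \<noteq> 0"
      using sgn_act_sq_nz[OF \<sigma> xt i] x i
      by (simp add: reg_off_def sgn_act_def mult.commute[of 2] power_int_mult)
  next
    fix \<sigma> i j assume \<sigma>: "\<sigma> \<in> signs n" and ij: "1 \<le> i \<and> i < j \<and> j \<le> n"
    then show "th (x i powi \<sigma> i * x j powi \<sigma> j) \<noteq> 0"
      using sgn_act_pair_nz[OF \<sigma> xt, of i j] x by (auto simp: reg_off_def sgn_act_def)
  qed
next
  assume xt: "x \<in> torus n" and reg: "diff_op_regular n p x"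
  have nz: "x i \<noteq> 0" if "i \<in> {1..n}" for i using torus_nz xt that by blast
  define one :: "nat \<Rightarrow> int" where "one = (\<lambda>i\<in>{1..n}. 1)"
  have one: "one \<in> signs n" by (auto simp: signs_def one_def)
  have lt: "x i \<notin> bad (x j)" if ij: "i \<in> {1..n}" "j \<in> {1..n}" "i < j" for i j
  proof -
    have 1: "th (x i * x j) \<noteq> 0"
      using reg one ij unfolding diff_op_regular_def one_def by fastforce
    \<comment> \<open>Negating the sign of \<open>i\<close> turns the condition on the product
      \<open>x i * x j\<close> into one on the quotient \<open>x j / x i\<close>.\<close>
    have "one(i := -1) \<in> signs n" using signs_upd[OF one ij(1)] by simp
    then have "th (x i powi (one(i := -1)) i * x j powi (one(i := -1)) j) \<noteq> 0"
      using reg ij unfolding diff_op_regular_def by (metis atLeastAtMost_iff)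
    then have 2: "th (x j / x i) \<noteq> 0" using ij by (simp add: one_def divide_inverse mult.commute)
    show ?thesis using 1 2 nz[OF ij(1)] nz[OF ij(2)] by (auto simp: bad_def theta_eq_0_iff mult.commute)
  qed
  have "x i * x i \<notin> pz" if "i \<in> {1..n}" for i
  proof -
    have "th (x i powi (2 * one i)) \<noteq> 0" using reg one that unfolding diff_op_regular_def by blast
    then show ?thesis using that nz by (simp add: one_def theta_eq_0_iff power2_eq_square)
  qed
  moreover have "x i \<notin> bad (x j)" if "i \<in> {1..n}" "j \<in> {1..n}" "i \<noteq> j" for i j
    using lt[of i j] lt[of j i] that bad_sym[OF nz nz, of i j] by (cases "i < j") auto
  ultimately show "x \<in> reg_off {} n" using xt by (simp add: reg_off_def)
qed

end

text \<open>The balancing condition \<open>bal\<close> gives every term of the operator the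
  multiplier of degree \<open>m\<close> when a coordinate is multiplied by \<open>p\<close>.\<close>

locale balanced_operator = nome +
  fixes a b c d sq t q :: complex and m n :: nat and f :: "(nat \<Rightarrow> complex) \<Rightarrow> complex"
  assumes nz: "a \<noteq> 0" "b \<noteq> 0" "c \<noteq> 0" "d \<noteq> 0" "sq \<noteq> 0" "t \<noteq> 0" and sq2: "sq\<^sup>2 = q"
    and bal: "q ^ m * t powi (int n - 1) * a * b * c * d = p"
    and f: "f \<in> BC_theta m n p"
begin

lemma wt_p: "y \<noteq> 0 \<Longrightarrow> wt a b c d (p * y) = wt a b c d y * (p / (a * b * c * d))"
proof -
  assume y: "y \<noteq> 0"
  have 1: "th (u * (p * y)) = - th (u * y) / (u * y)" if "u \<noteq> 0" for u
    using theta_p_mult[of "u * y"] that y by (simp add: mult_ac)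
  have "th ((p * y)\<^sup>2) = th (p * (p * y\<^sup>2))" by (simp add: power2_eq_square mult_ac)
  also have "\<dots> = th (y\<^sup>2) / (p * y ^ 4)"
    using y by (simp add: theta_p_mult power2_eq_square field_simps eval_nat_numeral)
  finally have 2: "th ((p * y)\<^sup>2) = th (y\<^sup>2) / (p * y ^ 4)" .
  show ?thesis
    unfolding wt_def 2 1[OF nz(1)] 1[OF nz(2)] 1[OF nz(3)] 1[OF nz(4)]
    using y nz by (simp add: divide_simps eval_nat_numeral)
qed

lemma ph_p:
  assumes "y \<noteq> 0"
  shows "ph t (p * y) = ph t y / t"
proof -
  have 1: "th (p * (t * y)) = - th (t * y) / (t * y)" using theta_p_mult[of "t * y"] nz assms by simp
  show ?thesis
    using assms nz by (simp add: ph_def mult.left_commute[of t p] 1 theta_p_mult[OF assms])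
qed

lemma card_pairs_containing:
  assumes "i \<in> {1..n}"
  shows "card {e \<in> pairs n. i \<in> e} = n - 1"
proof -
  have "{e \<in> pairs n. i \<in> e} = (\<lambda>j. {i, j}) ` ({1..n} - {i})"
    using assms by (auto simp: pairs_def card_2_iff)
  moreover have "inj_on (\<lambda>j. {i, j}) ({1..n} - {i})"
    by (auto simp: inj_on_def doubleton_eq_iff)
  ultimately have "card {e \<in> pairs n. i \<in> e} = card ({1..n} - {i})" by (simp add: card_image)
  then show ?thesis using assms by simp
qed

text \<open>Besides the expected multiplier there are three factors:
  \<open>p / (a * b * c * d)\<close> from the weight, \<open>1 / t\<close> from each of the
  \<open>n - 1\<close> pairs containing \<open>i\<close>, and \<open>1 / q ^ m\<close> from
  evaluating \<open>f\<close> at \<open>sq * y i\<close>. By the balancing condition their product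
  is \<open>1\<close>.\<close>

lemma dterm_p:
  assumes y: "y \<in> torus n" and i: "i \<in> {1..n}"
  shows "dterm n a b c d sq t f (pairs n) (y(i := p * y i)) =
    dterm n a b c d sq t f (pairs n) y / (p * (y i)\<^sup>2) ^ m"
proof -
  let ?y = "y(i := p * y i)"
  have yi: "y i \<noteq> 0" using torus_nz y i by blast
  have 1: "(\<Prod>j\<in>{1..n}. wt a b c d (?y j)) = (\<Prod>j\<in>{1..n}. wt a b c d (y j)) * (p / (a * b * c * d))"
  proof -
    have "(\<Prod>j\<in>{1..n}. wt a b c d (?y j)) = wt a b c d (p * y i) * (\<Prod>j\<in>{1..n} - {i}. wt a b c d (y j))"
      by (subst prod.remove[OF _ i]) (auto intro!: prod.cong)
    also have "\<dots> = wt a b c d (y i) * (\<Prod>j\<in>{1..n} - {i}. wt a b c d (y j)) * (p / (a * b * c * d))"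
      by (simp add: wt_p[OF yi])
    finally show ?thesis by (subst prod.remove[OF _ i]) auto
  qed
  have ph: "ph t (\<Prod>k\<in>e. ?y k) = ph t (\<Prod>k\<in>e. y k) * (if i \<in> e then 1 / t else 1)" if e: "e \<in> pairs n" for e
  proof (cases "i \<in> e")
    case True
    have fe: "finite e" using e by (auto simp: pairs_def intro: finite_subset)
    have "(\<Prod>k\<in>e. ?y k) = p * (\<Prod>k\<in>e. y k)"
      using True fe by (simp add: prod.remove[OF fe True])
    moreover have "(\<Prod>k\<in>e. y k) \<noteq> 0" using e torus_nz[OF y] fe by (auto simp: pairs_def)
    ultimately show ?thesis using True ph_p by simp
  next
    case False
    then have "(\<Prod>k\<in>e. ?y k) = (\<Prod>k\<in>e. y k)" by (intro prod.cong) auto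
    then show ?thesis using False by simp
  qed
  have "(\<Prod>e\<in>pairs n. if i \<in> e then 1 / t else 1) = (1 / t) ^ (n - 1)"
    using card_pairs_containing[OF i]
    by (subst prod.inter_filter[symmetric]) auto
  then have 2: "(\<Prod>e\<in>pairs n. ph t (\<Prod>k\<in>e. ?y k)) = (\<Prod>e\<in>pairs n. ph t (\<Prod>k\<in>e. y k)) * (1 / t) ^ (n - 1)"
    using ph by (simp add: prod.distrib)
  let ?s = "\<lambda>j\<in>{1..n}. sq * y j"
  have st: "?s \<in> torus n" using nz(5) torus_nz[OF y] by (intro torusI) simp
  have "(\<lambda>j\<in>{1..n}. sq * ?y j) = ?s(i := p * (sq * y i))" using i by (auto simp: fun_eq_iff)
  moreover have "f (?s(i := p * (sq * y i))) = f (?s(i := sq * y i)) / (p * (sq * y i)\<^sup>2) ^ m"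
    using BC1_p[OF sep_BC1D[OF BC_theta_sep[OF f] st i]] nz yi by simp
  moreover have "?s(i := sq * y i) = ?s" using i by (auto simp: fun_eq_iff)
  moreover have "(p * (sq * y i)\<^sup>2) ^ m = q ^ m * (p * (y i)\<^sup>2) ^ m"
    by (simp add: power_mult_distrib sq2[symmetric] mult_ac)
  ultimately have 3: "f (\<lambda>j\<in>{1..n}. sq * ?y j) = f ?s / (q ^ m * (p * (y i)\<^sup>2) ^ m)" by (simp only:)
  have q: "q \<noteq> 0" unfolding sq2[symmetric] using nz(5) by (rule power_not_zero)
  have "int n - 1 = int (n - 1)" using i by simp
  then have "t powi (int n - 1) = t ^ (n - 1)" by (simp only: power_int_of_nat)
  with bal have "p = q ^ m * t ^ (n - 1) * a * b * c * d" by simp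
  then have "p / (a * b * c * d) * (1 / t) ^ (n - 1) / q ^ m
      = (q ^ m * t ^ (n - 1) * a * b * c * d) / (a * b * c * d) * (1 / t) ^ (n - 1) / q ^ m" by (rule arg_cong)
  also have "\<dots> = 1" using q nz by (simp add: power_one_over)
  finally have one: "p / (a * b * c * d) * (1 / t) ^ (n - 1) / q ^ m = 1" .
  have "X * k * (Y * r) * (Z / (Q * W)) = X * Y * Z / W * (k * r / Q)" for X Y Z W k r Q :: complex
    by (simp add: divide_inverse mult_ac)
  then have 4: "X * (p / (a * b * c * d)) * (Y * (1 / t) ^ (n - 1)) * (Z / (q ^ m * W)) = X * Y * Z / W" for X Y Z W
    by (simp only: one mult_1_right)
  show ?thesis unfolding dterm_def 1 2 3 4 ..
qed

definition dsum :: "(nat \<Rightarrow> complex) \<Rightarrow> complex" where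
  "dsum x = (\<Sum>\<sigma>\<in>signs n. dterm n a b c d sq t f (pairs n) (sgn_act n \<sigma> x))"

text \<open>Inverting the coordinate exchanges the term of \<open>\<sigma>\<close> with that of
  \<open>\<sigma>\<close> negated at \<open>i\<close>.\<close>

lemma dsum_inv:
  assumes x: "x \<in> torus n" and i: "i \<in> {1..n}" and z: "z \<noteq> 0"
  shows "dsum (x(i := 1 / z)) = dsum (x(i := z))"
proof -
  have "\<sigma>(i := - \<sigma> i) \<in> signs n" if "\<sigma> \<in> signs n" for \<sigma>
    using signs_upd[OF that i] signs_cases[OF that i] by auto
  then have bij: "bij_betw (\<lambda>\<sigma>. \<sigma>(i := - \<sigma> i)) (signs n) (signs n)"
    by (intro bij_betw_byWitness[where f' = "\<lambda>\<sigma>. \<sigma>(i := - \<sigma> i)"]) auto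
  have "sgn_act n (\<sigma>(i := - \<sigma> i)) (x(i := 1 / z)) = sgn_act n \<sigma> (x(i := z))" for \<sigma>
    using z by (auto simp: sgn_act_def fun_eq_iff restrict_def power_int_minus power_int_divide_distrib divide_inverse
        simp flip: power_int_inverse)
  then have "dsum (x(i := z)) = (\<Sum>\<sigma>\<in>signs n. dterm n a b c d sq t f (pairs n) (sgn_act n (\<sigma>(i := - \<sigma> i)) (x(i := 1 / z))))"
    by (simp add: dsum_def)
  also have "\<dots> = dsum (x(i := 1 / z))"
    unfolding dsum_def by (rule sum.reindex_bij_betw[OF bij])
  finally show ?thesis ..
qed

lemma dsum_p:
  assumes x: "x \<in> torus n" and i: "i \<in> {1..n}" and z: "z \<noteq> 0"
  shows "dsum (x(i := p * z)) = dsum (x(i := z)) / (p * z\<^sup>2) ^ m"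
  unfolding dsum_def sum_divide_distrib
proof (rule sum.cong[OF refl])
  fix \<sigma> assume \<sigma>: "\<sigma> \<in> signs n"
  let ?y = "sgn_act n \<sigma> (x(i := z))" and ?y' = "sgn_act n \<sigma> (x(i := p * z))"
  let ?D = "dterm n a b c d sq t f (pairs n)"
  have yt: "?y \<in> torus n" "?y' \<in> torus n" using sgn_act_upd_torus x i z by auto
  show "?D ?y' = ?D ?y / (p * z\<^sup>2) ^ m"
    using signs_cases[OF \<sigma> i]
  proof
    assume s: "\<sigma> i = 1"
    then have "?y' = ?y(i := p * ?y i)" "?y i = z" using i by (auto simp: sgn_act_def fun_eq_iff)
    then show ?thesis using dterm_p[OF yt(1) i] by simp
  next
    \<comment> \<open>Now the coordinate is divided by \<open>p\<close>, so the multiplier is read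
      backwards, from \<open>?y'\<close> to \<open>?y\<close>.\<close>
    assume s: "\<sigma> i = -1"
    then have *: "?y = ?y'(i := p * ?y' i)" "?y' i = 1 / (p * z)"
      using i z by (auto simp: sgn_act_def fun_eq_iff divide_inverse)
    have "?D ?y = ?D ?y' / (p * (?y' i)\<^sup>2) ^ m"
      unfolding *(1) by (rule dterm_p[OF yt(2) i])
    also have "p * (?y' i)\<^sup>2 = 1 / (p * z\<^sup>2)" unfolding *(2) using z by (simp add: power2_eq_square)
    finally have eq: "?D ?y = ?D ?y' / (1 / (p * z\<^sup>2)) ^ m" .
    have "A = B / (1 / (p * z\<^sup>2)) ^ m \<Longrightarrow> B = A / (p * z\<^sup>2) ^ m" for A B
      using z by (simp add: power_one_over)
    from this[OF eq] show ?thesis .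
  qed
qed

section \<open>Poles of the summed operator and their cancellation\<close>

lemma wt_analytic:
  assumes "j \<in> {1..n}" "w \<noteq> 0" "x \<in> torus n" "i \<in> {1..n}" "th ((sgn_act n \<sigma> (x(i := w)) j)\<^sup>2) \<noteq> 0"
  shows "(\<lambda>z. wt a b c d (sgn_act n \<sigma> (x(i := z)) j)) analytic_on {w}"
proof -
  have "sgn_act n \<sigma> (x(i := w)) j \<noteq> 0"
    using sgn_act_upd_torus[OF assms(3,4,2)] torus_nz assms(1) by blast
  then show ?thesis
    unfolding wt_def
    by (intro analytic_on_divide analytic_on_mult analytic_theta sgn_act_analytic analytic_on_power analytic_on_const)
      (use assms nz in auto)
qed

lemma ph_analytic:
  assumes "e \<in> pairs n" "w \<noteq> 0" "x \<in> torus n" "i \<in> {1..n}" "th (\<Prod>k\<in>e. sgn_act n \<sigma> (x(i := w)) k) \<noteq> 0"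
  shows "(\<lambda>z. ph t (\<Prod>k\<in>e. sgn_act n \<sigma> (x(i := z)) k)) analytic_on {w}"
proof -
  have e: "e \<subseteq> {1..n}" "finite e" using assms(1) by (auto simp: pairs_def intro: finite_subset)
  have "sgn_act n \<sigma> (x(i := w)) j \<noteq> 0" if "j \<in> e" for j
    using sgn_act_upd_torus[OF assms(3,4,2)] torus_nz that e by blast
  then have "(\<Prod>k\<in>e. sgn_act n \<sigma> (x(i := w)) k) \<noteq> 0" using e by simp
  then show ?thesis
    unfolding ph_def
    by (intro analytic_on_divide analytic_on_mult analytic_theta analytic_on_prod sgn_act_analytic analytic_on_const)
      (use assms nz e in auto)
qed

lemma f_analytic:
  assumes "w \<noteq> 0" "x \<in> torus n" and i: "i \<in> {1..n}"
  shows "(\<lambda>z. f (\<lambda>j\<in>{1..n}. sq * sgn_act n \<sigma> (x(i := z)) j)) analytic_on {w}"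
proof -
  let ?s = "\<lambda>j\<in>{1..n}. sq * sgn_act n \<sigma> x j"
  have st: "?s \<in> torus n"
    using nz(5) torus_nz[OF sgn_act_torus[OF assms(2)]] by (intro torusI) simp
  have nzw: "sgn_act n \<sigma> (x(i := w)) i \<noteq> 0"
    by (rule torus_nz[OF sgn_act_upd_torus[OF assms(2) i assms(1)] i])
  have "(\<lambda>j\<in>{1..n}. sq * sgn_act n \<sigma> (x(i := z)) j) = ?s(i := sq * sgn_act n \<sigma> (x(i := z)) i)" for z
    using i by (auto simp: fun_eq_iff sgn_act_def)
  moreover have "(\<lambda>z. f (?s(i := sq * sgn_act n \<sigma> (x(i := z)) i))) analytic_on {w}"
    by (rule analytic_on_compose_punctured[OF BC1_holo[OF sep_BC1D[OF BC_theta_sep[OF f] st i]]])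
      (use sgn_act_analytic[OF i assms(1)] nzw nz in
        \<open>auto intro!: analytic_on_mult analytic_on_const simp del: One_nat_def\<close>)
  ultimately show ?thesis by simp
qed

lemma dterm_analytic:
  assumes w: "w \<noteq> 0" and x: "x \<in> torus n" and i: "i \<in> {1..n}" and S: "S \<subseteq> pairs n"
    and "\<And>j. j \<in> {1..n} \<Longrightarrow> th ((sgn_act n \<sigma> (x(i := w)) j)\<^sup>2) \<noteq> 0"
    and "\<And>e. e \<in> S \<Longrightarrow> th (\<Prod>k\<in>e. sgn_act n \<sigma> (x(i := w)) k) \<noteq> 0"
  shows "(\<lambda>z. dterm n a b c d sq t f S (sgn_act n \<sigma> (x(i := z)))) analytic_on {w}"
  unfolding dterm_def
  by (intro analytic_on_mult analytic_on_prod f_analytic wt_analytic ph_analytic)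
    (use assms in auto)

text \<open>The squares in \<open>pz\<close> come from the one-variable denominators, the classes
  \<open>bad (x j)\<close> from the pair denominators.\<close>

definition sing :: "(nat \<Rightarrow> complex) \<Rightarrow> nat \<Rightarrow> complex set" where
  "sing x i = {z. z * z \<in> pz \<or> (\<exists>j\<in>{1..n} - {i}. z \<in> bad (x j))}"

lemma reg_upd:
  assumes x: "x \<in> reg_off {} n" and i: "i \<in> {1..n}" and z: "z \<noteq> 0"
  shows "x(i := z) \<in> reg_off {} n \<longleftrightarrow> z \<notin> sing x i"
proof -
  have xt: "x \<in> torus n" using x by (simp add: reg_off_def)
  have "x j \<in> bad z \<longleftrightarrow> z \<in> bad (x j)" if "j \<in> {1..n}" for j
    using bad_sym[of z "x j"] torus_nz[OF xt that] z by blast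
  then show ?thesis
    using x i torus_upd[OF xt i z] unfolding sing_def reg_off_def by auto
qed

lemma reg_nz:
  assumes x: "x \<in> reg_off {} n" and \<sigma>: "\<sigma> \<in> signs n"
  shows "\<And>j. j \<in> {1..n} \<Longrightarrow> th ((sgn_act n \<sigma> x j)\<^sup>2) \<noteq> 0"
    and "\<And>e. e \<in> pairs n \<Longrightarrow> th (\<Prod>k\<in>e. sgn_act n \<sigma> x k) \<noteq> 0"
proof -
  have xt: "x \<in> torus n" using x by (simp add: reg_off_def)
  show "th ((sgn_act n \<sigma> x j)\<^sup>2) \<noteq> 0" if "j \<in> {1..n}" for j
    using sgn_act_sq_nz[OF \<sigma> xt that] x that by (simp add: reg_off_def)
  fix e assume "e \<in> pairs n"
  then obtain k l where "e = {k, l}" "k \<noteq> l" "k \<in> {1..n}" "l \<in> {1..n}"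
    by (auto simp: pairs_def card_2_iff)
  then show "th (\<Prod>k\<in>e. sgn_act n \<sigma> x k) \<noteq> 0"
    using sgn_act_pair_nz[OF \<sigma> xt, of k l] x by (simp add: reg_off_def)
qed

lemma dsum_analytic:
  assumes x: "x \<in> reg_off {} n" and i: "i \<in> {1..n}" and w: "w \<noteq> 0" "w \<notin> sing x i"
  shows "(\<lambda>z. dsum (x(i := z))) analytic_on {w}"
  unfolding dsum_def
proof (intro analytic_on_sum dterm_analytic w i subset_refl)
  show "x \<in> torus n" using x by (simp add: reg_off_def)
  fix \<sigma> assume "\<sigma> \<in> signs n"
  moreover have "x(i := w) \<in> reg_off {} n" using reg_upd[OF x i w(1)] w(2) by simp
  ultimately show "\<And>j. j \<in> {1..n} \<Longrightarrow> th ((sgn_act n \<sigma> (x(i := w)) j)\<^sup>2) \<noteq> 0"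
    "\<And>e. e \<in> pairs n \<Longrightarrow> th (\<Prod>k\<in>e. sgn_act n \<sigma> (x(i := w)) k) \<noteq> 0"
    using reg_nz by blast+
qed


text \<open>Keeps the two kinds of singular points apart: when \<open>x * x\<close> is not a power
  of \<open>p\<close>, a zero of the one-variable denominator is not a zero of a pair denominator,
  so the poles are simple.\<close>

lemma bad_of_square:
  assumes "w \<noteq> 0" "x \<noteq> 0" "w * w \<in> pz" "w \<in> bad x"
  shows "x * x \<in> pz"
proof -
  from assms(4) consider "x * w \<in> pz" | "x / w \<in> pz" by (auto simp: bad_def)
  then show ?thesis
  proof cases
    case 1
    from pz_divide[OF pz_mult[OF 1 1] assms(3)] show ?thesis using assms(1) by simp
  next
    case 2
    from pz_mult[OF pz_mult[OF 2 2] assms(3)] show ?thesis using assms(1) by simp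
  qed
qed

lemma simple_zeros_theta_square:
  assumes "s = 1 \<or> s = (-1::int)"
  shows "simple_zeros (\<lambda>z. th ((z powi s)\<^sup>2))"
proof (rule simple_zeros_theta_compose)
  show "(\<lambda>z. (z powi s)\<^sup>2) holomorphic_on - {0}" by (auto intro!: holomorphic_intros)
  fix z :: complex assume z: "z \<noteq> 0"
  show "(z powi s)\<^sup>2 \<noteq> 0" using z by simp
  have d1: "((\<lambda>z. (z powi 1)\<^sup>2) has_field_derivative 2 * z) (at z)"
    by (auto intro!: derivative_eq_intros)
  have d2: "((\<lambda>z. (z powi (-1))\<^sup>2) has_field_derivative - 2 / z ^ 3) (at z)"
    using z by (auto intro!: derivative_eq_intros simp: power_int_minus field_simps eval_nat_numeral)
  show "\<exists>D. ((\<lambda>z. (z powi s)\<^sup>2) has_field_derivative D) (at z) \<and> D \<noteq> 0"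
    using assms d1 d2 z by (metis divide_eq_0_iff mult_eq_0_iff neg_equal_0_iff_equal power_eq_0_iff zero_neq_numeral)
qed

lemma dterm_simple_pole:
  assumes x: "x \<in> reg_off {} n" and i: "i \<in> {1..n}" and w: "w \<noteq> 0" "w * w \<in> pz" and \<sigma>: "\<sigma> \<in> signs n"
  shows "\<exists>r. ((\<lambda>z. (z - w) * dterm n a b c d sq t f (pairs n) (sgn_act n \<sigma> (x(i := z)))) \<longlongrightarrow> r) (at w)"
proof -
  have xt: "x \<in> torus n" using x by (simp add: reg_off_def)
  let ?y = "\<lambda>z. sgn_act n \<sigma> (x(i := z))"
  have yt: "?y w \<in> torus n" by (rule sgn_act_upd_torus[OF xt i w(1)])
  have xwt: "x(i := w) \<in> torus n" by (rule torus_upd[OF xt i w(1)])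
  let ?num = "\<lambda>y. th (a * y) * th (b * y) * th (c * y) * th (d * y)"
  \<comment> \<open>The term with the denominator \<open>th ((?y z i)\<^sup>2)\<close> removed;
    nothing else in it is singular at \<open>w\<close>.\<close>
  define R where "R z = (\<Prod>j\<in>{1..n} - {i}. wt a b c d (?y z j)) * ?num (?y z i) *
    (\<Prod>e\<in>pairs n. ph t (\<Prod>k\<in>e. ?y z k)) * f (\<lambda>j\<in>{1..n}. sq * ?y z j)" for z
  have wj: "w \<notin> bad (x j)" if "j \<in> {1..n} - {i}" for j
    using bad_of_square[OF w(1) _ w(2), of "x j"] torus_nz[OF xt, of j] x that by (auto simp: reg_off_def)
  have "R analytic_on {w}"
    unfolding R_def
  proof (intro analytic_on_mult analytic_on_prod analytic_theta analytic_on_const sgn_act_analytic i w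
      f_analytic xt wt_analytic ph_analytic)
    fix j assume j: "j \<in> {1..n} - {i}"
    then show "j \<in> {1..n}" by simp
    show "th ((?y w j)\<^sup>2) \<noteq> 0"
      using sgn_act_sq_nz[OF \<sigma> xwt, of j] x j by (simp add: reg_off_def)
  next
    fix e assume e: "e \<in> pairs n"
    then show "e \<in> pairs n" .
    obtain k l where kl: "e = {k, l}" "k \<noteq> l" "k \<in> {1..n}" "l \<in> {1..n}"
      using e by (auto simp: pairs_def card_2_iff)
    have "(x(i := w)) k \<notin> bad ((x(i := w)) l)"
      using kl x wj[of l] wj[of k] bad_sym[of "x k" w] torus_nz[OF xt kl(3)] w(1)
      by (auto simp: reg_off_def)
    then show "th (\<Prod>k\<in>e. ?y w k) \<noteq> 0"
      using sgn_act_pair_nz[OF \<sigma> xwt kl(3,4)] kl(1,2) by simp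
  qed (use nz torus_nz[OF yt i] in auto)
  then have R: "(R \<longlongrightarrow> R w) (at w)"
    using analytic_at_imp_isCont by (auto simp: isCont_def)
  obtain \<rho> where \<rho>: "((\<lambda>z. (z - w) / th ((z powi \<sigma> i)\<^sup>2)) \<longlongrightarrow> \<rho>) (at w)"
    using simple_zeros_theta_square[OF signs_cases[OF \<sigma> i]] w(1) unfolding simple_zeros_def by blast
  have "dterm n a b c d sq t f (pairs n) (?y z) = R z / th ((z powi \<sigma> i)\<^sup>2)" for z
  proof -
    have "?y z i = z powi \<sigma> i" using i by (simp add: sgn_act_def)
    moreover have "(\<Prod>j\<in>{1..n}. wt a b c d (?y z j)) = wt a b c d (?y z i) * (\<Prod>j\<in>{1..n} - {i}. wt a b c d (?y z j))"
      by (rule prod.remove[OF _ i]) simp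
    ultimately show ?thesis by (simp add: dterm_def R_def wt_def)
  qed
  moreover have "((\<lambda>z. (z - w) / th ((z powi \<sigma> i)\<^sup>2) * R z) \<longlongrightarrow> \<rho> * R w) (at w)"
    by (intro tendsto_mult \<rho> R)
  ultimately show ?thesis by (auto simp: mult.commute)
qed

lemma isolated_sing:
  assumes x: "x \<in> reg_off {} n" and i: "i \<in> {1..n}" and w: "w \<noteq> 0"
  shows "eventually (\<lambda>z. z \<notin> sing x i \<and> z \<noteq> 0) (at w)"
proof -
  have xt: "x \<in> torus n" using x by (simp add: reg_off_def)
  have 1: "eventually (\<lambda>z. th ((z powi 1)\<^sup>2) \<noteq> 0) (at w)"
    using simple_zeros_theta_square[of 1] w unfolding simple_zeros_def by blast
  have 2: "eventually (\<lambda>z. \<forall>j\<in>{1..n} - {i}. thpm (x j) z \<noteq> 0) (at w)"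
  proof (rule eventually_ball_finite)
    show "\<forall>j\<in>{1..n} - {i}. eventually (\<lambda>z. thpm (x j) z \<noteq> 0) (at w)"
    proof
      fix j assume j: "j \<in> {1..n} - {i}"
      then have "simple_zeros (thpm (x j))"
        using x torus_nz[OF xt, of j] by (intro simple_zeros_thpm) (auto simp: reg_off_def)
      then show "eventually (\<lambda>z. thpm (x j) z \<noteq> 0) (at w)"
        using w unfolding simple_zeros_def by blast
    qed
  qed auto
  have 3: "eventually (\<lambda>z. z \<noteq> 0) (at w)"
    using t1_space_nhds[OF w] by (auto simp: eventually_at_filter elim: eventually_mono)
  from 1 2 3 show ?thesis
  proof eventually_elim
    case (elim z)
    have "z * z \<notin> pz" using elim(1,3) by (simp add: theta_eq_0_iff power2_eq_square)
    moreover have "z \<notin> bad (x j)" if "j \<in> {1..n} - {i}" for j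
      using elim(2,3) that thpm_eq_0_bad[of "x j" z] torus_nz[OF xt, of j] by auto
    ultimately show ?case using elim(3) by (auto simp: sing_def)
  qed
qed

lemma eventually_nz: "w \<noteq> 0 \<Longrightarrow> eventually (\<lambda>z. z \<noteq> (0::complex)) (at w)"
  using t1_space_nhds[of w 0] by (auto simp: eventually_at_filter elim: eventually_mono)

text \<open>The map \<open>z \<mapsto> w * w / z\<close> fixes \<open>w\<close>, reverses
  \<open>z - w\<close> to first order and multiplies \<open>dsum\<close> by a factor tending to
  \<open>1\<close>. The residue is therefore its own negative.\<close>

lemma residue_square:
  assumes x: "x \<in> reg_off {} n" and i: "i \<in> {1..n}" and w: "w \<noteq> 0" "w * w = 1 \<or> w * w = p"
  shows "((\<lambda>z. (z - w) * dsum (x(i := z))) \<longlongrightarrow> 0) (at w)"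
proof -
  have xt: "x \<in> torus n" using x by (simp add: reg_off_def)
  let ?F = "\<lambda>z. dsum (x(i := z))"
  have wp: "w * w \<in> pz" using w(2) one_in_pz p_in_pz by metis
  from bchoice[of "signs n" "\<lambda>\<sigma> r. ((\<lambda>z. (z - w) * dterm n a b c d sq t f (pairs n) (sgn_act n \<sigma> (x(i := z)))) \<longlongrightarrow> r) (at w)"]
    dterm_simple_pole[OF x i w(1) wp]
  obtain r where r: "\<And>\<sigma>. \<sigma> \<in> signs n \<Longrightarrow>
     ((\<lambda>z. (z - w) * dterm n a b c d sq t f (pairs n) (sgn_act n \<sigma> (x(i := z)))) \<longlongrightarrow> r \<sigma>) (at w)"
    by blast
  define \<rho> where "\<rho> = (\<Sum>\<sigma>\<in>signs n. r \<sigma>)"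
  have \<rho>: "((\<lambda>z. (z - w) * ?F z) \<longlongrightarrow> \<rho>) (at w)"
    unfolding dsum_def \<rho>_def sum_distrib_left by (intro tendsto_sum r)
  obtain k :: nat where k: "w * w = p ^ k" "k = 0 \<or> k = 1" using w(2) by (metis power_0 power_one_right)
  define s where "s z = p ^ k / z" for z
  \<comment> \<open>The ratio of \<open>(z - w) * ?F z\<close> to its transform under
    \<open>s\<close>; for \<open>w * w = p\<close> it contains the multiplier of
    \<open>dsum_p\<close> at \<open>1 / z\<close>.\<close>
  define cc where "cc z = (if k = 0 then - z / w else - (z / w) * (p * (1 / z)\<^sup>2) ^ m)" for z :: complex
  have "filterlim s (at w) (at w)"
  proof (rule filterlim_at_isCont)
    show "isCont s w" unfolding s_def using w(1) by (intro continuous_intros) auto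
    show "s w = w" using w(1) by (simp add: s_def k(1)[symmetric])
    show "eventually (\<lambda>z. s z \<noteq> w) (at w)"
      using eventually_nz[OF w(1)] eventually_neq_at_within[of w w UNIV]
    proof eventually_elim
      case (elim z)
      then show ?case using w(1) k(1)[symmetric] by (auto simp: s_def field_simps)
    qed
  qed
  moreover have "eventually (\<lambda>z. (z - w) * ?F z = cc z * ((s z - w) * ?F (s z))) (at w)"
    using eventually_nz[OF w(1)]
  proof eventually_elim
    case (elim z)
    have sz: "s z - w = - (w / z) * (z - w)"
      using elim by (simp add: s_def k(1)[symmetric] field_simps)
    show ?case
    proof (cases "k = 0")
      case True
      have "?F (s z) = ?F z" using dsum_inv[OF xt i elim] True by (simp add: s_def)
      then show ?thesis unfolding sz using True elim w(1) by (simp add: cc_def)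
    next
      case False
      then have "s z = p * (1 / z)" using k(2) by (simp add: s_def)
      then have "?F (s z) = ?F z / (p * (1 / z)\<^sup>2) ^ m"
        using dsum_p[OF xt i, of "1 / z"] dsum_inv[OF xt i elim] elim by simp
      then show ?thesis unfolding sz using False elim w(1) by (simp add: cc_def)
    qed
  qed
  moreover have "(cc \<longlongrightarrow> -1) (at w)"
  proof -
    have "isCont cc w" unfolding cc_def using w(1) by (cases "k = 0") (auto intro!: continuous_intros)
    moreover have "cc w = -1"
      using w(1) k by (auto simp: cc_def power2_eq_square)
    ultimately show ?thesis by (simp add: isCont_def)
  qed
  ultimately have "((\<lambda>z. (z - w) * ?F z) \<longlongrightarrow> -1 * \<rho>) (at w)"
    using simple_pole_transfer[OF \<rho>] by blast
  then have "-1 * \<rho> = \<rho>" using \<rho> by (intro tendsto_unique[of "at w"]) auto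
  then have "\<rho> = 0" by simp
  then show ?thesis using \<rho> by simp
qed

lemma theta_DERIV_1: "((\<lambda>x. th x) has_field_derivative theta_prime) (at 1)"
  using theta_limit_1 by (simp add: has_field_derivative_iff)

text \<open>The quotient \<open>ph t\<close> has residue \<open>th t / theta_prime\<close> at
  \<open>1\<close>; the sign \<open>s\<close> is the direction in which its argument passes through
  \<open>1\<close>.\<close>

lemma ph_residue:
  assumes w: "w \<noteq> 0" and s: "s = 1 \<or> s = (-1::int)"
  shows "((\<lambda>z. (z - w) * ph t (z powi s * w powi (- s))) \<longlongrightarrow> of_int s * (w * th t / theta_prime)) (at w)"
proof -
  let ?g = "\<lambda>z. z powi s * w powi (- s)"
  have g: "(?g has_field_derivative of_int s / w) (at w)" "?g w = 1"
    using s w by (auto intro!: derivative_eq_intros simp: power_int_minus field_simps power2_eq_square)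
  have th1: "((\<lambda>x. th x) has_field_derivative theta_prime) (at (?g w))"
    using theta_DERIV_1 g(2) by simp
  have D: "((\<lambda>z. th (?g z)) has_field_derivative theta_prime * (of_int s / w)) (at w)"
    by (rule DERIV_chain2[OF th1 g(1)])
  have "((\<lambda>z. (z - w) / th (?g z)) \<longlongrightarrow> 1 / (theta_prime * (of_int s / w))) (at w)"
    by (rule DERIV_nz_limits(2)[OF D]) (use g(2) s w theta_prime_nz in auto)
  moreover have "((\<lambda>z. th (t * ?g z)) \<longlongrightarrow> th (t * ?g w)) (at w)"
  proof -
    have "isCont (\<lambda>z. th (t * ?g z)) w"
      using w nz g(2) s
      by (intro analytic_at_imp_isCont analytic_theta) (auto intro!: analytic_intros)
    then show ?thesis by (simp add: isCont_def)
  qed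
  ultimately have "((\<lambda>z. (z - w) / th (?g z) * th (t * ?g z)) \<longlongrightarrow> 1 / (theta_prime * (of_int s / w)) * th (t * ?g w)) (at w)"
    by (rule tendsto_mult)
  moreover have "1 / (theta_prime * (of_int s / w)) * th (t * ?g w) = of_int s * (w * th t / theta_prime)"
    using g(2) s w by auto
  ultimately show ?thesis by (simp add: ph_def mult_ac)
qed

text \<open>At \<open>z = x\<^sub>j\<close> the residue of the term of \<open>\<sigma>\<close> cancels that of \<open>\<sigma>\<close> with the entries \<open>i, j\<close> exchanged.\<close>

lemma residue_pair:
  assumes x: "x \<in> reg_off {} n" and i: "i \<in> {1..n}" and j: "j \<in> {1..n}" "j \<noteq> i"
  defines "w \<equiv> x j"
  shows "((\<lambda>z. (z - w) * dsum (x(i := z))) \<longlongrightarrow> 0) (at w)"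
proof -
  have xt: "x \<in> torus n" using x by (simp add: reg_off_def)
  have w: "w \<noteq> 0" using torus_nz xt j by (auto simp: w_def)
  have ww: "w * w \<notin> pz" using x j by (simp add: w_def reg_off_def)
  have xwt: "x(i := w) \<in> torus n" by (rule torus_upd[OF xt i w])
  let ?y = "\<lambda>\<sigma> z. sgn_act n \<sigma> (x(i := z))"
  define S where "S = pairs n - {{i, j}}"
  have ij: "{i, j} \<in> pairs n" using i j by (auto simp: pairs_def)
  define R where "R \<sigma> z = dterm n a b c d sq t f S (?y \<sigma> z)" for \<sigma> z
  have split: "dterm n a b c d sq t f (pairs n) (?y \<sigma> z) = ph t (?y \<sigma> z i * ?y \<sigma> z j) * R \<sigma> z" for \<sigma> z
    unfolding R_def dterm_def S_def by (subst prod.remove[OF _ ij]) (use j in \<open>auto simp: mult_ac\<close>)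
  have sqnz: "th ((?y \<sigma> w k)\<^sup>2) \<noteq> 0" if \<sigma>: "\<sigma> \<in> signs n" and k: "k \<in> {1..n}" for \<sigma> k
    using sgn_act_sq_nz[OF \<sigma> xwt k] x k ww by (simp add: reg_off_def)
  have R: "(R \<sigma> \<longlongrightarrow> R \<sigma> w) (at w)" if \<sigma>: "\<sigma> \<in> signs n" for \<sigma>
  proof -
    have "R \<sigma> analytic_on {w}"
      unfolding R_def
    proof (intro dterm_analytic w xt i)
      show "S \<subseteq> pairs n" by (auto simp: S_def)
      show "th ((?y \<sigma> w k)\<^sup>2) \<noteq> 0" if "k \<in> {1..n}" for k using sqnz[OF \<sigma> that] .
      fix e assume e: "e \<in> S"
      then have "e \<in> pairs n" by (simp add: S_def)
      then obtain k l where kl: "e = {k, l}" "k \<noteq> l" "k \<in> {1..n}" "l \<in> {1..n}"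
        by (auto simp: pairs_def card_2_iff)
      have "(x(i := w)) k \<notin> bad ((x(i := w)) l)"
        using kl x e j i by (auto simp: reg_off_def S_def w_def insert_commute)
      then show "th (\<Prod>k\<in>e. ?y \<sigma> w k) \<noteq> 0"
        using sgn_act_pair_nz[OF \<sigma> xwt kl(3,4)] kl(1,2) by simp
    qed
    then show ?thesis using analytic_at_imp_isCont by (auto simp: isCont_def)
  qed
  define \<kappa> where "\<kappa> = w * th t / theta_prime"
  \<comment> \<open>For equal signs the pair factor is regular at \<open>w\<close> and this is
    \<open>0\<close>; for opposite signs the fraction is \<open>\<sigma> i\<close>, the sign in
    \<open>ph_residue\<close>.\<close>
  define r where "r \<sigma> = (of_int (\<sigma> i) - of_int (\<sigma> j)) / 2 * \<kappa> * R \<sigma> w" for \<sigma> :: "nat \<Rightarrow> int"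
  have r: "((\<lambda>z. (z - w) * dterm n a b c d sq t f (pairs n) (?y \<sigma> z)) \<longlongrightarrow> r \<sigma>) (at w)"
    if \<sigma>: "\<sigma> \<in> signs n" for \<sigma>
  proof -
    have y: "?y \<sigma> z i * ?y \<sigma> z j = z powi \<sigma> i * w powi \<sigma> j" for z
      using i j by (simp add: sgn_act_def w_def)
    have "((\<lambda>z. (z - w) * ph t (z powi \<sigma> i * w powi \<sigma> j)) \<longlongrightarrow> (of_int (\<sigma> i) - of_int (\<sigma> j)) / 2 * \<kappa>) (at w)"
    proof (cases "\<sigma> i = \<sigma> j")
      case True
      let ?g = "\<lambda>z. z powi \<sigma> i * w powi \<sigma> i"
      have "th (?g w) \<noteq> 0"
        using sqnz[OF \<sigma> i] i by (simp add: sgn_act_def power2_eq_square)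
      then have "isCont (\<lambda>z. ph t (?g z)) w"
        unfolding ph_def using w nz signs_cases[OF \<sigma> i]
        by (intro analytic_at_imp_isCont analytic_on_divide analytic_theta) (auto intro!: analytic_intros)
      then have "((\<lambda>z. ph t (?g z)) \<longlongrightarrow> ph t (?g w)) (at w)" by (simp add: isCont_def)
      then have "((\<lambda>z. (z - w) * ph t (?g z)) \<longlongrightarrow> (w - w) * ph t (?g w)) (at w)"
        by (intro tendsto_intros)
      then show ?thesis using True by simp
    next
      case False
      then have "\<sigma> j = - \<sigma> i" using signs_cases[OF \<sigma> i] signs_cases[OF \<sigma> j(1)] by auto
      then show ?thesis using ph_residue[OF w signs_cases[OF \<sigma> i]] by (simp add: \<kappa>_def)
    qed
    then have "((\<lambda>z. (z - w) * ph t (z powi \<sigma> i * w powi \<sigma> j) * R \<sigma> z) \<longlongrightarrow> (of_int (\<sigma> i) - of_int (\<sigma> j)) / 2 * \<kappa> * R \<sigma> w) (at w)"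
      by (rule tendsto_mult[OF _ R[OF \<sigma>]])
    then show ?thesis unfolding split y r_def by (simp add: mult.assoc)
  qed
  have lim: "((\<lambda>z. (z - w) * dsum (x(i := z))) \<longlongrightarrow> (\<Sum>\<sigma>\<in>signs n. r \<sigma>)) (at w)"
    unfolding dsum_def sum_distrib_left by (intro tendsto_sum r)
  let ?\<tau> = "Transposition.transpose i j"
  have \<tau>: "?\<tau> permutes {1..n}" using i j by (intro permutes_swap_id) auto
  have "x(i := w) \<circ> ?\<tau> = x(i := w)"
    by (auto simp: fun_eq_iff Transposition.transpose_def w_def)
  then have act: "?y (\<sigma> \<circ> ?\<tau>) w = ?y \<sigma> w \<circ> ?\<tau>" for \<sigma>
    using sgn_act_comp[OF \<tau>, of \<sigma> "x(i := w)"] by simp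
  have S: "(\<lambda>e. ?\<tau> ` e) ` S = S"
  proof -
    have "(\<lambda>e. ?\<tau> ` e) ` S = (\<lambda>e. ?\<tau> ` e) ` pairs n - {?\<tau> ` {i, j}}"
      unfolding S_def
      by (subst image_set_diff) (auto intro!: injI simp: inj_image_eq_iff[OF permutes_inj[OF \<tau>]])
    then show ?thesis
      unfolding permutes_image_pairs[OF \<tau>] S_def by (simp add: insert_commute)
  qed
  have "r (\<sigma> \<circ> ?\<tau>) = - r \<sigma>" for \<sigma>
  proof -
    have "R (\<sigma> \<circ> ?\<tau>) w = R \<sigma> w"
      unfolding R_def act
      by (rule dterm_comp[OF f \<tau> S sgn_act_torus[OF xwt] nz(5)])
    then show ?thesis by (simp add: r_def field_simps)
  qed
  then have "(\<Sum>\<sigma>\<in>signs n. r \<sigma>) = - (\<Sum>\<sigma>\<in>signs n. r \<sigma>)"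
    using sum.reindex_bij_betw[OF signs_comp_bij[OF \<tau>], of r] by (simp add: sum_negf)
  then have "(\<Sum>\<sigma>\<in>signs n. r \<sigma>) = 0" by simp
  then show ?thesis using lim by simp
qed

text \<open>Inversion and multiplication by \<open>p\<close> preserve the claim, and they carry
  every singular point to some \<open>x j\<close> or to a \<open>w\<close> with \<open>w * w\<close>
  equal to \<open>1\<close> or \<open>p\<close>.\<close>

lemma residue_zero:
  assumes x: "x \<in> reg_off {} n" and i: "i \<in> {1..n}" and w: "w \<noteq> 0" "w \<in> sing x i"
  shows "((\<lambda>z. (z - w) * dsum (x(i := z))) \<longlongrightarrow> 0) (at w)"
proof -
  have xt: "x \<in> torus n" using x by (simp add: reg_off_def)
  let ?F = "\<lambda>z. dsum (x(i := z))"
  let ?P = "\<lambda>w. ((\<lambda>z. (z - w) * ?F z) \<longlongrightarrow> 0) (at w)"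
  have inv: "?P (1 / w)" if P: "?P w" and w: "w \<noteq> 0" for w
  proof -
    have "((\<lambda>z. (z - 1 / w) * ?F z) \<longlongrightarrow> - ((1 / w) / w) * 0) (at (1 / w))"
    proof (rule simple_pole_transfer[OF P, where s = "\<lambda>z. 1 / z" and c = "\<lambda>z. - (z / w)"])
      have w': "1 / w \<noteq> 0" using w by simp
      show "filterlim (\<lambda>z. 1 / z) (at w) (at (1 / w))"
      proof (rule filterlim_at_isCont)
        show "eventually (\<lambda>z. 1 / z \<noteq> w) (at (1 / w))"
          using eventually_nz[OF w'] eventually_neq_at_within[of "1 / w" "1 / w" UNIV]
          by eventually_elim (use w in \<open>auto simp: field_simps\<close>)
      qed (use w in \<open>auto intro!: continuous_intros\<close>)
      show "eventually (\<lambda>z. (z - 1 / w) * ?F z = - (z / w) * ((1 / z - w) * ?F (1 / z))) (at (1 / w))"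
        using eventually_nz[OF w']
      proof eventually_elim
        case (elim z)
        have "z - 1 / w = - (z / w) * (1 / z - w)" using elim w by (simp add: field_simps)
        then show ?case using dsum_inv[OF xt i elim] by simp
      qed
      show "((\<lambda>z. - (z / w)) \<longlongrightarrow> - ((1 / w) / w)) (at (1 / w))" using w by (intro tendsto_intros)
    qed
    then show ?thesis by simp
  qed
  have up: "?P (p * w)" if P: "?P w" and w: "w \<noteq> 0" for w
  proof -
    have w': "p * w \<noteq> 0" using w by simp
    have "((\<lambda>z. (z - p * w) * ?F z) \<longlongrightarrow> p / (p * ((p * w) / p)\<^sup>2) ^ m * 0) (at (p * w))"
    proof (rule simple_pole_transfer[OF P, where s = "\<lambda>z. z / p" and c = "\<lambda>z. p / (p * (z / p)\<^sup>2) ^ m"])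
      show "filterlim (\<lambda>z. z / p) (at w) (at (p * w))"
      proof (rule filterlim_at_isCont)
        show "eventually (\<lambda>z. z / p \<noteq> w) (at (p * w))"
          using eventually_neq_at_within[of "p * w" "p * w" UNIV]
          by eventually_elim (auto simp: field_simps)
      qed (auto intro!: continuous_intros)
      show "eventually (\<lambda>z. (z - p * w) * ?F z = p / (p * (z / p)\<^sup>2) ^ m * ((z / p - w) * ?F (z / p))) (at (p * w))"
        using eventually_nz[OF w']
      proof eventually_elim
        case (elim z)
        then have "?F z = ?F (z / p) / (p * (z / p)\<^sup>2) ^ m" using dsum_p[OF xt i, of "z / p"] by simp
        moreover have "z - p * w = p * (z / p - w)" by (simp add: field_simps)
        ultimately show ?case by simp
      qed
      show "((\<lambda>z. p / (p * (z / p)\<^sup>2) ^ m) \<longlongrightarrow> p / (p * ((p * w) / p)\<^sup>2) ^ m) (at (p * w))"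
        using w by (intro tendsto_intros) auto
    qed
    then show ?thesis by simp
  qed
  have down: "?P (w / p)" if P: "?P w" and w: "w \<noteq> 0" for w
  proof -
    have w': "w / p \<noteq> 0" using w by simp
    have "((\<lambda>z. (z - w / p) * ?F z) \<longlongrightarrow> (p * (w / p)\<^sup>2) ^ m / p * 0) (at (w / p))"
    proof (rule simple_pole_transfer[OF P, where s = "\<lambda>z. p * z" and c = "\<lambda>z. (p * z\<^sup>2) ^ m / p"])
      show "filterlim (\<lambda>z. p * z) (at w) (at (w / p))"
      proof (rule filterlim_at_isCont)
        show "eventually (\<lambda>z. p * z \<noteq> w) (at (w / p))"
          using eventually_neq_at_within[of "w / p" "w / p" UNIV]
          by eventually_elim (auto simp: field_simps)
      qed (auto intro!: continuous_intros)
      show "eventually (\<lambda>z. (z - w / p) * ?F z = (p * z\<^sup>2) ^ m / p * ((p * z - w) * ?F (p * z))) (at (w / p))"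
        using eventually_nz[OF w']
      proof eventually_elim
        case (elim z)
        then have "?F (p * z) = ?F z / (p * z\<^sup>2) ^ m" using dsum_p[OF xt i, of z] by simp
        moreover have "p * z - w = p * (z - w / p)" by (simp add: field_simps)
        ultimately show ?case using elim by simp
      qed
      show "((\<lambda>z. (p * z\<^sup>2) ^ m / p) \<longlongrightarrow> (p * (w / p)\<^sup>2) ^ m / p) (at (w / p))"
        by (intro tendsto_intros) auto
    qed
    then show ?thesis by simp
  qed
  have shift: "?P (p powi k * w)" if P: "?P w" and w: "w \<noteq> 0" for k w
  proof -
    define Q where "Q k \<longleftrightarrow> ?P (p powi k * w)" for k
    have Q: "Q k" for k
    proof (induction k rule: int_induct[where k = 0])
      case base
      show ?case unfolding Q_def power_int_0_right mult_1_left by (rule P)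
    next
      case (step1 r)
      have eq: "p powi (r + 1) * w = p * (p powi r * w)" by (simp add: power_int_add mult_ac)
      show ?case unfolding Q_def eq by (rule up) (use step1(2) w in \<open>auto simp: Q_def\<close>)
    next
      case (step2 r)
      have eq: "p powi (r - 1) * w = (p powi r * w) / p" by (simp add: power_int_diff)
      show ?case unfolding Q_def eq by (rule down) (use step2(2) w in \<open>auto simp: Q_def\<close>)
    qed
    show ?thesis using Q unfolding Q_def .
  qed
  have half: "?P w" if "w * w \<in> pz" "w \<noteq> 0" for w
  proof -
    obtain k where k: "w * w = p powi k" using \<open>w * w \<in> pz\<close> by (auto simp: pz_def)
    \<comment> \<open>Halving the exponent leaves a square equal to \<open>1\<close> or
      \<open>p\<close>, according to the parity of \<open>k\<close>.\<close>
    define h where "h = k div 2"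
    define v where "v = p powi (- h) * w"
    have v: "v \<noteq> 0" using that(2) by (simp add: v_def)
    have "v * v = p powi (- h) * p powi (- h) * p powi k" using k by (simp add: v_def mult_ac)
    also have "\<dots> = p powi (k - 2 * h)" by (simp add: power_int_add[symmetric])
    finally have "v * v = p powi (k mod 2)" by (simp add: h_def minus_mult_div_eq_mod)
    then have "v * v = 1 \<or> v * v = p"
      by (cases "even k") (auto simp: even_iff_mod_2_eq_zero odd_iff_mod_2_eq_one)
    then have "?P v" by (rule residue_square[OF x i v])
    from shift[OF this v, of h] show ?thesis
      by (simp add: v_def power_int_minus mult.assoc[symmetric])
  qed
  from w(2) consider "w * w \<in> pz" | j where "j \<in> {1..n}" "j \<noteq> i" "w \<in> bad (x j)"
    unfolding sing_def by blast
  then show ?thesis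
  proof cases
    case 1
    then show ?thesis using half w by blast
  next
    case 2
    have xj: "x j \<noteq> 0" using torus_nz[OF xt 2(1)] .
    have P: "?P (x j)" by (rule residue_pair[OF x i 2(1,2)])
    from 2(3) consider k where "x j * w = p powi k" | k where "x j / w = p powi k"
      by (auto simp: bad_def pz_def)
    then show ?thesis
    proof cases
      case 1
      then have "w = p powi k * (1 / x j)" using xj by (simp add: field_simps)
      then show ?thesis using shift[OF inv[OF P xj], of k] xj by simp
    next
      case 2
      then have "w = p powi (- k) * x j" using xj w(1) by (simp add: field_simps power_int_minus)
      then show ?thesis using shift[OF P xj, of "- k"] by simp
    qed
  qed
qed

lemma countable_sing: "x \<in> torus n \<Longrightarrow> countable (sing x i)"
proof -
  assume x: "x \<in> torus n"
  have "sing x i = {z. z * z \<in> pz} \<union> (\<Union>j\<in>{1..n} - {i}. bad (x j))" by (auto simp: sing_def)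
  moreover have "countable (\<Union>j\<in>{1..n} - {i}. bad (x j))"
    by (rule countable_UN) (use torus_nz[OF x] in auto)
  ultimately show ?thesis using countable_sqrt[OF countable_pz] by simp
qed

lemma dsum_BC1:
  assumes x: "x \<in> reg_off {} n" and i: "i \<in> {1..n}"
  shows "\<exists>h\<in>BC1 m. \<forall>z. x(i := z) \<in> reg_off {} n \<longrightarrow> dsum (x(i := z)) = h z"
proof -
  have xt: "x \<in> torus n" using x by (simp add: reg_off_def)
  let ?F = "\<lambda>z. dsum (x(i := z))"
  obtain h where h: "h holomorphic_on - {0}" "\<And>z. z \<noteq> 0 \<Longrightarrow> z \<notin> sing x i \<Longrightarrow> h z = ?F z"
  proof (rule removable_singularities_punctured_plane[where Z = "sing x i" and F = ?F])
    show "eventually (\<lambda>z. z \<notin> sing x i) (at w)" if "w \<noteq> 0" for w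
      using isolated_sing[OF x i that] by (auto elim: eventually_mono)
    show "?F holomorphic_on - {0} - sing x i"
      by (rule analytic_imp_holomorphic, subst analytic_on_analytic_at)
        (use dsum_analytic[OF x i] in auto)
    show "((\<lambda>z. (z - w) * ?F z) \<longlongrightarrow> 0) (at w)" if "w \<noteq> 0" "w \<in> sing x i" for w
      using residue_zero[OF x i that] .
  qed blast
  have cont: "continuous_on (- {0}) h" using h(1) holomorphic_on_imp_continuous_on by blast
  have cs: "countable (sing x i)" using countable_sing[OF xt] .
  \<comment> \<open>Points are excluded also when their image under inversion, or under
    multiplication by \<open>p\<close>, is singular.\<close>
  have c1: "countable (sing x i \<union> (\<lambda>z. 1 / z) ` sing x i)" "countable (sing x i \<union> (\<lambda>z. z / p) ` sing x i)"
    using cs by auto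
  have "h (1 / z) = h z" if "z \<noteq> 0" for z
  proof (rule continuous_eq_off_countable[where f = "\<lambda>z. h (1 / z)", OF _ cont c1(1) _ that])
    show "continuous_on (- {0}) (\<lambda>z. h (1 / z))"
      by (rule continuous_on_compose2[OF cont]) (auto intro!: continuous_intros)
    fix z :: complex assume z: "z \<noteq> 0" "z \<notin> sing x i \<union> (\<lambda>z. 1 / z) ` sing x i"
    then have "1 / z \<notin> sing x i" by (auto simp: image_iff)
    then show "h (1 / z) = h z" using z h(2)[of z] h(2)[of "1 / z"] dsum_inv[OF xt i z(1)] by simp
  qed
  moreover have "h (p * z) = h z / (p * z\<^sup>2) ^ m" if "z \<noteq> 0" for z
  proof (rule continuous_eq_off_countable[where f = "\<lambda>z. h (p * z)" and g = "\<lambda>z. h z / (p * z\<^sup>2) ^ m", OF _ _ c1(2) _ that])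
    show "continuous_on (- {0}) (\<lambda>z. h (p * z))"
      by (rule continuous_on_compose2[OF cont]) (auto intro!: continuous_intros)
    show "continuous_on (- {0}) (\<lambda>z. h z / (p * z\<^sup>2) ^ m)"
      by (intro continuous_intros cont) auto
    fix z :: complex assume z: "z \<noteq> 0" "z \<notin> sing x i \<union> (\<lambda>z. z / p) ` sing x i"
    then have "p * z \<notin> sing x i" by (auto simp: image_iff)
    then show "h (p * z) = h z / (p * z\<^sup>2) ^ m"
      using z h(2)[of z] h(2)[of "p * z"] dsum_p[OF xt i z(1)] by simp
  qed
  ultimately have "h \<in> BC1 m" using h(1) by (simp add: BC1_def)
  moreover have "?F z = h z" if z: "x(i := z) \<in> reg_off {} n" for z
  proof -
    have "z \<noteq> 0" using z torus_nz[of "x(i := z)" n i] i by (auto simp: reg_off_def)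
    then show ?thesis using reg_upd[OF x i] z h(2) by auto
  qed
  ultimately show ?thesis by blast
qed

lemma diff_op_BC_theta:
  obtains G where "G \<in> BC_theta m n p"
    "\<And>x. x \<in> torus n \<Longrightarrow> diff_op_regular n p x \<Longrightarrow> G x = diff_op n a b c d sq t p f x"
proof -
  have cnt: "countable {}" by simp
  obtain G where G: "G \<in> BC_theta m n p" "\<And>x. x \<in> reg_off {} n \<Longrightarrow> G x = dsum x"
  proof (rule BC_theta_extension[OF cnt dsum_BC1])
    show "dsum (x \<circ> \<pi>) = dsum x" if "x \<in> reg_off {} n" "\<pi> permutes {1..n}" for x \<pi>
      unfolding dsum_def
      by (rule dterm_sum_comp[OF f that(2) _ nz(5)]) (use that in \<open>simp add: reg_off_def\<close>)
  qed blast+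
  moreover have "dsum x = diff_op n a b c d sq t p f x" if "x \<in> torus n" for x
    using diff_op_eq_dterm_sum[OF BC_theta_sep[OF f] nz(5) that] by (simp add: dsum_def)
  ultimately show ?thesis using that reg_off_empty_iff by metis
qed

end

subsection \<open>Generic parameters\<close>

text \<open>Integer exponents turn genericity into a statement on exponent vectors, and products and
  quotients into their sums and differences.\<close>

definition mon :: "complex \<Rightarrow> complex \<Rightarrow> complex \<Rightarrow> complex \<Rightarrow> int \<Rightarrow> int \<Rightarrow> int \<Rightarrow> int \<Rightarrow> complex" where
  "mon a b q t i j k l = a powi i * b powi j * q powi k * t powi l"

lemma mon_0 [simp]: "mon a b q t 0 0 0 0 = 1"
  by (simp add: mon_def)

context
  fixes a b q t :: complex
  assumes nz: "a \<noteq> 0" "b \<noteq> 0" "q \<noteq> 0" "t \<noteq> 0"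
begin

lemma mon_nz: "mon a b q t i j k l \<noteq> 0"
  using nz by (simp add: mon_def)

lemma mon_mult: "mon a b q t i j k l * mon a b q t i' j' k' l' = mon a b q t (i + i') (j + j') (k + k') (l + l')"
  using nz by (simp add: mon_def power_int_add mult_ac)

lemma mon_divide: "mon a b q t i j k l / mon a b q t i' j' k' l' = mon a b q t (i - i') (j - j') (k - k') (l - l')"
  using nz by (simp add: mon_def power_int_diff)

lemma mon_powi: "mon a b q t i j k l powi r = mon a b q t (i * r) (j * r) (k * r) (l * r)"
  using nz by (simp add: mon_def power_int_mult_distrib power_int_mult)

lemma mon_power: "mon a b q t i j k l ^ r = mon a b q t (i * int r) (j * int r) (k * int r) (l * int r)"
  using mon_powi[of i j k l "int r"] by simp

end

lemma mon_basis: "mon a b q t 1 0 0 0 = a" "mon a b q t 0 1 0 0 = b" "mon a b q t 0 0 1 0 = q" "mon a b q t 0 0 0 1 = t"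
  by (simp_all add: mon_def)

section \<open>Partitions in a box and the points attached to them\<close>

lemma partitions_le: "l \<in> partitions_in m n \<Longrightarrow> l i \<le> m"
  by (cases "i \<in> {1..n}") (auto simp: partitions_in_def)

lemma partitions_antimono: "l \<in> partitions_in m n \<Longrightarrow> 1 \<le> i \<Longrightarrow> i \<le> j \<Longrightarrow> l j \<le> l i"
  by (cases "j \<le> n") (auto simp: partitions_in_def)

lemma partitions_outside: "l \<in> partitions_in m n \<Longrightarrow> i \<notin> {1..n} \<Longrightarrow> l i = 0"
  by (auto simp: partitions_in_def)

lemma partitions_inI:
  assumes "\<And>i. i \<notin> {1..n} \<Longrightarrow> l i = 0" "\<And>i. i \<in> {1..n} \<Longrightarrow> l i \<le> m"
    and "\<And>i j. 1 \<le> i \<Longrightarrow> i \<le> j \<Longrightarrow> j \<le> n \<Longrightarrow> l j \<le> l i"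
  shows "l \<in> partitions_in m n"
  using assms unfolding partitions_in_def by blast

lemma partitions_SucD:
  assumes l: "l \<in> partitions_in m n"
  shows "l \<in> partitions_in m (Suc n)" "l (Suc n) = 0"
proof -
  show "l (Suc n) = 0" by (rule partitions_outside[OF l]) simp
  show "l \<in> partitions_in m (Suc n)"
    by (rule partitions_inI) (use partitions_le[OF l] partitions_outside[OF l] partitions_antimono[OF l] in auto)
qed

lemma partitions_SucI:
  assumes l: "l \<in> partitions_in m (Suc n)" "l (Suc n) = 0"
  shows "l \<in> partitions_in m n"
proof -
  have "l i = 0" if "i \<notin> {1..n}" for i
    using l(2) partitions_outside[OF l(1), of i] that by (cases "i = Suc n") auto
  then show ?thesis
    by (intro partitions_inI) (use partitions_le[OF l(1)] partitions_antimono[OF l(1)] in auto)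
qed

text \<open>Adds a first column of length \<open>n\<close> to the diagram, while
  \<open>decr_part\<close> removes the first column. On points this replaces \<open>a\<close> by
  \<open>a * q\<close>; on functions it corresponds to the divisor \<open>thpm a\<close>.\<close>

definition incr_part :: "nat \<Rightarrow> (nat \<Rightarrow> nat) \<Rightarrow> nat \<Rightarrow> nat" where
  "incr_part n l = (\<lambda>i. if i \<in> {1..n} then Suc (l i) else 0)"

definition decr_part :: "(nat \<Rightarrow> nat) \<Rightarrow> nat \<Rightarrow> nat" where
  "decr_part l = (\<lambda>i. l i - 1)"

lemma incr_part_in: "l \<in> partitions_in m n \<Longrightarrow> incr_part n l \<in> partitions_in (Suc m) n"
  by (rule partitions_inI) (auto simp: incr_part_def partitions_le partitions_antimono)

lemma decr_part_in:
  assumes l: "l \<in> partitions_in (Suc m) n"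
  shows "decr_part l \<in> partitions_in m n"
proof (rule partitions_inI)
  show "decr_part l i = 0" if "i \<notin> {1..n}" for i
    unfolding decr_part_def using partitions_outside[OF l that] by simp
  show "decr_part l i \<le> m" for i
    unfolding decr_part_def using partitions_le[OF l, of i] by simp
  show "decr_part l j \<le> decr_part l i" if "1 \<le> i" "i \<le> j" for i j
    unfolding decr_part_def by (rule diff_le_mono[OF partitions_antimono[OF l that]])
qed

lemma decr_incr_part: "l \<in> partitions_in m n \<Longrightarrow> decr_part (incr_part n l) = l"
  using partitions_outside[of l m n] by (auto simp: decr_part_def incr_part_def fun_eq_iff)

lemma incr_decr_part:
  assumes "l \<in> partitions_in m n" "1 \<le> l n"
  shows "incr_part n (decr_part l) = l"
proof (rule ext)
  fix i
  show "incr_part n (decr_part l) i = l i"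
    using partitions_outside[OF assms(1), of i] partitions_antimono[OF assms(1), of i n] assms(2)
    by (cases "i \<in> {1..n}") (auto simp: decr_part_def incr_part_def)
qed

text \<open>The index \<open>l1\<close> of \<open>vanishing_length\<close>; for a partition it
  counts the indices in \<open>{1..n}\<close> whose part is \<open>m\<close>.\<close>

definition full_length :: "nat \<Rightarrow> nat \<Rightarrow> (nat \<Rightarrow> nat) \<Rightarrow> nat" where
  "full_length m n \<mu> = Max (insert 0 {i \<in> {1..n}. \<mu> i = m})"

text \<open>The vanishing point with its cut \<open>k\<close> left free: the operator changes the
  partition but keeps the cut, so cuts occur that belong to no node of the new partition.\<close>

definition pt :: "nat \<Rightarrow> nat \<Rightarrow> nat \<Rightarrow> (nat \<Rightarrow> nat) \<Rightarrow> complex \<Rightarrow> complex \<Rightarrow> complex \<Rightarrow> complex \<Rightarrow> nat \<Rightarrow> complex" where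
  "pt m n k \<mu> a b q t = (\<lambda>i\<in>{1..n}. if i \<le> k then b * q ^ (m - \<mu> i) * t ^ (i - 1) else a * q ^ \<mu> i * t ^ (n - i))"

lemma vanishing_point_eq_pt: "vanishing_point m n l \<mu> a b q t = pt m n (vanishing_length m n l \<mu>) \<mu> a b q t"
  by (simp add: vanishing_point_def pt_def)

lemma vanishing_length_altdef:
  "vanishing_length m n l \<mu> = (let l0 = Max {i \<in> {1..n}. \<mu> i \<noteq> l i} in
    if \<mu> l0 < l l0 then full_length m n \<mu> else l0)"
  by (simp add: vanishing_length_def full_length_def Let_def)

lemma full_length_le: "full_length m n \<mu> \<le> n"
  unfolding full_length_def by (intro Max.boundedI) auto

lemma full_length_part:
  assumes "\<mu> \<in> partitions_in m n" "i \<in> {1..n}"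
  shows "i \<le> full_length m n \<mu> \<longleftrightarrow> \<mu> i = m"
proof
  assume "\<mu> i = m"
  then show "i \<le> full_length m n \<mu>" unfolding full_length_def using assms by (intro Max_ge) auto
next
  assume i: "i \<le> full_length m n \<mu>"
  have "full_length m n \<mu> \<in> insert 0 {i \<in> {1..n}. \<mu> i = m}"
    unfolding full_length_def by (intro Max_in) auto
  then have "\<mu> (full_length m n \<mu>) = m" using i assms(2) by auto
  then have "m \<le> \<mu> i" using partitions_antimono[OF assms(1) _ i] assms(2) by auto
  then show "\<mu> i = m" using partitions_le[OF assms(1), of i] by simp
qed

lemma full_length_Suc: "\<mu> (Suc n) \<noteq> m \<Longrightarrow> full_length m (Suc n) \<mu> = full_length m n \<mu>"
  unfolding full_length_def by (rule arg_cong[where f = "\<lambda>S. Max (insert 0 S)"]) (auto simp: le_Suc_eq)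

lemma full_length_incr: "full_length (Suc m) n (incr_part n \<mu>) = full_length m n \<mu>"
  unfolding full_length_def by (rule arg_cong[where f = "\<lambda>S. Max (insert 0 S)"]) (auto simp: incr_part_def)

lemma vanishing_length_last:
  assumes "\<mu> (Suc n) \<noteq> l (Suc n)"
  shows "vanishing_length m (Suc n) l \<mu> = (if \<mu> (Suc n) < l (Suc n) then full_length m (Suc n) \<mu> else Suc n)"
proof -
  have "Max {i \<in> {1..Suc n}. \<mu> i \<noteq> l i} = Suc n"
    using assms by (intro Max_eqI) auto
  then show ?thesis by (simp add: vanishing_length_altdef Let_def)
qed

lemma vanishing_length_Suc:
  assumes "\<mu> (Suc n) = l (Suc n)" "\<mu> (Suc n) \<noteq> m"
  shows "vanishing_length m (Suc n) l \<mu> = vanishing_length m n l \<mu>"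
proof -
  have "{i \<in> {1..Suc n}. \<mu> i \<noteq> l i} = {i \<in> {1..n}. \<mu> i \<noteq> l i}"
    using assms by (auto simp: le_Suc_eq)
  then show ?thesis
    unfolding vanishing_length_altdef Let_def using full_length_Suc[of \<mu> n m] assms by simp
qed

lemma vanishing_length_le:
  assumes "\<exists>i\<in>{1..n}. \<mu> i \<noteq> l i"
  shows "vanishing_length m n l \<mu> \<le> n"
proof -
  have "Max {i \<in> {1..n}. \<mu> i \<noteq> l i} \<le> n" using assms by (intro Max.boundedI) auto
  then show ?thesis using full_length_le[of m n \<mu>] by (simp add: vanishing_length_altdef Let_def)
qed

lemma partitions_neq:
  assumes "\<mu> \<in> partitions_in m n" "l \<in> partitions_in m n" "\<mu> \<noteq> l"
  shows "\<exists>i\<in>{1..n}. \<mu> i \<noteq> l i"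
  using partitions_outside[OF assms(1)] partitions_outside[OF assms(2)] assms(3) by (metis ext)

lemma vanishing_length_incr:
  assumes "\<exists>i\<in>{1..n}. \<mu> i \<noteq> l i"
  shows "vanishing_length (Suc m) n (incr_part n l) (incr_part n \<mu>) = vanishing_length m n l \<mu>"
proof -
  have eq: "{i \<in> {1..n}. incr_part n \<mu> i \<noteq> incr_part n l i} = {i \<in> {1..n}. \<mu> i \<noteq> l i}"
    by (auto simp: incr_part_def)
  have "Max {i \<in> {1..n}. \<mu> i \<noteq> l i} \<in> {i \<in> {1..n}. \<mu> i \<noteq> l i}" using assms by (intro Max_in) auto
  then have "Max {i \<in> {1..n}. \<mu> i \<noteq> l i} \<in> {1..n}" by blast
  then show ?thesis
    unfolding vanishing_length_altdef eq Let_def full_length_incr by (simp add: incr_part_def)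
qed

lemma pt_incr: "pt (Suc m) n k (incr_part n \<mu>) a b q t = pt m n k \<mu> (a * q) b q t"
  by (auto simp: pt_def incr_part_def fun_eq_iff)

lemma pt_Suc:
  assumes "k \<le> n" "\<mu> (Suc n) = 0"
  shows "pt m (Suc n) k \<mu> a b q t = (pt m n k \<mu> (a * t) b q t)(Suc n := a)"
proof (rule ext)
  fix i
  show "pt m (Suc n) k \<mu> a b q t i = ((pt m n k \<mu> (a * t) b q t)(Suc n := a)) i"
    using assms by (cases "i = Suc n"; cases "i \<in> {1..n}") (auto simp: pt_def Suc_diff_le)
qed

lemma pt_torus: "a \<noteq> 0 \<Longrightarrow> b \<noteq> 0 \<Longrightarrow> q \<noteq> 0 \<Longrightarrow> t \<noteq> 0 \<Longrightarrow> pt m n k \<mu> a b q t \<in> torus n"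
  unfolding pt_def by (intro torusI) auto

lemma pt_mon:
  assumes "a \<noteq> 0" "b \<noteq> 0" "q \<noteq> 0" "t \<noteq> 0" "i \<in> {1..n}" "\<mu> i \<le> m"
  shows "pt m n k \<mu> a b q t i =
    (if i \<le> k then mon a b q t 0 1 (int m - int (\<mu> i)) (int i - 1)
     else mon a b q t 1 0 (int (\<mu> i)) (int n - int i))"
proof -
  have "q ^ (m - \<mu> i) = q powi (int m - int (\<mu> i))" "t ^ (i - 1) = t powi (int i - 1)"
    "t ^ (n - i) = t powi (int n - int i)"
    using assms by (simp_all add: power_int_of_nat[symmetric] of_nat_diff del: power_int_of_nat)
  then show ?thesis using assms(5) by (simp add: pt_def mon_def)
qed

context nome
begin

lemma generic_params_iff:
  "generic_params p a b q t \<longleftrightarrow> a \<noteq> 0 \<and> b \<noteq> 0 \<and> q \<noteq> 0 \<and> t \<noteq> 0 \<and>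
    (\<forall>i j k l. mon a b q t i j k l \<in> pz \<longrightarrow> i = 0 \<and> j = 0 \<and> k = 0 \<and> l = 0)"
proof -
  have "mon a b q t i j k l \<in> pz \<longleftrightarrow> (\<exists>h. p powi h * a powi i * b powi j * q powi k * t powi l = 1)" for i j k l
  proof
    assume "mon a b q t i j k l \<in> pz"
    then obtain h where h: "mon a b q t i j k l = p powi h" by (auto simp: pz_def)
    have "p powi (-h) * a powi i * b powi j * q powi k * t powi l = p powi (-h) * mon a b q t i j k l"
      by (simp add: mon_def mult_ac)
    also have "\<dots> = 1" by (simp add: h power_int_minus)
    finally show "\<exists>h. p powi h * a powi i * b powi j * q powi k * t powi l = 1" by blast
  next
    assume "\<exists>h. p powi h * a powi i * b powi j * q powi k * t powi l = 1"
    then obtain h where "p powi h * mon a b q t i j k l = 1" by (auto simp: mon_def mult_ac)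
    then have "mon a b q t i j k l = p powi (-h)" by (simp add: power_int_minus field_simps)
    then show "mon a b q t i j k l \<in> pz" by simp
  qed
  then show ?thesis unfolding generic_params_def by blast
qed

lemma generic_nz: "generic_params p a b q t \<Longrightarrow> a \<noteq> 0 \<and> b \<noteq> 0 \<and> q \<noteq> 0 \<and> t \<noteq> 0"
  by (simp add: generic_params_def)

lemma generic_mon_pz: "generic_params p a b q t \<Longrightarrow> mon a b q t i j k l \<in> pz \<longleftrightarrow> i = 0 \<and> j = 0 \<and> k = 0 \<and> l = 0"
  by (auto simp: generic_params_iff)

lemma generic_theta_mon: "generic_params p a b q t \<Longrightarrow> th (mon a b q t i j k l) = 0 \<longleftrightarrow> i = 0 \<and> j = 0 \<and> k = 0 \<and> l = 0"
  using generic_mon_pz generic_nz mon_nz by (subst theta_eq_0_iff) auto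

lemma generic_swap: "generic_params p a b q t \<Longrightarrow> generic_params p b a q t"
proof -
  assume g: "generic_params p a b q t"
  have "mon b a q t i j k l = mon a b q t j i k l" for i j k l by (simp add: mon_def)
  then show ?thesis using g unfolding generic_params_iff by metis
qed

lemma generic_mult:
  assumes g: "generic_params p a b q t"
  shows "generic_params p (a * q) b q t" "generic_params p (a * t) b q t"
proof -
  have 1: "mon (a * q) b q t i j k l = mon a b q t i j (k + i) l" for i j k l
    using generic_nz[OF g] by (simp add: mon_def power_int_mult_distrib power_int_add mult_ac)
  have 2: "mon (a * t) b q t i j k l = mon a b q t i j k (l + i)" for i j k l
    using generic_nz[OF g] by (simp add: mon_def power_int_mult_distrib power_int_add mult_ac)
  show "generic_params p (a * q) b q t"
    using generic_nz[OF g] unfolding generic_params_iff 1 generic_mon_pz[OF g] by auto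
  show "generic_params p (a * t) b q t"
    using generic_nz[OF g] unfolding generic_params_iff 2 generic_mon_pz[OF g] by auto
qed

text \<open>The square of a monomial in the rescaled parameters is a monomial in the original ones,
  and the map of exponents is injective. So the square root of \<open>q\<close> creates no new
  relation.\<close>

lemma generic_sqrt:
  assumes g: "generic_params p a b q t" and "sq\<^sup>2 = q"
  shows "generic_params p (sq * a) (sq * b) q t" "generic_params p (a / sq) (b / sq) q t"
proof -
  have nz: "a \<noteq> 0" "b \<noteq> 0" "q \<noteq> 0" "t \<noteq> 0" "sq \<noteq> 0" using generic_nz[OF g] assms(2) by auto
  have sq: "sq powi (2 * i) = q powi i" for i using assms(2) nz(5) by (simp add: power_int_mult)
  have 1: "(mon (sq * a) (sq * b) q t i j k l)\<^sup>2 = mon a b q t (2 * i) (2 * j) (2 * k + i + j) (2 * l)" for i j k l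
    using nz
    by (simp add: mon_power mon_def power_int_mult_distrib power_int_add mult_ac)
      (simp add: sq[symmetric] power_int_mult mult_ac power2_eq_square power_int_add)
  have 2: "(mon (a / sq) (b / sq) q t i j k l)\<^sup>2 = mon a b q t (2 * i) (2 * j) (2 * k - i - j) (2 * l)" for i j k l
    using nz
    by (simp add: mon_def power_int_divide_distrib power_int_diff mult_ac)
      (simp add: sq[symmetric] power_int_mult mult_ac power2_eq_square power_int_add field_simps)
  have "i = 0 \<and> j = 0 \<and> k = 0 \<and> l = 0" if "mon (sq * a) (sq * b) q t i j k l \<in> pz" for i j k l
    using pz_power2[OF that] unfolding 1 generic_mon_pz[OF g] by auto
  then show "generic_params p (sq * a) (sq * b) q t" using nz by (simp add: generic_params_iff)
  have "i = 0 \<and> j = 0 \<and> k = 0 \<and> l = 0" if "mon (a / sq) (b / sq) q t i j k l \<in> pz" for i j k l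
    using pz_power2[OF that] unfolding 2 generic_mon_pz[OF g] by auto
  then show "generic_params p (a / sq) (b / sq) q t" using nz by (simp add: generic_params_iff)
qed

lemma generic_square: "generic_params p a b q t \<Longrightarrow> a * a \<notin> pz"
  using generic_mon_pz[of a b q t 2 0 0 0] by (simp add: mon_def power2_eq_square)

text \<open>A part at least \<open>1\<close> keeps the coordinate out of the class of
  \<open>a\<close> on either side of the cut. Division by the product of the \<open>thpm a\<close>
  therefore preserves zeros at points whose parts are all positive.\<close>

lemma thpm_pt_nz:
  assumes g: "generic_params p a b q t" and "i \<in> {1..n}" "\<mu> i \<le> m" "1 \<le> \<mu> i"
  shows "thpm a (pt m n k \<mu> a b q t i) \<noteq> 0"
proof -
  note nz = generic_nz[OF g]
  let ?x = "pt m n k \<mu> a b q t i"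
  have x: "?x = (if i \<le> k then mon a b q t 0 1 (int m - int (\<mu> i)) (int i - 1)
     else mon a b q t 1 0 (int (\<mu> i)) (int n - int i))"
    using nz assms by (intro pt_mon) auto
  have "mon a b q t 1 0 0 0 * ?x \<notin> pz" "mon a b q t 1 0 0 0 / ?x \<notin> pz"
    unfolding x using nz assms(4) g by (auto simp: mon_mult mon_divide generic_mon_pz)
  then have "a * ?x \<notin> pz" "a / ?x \<notin> pz" by (simp_all add: mon_basis)
  moreover have "?x \<noteq> 0" using x nz mon_nz by (simp split: if_splits)
  ultimately show ?thesis using nz thpm_eq_0_iff by blast
qed

lemma thpm_pt_incr_nz:
  assumes "generic_params p a b q t" "\<mu> \<in> partitions_in m n" "i \<in> {1..n}"
  shows "thpm a (pt (Suc m) n k (incr_part n \<mu>) a b q t i) \<noteq> 0"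
  by (rule thpm_pt_nz[OF assms(1,3)]) (use partitions_le[OF assms(2), of i] assms(3) in \<open>auto simp: incr_part_def\<close>)

subsection \<open>Unisolvent sets of points\<close>

text \<open>Only the uniqueness half of interpolation; solvability enters separately in
  \<open>interp_space_nontrivial\<close>.\<close>

definition unisolvent :: "nat \<Rightarrow> nat \<Rightarrow> (nat \<Rightarrow> complex) set \<Rightarrow> bool" where
  "unisolvent m n X \<longleftrightarrow> X \<subseteq> torus n \<and>
    (\<forall>f\<in>BC_theta m n p. (\<forall>x\<in>X. f x = 0) \<longrightarrow> (\<forall>x\<in>torus n. f x = 0))"

lemma unisolventD: "unisolvent m n X \<Longrightarrow> f \<in> BC_theta m n p \<Longrightarrow> (\<And>x. x \<in> X \<Longrightarrow> f x = 0) \<Longrightarrow> x \<in> torus n \<Longrightarrow> f x = 0"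
  by (auto simp: unisolvent_def)

lemma BC_theta_0_const:
  assumes f: "f \<in> BC_theta 0 n p" and x: "x \<in> torus n" and y: "y \<in> torus n"
  shows "f x = f y"
proof -
  have "f (\<lambda>i\<in>{1..n}. if i \<in> S then y i else x i) = f x" if "finite S" "S \<subseteq> {1..n}" for S
    using that
  proof (induction S rule: finite_induct)
    case empty
    have "(\<lambda>i\<in>{1..n}. x i) = x" using x by (auto simp: torus_def PiE_def extensional_restrict)
    then show ?case by simp
  next
    case (insert j S)
    let ?z = "\<lambda>i\<in>{1..n}. if i \<in> S then y i else x i"
    have z: "?z \<in> torus n" using torus_nz[OF x] torus_nz[OF y] by (intro torusI) auto
    have j: "j \<in> {1..n}" using insert by auto
    have 1: "(\<lambda>i\<in>{1..n}. if i \<in> insert j S then y i else x i) = ?z(j := y j)"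
      using j by (auto simp: fun_eq_iff)
    obtain k where k: "\<And>w. w \<noteq> 0 \<Longrightarrow> f (?z(j := w)) = k"
      using BC1_0_const[OF sep_BC1D[OF BC_theta_sep[OF f] z j]] by blast
    have 2: "f (?z(j := y j)) = f (?z(j := x j))" using k torus_nz[OF x j] torus_nz[OF y j] by simp
    have 3: "?z(j := x j) = ?z" using insert.hyps j by (auto simp: fun_eq_iff)
    show ?case unfolding 1 2 3 using insert.IH insert.prems by blast
  qed
  from this[of "{1..n}"] have "f (\<lambda>i\<in>{1..n}. y i) = f x" by (simp cong: restrict_cong)
  moreover have "(\<lambda>i\<in>{1..n}. y i) = y" using y by (auto simp: torus_def PiE_def extensional_restrict)
  ultimately show ?thesis by simp
qed

lemma unisolvent_0: "X \<subseteq> torus n \<Longrightarrow> X \<noteq> {} \<Longrightarrow> unisolvent 0 n X"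
  unfolding unisolvent_def using BC_theta_0_const by (metis ex_in_conv subsetD)

lemma unisolvent_no_vars: "X \<subseteq> torus 0 \<Longrightarrow> X \<noteq> {} \<Longrightarrow> unisolvent m 0 X"
  unfolding unisolvent_def torus_def by auto

lemma torus_split:
  assumes "x \<in> torus (Suc n)"
  shows "(\<lambda>i\<in>{1..n}. x i) \<in> torus n" "x = (\<lambda>i\<in>{1..n}. x i)(Suc n := x (Suc n))"
proof -
  show "(\<lambda>i\<in>{1..n}. x i) \<in> torus n" using torus_nz[OF assms] by (intro torusI) auto
  show "x = (\<lambda>i\<in>{1..n}. x i)(Suc n := x (Suc n))"
    using assms by (auto simp: fun_eq_iff torus_def PiE_def extensional_def)
qed

text \<open>The zeros on \<open>Y\<close> make the restriction to last coordinate \<open>u\<close>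
  vanish identically, which is what divisibility requires.\<close>

lemma BC_theta_split:
  assumes f: "f \<in> BC_theta (Suc m) (Suc n) p" and u: "u \<noteq> 0" "u * u \<notin> pz"
    and Y: "unisolvent (Suc m) n Y" "\<And>y. y \<in> Y \<Longrightarrow> f (y(Suc n := u)) = 0"
  obtains g where "g \<in> BC_theta m (Suc n) p"
    "\<And>x. x \<in> torus (Suc n) \<Longrightarrow> f x = (\<Prod>i\<in>{1..Suc n}. thpm u (x i)) * g x"
proof (rule BC_theta_divide[OF f u])
  let ?r = "\<lambda>x\<in>torus n. f (x(Suc n := u))"
  have r: "?r x = 0" if "x \<in> torus n" for x
    by (rule unisolventD[OF Y(1) BC_theta_restrict[OF f u(1)] _ that])
      (use Y in \<open>auto simp: unisolvent_def\<close>)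
  show "f x = 0" if x: "x \<in> torus (Suc n)" "x (Suc n) = u" for x
    using r[OF torus_split(1)[OF x(1)]] torus_split[OF x(1)] x(2) by simp
qed (use that in auto)

text \<open>A recursion of Pascal type: \<open>Y\<close> controls the restriction to last coordinate
  \<open>u\<close>, with one variable less, and \<open>W\<close> controls the quotient by the
  divisor, with degree one less.\<close>

lemma unisolvent_step:
  assumes u: "u \<noteq> 0" "u * u \<notin> pz" and X: "X \<subseteq> torus (Suc n)"
    and Y: "unisolvent (Suc m) n Y" "\<And>y. y \<in> Y \<Longrightarrow> y(Suc n := u) \<in> X"
    and W: "unisolvent m (Suc n) W" "W \<subseteq> X" "\<And>x i. x \<in> W \<Longrightarrow> i \<in> {1..Suc n} \<Longrightarrow> thpm u (x i) \<noteq> 0"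
  shows "unisolvent (Suc m) (Suc n) X"
  unfolding unisolvent_def
proof (intro conjI X ballI impI)
  fix f x assume f: "f \<in> BC_theta (Suc m) (Suc n) p" and zero: "\<forall>x\<in>X. f x = 0" and x: "x \<in> torus (Suc n)"
  obtain g where g: "g \<in> BC_theta m (Suc n) p"
    "\<And>x. x \<in> torus (Suc n) \<Longrightarrow> f x = (\<Prod>i\<in>{1..Suc n}. thpm u (x i)) * g x"
    using BC_theta_split[OF f u Y(1)] Y(2) zero by blast
  have "g x = 0"
  proof (rule unisolventD[OF W(1) g(1) _ x])
    fix w assume w: "w \<in> W"
    then have "w \<in> torus (Suc n)" "f w = 0" using W X zero by auto
    moreover have "(\<Prod>i\<in>{1..Suc n}. thpm u (w i)) \<noteq> 0" using W(3)[OF w] by simp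
    ultimately show "g w = 0" using g(2)[of w] by simp
  qed
  then show "f x = 0" using g(2)[OF x] by simp
qed

definition simplex_points :: "nat \<Rightarrow> nat \<Rightarrow> complex \<Rightarrow> complex \<Rightarrow> complex \<Rightarrow> (nat \<Rightarrow> complex) set" where
  "simplex_points m n u q t = (\<lambda>\<rho>. pt m n 0 \<rho> u u q t) ` partitions_in m n"

lemma zero_partition: "(\<lambda>_. 0) \<in> partitions_in m n"
  by (auto simp: partitions_in_def)

lemma pt_0_b: "pt m n 0 \<rho> u b q t = pt m n 0 \<rho> u b' q t"
  by (auto simp: pt_def)

lemma simplex_points_altdef: "simplex_points m n u q t = (\<lambda>\<rho>. pt m n 0 \<rho> u b q t) ` partitions_in m n"
  unfolding simplex_points_def by (intro image_cong refl pt_0_b)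

text \<open>Partitions with last part \<open>0\<close> give points with last coordinate
  \<open>a\<close>, leading to \<open>a * t\<close> in one variable less; the others lose a column,
  leading to \<open>a * q\<close> in degree one less.\<close>

lemma unisolvent_simplex: "generic_params p a b q t \<Longrightarrow> unisolvent m n (simplex_points m n a q t)"
proof (induction "m + n" arbitrary: m n a rule: less_induct)
  case less
  note nz = generic_nz[OF less.prems]
  have sub: "simplex_points m n a q t \<subseteq> torus n" unfolding simplex_points_def using pt_torus nz by blast
  have ne: "simplex_points m n a q t \<noteq> {}" unfolding simplex_points_def using zero_partition by blast
  consider "m = 0" | "n = 0" | m' n' where "m = Suc m'" "n = Suc n'"
    by (metis old.nat.exhaust)
  then show ?case
  proof cases
    case 1 then show ?thesis using unisolvent_0 sub ne by simp
  next
    case 2 then show ?thesis using unisolvent_no_vars sub ne by simp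
  next
    case (3 m' n')
    have Y: "unisolvent (Suc m') n' (simplex_points (Suc m') n' (a * t) q t)"
      using less.hyps[of m n'] generic_mult(2)[OF less.prems] 3 by simp
    have W: "unisolvent m' (Suc n') (simplex_points m' (Suc n') (a * q) q t)"
      using less.hyps[of m' n] generic_mult(1)[OF less.prems] 3 by simp
    show ?thesis
      unfolding 3
    proof (rule unisolvent_step[OF _ generic_square[OF less.prems] _ Y _ W])
      show "simplex_points (Suc m') (Suc n') a q t \<subseteq> torus (Suc n')" using sub 3 by simp
      fix y assume "y \<in> simplex_points (Suc m') n' (a * t) q t"
      then obtain \<rho> where \<rho>: "\<rho> \<in> partitions_in (Suc m') n'" "y = pt (Suc m') n' 0 \<rho> (a * t) b q t"
        unfolding simplex_points_altdef[where b = b] by blast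
      then have "y(Suc n' := a) = pt (Suc m') (Suc n') 0 \<rho> a b q t"
        using pt_Suc[of 0 n' \<rho>] partitions_SucD(2)[OF \<rho>(1)] by simp
      then show "y(Suc n' := a) \<in> simplex_points (Suc m') (Suc n') a q t"
        unfolding simplex_points_altdef[where b = b] using partitions_SucD(1)[OF \<rho>(1)] by blast
    next
      have *: "\<exists>\<rho>. \<rho> \<in> partitions_in m' (Suc n') \<and> x = pt (Suc m') (Suc n') 0 (incr_part (Suc n') \<rho>) a b q t"
        if x: "x \<in> simplex_points m' (Suc n') (a * q) q t" for x
      proof -
        obtain \<rho> where \<rho>: "\<rho> \<in> partitions_in m' (Suc n')" "x = pt m' (Suc n') 0 \<rho> (a * q) b q t"
          using x unfolding simplex_points_altdef[where b = b] by blast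
        then show ?thesis by (auto simp: pt_incr)
      qed
      show "simplex_points m' (Suc n') (a * q) q t \<subseteq> simplex_points (Suc m') (Suc n') a q t"
      proof
        fix x assume "x \<in> simplex_points m' (Suc n') (a * q) q t"
        from *[OF this] obtain \<rho> where \<rho>: "\<rho> \<in> partitions_in m' (Suc n')"
          "x = pt (Suc m') (Suc n') 0 (incr_part (Suc n') \<rho>) a b q t" by blast
        then show "x \<in> simplex_points (Suc m') (Suc n') a q t"
          unfolding simplex_points_altdef[where b = b] using incr_part_in[OF \<rho>(1)] by blast
      qed
      fix x i assume x: "x \<in> simplex_points m' (Suc n') (a * q) q t" and i: "i \<in> {1..Suc n'}"
      from *[OF x] obtain \<rho> where \<rho>: "\<rho> \<in> partitions_in m' (Suc n')"
        "x = pt (Suc m') (Suc n') 0 (incr_part (Suc n') \<rho>) a b q t" by blast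
      show "thpm a (x i) \<noteq> 0"
        unfolding \<rho>(2)
        by (rule thpm_pt_incr_nz[OF less.prems \<rho>(1) i])
    qed (use nz in simp)
  qed
qed

text \<open>The point attached to \<open>\<mu>\<close> itself, cut after its parts equal to
  \<open>m\<close>. A node whose partition is below \<open>l\<close> at the last difference is also
  of this form.\<close>

definition full_pt :: "nat \<Rightarrow> nat \<Rightarrow> (nat \<Rightarrow> nat) \<Rightarrow> complex \<Rightarrow> complex \<Rightarrow> complex \<Rightarrow> complex \<Rightarrow> nat \<Rightarrow> complex" where
  "full_pt m n \<mu> a b q t = pt m n (full_length m n \<mu>) \<mu> a b q t"

lemma full_pt_incr: "full_pt (Suc m) n (incr_part n \<mu>) a b q t = full_pt m n \<mu> (a * q) b q t"
  by (simp add: full_pt_def full_length_incr pt_incr)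

lemma full_pt_Suc:
  "\<mu> (Suc n) = 0 \<Longrightarrow> full_pt (Suc m) (Suc n) \<mu> a b q t = (full_pt (Suc m) n \<mu> (a * t) b q t)(Suc n := a)"
  by (simp add: full_pt_def full_length_Suc pt_Suc full_length_le)

lemma full_pt_torus: "generic_params p a b q t \<Longrightarrow> full_pt m n \<mu> a b q t \<in> torus n"
  unfolding full_pt_def using generic_nz by (intro pt_torus) auto

text \<open>The recursion of \<open>unisolvent_simplex\<close> still applies: in positive degree a
  part \<open>0\<close> lies after the cut, and removing a column preserves the cut.\<close>

lemma unisolvent_full: "generic_params p a b q t \<Longrightarrow> unisolvent m n ((\<lambda>\<mu>. full_pt m n \<mu> a b q t) ` partitions_in m n)"
proof (induction "m + n" arbitrary: m n a rule: less_induct)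
  case less
  note nz = generic_nz[OF less.prems]
  let ?X = "\<lambda>m n a. (\<lambda>\<mu>. full_pt m n \<mu> a b q t) ` partitions_in m n"
  have sub: "?X m n a \<subseteq> torus n" using full_pt_torus[OF less.prems] by blast
  have ne: "?X m n a \<noteq> {}" using zero_partition by blast
  consider "m = 0" | "n = 0" | m' n' where "m = Suc m'" "n = Suc n'"
    by (metis old.nat.exhaust)
  then show ?case
  proof cases
    case 1 then show ?thesis using unisolvent_0 sub ne by simp
  next
    case 2 then show ?thesis using unisolvent_no_vars sub ne by simp
  next
    case (3 m' n')
    have Y: "unisolvent (Suc m') n' (?X (Suc m') n' (a * t))"
      using less.hyps[of m n'] generic_mult(2)[OF less.prems] 3 by simp
    have W: "unisolvent m' (Suc n') (?X m' (Suc n') (a * q))"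
      using less.hyps[of m' n] generic_mult(1)[OF less.prems] 3 by simp
    show ?thesis
      unfolding 3
    proof (rule unisolvent_step[OF _ generic_square[OF less.prems] _ Y _ W])
      show "?X (Suc m') (Suc n') a \<subseteq> torus (Suc n')" using sub 3 by simp
      fix y assume "y \<in> ?X (Suc m') n' (a * t)"
      then obtain \<mu> where \<mu>: "\<mu> \<in> partitions_in (Suc m') n'" "y = full_pt (Suc m') n' \<mu> (a * t) b q t" by blast
      then have "y(Suc n' := a) = full_pt (Suc m') (Suc n') \<mu> a b q t"
        using full_pt_Suc[where \<mu> = \<mu> and n = n', OF partitions_SucD(2)[OF \<mu>(1)]] by simp
      then show "y(Suc n' := a) \<in> ?X (Suc m') (Suc n') a"
        using partitions_SucD(1)[OF \<mu>(1)] by blast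
    next
      show "?X m' (Suc n') (a * q) \<subseteq> ?X (Suc m') (Suc n') a"
        unfolding full_pt_incr[symmetric] using incr_part_in by blast
      fix x i assume x: "x \<in> ?X m' (Suc n') (a * q)" and i: "i \<in> {1..Suc n'}"
      then obtain \<mu> where \<mu>: "\<mu> \<in> partitions_in m' (Suc n')"
        "x = full_pt (Suc m') (Suc n') (incr_part (Suc n') \<mu>) a b q t"
        unfolding full_pt_incr by blast
      show "thpm a (x i) \<noteq> 0"
        unfolding \<mu>(2) full_pt_def
        by (rule thpm_pt_incr_nz[OF less.prems \<mu>(1) i])
    qed (use nz in simp)
  qed
qed

lemma compl_part_in:
  assumes l: "l \<in> partitions_in m n"
  shows "compl_part m n l \<in> partitions_in m n"
proof (rule partitions_inI)
  fix i j :: nat assume ij: "1 \<le> i" "i \<le> j" "j \<le> n"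
  then have "l (n + 1 - i) \<le> l (n + 1 - j)" by (intro partitions_antimono[OF l]) auto
  then show "compl_part m n l j \<le> compl_part m n l i"
    using ij by (simp add: compl_part_def)
qed (auto simp: compl_part_def)

text \<open>Reversing the coordinates and complementing the partitions turns these points into
  simplex points for \<open>b\<close>.\<close>

lemma unisolvent_all_b:
  assumes g: "generic_params p a b q t"
  shows "unisolvent m n ((\<lambda>\<mu>. pt m n n \<mu> a b q t) ` partitions_in m n)"
  unfolding unisolvent_def
proof (intro conjI ballI impI)
  note nz = generic_nz[OF g]
  show "(\<lambda>\<mu>. pt m n n \<mu> a b q t) ` partitions_in m n \<subseteq> torus n" using pt_torus nz by blast
  fix f x assume f: "f \<in> BC_theta m n p" and zero: "\<forall>x\<in>(\<lambda>\<mu>. pt m n n \<mu> a b q t) ` partitions_in m n. f x = 0"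
    and x: "x \<in> torus n"
  define \<pi> where "\<pi> i = (if i \<in> {1..n} then n + 1 - i else i)" for i
  have \<pi>: "\<pi> permutes {1..n}"
  proof (rule bij_imp_permutes)
    show "bij_betw \<pi> {1..n} {1..n}"
      by (rule bij_betw_byWitness[where f' = \<pi>]) (auto simp: \<pi>_def)
  qed (auto simp: \<pi>_def)
  show "f x = 0"
  proof (rule unisolventD[OF unisolvent_simplex[OF generic_swap[OF g]] f _ x])
    fix y assume "y \<in> simplex_points m n b q t"
    then obtain \<rho> where \<rho>: "\<rho> \<in> partitions_in m n" "y = pt m n 0 \<rho> b b q t"
      by (auto simp: simplex_points_def)
    have "pt m n n (compl_part m n \<rho>) a b q t = y \<circ> \<pi>"
      unfolding \<rho>(2) using partitions_le[OF \<rho>(1)] by (auto simp: fun_eq_iff pt_def \<pi>_def compl_part_def)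
    moreover have "f (pt m n n (compl_part m n \<rho>) a b q t) = 0" using zero compl_part_in[OF \<rho>(1)] by blast
    moreover have "y \<in> torus n" unfolding \<rho>(2) using pt_torus nz by blast
    ultimately show "f y = 0" using BC_theta_sym[OF f _ \<pi>] by simp
  qed
qed

definition node_set :: "nat \<Rightarrow> nat \<Rightarrow> (nat \<Rightarrow> nat) \<Rightarrow> complex \<Rightarrow> complex \<Rightarrow> complex \<Rightarrow> complex \<Rightarrow> (nat \<Rightarrow> complex) set" where
  "node_set m n l a b q t = (\<lambda>\<mu>. vanishing_point m n l \<mu> a b q t) ` (partitions_in m n - {l})"

lemma node_set_torus: "generic_params p a b q t \<Longrightarrow> node_set m n l a b q t \<subseteq> torus n"
  unfolding node_set_def vanishing_point_eq_pt using pt_torus generic_nz by blast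

lemma vanishing_point_incr:
  assumes "\<mu> \<in> partitions_in m n" "l \<in> partitions_in m n" "\<mu> \<noteq> l"
  shows "vanishing_point (Suc m) n (incr_part n l) (incr_part n \<mu>) a b q t = vanishing_point m n l \<mu> (a * q) b q t"
  unfolding vanishing_point_eq_pt vanishing_length_incr[OF partitions_neq[OF assms]] pt_incr ..

lemma incr_part_inject: "\<mu> \<in> partitions_in m n \<Longrightarrow> l \<in> partitions_in m n \<Longrightarrow> incr_part n \<mu> = incr_part n l \<Longrightarrow> \<mu> = l"
  by (metis decr_incr_part)

lemma node_set_incr:
  assumes l: "l \<in> partitions_in m n"
  shows "node_set m n l (a * q) b q t \<subseteq> node_set (Suc m) n (incr_part n l) a b q t"
proof
  fix x assume "x \<in> node_set m n l (a * q) b q t"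
  then obtain \<mu> where \<mu>: "\<mu> \<in> partitions_in m n" "\<mu> \<noteq> l" "x = vanishing_point m n l \<mu> (a * q) b q t"
    by (auto simp: node_set_def)
  then have "x = vanishing_point (Suc m) n (incr_part n l) (incr_part n \<mu>) a b q t"
    using vanishing_point_incr l by simp
  moreover have "incr_part n \<mu> \<noteq> incr_part n l" using incr_part_inject \<mu> l by blast
  ultimately show "x \<in> node_set (Suc m) n (incr_part n l) a b q t"
    using incr_part_in[OF \<mu>(1)] by (auto simp: node_set_def)
qed

lemma vanishing_point_less:
  assumes "\<mu> (Suc n) < l (Suc n)"
  shows "vanishing_point m (Suc n) l \<mu> a b q t = full_pt m (Suc n) \<mu> a b q t"
  using assms by (simp add: vanishing_point_eq_pt vanishing_length_last full_pt_def)

lemma vanishing_point_Suc: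
  assumes "\<mu> \<in> partitions_in (Suc m) n" "l \<in> partitions_in (Suc m) n" "\<mu> \<noteq> l"
  shows "vanishing_point (Suc m) (Suc n) l \<mu> a b q t = (vanishing_point (Suc m) n l \<mu> (a * t) b q t)(Suc n := a)"
proof -
  have 0: "\<mu> (Suc n) = 0" "l (Suc n) = 0" using partitions_SucD(2) assms by blast+
  then have "vanishing_length (Suc m) (Suc n) l \<mu> = vanishing_length (Suc m) n l \<mu>"
    by (intro vanishing_length_Suc) auto
  then show ?thesis
    unfolding vanishing_point_eq_pt
    using pt_Suc[where \<mu> = \<mu> and n = n, OF vanishing_length_le[OF partitions_neq[OF assms]] 0(1)] by simp
qed

text \<open>If \<open>l n = 0\<close>, the nodes with positive last part are cut at
  \<open>n\<close>, hence of \<open>b\<close> type throughout, and they determine the quotient. If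
  \<open>l n > 0\<close>, the nodes with last part \<open>0\<close> are full points and determine
  the restriction. In either case the other half is the induction hypothesis.\<close>

lemma unisolvent_node_set:
  "generic_params p a b q t \<Longrightarrow> l \<in> partitions_in m n \<Longrightarrow>
    unisolvent m n (insert (full_pt m n l a b q t) (node_set m n l a b q t))"
proof (induction "m + n" arbitrary: m n a l rule: less_induct)
  case less
  note g = less.prems(1) and l = less.prems(2)
  note nz = generic_nz[OF g]
  let ?X = "\<lambda>m n l a. insert (full_pt m n l a b q t) (node_set m n l a b q t)"
  have sub: "?X m n l a \<subseteq> torus n" using full_pt_torus[OF g] node_set_torus[OF g] by blast
  consider "m = 0" | "n = 0" | m' n' where "m = Suc m'" "n = Suc n'"
    by (metis old.nat.exhaust)
  then show ?case
  proof cases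
    case 1 then show ?thesis using unisolvent_0 sub by simp
  next
    case 2 then show ?thesis using unisolvent_no_vars sub by simp
  next
    case (3 m' n')
    show ?thesis
    proof (cases "l n = 0")
      case True
      then have l': "l \<in> partitions_in (Suc m') n'" using l 3 partitions_SucI by simp
      have Y: "unisolvent (Suc m') n' (?X (Suc m') n' l (a * t))"
        using less.hyps[of m n' "a * t" l] generic_mult(2)[OF g] 3 l' by simp
      let ?W = "(\<lambda>\<mu>. pt m' (Suc n') (Suc n') \<mu> (a * q) b q t) ` partitions_in m' (Suc n')"
      have W: "unisolvent m' (Suc n') ?W" by (rule unisolvent_all_b[OF generic_mult(1)[OF g]])
      show ?thesis
        unfolding 3
      proof (rule unisolvent_step[OF _ generic_square[OF g] _ Y _ W])
        show "?X (Suc m') (Suc n') l a \<subseteq> torus (Suc n')" using sub 3 by simp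
        fix y assume "y \<in> ?X (Suc m') n' l (a * t)"
        then consider "y = full_pt (Suc m') n' l (a * t) b q t" |
          \<mu> where "\<mu> \<in> partitions_in (Suc m') n'" "\<mu> \<noteq> l" "y = vanishing_point (Suc m') n' l \<mu> (a * t) b q t"
          by (auto simp: node_set_def)
        then show "y(Suc n' := a) \<in> ?X (Suc m') (Suc n') l a"
        proof cases
          case 1
          then show ?thesis using True 3 full_pt_Suc by simp
        next
          case (2 \<mu>)
          then have "y(Suc n' := a) = vanishing_point (Suc m') (Suc n') l \<mu> a b q t"
            using vanishing_point_Suc l' by simp
          then show ?thesis using 2 partitions_SucD(1) by (auto simp: node_set_def)
        qed
      next
        show "?W \<subseteq> ?X (Suc m') (Suc n') l a"
        proof
          fix x assume "x \<in> ?W"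
          then obtain \<mu> where \<mu>: "\<mu> \<in> partitions_in m' (Suc n')"
            "x = pt (Suc m') (Suc n') (Suc n') (incr_part (Suc n') \<mu>) a b q t"
            unfolding pt_incr by blast
          let ?\<nu> = "incr_part (Suc n') \<mu>"
          have "?\<nu> (Suc n') > l (Suc n')" using True 3 by (simp add: incr_part_def)
          then have "vanishing_length (Suc m') (Suc n') l ?\<nu> = Suc n'" "?\<nu> \<noteq> l"
            by (auto simp: vanishing_length_last)
          then have "x = vanishing_point (Suc m') (Suc n') l ?\<nu> a b q t"
            "?\<nu> \<in> partitions_in (Suc m') (Suc n') - {l}"
            using incr_part_in[OF \<mu>(1)] \<mu>(2) by (simp_all add: vanishing_point_eq_pt)
          then show "x \<in> ?X (Suc m') (Suc n') l a" unfolding node_set_def by blast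
        qed
        fix x i assume x: "x \<in> ?W" and i: "i \<in> {1..Suc n'}"
        then obtain \<mu> where \<mu>: "\<mu> \<in> partitions_in m' (Suc n')"
          "x = pt (Suc m') (Suc n') (Suc n') (incr_part (Suc n') \<mu>) a b q t"
          unfolding pt_incr by blast
        show "thpm a (x i) \<noteq> 0"
          unfolding \<mu>(2)
          by (rule thpm_pt_incr_nz[OF g \<mu>(1) i])
      qed (use nz in simp)
    next
      case False
      let ?Y = "(\<lambda>\<mu>. full_pt (Suc m') n' \<mu> (a * t) b q t) ` partitions_in (Suc m') n'"
      have Y: "unisolvent (Suc m') n' ?Y" by (rule unisolvent_full[OF generic_mult(2)[OF g]])
      let ?l = "decr_part l"
      have l': "?l \<in> partitions_in m' (Suc n')" using decr_part_in l 3 by simp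
      have ll: "incr_part (Suc n') ?l = l" using incr_decr_part[OF l] False 3 by simp
      have W: "unisolvent m' (Suc n') (?X m' (Suc n') ?l (a * q))"
        using less.hyps[of m' n "a * q" ?l] generic_mult(1)[OF g] 3 l' by simp
      have full: "full_pt (Suc m') (Suc n') l a b q t = full_pt m' (Suc n') ?l (a * q) b q t"
        using full_pt_incr[of m' "Suc n'" ?l] ll by simp
      show ?thesis
        unfolding 3
      proof (rule unisolvent_step[OF _ generic_square[OF g] _ Y _ W])
        show "?X (Suc m') (Suc n') l a \<subseteq> torus (Suc n')" using sub 3 by simp
        fix y assume "y \<in> ?Y"
        then obtain \<mu> where \<mu>: "\<mu> \<in> partitions_in (Suc m') n'" "y = full_pt (Suc m') n' \<mu> (a * t) b q t"
          by blast
        have 0: "\<mu> (Suc n') = 0" "\<mu> \<in> partitions_in (Suc m') (Suc n')" using partitions_SucD[OF \<mu>(1)] by auto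
        have "y(Suc n' := a) = vanishing_point (Suc m') (Suc n') l \<mu> a b q t"
          using \<mu>(2) 0(1) full_pt_Suc[of \<mu> n'] False 3 by (simp add: vanishing_point_less)
        moreover have "\<mu> \<noteq> l" using 0 False 3 by auto
        ultimately show "y(Suc n' := a) \<in> ?X (Suc m') (Suc n') l a" using 0 by (auto simp: node_set_def)
      next
        show "?X m' (Suc n') ?l (a * q) \<subseteq> ?X (Suc m') (Suc n') l a"
          unfolding full using node_set_incr[OF l', of a q b t] ll by auto
        fix x i assume x: "x \<in> ?X m' (Suc n') ?l (a * q)" and i: "i \<in> {1..Suc n'}"
        then obtain \<mu> k where \<mu>: "\<mu> \<in> partitions_in m' (Suc n')" "x = pt m' (Suc n') k \<mu> (a * q) b q t"
          unfolding node_set_def full_pt_def vanishing_point_eq_pt using l' by blast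
        then have x': "x = pt (Suc m') (Suc n') k (incr_part (Suc n') \<mu>) a b q t" by (simp add: pt_incr)
        show "thpm a (x i) \<noteq> 0"
          unfolding x'
          by (rule thpm_pt_incr_nz[OF g \<mu>(1) i])
      qed (use nz in simp)
    qed
  qed
qed

subsection \<open>Spaces of interpolation functions\<close>


definition interp_space :: "nat \<Rightarrow> nat \<Rightarrow> (nat \<Rightarrow> nat) \<Rightarrow> complex \<Rightarrow> complex \<Rightarrow> complex \<Rightarrow> complex \<Rightarrow>
    ((nat \<Rightarrow> complex) \<Rightarrow> complex) set" where
  "interp_space m n l a b q t = {f \<in> BC_theta m n p. \<forall>x\<in>node_set m n l a b q t. f x = 0}"

lemma interp_spaceD:
  "f \<in> interp_space m n l a b q t \<Longrightarrow> f \<in> BC_theta m n p"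
  "f \<in> interp_space m n l a b q t \<Longrightarrow> x \<in> node_set m n l a b q t \<Longrightarrow> f x = 0"
  by (auto simp: interp_space_def)

lemma interp_space_determined:
  assumes "generic_params p a b q t" "l \<in> partitions_in m n" "f \<in> interp_space m n l a b q t"
    and "f (full_pt m n l a b q t) = 0" "x \<in> torus n"
  shows "f x = 0"
  by (rule unisolventD[OF unisolvent_node_set[OF assms(1,2)] interp_spaceD(1)[OF assms(3)] _ assms(5)])
    (use assms interp_spaceD(2) in blast)

lemma sep_BC1_scale: "sep_BC1 m n f \<Longrightarrow> sep_BC1 m n (\<lambda>x. k * f x)"
  by (auto simp: sep_BC1_def intro: BC1_scale)

lemma sep_BC1_sum: "(\<And>i. i \<in> I \<Longrightarrow> sep_BC1 m n (f i)) \<Longrightarrow> sep_BC1 m n (\<lambda>x. \<Sum>i\<in>I. f i x)"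
  by (auto simp: sep_BC1_def intro!: BC1_sum)

lemma BC_theta_lincomb:
  assumes "\<And>i. i \<in> I \<Longrightarrow> f i \<in> BC_theta m n p"
  shows "(\<lambda>x\<in>torus n. \<Sum>i\<in>I. c i * f i x) \<in> BC_theta m n p"
proof (rule BC_theta_restrictI)
  show "sep_BC1 m n (\<lambda>x. \<Sum>i\<in>I. c i * f i x)"
    using assms BC_theta_sep by (intro sep_BC1_sum sep_BC1_scale) blast
  fix x \<pi> assume "x \<in> torus n" "\<pi> permutes {1..n}"
  then show "(\<Sum>i\<in>I. c i * f i (x \<circ> \<pi>)) = (\<Sum>i\<in>I. c i * f i x)"
    using BC_theta_sym[OF assms] by (intro sum.cong) simp_all
qed

lemma interp_space_scale:
  assumes g: "generic_params p a b q t" and f: "f \<in> interp_space m n l a b q t"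
  shows "(\<lambda>x\<in>torus n. k * f x) \<in> interp_space m n l a b q t"
proof -
  have "(\<lambda>x\<in>torus n. \<Sum>i\<in>{()}. k * f x) \<in> BC_theta m n p"
    using BC_theta_lincomb[of "{()}" "\<lambda>_. f" m n "\<lambda>_. k"] interp_spaceD(1)[OF f] by blast
  then show ?thesis
    using interp_spaceD(2)[OF f] node_set_torus[OF g, of m n l] by (auto simp: interp_space_def)
qed

lemma interp_space_diff:
  assumes g: "generic_params p a b q t" and f: "f \<in> interp_space m n l a b q t" and h: "h \<in> interp_space m n l a b q t"
  shows "(\<lambda>x\<in>torus n. f x - k * h x) \<in> interp_space m n l a b q t"
proof -
  have "(\<lambda>x\<in>torus n. \<Sum>i\<in>{True, False}. (if i then 1 else - k) * (if i then f else h) x) \<in> BC_theta m n p"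
    by (rule BC_theta_lincomb) (use interp_spaceD(1)[OF f] interp_spaceD(1)[OF h] in auto)
  then show ?thesis
    using interp_spaceD(2)[OF f] interp_spaceD(2)[OF h] node_set_torus[OF g, of m n l] by (auto simp: interp_space_def)
qed

text \<open>The combination of \<open>f\<close> and \<open>h\<close> that vanishes at the full point
  is zero by \<open>interp_space_determined\<close>.\<close>

lemma interp_space_proportional:
  assumes g: "generic_params p a b q t" and l: "l \<in> partitions_in m n"
    and f: "f \<in> interp_space m n l a b q t" and h: "h \<in> interp_space m n l a b q t"
    and nz: "h (full_pt m n l a b q t) \<noteq> 0" and x: "x \<in> torus n"
  shows "f x = f (full_pt m n l a b q t) / h (full_pt m n l a b q t) * h x"
proof -
  let ?P = "full_pt m n l a b q t"
  have "(\<lambda>x\<in>torus n. f x - f ?P / h ?P * h x) x = 0"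
    by (rule interp_space_determined[OF g l interp_space_diff[OF g f h] _ x])
      (use nz full_pt_torus[OF g] in simp)
  then show ?thesis using x by simp
qed

section \<open>Descent of the vanishing conditions, and additional zeros\<close>

lemma interp_space_restrict:
  assumes g: "generic_params p a b q t" and l: "l \<in> partitions_in (Suc m) n"
    and f: "f \<in> interp_space (Suc m) (Suc n) l a b q t"
  shows "(\<lambda>x\<in>torus n. f (x(Suc n := a))) \<in> interp_space (Suc m) n l (a * t) b q t"
  unfolding interp_space_def
proof (intro CollectI conjI ballI)
  show "(\<lambda>x\<in>torus n. f (x(Suc n := a))) \<in> BC_theta (Suc m) n p"
    using BC_theta_restrict[OF interp_spaceD(1)[OF f]] generic_nz[OF g] by blast
  fix x assume x: "x \<in> node_set (Suc m) n l (a * t) b q t"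
  then have xt: "x \<in> torus n" using node_set_torus[OF generic_mult(2)[OF g]] by blast
  from x obtain \<mu> where \<mu>: "\<mu> \<in> partitions_in (Suc m) n" "\<mu> \<noteq> l" "x = vanishing_point (Suc m) n l \<mu> (a * t) b q t"
    by (auto simp: node_set_def)
  then have "x(Suc n := a) = vanishing_point (Suc m) (Suc n) l \<mu> a b q t"
    using vanishing_point_Suc[OF \<mu>(1) l \<mu>(2)] by simp
  then have "x(Suc n := a) \<in> node_set (Suc m) (Suc n) l a b q t"
    using \<mu>(2) partitions_SucD(1)[OF \<mu>(1)] by (auto simp: node_set_def)
  then show "(\<lambda>x\<in>torus n. f (x(Suc n := a))) x = 0" using interp_spaceD(2)[OF f] xt by simp
qed

text \<open>The last part of the enlarged partition is positive, so all partitions with last part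
  \<open>0\<close> give full points as nodes, and these force the restriction to last coordinate
  \<open>a\<close> to vanish.\<close>

lemma interp_space_divide:
  assumes g: "generic_params p a b q t" and l: "l \<in> partitions_in m (Suc n)"
    and f: "f \<in> interp_space (Suc m) (Suc n) (incr_part (Suc n) l) a b q t"
  obtains h where "h \<in> interp_space m (Suc n) l (a * q) b q t"
    "\<And>x. x \<in> torus (Suc n) \<Longrightarrow> f x = (\<Prod>i\<in>{1..Suc n}. thpm a (x i)) * h x"
proof -
  let ?l = "incr_part (Suc n) l"
  have zero: "f (y(Suc n := a)) = 0"
    if y: "y \<in> (\<lambda>\<mu>. full_pt (Suc m) n \<mu> (a * t) b q t) ` partitions_in (Suc m) n" for y
  proof -
    obtain \<mu> where \<mu>: "\<mu> \<in> partitions_in (Suc m) n" "y = full_pt (Suc m) n \<mu> (a * t) b q t" using y by blast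
    have 0: "\<mu> (Suc n) = 0" "\<mu> \<in> partitions_in (Suc m) (Suc n)" using partitions_SucD[OF \<mu>(1)] by auto
    have less: "\<mu> (Suc n) < ?l (Suc n)" using 0 by (simp add: incr_part_def)
    have "y(Suc n := a) = vanishing_point (Suc m) (Suc n) ?l \<mu> a b q t"
      unfolding vanishing_point_less[where \<mu> = \<mu> and l = ?l, OF less]
      using \<mu>(2) full_pt_Suc[where \<mu> = \<mu> and n = n, OF 0(1)] by simp
    moreover have "\<mu> \<noteq> ?l" using less by auto
    ultimately have "y(Suc n := a) \<in> node_set (Suc m) (Suc n) ?l a b q t" using 0 by (auto simp: node_set_def)
    then show ?thesis by (rule interp_spaceD(2)[OF f])
  qed
  obtain h where h: "h \<in> BC_theta m (Suc n) p"
    "\<And>x. x \<in> torus (Suc n) \<Longrightarrow> f x = (\<Prod>i\<in>{1..Suc n}. thpm a (x i)) * h x"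
    using BC_theta_split[OF interp_spaceD(1)[OF f] _ generic_square[OF g] unisolvent_full[OF generic_mult(2)[OF g]] zero]
      generic_nz[OF g] by blast
  have "h x = 0" if x: "x \<in> node_set m (Suc n) l (a * q) b q t" for x
  proof -
    have xt: "x \<in> torus (Suc n)" using x node_set_torus[OF generic_mult(1)[OF g]] by blast
    have "f x = 0" using interp_spaceD(2)[OF f] node_set_incr[OF l] x by blast
    moreover obtain \<mu> k where \<mu>: "\<mu> \<in> partitions_in m (Suc n)" "x = pt m (Suc n) k \<mu> (a * q) b q t"
      using x unfolding node_set_def vanishing_point_eq_pt by blast
    have "thpm a (x i) \<noteq> 0" if "i \<in> {1..Suc n}" for i
      unfolding \<mu>(2) pt_incr[symmetric] by (rule thpm_pt_incr_nz[OF g \<mu>(1) that])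
    ultimately show ?thesis using h(2)[OF xt] by simp
  qed
  then have "h \<in> interp_space m (Suc n) l (a * q) b q t" using h(1) by (simp add: interp_space_def)
  then show ?thesis using that h(2) by blast
qed

text \<open>The coordinates of \<open>x\<close> before \<open>k\<close> are arbitrary, so these are
  zeros beyond the nodes; they are needed because the operator can move a node to a point whose cut
  is too short. The recursion is again on \<open>m + n\<close>, and when the last part of
  \<open>\<nu>\<close> is \<open>0\<close> below a positive part of \<open>l\<close>, the divisor
  \<open>thpm a\<close> itself vanishes.\<close>

lemma extra_vanishing:
  assumes "generic_params p a b q t" "l \<in> partitions_in m n" "f \<in> interp_space m n l a b q t"
    and "k \<in> {1..n}" "\<nu> k < l k" "\<And>i. k < i \<Longrightarrow> i \<le> n \<Longrightarrow> \<nu> i = l i"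
    and "x \<in> torus n" "\<And>i. k \<le> i \<Longrightarrow> i \<le> n \<Longrightarrow> x i = a * q ^ \<nu> i * t ^ (n - i)"
    and "\<And>i j. k \<le> i \<Longrightarrow> i \<le> j \<Longrightarrow> j \<le> n \<Longrightarrow> \<nu> j \<le> \<nu> i"
  shows "f x = 0"
  using assms
proof (induction "m + n" arbitrary: m n a l f \<nu> x rule: less_induct)
  case less
  note g = less.prems(1) and l = less.prems(2) and f = less.prems(3) and k = less.prems(4)
  have "n \<noteq> 0" using k by auto
  moreover have "m \<noteq> 0" using less.prems(5) partitions_le[OF l, of k] by linarith
  ultimately obtain m' n' where mn: "m = Suc m'" "n = Suc n'" by (metis nat.exhaust)
  show ?case
  proof (cases "l n = 0")
    case True
    then have kn: "k < n" using k less.prems(5) by (cases "k = n") auto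
    then have "\<nu> n = 0" using less.prems(6)[of n] True by simp
    then have xn: "x n = a" using less.prems(8)[of n] kn by simp
    have l': "l \<in> partitions_in (Suc m') n'" using l True mn partitions_SucI by simp
    define x' where "x' = (\<lambda>i\<in>{1..n'}. x i)"
    have x': "x' \<in> torus n'" "x = x'(Suc n' := a)"
      using torus_split[of x n'] less.prems(7) mn xn by (auto simp: x'_def)
    let ?r = "\<lambda>x\<in>torus n'. f (x(Suc n' := a))"
    have "?r x' = 0"
    proof (rule less.hyps[of "Suc m'" n' "a * t" l ?r \<nu> x'])
      show "?r \<in> interp_space (Suc m') n' l (a * t) b q t"
        using interp_space_restrict[OF g l'] f mn by simp
      show "k \<in> {1..n'}" using k kn mn by simp
      show "x' i = a * t * q ^ \<nu> i * t ^ (n' - i)" if "k \<le> i" "i \<le> n'" for i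
        using less.prems(8)[of i] that mn k by (simp add: x'_def Suc_diff_le mult_ac)
      show "\<nu> j \<le> \<nu> i" if "k \<le> i" "i \<le> j" "j \<le> n'" for i j
        using less.prems(9)[of i j] that mn by simp
      show "\<nu> i = l i" if "k < i" "i \<le> n'" for i
        using less.prems(6)[of i] that mn by simp
    qed (use mn generic_mult(2)[OF g] l' less.prems(5) x'(1) in auto)
    then show ?thesis using x' by simp
  next
    case False
    let ?l = "decr_part l"
    have l': "?l \<in> partitions_in m' (Suc n')" using decr_part_in l mn by simp
    have ll: "incr_part (Suc n') ?l = l" using incr_decr_part[OF l] False mn by simp
    obtain h where h: "h \<in> interp_space m' (Suc n') ?l (a * q) b q t"
      "\<And>x. x \<in> torus (Suc n') \<Longrightarrow> f x = (\<Prod>i\<in>{1..Suc n'}. thpm a (x i)) * h x"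
      using interp_space_divide[OF g l'] f ll mn by metis
    show ?thesis
    proof (cases "\<nu> n = 0")
      case True
      then have "x n = a" using less.prems(8)[of n] k by simp
      then have "thpm a (x n) = 0" using generic_nz[OF g] by (simp add: thpm_def)
      then have "(\<Prod>i\<in>{1..Suc n'}. thpm a (x i)) = 0" using mn by (intro prod_zero) auto
      then show ?thesis using h(2) less.prems(7) mn by simp
    next
      case pos: False
      have \<nu>1: "1 \<le> \<nu> i" if "k \<le> i" "i \<le> n" for i
        using less.prems(9)[of i n] that pos k by simp
      have "h x = 0"
      proof (rule less.hyps[of m' n "a * q" ?l h "decr_part \<nu>" x])
        show "decr_part \<nu> k < ?l k" using less.prems(5) \<nu>1[of k] k by (simp add: decr_part_def)
        show "decr_part \<nu> i = ?l i" if "k < i" "i \<le> n" for i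
          using less.prems(6)[OF that] by (simp add: decr_part_def)
        show "x i = a * q * q ^ decr_part \<nu> i * t ^ (n - i)" if "k \<le> i" "i \<le> n" for i
        proof -
          have "q ^ \<nu> i = q * q ^ (\<nu> i - 1)" using \<nu>1[OF that] by (cases "\<nu> i") auto
          then show ?thesis using less.prems(8)[OF that] by (simp add: decr_part_def mult_ac)
        qed
        show "decr_part \<nu> j \<le> decr_part \<nu> i" if "k \<le> i" "i \<le> j" "j \<le> n" for i j
          unfolding decr_part_def by (rule diff_le_mono[OF less.prems(9)[OF that]])
      qed (use mn generic_mult(1)[OF g] l' h(1) k less.prems(7) in auto)
      then show ?thesis using h(2) less.prems(7) mn by simp
    qed
  qed
qed

lemma vanishing_length_eq:
  assumes "i \<in> {1..n}" "\<mu> i \<noteq> l i" "\<And>j. i < j \<Longrightarrow> j \<le> n \<Longrightarrow> \<mu> j = l j"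
  shows "vanishing_length m n l \<mu> = (if \<mu> i < l i then full_length m n \<mu> else i)"
proof -
  have "Max {j \<in> {1..n}. \<mu> j \<noteq> l j} = i"
    using assms by (intro Max_eqI) (auto intro: leI)
  then show ?thesis by (simp add: vanishing_length_altdef Let_def)
qed

lemma last_difference:
  assumes "\<mu> \<in> partitions_in m n" "l \<in> partitions_in m n" "\<mu> \<noteq> l"
  obtains i where "i \<in> {1..n}" "\<mu> i \<noteq> l i" "\<And>j. i < j \<Longrightarrow> j \<le> n \<Longrightarrow> \<mu> j = l j"
proof -
  let ?S = "{j \<in> {1..n}. \<mu> j \<noteq> l j}"
  have "?S \<noteq> {}" using partitions_neq[OF assms] by blast
  then have m: "Max ?S \<in> ?S" by (intro Max_in) auto
  show ?thesis
  proof (rule that[of "Max ?S"])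
    fix j assume j: "Max ?S < j" "j \<le> n"
    show "\<mu> j = l j"
    proof (rule ccontr)
      assume "\<mu> j \<noteq> l j"
      then have "j \<le> Max ?S" using j m by (intro Max_ge) auto
      then show False using j by simp
    qed
  qed (use m in auto)
qed

lemma full_length_cong:
  assumes "\<mu> \<in> partitions_in m n" "\<nu> \<in> partitions_in m n" "\<And>i. i \<in> {1..n} \<Longrightarrow> \<mu> i = m \<longleftrightarrow> \<nu> i = m"
  shows "full_length m n \<mu> = full_length m n \<nu>"
  unfolding full_length_def using assms(3) by (intro arg_cong[where f = "\<lambda>S. Max (insert 0 S)"]) auto

text \<open>Either the cut is the prescribed one and the point is a node, or the cut lies before
  \<open>i\<close>, the coordinates from \<open>i\<close> on are of \<open>a\<close> type, and
  \<open>extra_vanishing\<close> applies.\<close>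

lemma interp_space_vanish_pt:
  assumes g: "generic_params p a b q t" and l: "l \<in> partitions_in m n" and f: "f \<in> interp_space m n l a b q t"
    and \<nu>: "\<nu> \<in> partitions_in m n" and i: "i \<in> {1..n}" "\<nu> i \<noteq> l i" "\<And>j. i < j \<Longrightarrow> j \<le> n \<Longrightarrow> \<nu> j = l j"
    and k: "\<nu> i < l i \<Longrightarrow> k = full_length m n \<nu> \<or> k < i" "l i < \<nu> i \<Longrightarrow> k = i"
  shows "f (pt m n k \<nu> a b q t) = 0"
proof (cases "\<nu> i < l i \<and> k \<noteq> full_length m n \<nu>")
  case False
  then have "k = vanishing_length m n l \<nu>" using vanishing_length_eq[where \<mu> = \<nu> and l = l, OF i, of m] k i(2) by auto
  moreover have "\<nu> \<noteq> l" using i(2) by auto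
  ultimately have "pt m n k \<nu> a b q t \<in> node_set m n l a b q t"
    using \<nu> by (auto simp: node_set_def vanishing_point_eq_pt)
  then show ?thesis by (rule interp_spaceD(2)[OF f])
next
  case True
  then have ki: "k < i" using k(1) by blast
  show ?thesis
  proof (rule extra_vanishing[OF g l f i(1) _ i(3)])
    show "pt m n k \<nu> a b q t \<in> torus n" using generic_nz[OF g] by (intro pt_torus) auto
    show "pt m n k \<nu> a b q t j = a * q ^ \<nu> j * t ^ (n - j)" if "i \<le> j" "j \<le> n" for j
      using that ki i(1) by (simp add: pt_def)
    show "\<nu> j' \<le> \<nu> j" if "i \<le> j" "j \<le> j'" "j' \<le> n" for j j'
      using partitions_antimono[OF \<nu>, of j j'] that i(1) by simp
  qed (use True in auto)
qed

subsection \<open>The difference operator at the nodes\<close>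

definition dcoeff :: "nat \<Rightarrow> complex \<Rightarrow> complex \<Rightarrow> complex \<Rightarrow> complex \<Rightarrow> complex \<Rightarrow> (nat \<Rightarrow> int) \<Rightarrow> (nat \<Rightarrow> complex) \<Rightarrow> complex" where
  "dcoeff n a b c d t \<sigma> x =
      (\<Prod>i\<in>{1..n}.
        th (a * x i powi \<sigma> i) * th (b * x i powi \<sigma> i) *
        th (c * x i powi \<sigma> i) * th (d * x i powi \<sigma> i) /
        th (x i powi (2 * \<sigma> i))) *
      (\<Prod>(i, j)\<in>{(i, j). 1 \<le> i \<and> i < j \<and> j \<le> n}.
        th (t * x i powi \<sigma> i * x j powi \<sigma> j) /
        th (x i powi \<sigma> i * x j powi \<sigma> j))"

definition shift_pt :: "nat \<Rightarrow> complex \<Rightarrow> (nat \<Rightarrow> int) \<Rightarrow> (nat \<Rightarrow> complex) \<Rightarrow> nat \<Rightarrow> complex" where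
  "shift_pt n sq \<sigma> x = (\<lambda>i\<in>{1..n}. sq powi \<sigma> i * x i)"

lemma diff_op_dcoeff:
  "diff_op n a b c d sq t p f x = (\<Sum>\<sigma>\<in>signs n. dcoeff n a b c d t \<sigma> x * f (shift_pt n sq \<sigma> x))"
  by (simp add: diff_op_def dcoeff_def shift_pt_def)

lemma finite_index_pairs: "finite {(i, j). 1 \<le> i \<and> i < j \<and> j \<le> (n::nat)}"
  by (rule finite_subset[of _ "{1..n} \<times> {1..n}"]) auto

lemma dcoeff_nz_single:
  assumes "dcoeff n a b c d t \<sigma> x \<noteq> 0" "i \<in> {1..n}"
  shows "th (a * x i powi \<sigma> i) \<noteq> 0" "th (b * x i powi \<sigma> i) \<noteq> 0" "th (c * x i powi \<sigma> i) \<noteq> 0"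
proof -
  have "th (a * x i powi \<sigma> i) * th (b * x i powi \<sigma> i) * th (c * x i powi \<sigma> i) * th (d * x i powi \<sigma> i) /
        th (x i powi (2 * \<sigma> i)) \<noteq> 0"
    using assms unfolding dcoeff_def by (metis (no_types, lifting) finite_atLeastAtMost mult_not_zero prod_zero_iff)
  then show "th (a * x i powi \<sigma> i) \<noteq> 0" "th (b * x i powi \<sigma> i) \<noteq> 0" "th (c * x i powi \<sigma> i) \<noteq> 0" by auto
qed

lemma dcoeff_nz_pair:
  assumes "dcoeff n a b c d t \<sigma> x \<noteq> 0" "1 \<le> i" "i < j" "j \<le> n"
  shows "th (t * x i powi \<sigma> i * x j powi \<sigma> j) \<noteq> 0"
proof -
  have "(\<Prod>(i, j)\<in>{(i, j). 1 \<le> i \<and> i < j \<and> j \<le> n}.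
        th (t * x i powi \<sigma> i * x j powi \<sigma> j) / th (x i powi \<sigma> i * x j powi \<sigma> j)) \<noteq> 0"
    using assms(1) unfolding dcoeff_def by (rule contrapos_nn) simp
  then have "\<forall>e\<in>{(i, j). 1 \<le> i \<and> i < j \<and> j \<le> n}.
      (case e of (i, j) \<Rightarrow> th (t * x i powi \<sigma> i * x j powi \<sigma> j) / th (x i powi \<sigma> i * x j powi \<sigma> j)) \<noteq> 0"
    by (simp only: prod_zero_iff[OF finite_index_pairs]) blast
  from this[rule_format, of "(i, j)"] show ?thesis using assms by auto
qed

lemma antimono_adjacent:
  fixes e :: "nat \<Rightarrow> 'b::order"
  assumes "\<And>i. 1 \<le> i \<Longrightarrow> i < n \<Longrightarrow> e (Suc i) \<le> e i" "1 \<le> i" "i \<le> j" "j \<le> n"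
  shows "e j \<le> e i"
  using assms(3,4)
proof (induction j rule: dec_induct)
  case (step j)
  then show ?case using assms(1)[of j] assms(2) by (meson Suc_le_eq dual_order.trans le_trans less_imp_le)
qed simp

text \<open>Shifts that would leave the nodes have coefficient zero, because of a theta factor at \<open>1\<close>.\<close>

lemma shift_pt_node:
  assumes g: "generic_params p a b q t" and sq: "sq\<^sup>2 = q" and \<mu>: "\<mu> \<in> partitions_in m n"
    and \<sigma>: "\<sigma> \<in> signs n" and k: "k \<le> n" and nz: "dcoeff n a b c d t \<sigma> (pt m n k \<mu> a b q t) \<noteq> 0"
  obtains \<nu> where "\<nu> \<in> partitions_in m n"
    "\<And>i. i \<in> {1..n} \<Longrightarrow> \<nu> i = (if \<sigma> i = 1 then \<mu> i else if i \<le> k then \<mu> i + 1 else \<mu> i - 1)"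
    "\<And>i. i \<in> {1..n} \<Longrightarrow> k < i \<Longrightarrow> \<sigma> i = -1 \<Longrightarrow> 1 \<le> \<mu> i"
    "shift_pt n sq \<sigma> (pt m n k \<mu> a b q t) = pt m n k \<nu> (sq * a) (sq * b) q t"
proof -
  note ab = generic_nz[OF g]
  have sqnz: "sq \<noteq> 0" using sq ab by auto
  let ?x = "pt m n k \<mu> a b q t"
  \<comment> \<open>The shifted partition with integer values, so that leaving the range from
    \<open>0\<close> to \<open>m\<close> can be expressed before it is excluded.\<close>
  define e where "e i = int (\<mu> i) + (if \<sigma> i = 1 then 0 else if i \<le> k then 1 else -1)" for i
  have s: "\<sigma> i = 1 \<or> \<sigma> i = -1" if "i \<in> {1..n}" for i using signs_cases[OF \<sigma> that] .
  \<comment> \<open>On one side of the cut an increase can only arise from two equal neighbouring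
    parts shifted apart, and then the theta argument of that pair is \<open>1\<close>. Across the
    cut the shifts act in opposite directions and no increase occurs.\<close>
  have adj: "e (Suc i) \<le> e i" if i: "1 \<le> i" "i < n" for i
  proof (rule ccontr)
    assume "\<not> ?thesis"
    then have lt: "e i < e (Suc i)" by simp
    have i': "i \<in> {1..n}" "Suc i \<in> {1..n}" using i by auto
    have le: "\<mu> (Suc i) \<le> \<mu> i" using partitions_antimono[OF \<mu>, of i "Suc i"] i by simp
    have th: "th (t * ?x i powi \<sigma> i * ?x (Suc i) powi \<sigma> (Suc i)) \<noteq> 0"
      using dcoeff_nz_pair[OF nz, of i "Suc i"] i by simp
    consider "Suc i \<le> k" | "i = k" | "k < i" by linarith
    then show False
    proof cases
      case 1
      then have "\<mu> (Suc i) = \<mu> i" "\<sigma> i = 1" "\<sigma> (Suc i) = -1"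
        using lt le s[OF i'(1)] s[OF i'(2)] by (auto simp: e_def split: if_splits)
      moreover have "?x (Suc i) = t * ?x i"
        using 1 i \<open>\<mu> (Suc i) = \<mu> i\<close> by (cases i) (auto simp: pt_def)
      moreover have "?x i \<noteq> 0" using 1 i ab by (simp add: pt_def)
      ultimately show False using th ab by (simp add: field_simps)
    next
      case 2
      then show False using lt le s[OF i'(1)] s[OF i'(2)] by (auto simp: e_def split: if_splits)
    next
      case 3
      then have "\<mu> (Suc i) = \<mu> i" "\<sigma> i = -1" "\<sigma> (Suc i) = 1"
        using lt le s[OF i'(1)] s[OF i'(2)] by (auto simp: e_def split: if_splits)
      moreover have "?x i = t * ?x (Suc i)"
      proof -
        have "n - i = Suc (n - Suc i)" using i by simp
        then show ?thesis using 3 i \<open>\<mu> (Suc i) = \<mu> i\<close> by (simp add: pt_def)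
      qed
      moreover have "?x (Suc i) \<noteq> 0" using 3 i ab by (simp add: pt_def)
      ultimately show False using th ab by (simp add: field_simps)
    qed
  qed
  \<comment> \<open>The first part could exceed \<open>m\<close> only if \<open>?x 1 = b\<close> is
    divided by \<open>sq\<close>, where the factor with \<open>b\<close> is
    \<open>th 1\<close>.\<close>
  have le_m: "e i \<le> int m" if i: "i \<in> {1..n}" for i
  proof -
    have "e i \<le> e 1" using antimono_adjacent[of n e 1 i] adj i by auto
    also have "e 1 \<le> int m"
    proof (rule ccontr)
      assume "\<not> ?thesis"
      then have *: "\<mu> 1 = m" "\<sigma> 1 = -1" "1 \<le> k"
        using partitions_le[OF \<mu>, of 1] s[of 1] i by (auto simp: e_def split: if_splits)
      then have "?x 1 = b" using i by (simp add: pt_def)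
      then show False using dcoeff_nz_single(2)[OF nz, of 1] * i ab by simp
    qed
    finally show ?thesis .
  qed
  \<comment> \<open>The last part could become negative only if \<open>?x n = a\<close> is divided
    by \<open>sq\<close>, where the factor with \<open>a\<close> is \<open>th 1\<close>.\<close>
  have ge_0: "0 \<le> e i" if i: "i \<in> {1..n}" for i
  proof -
    have "0 \<le> e n"
    proof (rule ccontr)
      assume "\<not> ?thesis"
      then have *: "\<mu> n = 0" "\<sigma> n = -1" "\<not> n \<le> k"
        using s[of n] i by (auto simp: e_def split: if_splits)
      then have "?x n = a" using i by (simp add: pt_def)
      then show False using dcoeff_nz_single(1)[OF nz, of n] * i ab by simp
    qed
    also have "e n \<le> e i" using antimono_adjacent[of n e i n] adj i by auto
    finally show ?thesis .
  qed
  define \<nu> where "\<nu> i = (if i \<in> {1..n} then nat (e i) else 0)" for i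
  have \<nu>: "\<nu> \<in> partitions_in m n"
  proof (rule partitions_inI)
    show "\<nu> i \<le> m" if "i \<in> {1..n}" for i using le_m[OF that] that by (simp add: \<nu>_def)
    show "\<nu> j \<le> \<nu> i" if "1 \<le> i" "i \<le> j" "j \<le> n" for i j
      using antimono_adjacent[of n e i j] adj that by (auto simp: \<nu>_def intro!: nat_mono)
  qed (auto simp: \<nu>_def)
  have \<mu>1: "1 \<le> \<mu> i" if "i \<in> {1..n}" "k < i" "\<sigma> i = -1" for i
    using ge_0[OF that(1)] that by (simp add: e_def)
  have \<mu>m: "\<mu> i < m" if "i \<in> {1..n}" "i \<le> k" "\<sigma> i = -1" for i
    using le_m[OF that(1)] that by (simp add: e_def)
  have \<nu>e: "\<nu> i = (if \<sigma> i = 1 then \<mu> i else if i \<le> k then \<mu> i + 1 else \<mu> i - 1)" if i: "i \<in> {1..n}" for i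
    using s[OF i] \<mu>1[OF i] i by (auto simp: \<nu>_def e_def nat_add_distrib nat_diff_distrib)
  have "shift_pt n sq \<sigma> ?x i = pt m n k \<nu> (sq * a) (sq * b) q t i" for i
  proof (cases "i \<in> {1..n}")
    case False
    then show ?thesis by (auto simp: shift_pt_def pt_def)
  next
    case i: True
    show ?thesis
    proof (cases "\<sigma> i = 1")
      case True
      then show ?thesis using i \<nu>e[OF i] by (simp add: shift_pt_def pt_def)
    next
      case False
      then have s1: "\<sigma> i = -1" using s[OF i] by simp
      show ?thesis
      proof (cases "i \<le> k")
        case True
        then have "m - \<mu> i = Suc (m - \<nu> i)" using \<mu>m[OF i True s1] \<nu>e[OF i] s1 by simp
        then show ?thesis
          using i s1 True sq[symmetric] sqnz by (simp add: shift_pt_def pt_def power2_eq_square field_simps)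
      next
        case False
        then have "\<mu> i = Suc (\<nu> i)" using \<mu>1[OF i _ s1] \<nu>e[OF i] s1 by simp
        then show ?thesis
          using i s1 False sq[symmetric] sqnz by (simp add: shift_pt_def pt_def power2_eq_square field_simps)
      qed
    qed
  qed
  then have "shift_pt n sq \<sigma> ?x = pt m n k \<nu> (sq * a) (sq * b) q t" by (rule ext)
  then show ?thesis using that \<nu> \<nu>e \<mu>1 by blast
qed

text \<open>A surviving shift raises parts up to the cut and lowers parts after it, which at the
  last difference \<open>i\<close> means away from \<open>l\<close>. So the shifted partition still
  differs from \<open>l\<close> at \<open>i\<close>, its last difference is at \<open>i\<close> or
  later, and \<open>interp_space_vanish_pt\<close> applies.\<close>

lemma diff_op_vanishes_at_node:
  assumes g: "generic_params p a b q t" and sq: "sq\<^sup>2 = q" and l: "l \<in> partitions_in m n"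
    and f: "f \<in> interp_space m n l (sq * a) (sq * b) q t" and x: "x \<in> node_set m n l a b q t"
  shows "diff_op n a b c d sq t p f x = 0"
  unfolding diff_op_dcoeff
proof (rule sum.neutral, rule ballI)
  fix \<sigma> assume \<sigma>: "\<sigma> \<in> signs n"
  obtain \<mu> where \<mu>: "\<mu> \<in> partitions_in m n" "\<mu> \<noteq> l" "x = vanishing_point m n l \<mu> a b q t"
    using x by (auto simp: node_set_def)
  obtain i where i: "i \<in> {1..n}" "\<mu> i \<noteq> l i" "\<And>j. i < j \<Longrightarrow> j \<le> n \<Longrightarrow> \<mu> j = l j"
    using last_difference[OF \<mu>(1) l \<mu>(2)] by blast
  define k where "k = vanishing_length m n l \<mu>"
  have k: "k = (if \<mu> i < l i then full_length m n \<mu> else i)" unfolding k_def by (rule vanishing_length_eq[where \<mu> = \<mu> and l = l, OF i])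
  have kn: "k \<le> n" using k full_length_le[of m n \<mu>] i by auto
  have x': "x = pt m n k \<mu> a b q t" using \<mu>(3) by (simp add: k_def vanishing_point_eq_pt)
  show "dcoeff n a b c d t \<sigma> x * f (shift_pt n sq \<sigma> x) = 0"
  proof (cases "dcoeff n a b c d t \<sigma> x = 0")
    case False
    then obtain \<nu> where \<nu>: "\<nu> \<in> partitions_in m n"
      "\<And>i. i \<in> {1..n} \<Longrightarrow> \<nu> i = (if \<sigma> i = 1 then \<mu> i else if i \<le> k then \<mu> i + 1 else \<mu> i - 1)"
      "\<And>i. i \<in> {1..n} \<Longrightarrow> k < i \<Longrightarrow> \<sigma> i = -1 \<Longrightarrow> 1 \<le> \<mu> i"
      "shift_pt n sq \<sigma> x = pt m n k \<nu> (sq * a) (sq * b) q t"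
      using shift_pt_node[OF g sq \<mu>(1) \<sigma> kn, of c d] x' by metis
    have ge: "\<nu> j \<ge> \<mu> j" if "j \<in> {1..n}" "j \<le> k" for j using \<nu>(2)[OF that(1)] that by auto
    have le: "\<nu> j \<le> \<mu> j" if "j \<in> {1..n}" "k < j" for j using \<nu>(2)[OF that(1)] that by auto
    have ne: "\<nu> i \<noteq> l i"
    proof (cases "\<mu> i < l i")
      case True
      then have "k < i" using k full_length_part[OF \<mu>(1) i(1)] partitions_le[OF l, of i] by auto
      then show ?thesis using le[OF i(1)] True by simp
    next
      case False
      then show ?thesis using ge[OF i(1)] k i(2) by simp
    qed
    then have "\<nu> \<noteq> l" by auto
    then obtain i' where i': "i' \<in> {1..n}" "\<nu> i' \<noteq> l i'" "\<And>j. i' < j \<Longrightarrow> j \<le> n \<Longrightarrow> \<nu> j = l j"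
      using last_difference[OF \<nu>(1) l] by blast
    have ii': "i \<le> i'" using i'(3)[of i] ne i(1) by (metis atLeastAtMost_iff not_le)
    have "f (pt m n k \<nu> (sq * a) (sq * b) q t) = 0"
    proof (rule interp_space_vanish_pt[OF generic_sqrt(1)[OF g sq] l f \<nu>(1) i'])
      assume lt: "\<nu> i' < l i'"
      show "k = full_length m n \<nu> \<or> k < i'"
      proof (cases "\<mu> i < l i")
        case True
        then have kf: "k = full_length m n \<mu>" using k by simp
        have "\<mu> j = m \<longleftrightarrow> \<nu> j = m" if j: "j \<in> {1..n}" for j
        proof (cases "j \<le> k")
          case True
          then have "\<mu> j = m" using full_length_part[OF \<mu>(1) j] kf by simp
          then show ?thesis using ge[OF j True] partitions_le[OF \<nu>(1), of j] by simp
        next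
          case False
          then have "\<mu> j < m" using full_length_part[OF \<mu>(1) j] kf partitions_le[OF \<mu>(1), of j] by auto
          then show ?thesis using le[OF j] False by simp
        qed
        then have "full_length m n \<mu> = full_length m n \<nu>" by (rule full_length_cong[OF \<mu>(1) \<nu>(1)])
        then show ?thesis using kf by simp
      next
        case False
        then have ki: "k = i" using k by simp
        have "i \<noteq> i'" using lt ge[OF i(1)] ki False i(2) by auto
        then show ?thesis using ki ii' by simp
      qed
    next
      assume gt: "l i' < \<nu> i'"
      show "k = i'"
      proof (cases "\<mu> i < l i")
        case True
        then have "k < i" using k full_length_part[OF \<mu>(1) i(1)] partitions_le[OF l, of i] by auto
        then have "\<nu> i' \<le> \<mu> i'" using le[OF i'(1)] ii' by simp
        moreover have "\<mu> i' \<le> l i'" using i(3)[of i'] True ii' i'(1) by (cases "i = i'") auto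
        ultimately show ?thesis using gt by simp
      next
        case False
        then have ki: "k = i" using k by simp
        show ?thesis
        proof (rule ccontr)
          assume "k \<noteq> i'"
          then have "i < i'" using ki ii' by simp
          then have "\<nu> i' \<le> \<mu> i'" "\<mu> i' = l i'" using le[OF i'(1)] ki i(3)[of i'] i'(1) by auto
          then show False using gt by simp
        qed
      qed
    qed
    then show ?thesis using \<nu>(4) by simp
  qed simp
qed

definition all_plus :: "nat \<Rightarrow> nat \<Rightarrow> int" where
  "all_plus n = (\<lambda>i\<in>{1..n}. 1)"

lemma all_plus_signs: "all_plus n \<in> signs n"
  by (auto simp: all_plus_def signs_def)

text \<open>Parts up to the cut equal \<open>m\<close> and cannot be raised, so a sign
  \<open>-1\<close> lowers some part after it. The shifted partition is then below \<open>l\<close>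
  with the same cut, and \<open>f\<close> vanishes at its point.\<close>

lemma diff_op_at_full_pt:
  assumes g: "generic_params p a b q t" and sq: "sq\<^sup>2 = q" and l: "l \<in> partitions_in m n"
    and f: "f \<in> interp_space m n l (sq * a) (sq * b) q t"
  shows "diff_op n a b c d sq t p f (full_pt m n l a b q t) =
    dcoeff n a b c d t (all_plus n) (full_pt m n l a b q t) * f (full_pt m n l (sq * a) (sq * b) q t)"
proof -
  let ?x = "full_pt m n l a b q t"
  define k where "k = full_length m n l"
  have x: "?x = pt m n k l a b q t" by (simp add: full_pt_def k_def)
  have kn: "k \<le> n" by (simp add: k_def full_length_le)
  have "dcoeff n a b c d t \<sigma> ?x * f (shift_pt n sq \<sigma> ?x) = 0"
    if \<sigma>: "\<sigma> \<in> signs n - {all_plus n}" for \<sigma>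
  proof (cases "dcoeff n a b c d t \<sigma> ?x = 0")
    case False
    then obtain \<nu> where \<nu>: "\<nu> \<in> partitions_in m n"
      "\<And>i. i \<in> {1..n} \<Longrightarrow> \<nu> i = (if \<sigma> i = 1 then l i else if i \<le> k then l i + 1 else l i - 1)"
      "\<And>i. i \<in> {1..n} \<Longrightarrow> k < i \<Longrightarrow> \<sigma> i = -1 \<Longrightarrow> 1 \<le> l i"
      "shift_pt n sq \<sigma> ?x = pt m n k \<nu> (sq * a) (sq * b) q t"
      using shift_pt_node[OF g sq l _ kn, of \<sigma> c d] x \<sigma> by (metis DiffD1)
    have small: "\<sigma> j = 1 \<and> \<nu> j = m" if j: "j \<in> {1..n}" "j \<le> k" for j
    proof -
      have "l j = m" using full_length_part[OF l j(1)] j(2) by (simp add: k_def)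
      then show ?thesis using \<nu>(2)[OF j(1)] j(2) partitions_le[OF \<nu>(1), of j] by (auto split: if_splits)
    qed
    have large: "\<nu> j \<le> l j" "\<nu> j \<noteq> m" if j: "j \<in> {1..n}" "k < j" for j
    proof -
      show "\<nu> j \<le> l j" using \<nu>(2)[OF j(1)] j(2) by auto
      moreover have "l j < m" using full_length_part[OF l j(1)] j(2) partitions_le[OF l, of j] by (auto simp: k_def)
      ultimately show "\<nu> j \<noteq> m" by simp
    qed
    have "\<exists>j\<in>{1..n}. \<sigma> j \<noteq> 1"
    proof (rule ccontr)
      assume "\<not> ?thesis"
      then have "\<sigma> = all_plus n"
        using \<sigma> by (auto simp: signs_def all_plus_def PiE_def extensional_def fun_eq_iff)
      then show False using \<sigma> by simp
    qed
    then obtain j where j: "j \<in> {1..n}" "\<sigma> j \<noteq> 1" by blast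
    then have "k < j" using small[OF j(1)] by force
    have "\<sigma> j = -1" using signs_cases[of \<sigma> n j] \<sigma> j by auto
    then have "\<nu> j \<noteq> l j" using \<nu>(2,3)[OF j(1)] \<open>k < j\<close> by simp
    then have "\<nu> \<noteq> l" by auto
    then obtain i where i: "i \<in> {1..n}" "\<nu> i \<noteq> l i" "\<And>j. i < j \<Longrightarrow> j \<le> n \<Longrightarrow> \<nu> j = l j"
      using last_difference[OF \<nu>(1) l] by blast
    have lt: "\<nu> i < l i"
    proof (cases "i \<le> k")
      case True
      then show ?thesis using small[OF i(1)] full_length_part[OF l i(1)] i(2) by (simp add: k_def)
    next
      case False
      then show ?thesis using large[OF i(1)] i(2) by simp
    qed
    have "l j = m \<longleftrightarrow> \<nu> j = m" if "j \<in> {1..n}" for j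
      using small[OF that] large[OF that] full_length_part[OF l that] by (cases "j \<le> k") (auto simp: k_def)
    then have "full_length m n l = full_length m n \<nu>" by (rule full_length_cong[OF l \<nu>(1)])
    then have "f (pt m n k \<nu> (sq * a) (sq * b) q t) = 0"
      using lt by (intro interp_space_vanish_pt[OF generic_sqrt(1)[OF g sq] l f \<nu>(1) i]) (auto simp: k_def)
    then show ?thesis using \<nu>(4) by simp
  qed simp
  then have "(\<Sum>\<sigma>\<in>signs n - {all_plus n}. dcoeff n a b c d t \<sigma> ?x * f (shift_pt n sq \<sigma> ?x)) = 0"
    by (intro sum.neutral ballI)
  then have "diff_op n a b c d sq t p f ?x =
      dcoeff n a b c d t (all_plus n) ?x * f (shift_pt n sq (all_plus n) ?x)"
    unfolding diff_op_dcoeff by (subst sum.remove[OF finite_signs all_plus_signs]) simp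
  moreover have "shift_pt n sq (all_plus n) ?x = full_pt m n l (sq * a) (sq * b) q t"
    by (auto simp: shift_pt_def all_plus_def full_pt_def pt_def fun_eq_iff)
  ultimately show ?thesis by simp
qed

end

subsection \<open>Existence of interpolation functions\<close>

text \<open>Gaussian elimination: equation \<open>j\<close> is solved for an unknown
  \<open>i0\<close> and substituted into the others, which gives the coefficients
  \<open>B\<close>.\<close>

lemma nontrivial_solution:
  fixes A :: "'j \<Rightarrow> 'i \<Rightarrow> 'a::field"
  assumes "finite J" "finite I" "card J < card I"
  shows "\<exists>c. (\<exists>i\<in>I. c i \<noteq> 0) \<and> (\<forall>j\<in>J. (\<Sum>i\<in>I. c i * A j i) = 0)"
  using assms
proof (induction J arbitrary: I A rule: finite_induct)
  case empty
  then obtain i where "i \<in> I" by fastforce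
  then show ?case by (intro exI[of _ "\<lambda>_. 1"]) auto
next
  case (insert j J)
  show ?case
  proof (cases "\<forall>i\<in>I. A j i = 0")
    case True
    have "card J < card I" using insert.hyps insert.prems(2) by simp
    from insert.IH[OF insert.prems(1) this, of A]
    obtain c where "\<exists>i\<in>I. c i \<noteq> 0" "\<forall>j\<in>J. (\<Sum>i\<in>I. c i * A j i) = 0" by blast
    then show ?thesis using True by (intro exI[of _ c]) (simp add: sum.neutral)
  next
    case False
    then obtain i0 where i0: "i0 \<in> I" "A j i0 \<noteq> 0" by blast
    let ?I = "I - {i0}"
    define B where "B j' i = A j' i - A j' i0 * A j i / A j i0" for j' i
    have "card J < card ?I" using insert i0 by simp
    from insert.IH[OF _ this, of B] obtain c
      where c: "\<exists>i\<in>?I. c i \<noteq> 0" "\<And>j'. j' \<in> J \<Longrightarrow> (\<Sum>i\<in>?I. c i * B j' i) = 0"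
      using insert.prems by auto
    define S where "S = (\<Sum>i\<in>?I. c i * A j i)"
    define c' where "c' = c(i0 := - S / A j i0)"
    have eq: "(\<Sum>i\<in>I. c' i * A j' i) = (\<Sum>i\<in>?I. c i * A j' i) - S / A j i0 * A j' i0" for j'
    proof -
      have "(\<Sum>i\<in>?I. c' i * A j' i) = (\<Sum>i\<in>?I. c i * A j' i)" by (intro sum.cong) (auto simp: c'_def)
      then show ?thesis using insert.prems i0(1) by (subst sum.remove[OF _ i0(1)]) (auto simp: c'_def)
    qed
    have "(\<Sum>i\<in>I. c' i * A j i) = 0" unfolding eq using i0(2) by (simp add: S_def)
    moreover have "(\<Sum>i\<in>I. c' i * A j' i) = 0" if "j' \<in> J" for j'
    proof -
      have "0 = (\<Sum>i\<in>?I. c i * A j' i - A j' i0 / A j i0 * (c i * A j i))"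
        using c(2)[OF that] by (simp add: B_def algebra_simps)
      also have "\<dots> = (\<Sum>i\<in>?I. c i * A j' i) - A j' i0 / A j i0 * S"
        by (simp add: sum_subtractf sum_distrib_left S_def)
      finally show ?thesis unfolding eq by (simp add: mult.commute)
    qed
    moreover have "\<exists>i\<in>I. c' i \<noteq> 0" using c(1) by (auto simp: c'_def)
    ultimately show ?thesis by (intro exI[of _ c']) auto
  qed
qed

section \<open>A triangular family of products of theta functions\<close>

lemma finite_partitions_in: "finite (partitions_in m n)"
proof (rule finite_subset)
  show "partitions_in m n \<subseteq> {l. \<forall>i. (i \<in> {1..n} \<longrightarrow> l i \<in> {..m}) \<and> (i \<notin> {1..n} \<longrightarrow> l i = 0)}"
    by (auto simp: partitions_in_def)
qed (intro finite_set_of_finite_funs; simp)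

text \<open>The parts of the conjugate partition.\<close>

definition col :: "nat \<Rightarrow> (nat \<Rightarrow> nat) \<Rightarrow> nat \<Rightarrow> nat" where
  "col n \<kappa> j = card {i \<in> {1..n}. j \<le> \<kappa> i}"

lemma le_col_iff:
  assumes \<kappa>: "\<kappa> \<in> partitions_in m n" and i: "i \<in> {1..n}"
  shows "i \<le> col n \<kappa> j \<longleftrightarrow> j \<le> \<kappa> i"
proof
  assume "j \<le> \<kappa> i"
  then have "{1..i} \<subseteq> {i \<in> {1..n}. j \<le> \<kappa> i}"
    using i partitions_antimono[OF \<kappa>, of _ i] by (auto intro: order_trans)
  then have "card {1..i} \<le> col n \<kappa> j" unfolding col_def by (intro card_mono) auto
  then show "i \<le> col n \<kappa> j" by simp
next
  assume le: "i \<le> col n \<kappa> j"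
  show "j \<le> \<kappa> i"
  proof (rule ccontr)
    assume "\<not> ?thesis"
    then have "{i \<in> {1..n}. j \<le> \<kappa> i} \<subseteq> {1..i - 1}"
      using partitions_antimono[OF \<kappa>, of i] i by (auto simp: not_le) (metis Suc_leI le_less_trans linorder_not_le not_less_eq_eq One_nat_def Suc_pred less_le_trans zero_less_one)
    then have "col n \<kappa> j \<le> card {1..i - 1}" unfolding col_def by (intro card_mono) auto
    moreover have "i \<ge> 1" using i by simp
    ultimately show False using le unfolding card_atLeastAtMost by linarith
  qed
qed

lemma col_le: "col n \<kappa> j \<le> n"
proof -
  have "col n \<kappa> j \<le> card {1..n}" unfolding col_def by (intro card_mono) auto
  then show ?thesis by simp
qed

context nome
begin

text \<open>At the points \<open>a q\<^bsup>\<mu> i\<^esup> t\<^bsup>n - i\<^esup>\<close> these functions form a triangular matrix, the factors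
  being indexed by the columns of the diagram of \<open>\<kappa>\<close>.\<close>

definition column_product :: "nat \<Rightarrow> nat \<Rightarrow> complex \<Rightarrow> complex \<Rightarrow> complex \<Rightarrow> (nat \<Rightarrow> nat) \<Rightarrow> (nat \<Rightarrow> complex) \<Rightarrow> complex" where
  "column_product m n a q t \<kappa> = (\<lambda>x\<in>torus n. \<Prod>j\<in>{1..m}. \<Prod>i\<in>{1..n}.
    thpm (a * q ^ (j - 1) * t ^ (n - col n \<kappa> j)) (x i))"

lemma sep_BC1_prods:
  assumes "finite J" "\<And>j. j \<in> J \<Longrightarrow> u j \<noteq> 0"
  shows "sep_BC1 (card J) n (\<lambda>x. \<Prod>j\<in>J. \<Prod>i\<in>{1..n}. thpm (u j) (x i))"
  using assms
proof (induction J rule: finite_induct)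
  case empty
  then show ?case by (simp add: sep_BC1_def BC1_const)
next
  case (insert j J)
  then show ?case using sep_BC1_mult[OF sep_BC1_prod_thpm[of "u j" n]] by simp
qed

lemma column_product_BC_theta:
  assumes "a \<noteq> 0" "q \<noteq> 0" "t \<noteq> 0"
  shows "column_product m n a q t \<kappa> \<in> BC_theta m n p"
  unfolding column_product_def
proof (rule BC_theta_restrictI)
  show "sep_BC1 m n (\<lambda>x. \<Prod>j\<in>{1..m}. \<Prod>i\<in>{1..n}. thpm (a * q ^ (j - 1) * t ^ (n - col n \<kappa> j)) (x i))"
    using sep_BC1_prods[of "{1..m}" "\<lambda>j. a * q ^ (j - 1) * t ^ (n - col n \<kappa> j)" n] assms by simp
  fix x \<pi> assume "\<pi> permutes {1..n}"
  then show "(\<Prod>j\<in>{1..m}. \<Prod>i\<in>{1..n}. thpm (a * q ^ (j - 1) * t ^ (n - col n \<kappa> j)) ((x \<circ> \<pi>) i)) =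
    (\<Prod>j\<in>{1..m}. \<Prod>i\<in>{1..n}. thpm (a * q ^ (j - 1) * t ^ (n - col n \<kappa> j)) (x i))"
    by (simp add: prod_comp_permutes[where g = "\<lambda>i. thpm _ (x i)"])
qed

text \<open>By genericity a factor vanishes at a coordinate only if the two monomials have equal
  exponents; the power of \<open>t\<close> then singles out the row
  \<open>col n \<kappa> j\<close>.\<close>

lemma column_product_pt:
  assumes g: "generic_params p a b q t" and \<kappa>: "\<kappa> \<in> partitions_in m n" and \<mu>: "\<mu> \<in> partitions_in m n"
  shows "column_product m n a q t \<kappa> (pt m n 0 \<mu> a b q t) = 0 \<longleftrightarrow>
    (\<exists>j\<in>{1..m}. 1 \<le> col n \<kappa> j \<and> \<mu> (col n \<kappa> j) = j - 1)"
proof -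
  note nz = generic_nz[OF g]
  have *: "thpm (a * q ^ (j - 1) * t ^ (n - col n \<kappa> j)) (pt m n 0 \<mu> a b q t i) = 0 \<longleftrightarrow>
      i = col n \<kappa> j \<and> \<mu> i = j - 1" if j: "j \<in> {1..m}" and i: "i \<in> {1..n}" for i j
  proof -
    have x: "pt m n 0 \<mu> a b q t i = mon a b q t 1 0 (int (\<mu> i)) (int n - int i)"
      using pt_mon[of a b q t i n \<mu> m 0] nz i partitions_le[OF \<mu>] by simp
    have u: "a * q ^ (j - 1) * t ^ (n - col n \<kappa> j) = mon a b q t 1 0 (int (j - 1)) (int n - int (col n \<kappa> j))"
      using col_le[of n \<kappa> j] by (simp add: mon_def power_int_of_nat[symmetric] of_nat_diff del: power_int_of_nat)
    show ?thesis
      unfolding u x using nz g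
      by (subst thpm_eq_0_iff) (auto simp: mon_nz mon_mult mon_divide generic_mon_pz)
  qed
  have "column_product m n a q t \<kappa> (pt m n 0 \<mu> a b q t) = 0 \<longleftrightarrow>
      (\<exists>j\<in>{1..m}. \<exists>i\<in>{1..n}. i = col n \<kappa> j \<and> \<mu> i = j - 1)"
    using pt_torus[of a b q t m n 0 \<mu>] nz * by (simp add: column_product_def)
  then show ?thesis using col_le[of n \<kappa>] by auto
qed

lemma column_product_self_nz:
  assumes g: "generic_params p a b q t" and \<kappa>: "\<kappa> \<in> partitions_in m n"
  shows "column_product m n a q t \<kappa> (pt m n 0 \<kappa> a b q t) \<noteq> 0"
proof
  assume "column_product m n a q t \<kappa> (pt m n 0 \<kappa> a b q t) = 0"
  then obtain j where j: "j \<in> {1..m}" "1 \<le> col n \<kappa> j" "\<kappa> (col n \<kappa> j) = j - 1"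
    using column_product_pt[OF g \<kappa> \<kappa>] by blast
  have "j \<le> \<kappa> (col n \<kappa> j)" using le_col_iff[OF \<kappa>, of "col n \<kappa> j" j] j(2) col_le[of n \<kappa> j] by simp
  moreover have "1 \<le> j" using j(1) by simp
  ultimately show False using j(3) by linarith
qed

text \<open>If \<open>\<mu> i < \<kappa> i\<close>, there is a first column \<open>j\<close> of
  \<open>\<kappa>\<close> with \<open>\<mu> (col n \<kappa> j) < j\<close>. Minimality forces the
  value \<open>j - 1\<close>, which is a zero of the product.\<close>

lemma column_product_triangular:
  assumes g: "generic_params p a b q t" and \<kappa>: "\<kappa> \<in> partitions_in m n" and \<mu>: "\<mu> \<in> partitions_in m n"
    and nz: "column_product m n a q t \<kappa> (pt m n 0 \<mu> a b q t) \<noteq> 0" and i: "i \<in> {1..n}"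
  shows "\<kappa> i \<le> \<mu> i"
proof (rule ccontr)
  assume lt: "\<not> \<kappa> i \<le> \<mu> i"
  let ?Q = "\<lambda>j. 1 \<le> j \<and> 1 \<le> col n \<kappa> j \<and> \<mu> (col n \<kappa> j) < j"
  have "i \<le> col n \<kappa> (\<kappa> i)" using le_col_iff[OF \<kappa> i] by simp
  then have "?Q (\<kappa> i)" using lt partitions_antimono[OF \<mu>, of i "col n \<kappa> (\<kappa> i)"] i by auto
  define j where "j = (LEAST j. ?Q j)"
  have j: "?Q j" unfolding j_def by (rule LeastI) fact
  have jm: "j \<le> \<kappa> i" unfolding j_def by (rule Least_le) fact
  have "\<mu> (col n \<kappa> j) = j - 1"
  proof (cases "j = 1")
    case True then show ?thesis using j by simp
  next
    case False
    have le: "col n \<kappa> j \<le> col n \<kappa> (j - 1)" unfolding col_def by (intro card_mono) auto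
    have "\<not> ?Q (j - 1)" using not_less_Least[of "j - 1" ?Q] j unfolding j_def[symmetric] by auto
    then have "j - 1 \<le> \<mu> (col n \<kappa> (j - 1))" using le j False by auto
    also have "\<dots> \<le> \<mu> (col n \<kappa> j)" using partitions_antimono[OF \<mu> _ le] j by simp
    finally show ?thesis using j by linarith
  qed
  moreover have "j \<in> {1..m}" using j jm partitions_le[OF \<kappa>, of i] by auto
  ultimately show False using nz column_product_pt[OF g \<kappa> \<mu>] j by blast
qed

text \<open>One unknown for each partition and one equation for each node leave a nonzero
  combination. It is not the zero function: at the point of a \<open>\<kappa>\<close> of least size
  with nonzero coefficient only its own term survives. By unisolvence the full point is then no zero
  either.\<close>

lemma interp_space_nontrivial:
  assumes g: "generic_params p a b q t" and l: "l \<in> partitions_in m n"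
  obtains f where "f \<in> interp_space m n l a b q t" "f (full_pt m n l a b q t) \<noteq> 0"
proof -
  note nz = generic_nz[OF g]
  let ?P = "partitions_in m n" and ?F = "column_product m n a q t"
  have "card (?P - {l}) < card ?P" using l finite_partitions_in by (intro psubset_card_mono) auto
  from nontrivial_solution[OF _ finite_partitions_in this, where A = "\<lambda>\<mu> \<kappa>. ?F \<kappa> (vanishing_point m n l \<mu> a b q t)"]
  obtain c where c: "\<exists>\<kappa>\<in>?P. c \<kappa> \<noteq> 0"
    "\<And>\<mu>. \<mu> \<in> ?P - {l} \<Longrightarrow> (\<Sum>\<kappa>\<in>?P. c \<kappa> * ?F \<kappa> (vanishing_point m n l \<mu> a b q t)) = 0"
    using finite_partitions_in[of m n] by auto
  define f where "f = (\<lambda>x\<in>torus n. \<Sum>\<kappa>\<in>?P. c \<kappa> * ?F \<kappa> x)"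
  have f: "f \<in> interp_space m n l a b q t"
    unfolding interp_space_def
  proof (intro CollectI conjI ballI)
    show "f \<in> BC_theta m n p"
      unfolding f_def by (rule BC_theta_lincomb) (use column_product_BC_theta nz in auto)
    fix x assume x: "x \<in> node_set m n l a b q t"
    then show "f x = 0" using c(2) node_set_torus[OF g, of m n l] by (auto simp: f_def node_set_def)
  qed
  define size where "size \<kappa> = (\<Sum>i\<in>{1..n}. \<kappa> i)" for \<kappa> :: "nat \<Rightarrow> nat"
  obtain \<kappa> where \<kappa>: "\<kappa> \<in> ?P" "c \<kappa> \<noteq> 0" "\<And>\<kappa>'. \<kappa>' \<in> ?P \<Longrightarrow> c \<kappa>' \<noteq> 0 \<Longrightarrow> size \<kappa> \<le> size \<kappa>'"
    using ex_has_least_nat[of "\<lambda>\<kappa>. \<kappa> \<in> ?P \<and> c \<kappa> \<noteq> 0" _ size] c(1) by blast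
  let ?x = "pt m n 0 \<kappa> a b q t"
  have xt: "?x \<in> torus n" using nz by (intro pt_torus) auto
  have "c \<kappa>' * ?F \<kappa>' ?x = 0" if \<kappa>': "\<kappa>' \<in> ?P - {\<kappa>}" for \<kappa>'
  proof (rule ccontr)
    assume "c \<kappa>' * ?F \<kappa>' ?x \<noteq> 0"
    then have *: "c \<kappa>' \<noteq> 0" "?F \<kappa>' ?x \<noteq> 0" by auto
    have le: "\<kappa>' i \<le> \<kappa> i" if "i \<in> {1..n}" for i
      using column_product_triangular[OF g _ \<kappa>(1) *(2) that] \<kappa>' by blast
    obtain i where "i \<in> {1..n}" "\<kappa>' i \<noteq> \<kappa> i" using partitions_neq[of \<kappa>' m n \<kappa>] \<kappa>' \<kappa>(1) by blast
    then have "size \<kappa>' < size \<kappa>"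
      unfolding size_def using le by (intro sum_strict_mono_ex1) (auto intro!: bexI[of _ i] simp: le_neq_implies_less)
    then show False using \<kappa>(3)[of \<kappa>'] \<kappa>' *(1) by auto
  qed
  then have "(\<Sum>\<kappa>'\<in>?P - {\<kappa>}. c \<kappa>' * ?F \<kappa>' ?x) = 0" by (intro sum.neutral ballI)
  then have "f ?x = c \<kappa> * ?F \<kappa> ?x"
    using xt \<kappa>(1) finite_partitions_in by (simp add: f_def sum.remove[of ?P \<kappa>])
  then have "f ?x \<noteq> 0" using \<kappa>(2) column_product_self_nz[OF g \<kappa>(1)] by simp
  then have "f (full_pt m n l a b q t) \<noteq> 0" using interp_space_determined[OF g l f _ xt] by blast
  then show ?thesis using that f by blast
qed

subsection \<open>The action on interpolation functions up to scalars\<close>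

lemma mon_regular:
  assumes g: "generic_params p a b q t"
    and x: "\<And>r. r \<in> {1..n} \<Longrightarrow> x r = mon a b q t (i r) (j r) (k r) (l r)" and xt: "x \<in> torus n"
    and 1: "\<And>r. r \<in> {1..n} \<Longrightarrow> i r \<noteq> 0 \<or> j r \<noteq> 0"
    and 2: "\<And>r s. r \<in> {1..n} \<Longrightarrow> s \<in> {1..n} \<Longrightarrow> r < s \<Longrightarrow>
      (i r + i s \<noteq> 0 \<or> j r + j s \<noteq> 0) \<and> (i r \<noteq> i s \<or> j r \<noteq> j s \<or> l r \<noteq> l s)"
  shows "diff_op_regular n p x"
proof -
  note nz = generic_nz[OF g]
  have "x r * x r \<notin> pz" if "r \<in> {1..n}" for r
    using x[OF that] 1[OF that] nz g by (auto simp: mon_mult generic_mon_pz)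
  moreover have "x r \<notin> bad (x s)" if rs: "r \<in> {1..n}" "s \<in> {1..n}" "r \<noteq> s" for r s
  proof (cases "r < s")
    case True
    then show ?thesis
      using 2[OF rs(1,2)] x[OF rs(1)] x[OF rs(2)] nz g by (auto simp: bad_def mon_mult mon_divide generic_mon_pz)
  next
    case False
    then have "s < r" using rs by simp
    then show ?thesis
      using 2[OF rs(2,1)] x[OF rs(1)] x[OF rs(2)] nz g by (auto simp: bad_def mon_mult mon_divide generic_mon_pz)
  qed
  ultimately have "x \<in> reg_off {} n" using xt by (simp add: reg_off_def)
  then show ?thesis using reg_off_empty_iff by blast
qed

lemma pt_regular:
  assumes g: "generic_params p a b q t" and \<mu>: "\<mu> \<in> partitions_in m n"
  shows "diff_op_regular n p (pt m n k \<mu> a b q t)"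
proof (rule mon_regular[OF g])
  note nz = generic_nz[OF g]
  show "pt m n k \<mu> a b q t r = mon a b q t (if r \<le> k then 0 else 1) (if r \<le> k then 1 else 0)
    (if r \<le> k then int m - int (\<mu> r) else int (\<mu> r)) (if r \<le> k then int r - 1 else int n - int r)"
    if "r \<in> {1..n}" for r
    using pt_mon[of a b q t r n \<mu> m k] nz that partitions_le[OF \<mu>, of r] by simp
  show "pt m n k \<mu> a b q t \<in> torus n" using nz by (intro pt_torus) auto
qed auto

lemma dcoeff_all_plus:
  "dcoeff n a b c d t (all_plus n) x =
    (\<Prod>i\<in>{1..n}. th (c * x i) * th (d * x i)) *
    ((\<Prod>i\<in>{1..n}. th (a * x i) * th (b * x i) / th ((x i)\<^sup>2)) *
    (\<Prod>(i, j)\<in>{(i, j). 1 \<le> i \<and> i < j \<and> j \<le> n}. th (t * x i * x j) / th (x i * x j)))"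
proof -
  have "(\<Prod>i\<in>{1..n}.
        th (a * x i powi all_plus n i) * th (b * x i powi all_plus n i) *
        th (c * x i powi all_plus n i) * th (d * x i powi all_plus n i) /
        th (x i powi (2 * all_plus n i))) =
      (\<Prod>i\<in>{1..n}. (th (c * x i) * th (d * x i)) * (th (a * x i) * th (b * x i) / th ((x i)\<^sup>2)))"
    by (intro prod.cong) (auto simp: all_plus_def)
  moreover have "(\<Prod>(i, j)\<in>{(i, j). 1 \<le> i \<and> i < j \<and> j \<le> n}.
        th (t * x i powi all_plus n i * x j powi all_plus n j) / th (x i powi all_plus n i * x j powi all_plus n j)) =
      (\<Prod>(i, j)\<in>{(i, j). 1 \<le> i \<and> i < j \<and> j \<le> n}. th (t * x i * x j) / th (x i * x j))"
    by (intro prod.cong) (auto simp: all_plus_def)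
  ultimately show ?thesis by (simp only: dcoeff_def prod.distrib mult.assoc)
qed

definition balanced :: "nat \<Rightarrow> nat \<Rightarrow> complex \<Rightarrow> complex \<Rightarrow> complex \<Rightarrow> complex \<Rightarrow> complex \<Rightarrow> complex \<Rightarrow> bool" where
  "balanced m n a b c d q t \<longleftrightarrow> c \<noteq> 0 \<and> d \<noteq> 0 \<and> q ^ m * t powi (int n - 1) * a * b * c * d = p"

text \<open>The part of the eigenvalue that depends on \<open>c\<close>; the factors in
  \<open>a * b\<close> come out later as the constant \<open>K\<close>.\<close>

definition eig :: "nat \<Rightarrow> nat \<Rightarrow> (nat \<Rightarrow> nat) \<Rightarrow> complex \<Rightarrow> complex \<Rightarrow> complex \<Rightarrow> complex \<Rightarrow> complex \<Rightarrow> complex" where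
  "eig m n l a b c q t = (\<Prod>i\<in>{1..n}. th (a * c * q ^ l i * t ^ (n - i)) * th (b * c * q ^ (m - l i) * t ^ (i - 1)))"

lemma theta_p_over: "x * y = p \<Longrightarrow> th x = th y"
  by (metis nonzero_mult_div_cancel_right p_nz theta_p_divide mult_zero_right)

text \<open>By the balancing condition \<open>d * x i\<close> times one of the two arguments in
  \<open>eig\<close> is \<open>p\<close>, and \<open>th\<close> is invariant under
  \<open>y \<mapsto> p / y\<close>. Coordinates of \<open>a\<close> type and of \<open>b\<close>
  type yield the same two factors in different order.\<close>

lemma eig_at_full_pt:
  assumes g: "generic_params p a b q t" and l: "l \<in> partitions_in m n" and bal: "balanced m n a b c d q t"
  defines "x \<equiv> full_pt m n l a b q t"
  shows "(\<Prod>i\<in>{1..n}. th (c * x i) * th (d * x i)) = eig m n l a b c q t"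
  unfolding eig_def
proof (rule prod.cong[OF refl])
  fix i assume i: "i \<in> {1..n}"
  have li: "l i \<le> m" by (rule partitions_le[OF l])
  have "int n - 1 = int ((n - i) + (i - 1))" using i by simp
  then have tn: "t powi (int n - 1) = t ^ (n - i) * t ^ (i - 1)" by (simp only: power_int_of_nat power_add)
  have qm: "q ^ m = q ^ l i * q ^ (m - l i)" using li by (simp add: power_add[symmetric])
  have prod: "(d * (a * q ^ l i * t ^ (n - i))) * (b * c * q ^ (m - l i) * t ^ (i - 1)) = p"
    "(d * (b * q ^ (m - l i) * t ^ (i - 1))) * (a * c * q ^ l i * t ^ (n - i)) = p"
    using bal unfolding balanced_def tn qm by (simp_all add: mult_ac)
  show "th (c * x i) * th (d * x i) = th (a * c * q ^ l i * t ^ (n - i)) * th (b * c * q ^ (m - l i) * t ^ (i - 1))"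
  proof (cases "i \<le> full_length m n l")
    case True
    then have "x i = b * q ^ (m - l i) * t ^ (i - 1)" using i by (simp add: x_def full_pt_def pt_def)
    then show ?thesis using theta_p_over[OF prod(2)] by (simp add: mult_ac)
  next
    case False
    then have "x i = a * q ^ l i * t ^ (n - i)" using i by (simp add: x_def full_pt_def pt_def)
    then show ?thesis using theta_p_over[OF prod(1)] by (simp add: mult_ac)
  qed
qed

text \<open>\<open>G\<close> is the image extended across the poles of the coefficients. The nodes
  are regular points, so its vanishing there can be checked on the operator itself.\<close>

lemma diff_op_interp_space:
  assumes g: "generic_params p a b q t" and sq: "sq\<^sup>2 = q" and l: "l \<in> partitions_in m n"
    and bal: "balanced m n a b c d q t" and fI: "f \<in> interp_space m n l (sq * a) (sq * b) q t"
  obtains G where "G \<in> interp_space m n l a b q t"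
    "\<And>x. x \<in> torus n \<Longrightarrow> diff_op_regular n p x \<Longrightarrow> G x = diff_op n a b c d sq t p f x"
proof -
  note nz = generic_nz[OF g]
  have "sq \<noteq> 0" using sq nz by auto
  then interpret balanced_operator p a b c d sq t q m n f
    using nz sq bal interp_spaceD(1)[OF fI] by unfold_locales (auto simp: balanced_def)
  obtain G where G: "G \<in> BC_theta m n p"
    "\<And>x. x \<in> torus n \<Longrightarrow> diff_op_regular n p x \<Longrightarrow> G x = diff_op n a b c d sq t p f x"
    by (rule diff_op_BC_theta) blast
  have "G x = 0" if x: "x \<in> node_set m n l a b q t" for x
  proof -
    obtain \<mu> k where \<mu>: "\<mu> \<in> partitions_in m n" "x = pt m n k \<mu> a b q t"
      using x unfolding node_set_def vanishing_point_eq_pt by blast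
    then have "diff_op_regular n p x" using pt_regular[OF g] by simp
    then have "G x = diff_op n a b c d sq t p f x" using G(2) x node_set_torus[OF g] by blast
    then show ?thesis using diff_op_vanishes_at_node[OF g sq l fI x] by simp
  qed
  then have "G \<in> interp_space m n l a b q t" using G(1) by (simp add: interp_space_def)
  then show ?thesis using that G(2) by blast
qed

text \<open>The constant is read off at the full point, where a single term survives. It is chosen
  before \<open>c\<close> and \<open>d\<close>, and this independence later allows \<open>c\<close>
  to vary.\<close>

lemma diff_op_eigen:
  assumes g: "generic_params p a b q t" and sq: "sq\<^sup>2 = q" and l: "l \<in> partitions_in m n"
    and f: "f \<in> interp_space m n l (sq * a) (sq * b) q t" "f (full_pt m n l (sq * a) (sq * b) q t) \<noteq> 0"
    and h: "h \<in> interp_space m n l a b q t" "h (full_pt m n l a b q t) \<noteq> 0"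
  shows "\<exists>K. K \<noteq> 0 \<and> (\<forall>c d x. balanced m n a b c d q t \<longrightarrow> x \<in> torus n \<longrightarrow> diff_op_regular n p x \<longrightarrow>
      diff_op n a b c d sq t p f x = K * eig m n l a b c q t * h x)"
proof -
  note nz = generic_nz[OF g]
  let ?x = "full_pt m n l a b q t"
  have xt: "?x \<in> torus n" by (rule full_pt_torus[OF g])
  have reg: "diff_op_regular n p ?x" unfolding full_pt_def by (rule pt_regular[OF g l])
  define E where "E = (\<Prod>i\<in>{1..n}. th (a * ?x i) * th (b * ?x i) / th ((?x i)\<^sup>2)) *
    (\<Prod>(i, j)\<in>{(i, j). 1 \<le> i \<and> i < j \<and> j \<le> n}. th (t * ?x i * ?x j) / th (?x i * ?x j))"
  have x: "?x i = mon a b q t (if i \<le> full_length m n l then 0 else 1) (if i \<le> full_length m n l then 1 else 0)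
      (if i \<le> full_length m n l then int m - int (l i) else int (l i))
      (if i \<le> full_length m n l then int i - 1 else int n - int i)" if "i \<in> {1..n}" for i
    using pt_mon[of a b q t i n l m "full_length m n l"] nz that partitions_le[OF l, of i] by (simp add: full_pt_def)
  have "E \<noteq> 0"
  proof -
    have ab: "mon a b q t 1 0 0 0 = a" "mon a b q t 0 1 0 0 = b" "mon a b q t 0 0 0 1 = t" by (simp_all add: mon_basis)
    have "th (mon a b q t 1 0 0 0 * ?x i) * th (mon a b q t 0 1 0 0 * ?x i) / th ((?x i)\<^sup>2) \<noteq> 0" if i: "i \<in> {1..n}" for i
      unfolding x[OF i] using nz g by (auto simp: mon_mult mon_power generic_theta_mon)
    moreover have "th (mon a b q t 0 0 0 1 * ?x i * ?x j) / th (?x i * ?x j) \<noteq> 0" if "1 \<le> i" "i < j" "j \<le> n" for i j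
    proof -
      have ij: "i \<in> {1..n}" "j \<in> {1..n}" using that by auto
      show ?thesis
        unfolding x[OF ij(1)] x[OF ij(2)] using nz g by (auto simp: mon_mult mon_power generic_theta_mon)
    qed
    ultimately have "(\<Prod>i\<in>{1..n}. th (a * ?x i) * th (b * ?x i) / th ((?x i)\<^sup>2)) \<noteq> 0"
      "(\<Prod>(i, j)\<in>{(i, j). 1 \<le> i \<and> i < j \<and> j \<le> n}. th (t * ?x i * ?x j) / th (?x i * ?x j)) \<noteq> 0"
      unfolding ab by (simp, subst prod_zero_iff[OF finite_index_pairs]) auto
    then show ?thesis by (simp add: E_def)
  qed
  define K where "K = E * f (full_pt m n l (sq * a) (sq * b) q t) / h ?x"
  show ?thesis
  proof (intro exI[of _ K] conjI allI impI)
    show "K \<noteq> 0" using \<open>E \<noteq> 0\<close> f h by (simp add: K_def)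
    fix c d x assume bal: "balanced m n a b c d q t" and x: "x \<in> torus n" "diff_op_regular n p x"
    obtain G where G: "G \<in> interp_space m n l a b q t"
      "\<And>x. x \<in> torus n \<Longrightarrow> diff_op_regular n p x \<Longrightarrow> G x = diff_op n a b c d sq t p f x"
      using diff_op_interp_space[OF g sq l bal f(1)] by blast
    have "G ?x = eig m n l a b c q t * E * f (full_pt m n l (sq * a) (sq * b) q t)"
      unfolding G(2)[OF xt reg] diff_op_at_full_pt[OF g sq l f(1)] dcoeff_all_plus
        eig_at_full_pt[OF g l bal] E_def by (simp add: mult_ac)
    then have "G x = K * eig m n l a b c q t * h x"
      using interp_space_proportional[OF g l G(1) h x(1)] by (simp add: K_def mult_ac)
    then show "diff_op n a b c d sq t p f x = K * eig m n l a b c q t * h x" using G(2)[OF x] by simp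
  qed
qed

end

subsection \<open>Values on the principal specialization\<close>

lemma mon_inverse: "1 / mon a b q t i j k l = mon a b q t (- i) (- j) (- k) (- l)"
  by (simp add: mon_def power_int_minus divide_inverse)

definition diag :: "nat \<Rightarrow> complex \<Rightarrow> complex \<Rightarrow> nat \<Rightarrow> complex" where
  "diag n v t = (\<lambda>i\<in>{1..n}. v * t ^ (n - i))"

lemma diag_torus: "v \<noteq> 0 \<Longrightarrow> t \<noteq> 0 \<Longrightarrow> diag n v t \<in> torus n"
  unfolding diag_def by (intro torusI) auto

lemma diag_powi: "i \<in> {1..n} \<Longrightarrow> diag n v t i = v * t powi (int n - int i)"
  by (simp add: diag_def power_int_of_nat[symmetric] of_nat_diff del: power_int_of_nat)

lemma prod_telescope_divide:
  fixes g :: "nat \<Rightarrow> 'a::field"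
  assumes "i \<le> n" "\<And>j. i < j \<Longrightarrow> j \<le> Suc n \<Longrightarrow> g j \<noteq> 0"
  shows "(\<Prod>j\<in>{Suc i..n}. g j / g (Suc j)) = g (Suc i) / g (Suc n)"
  using assms
proof (induction n rule: dec_induct)
  case base
  then show ?case by simp
next
  case (step n)
  have "{Suc i..Suc n} = insert (Suc n) {Suc i..n}" using step(1) by auto
  then have "(\<Prod>j\<in>{Suc i..Suc n}. g j / g (Suc j)) = g (Suc n) / g (Suc (Suc n)) * (g (Suc i) / g (Suc n))"
    using step by simp
  then show ?case using step(4)[of "Suc n"] step(1) by simp
qed

lemma prod_index_pairs:
  "(\<Prod>(i, j)\<in>{(i, j). 1 \<le> i \<and> i < j \<and> j \<le> (n::nat)}. h i j) = (\<Prod>i\<in>{1..n}. \<Prod>j\<in>{Suc i..n}. h i j)"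
proof -
  have "{(i, j). 1 \<le> i \<and> i < j \<and> j \<le> n} = Sigma {1..n} (\<lambda>i. {Suc i..n})" by auto
  then show ?thesis by (simp add: prod.Sigma)
qed

context nome
begin

text \<open>Makes the points \<open>diag n c t\<close> regular, and the factors cancelled in
  \<open>dcoeff_diag_all_plus\<close> nonzero, for all \<open>n\<close> at once.\<close>

definition diag_ok :: "complex \<Rightarrow> complex \<Rightarrow> bool" where
  "diag_ok c t \<longleftrightarrow> c \<noteq> 0 \<and> t \<noteq> 0 \<and> (\<forall>k::int. c * c * t powi k \<notin> pz) \<and> (\<forall>k::int. t powi k \<in> pz \<longrightarrow> k = 0)"

lemma diag_regular:
  assumes "diag_ok c t"
  shows "diff_op_regular n p (diag n c t)"
proof -
  have nz: "c \<noteq> 0" "t \<noteq> 0" using assms by (auto simp: diag_ok_def)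
  have mult: "diag n c t r * diag n c t s = c * c * t powi (2 * int n - int r - int s)"
    if "r \<in> {1..n}" "s \<in> {1..n}" for r s
    unfolding diag_powi[OF that(1)] diag_powi[OF that(2)] using nz
    by (simp add: power_int_diff power_int_add power_int_mult field_simps power2_eq_square)
  have div: "diag n c t r / diag n c t s = t powi (int s - int r)"
    if "r \<in> {1..n}" "s \<in> {1..n}" for r s
    unfolding diag_powi[OF that(1)] diag_powi[OF that(2)] using nz
    by (simp add: power_int_diff)
  have "diag n c t \<in> reg_off {} n"
    unfolding reg_off_def bad_def
    using assms diag_torus[OF nz] mult div by (auto simp: diag_ok_def)
  then show ?thesis using reg_off_empty_iff by blast
qed

text \<open>For fixed \<open>i\<close> the pair factors telescope in \<open>j\<close>, and what
  remains cancels the quotient of \<open>th (c * ?x i)\<close> by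
  \<open>th ((?x i)\<^sup>2)\<close>. The factor with \<open>d\<close> becomes one in
  \<open>a * b\<close> by the balancing condition.\<close>

lemma dcoeff_diag_all_plus:
  assumes ok: "diag_ok c t" and bal: "balanced m n a b c d q t"
  shows "dcoeff n a b c d t (all_plus n) (diag n c t) =
    (\<Prod>i\<in>{1..n}. th (a * b * q ^ m * t ^ (i - 1)) * th (a * c * t ^ (n - i)) * th (b * c * t ^ (n - i)))"
proof -
  have nz: "c \<noteq> 0" "t \<noteq> 0" using ok by (auto simp: diag_ok_def)
  let ?x = "diag n c t"
  define T where "T k = th (c * c * t powi k)" for k :: int
  have T: "T k \<noteq> 0" for k using ok nz unfolding T_def diag_ok_def by (subst theta_eq_0_iff) auto
  have 1: "th (c * ?x i) = T (int n - int i)" if "i \<in> {1..n}" for i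
    using diag_powi[OF that] by (simp add: T_def mult.assoc)
  have 2: "th ((?x i)\<^sup>2) = T (2 * int n - 2 * int i)" if "i \<in> {1..n}" for i
  proof -
    have "t powi (int n - int i) * t powi (int n - int i) = t powi (2 * int n - 2 * int i)"
      using nz by (simp flip: power_int_add)
    moreover have "(c * X)\<^sup>2 = c * c * (X * X)" for X by (simp add: power2_eq_square mult_ac)
    ultimately show ?thesis unfolding diag_powi[OF that] T_def by simp
  qed
  have 3: "th (t * ?x i * ?x j) / th (?x i * ?x j) =
      T (2 * int n - int i - int j + 1) / T (2 * int n - int i - int (Suc j) + 1)"
    if "i \<in> {1..n}" "j \<in> {Suc i..n}" for i j
  proof -
    have j: "j \<in> {1..n}" using that by auto
    have "?x i * ?x j = c * c * t powi (2 * int n - int i - int j)"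
      unfolding diag_powi[OF that(1)] diag_powi[OF j] using nz
      by (simp add: power_int_diff power_int_add power_int_mult field_simps power2_eq_square)
    moreover from this have "t * ?x i * ?x j = c * c * t powi (2 * int n - int i - int j + 1)"
      using nz by (simp add: power_int_add mult_ac)
    moreover have "2 * int n - int i - int (Suc j) + 1 = 2 * int n - int i - int j" by simp
    ultimately show ?thesis by (simp only: T_def)
  qed
  have pairs: "(\<Prod>(i, j)\<in>{(i, j). 1 \<le> i \<and> i < j \<and> j \<le> n}. th (t * ?x i * ?x j) / th (?x i * ?x j)) =
      (\<Prod>i\<in>{1..n}. T (2 * int n - 2 * int i) / T (int n - int i))"
    unfolding prod_index_pairs
  proof (rule prod.cong[OF refl])
    fix i assume i: "i \<in> {1..n}"
    have "(\<Prod>j\<in>{Suc i..n}. th (t * ?x i * ?x j) / th (?x i * ?x j)) =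
        (\<Prod>j\<in>{Suc i..n}. T (2 * int n - int i - int j + 1) / T (2 * int n - int i - int (Suc j) + 1))"
      using 3[OF i] by (intro prod.cong) auto
    also have "\<dots> = T (2 * int n - int i - int (Suc i) + 1) / T (2 * int n - int i - int (Suc n) + 1)"
      by (rule prod_telescope_divide[where g = "\<lambda>j. T (2 * int n - int i - int j + 1)"]) (use i T in auto)
    also have "2 * int n - int i - int (Suc i) + 1 = 2 * int n - 2 * int i" by simp
    also have "2 * int n - int i - int (Suc n) + 1 = int n - int i" by simp
    finally show "(\<Prod>j\<in>{Suc i..n}. th (t * ?x i * ?x j) / th (?x i * ?x j)) = T (2 * int n - 2 * int i) / T (int n - int i)" .
  qed
  have "dcoeff n a b c d t (all_plus n) ?x =
      (\<Prod>i\<in>{1..n}. (th (c * ?x i) * th (d * ?x i)) * (th (a * ?x i) * th (b * ?x i) / th ((?x i)\<^sup>2)) *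
        (T (2 * int n - 2 * int i) / T (int n - int i)))"
    unfolding dcoeff_all_plus pairs by (simp only: prod.distrib mult.assoc)
  also have "\<dots> = (\<Prod>i\<in>{1..n}. th (a * b * q ^ m * t ^ (i - 1)) * th (a * c * t ^ (n - i)) * th (b * c * t ^ (n - i)))"
  proof (rule prod.cong[OF refl])
    fix i assume i: "i \<in> {1..n}"
    have "int n - 1 = int ((n - i) + (i - 1))" using i by simp
    then have tn: "t powi (int n - 1) = t ^ (n - i) * t ^ (i - 1)" by (simp only: power_int_of_nat power_add)
    have "(d * (c * t ^ (n - i))) * (a * b * q ^ m * t ^ (i - 1)) = p"
      using bal unfolding balanced_def tn by (simp add: mult_ac)
    then have d: "th (d * ?x i) = th (a * b * q ^ m * t ^ (i - 1))"
      using theta_p_over i by (simp add: diag_def)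
    have "th (a * ?x i) = th (a * c * t ^ (n - i))" "th (b * ?x i) = th (b * c * t ^ (n - i))"
      using i by (simp_all add: diag_def mult.assoc)
    then show "(th (c * ?x i) * th (d * ?x i)) * (th (a * ?x i) * th (b * ?x i) / th ((?x i)\<^sup>2)) *
        (T (2 * int n - 2 * int i) / T (int n - int i)) =
        th (a * b * q ^ m * t ^ (i - 1)) * th (a * c * t ^ (n - i)) * th (b * c * t ^ (n - i))"
      unfolding 1[OF i] 2[OF i] d using T by (simp add: field_simps)
  qed
  finally show ?thesis .
qed

text \<open>A sign \<open>-1\<close> in the last place produces \<open>th 1\<close> in the factor
  with \<open>c\<close>. A sign \<open>-1\<close> followed by \<open>1\<close> produces
  \<open>th 1\<close> in the factor of these neighbours, whose coordinates have ratio
  \<open>t\<close>. Going down from \<open>n\<close>, all signs must be \<open>1\<close>.\<close>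

lemma diff_op_diag:
  assumes ok: "diag_ok c t" and bal: "balanced m n a b c d q t"
  shows "diff_op n a b c d sq t p f (diag n c t) =
    (\<Prod>i\<in>{1..n}. th (a * b * q ^ m * t ^ (i - 1)) * th (a * c * t ^ (n - i)) * th (b * c * t ^ (n - i))) *
    f (diag n (sq * c) t)"
proof -
  have nz: "c \<noteq> 0" "t \<noteq> 0" using ok by (auto simp: diag_ok_def)
  let ?x = "diag n c t"
  have "dcoeff n a b c d t \<sigma> ?x * f (shift_pt n sq \<sigma> ?x) = 0" if \<sigma>: "\<sigma> \<in> signs n - {all_plus n}" for \<sigma>
  proof (cases "dcoeff n a b c d t \<sigma> ?x = 0")
    case False
    have s: "\<sigma> i = 1 \<or> \<sigma> i = -1" if "i \<in> {1..n}" for i using signs_cases[of \<sigma> n i] \<sigma> that by blast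
    have "\<sigma> i = 1" if i: "1 \<le> i" "i \<le> n" for i
      using i(2) i(1)
    proof (induction i rule: inc_induct)
      case base
      have "\<sigma> n \<noteq> -1"
      proof
        assume "\<sigma> n = -1"
        then show False using dcoeff_nz_single(3)[OF False, of n] base nz by (simp add: diag_def)
      qed
      then show ?case using s[of n] base by auto
    next
      case (step r)
      have "\<sigma> r \<noteq> -1"
      proof
        assume r: "\<sigma> r = -1"
        have "n - r = Suc (n - Suc r)" using step by simp
        then have "?x r = t * ?x (Suc r)" using step by (simp add: diag_def)
        moreover have "?x (Suc r) \<noteq> 0" using step nz by (simp add: diag_def)
        ultimately have "t * ?x r powi \<sigma> r * ?x (Suc r) powi \<sigma> (Suc r) = 1"
          using r step nz by (simp add: field_simps)
        then show False using dcoeff_nz_pair[OF False, of r "Suc r"] step by simp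
      qed
      then show ?case using s[of r] step by auto
    qed
    then have "\<sigma> = all_plus n"
      using \<sigma> by (auto simp: signs_def all_plus_def PiE_def extensional_def fun_eq_iff)
    then show ?thesis using \<sigma> by simp
  qed simp
  then have "(\<Sum>\<sigma>\<in>signs n - {all_plus n}. dcoeff n a b c d t \<sigma> ?x * f (shift_pt n sq \<sigma> ?x)) = 0"
    by (intro sum.neutral ballI)
  then have "diff_op n a b c d sq t p f ?x =
      dcoeff n a b c d t (all_plus n) ?x * f (shift_pt n sq (all_plus n) ?x)"
    unfolding diff_op_dcoeff by (subst sum.remove[OF finite_signs all_plus_signs]) simp
  moreover have "shift_pt n sq (all_plus n) ?x = diag n (sq * c) t"
    by (auto simp: shift_pt_def all_plus_def diag_def fun_eq_iff)
  ultimately show ?thesis using dcoeff_diag_all_plus[OF ok bal] by simp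
qed

lemma balanced_exists:
  assumes "a \<noteq> 0" "b \<noteq> 0" "c \<noteq> 0" "q \<noteq> 0" "t \<noteq> 0"
  shows "\<exists>d. balanced m n a b c d q t"
  by (rule exI[of _ "p / (q ^ m * t powi (int n - 1) * a * b * c)"]) (use assms in \<open>simp add: balanced_def\<close>)

text \<open>For each \<open>c\<close> some \<open>d\<close> balances the operator, and the value on
  \<open>diag n c t\<close> has already been written without \<open>d\<close>.\<close>

lemma diag_functional_equation:
  assumes g: "generic_params p a b q t" and sq: "sq\<^sup>2 = q" and l: "l \<in> partitions_in m n"
    and f: "f \<in> interp_space m n l (sq * a) (sq * b) q t" "f (full_pt m n l (sq * a) (sq * b) q t) \<noteq> 0"
    and h: "h \<in> interp_space m n l a b q t" "h (full_pt m n l a b q t) \<noteq> 0"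
  shows "\<exists>K. K \<noteq> 0 \<and>
    (\<forall>c. diag_ok c t \<longrightarrow> K * eig m n l a b c q t * h (diag n c t) =
      (\<Prod>i\<in>{1..n}. th (a * b * q ^ m * t ^ (i - 1)) * th (a * c * t ^ (n - i)) * th (b * c * t ^ (n - i))) *
      f (diag n (sq * c) t)) \<and>
    (\<forall>c d x. balanced m n a b c d q t \<longrightarrow> x \<in> torus n \<longrightarrow> diff_op_regular n p x \<longrightarrow>
      diff_op n a b c d sq t p f x = K * eig m n l a b c q t * h x)"
proof -
  note nz = generic_nz[OF g]
  obtain K where K: "K \<noteq> 0"
    "\<forall>c d x. balanced m n a b c d q t \<longrightarrow> x \<in> torus n \<longrightarrow> diff_op_regular n p x \<longrightarrow>
      diff_op n a b c d sq t p f x = K * eig m n l a b c q t * h x"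
    using diff_op_eigen[OF g sq l f h] by (elim exE conjE)
  have "K * eig m n l a b c q t * h (diag n c t) =
      (\<Prod>i\<in>{1..n}. th (a * b * q ^ m * t ^ (i - 1)) * th (a * c * t ^ (n - i)) * th (b * c * t ^ (n - i))) *
      f (diag n (sq * c) t)" if ok: "diag_ok c t" for c
  proof -
    have c: "c \<noteq> 0" using ok by (simp add: diag_ok_def)
    obtain d where bal: "balanced m n a b c d q t" using balanced_exists nz c by blast
    show ?thesis
      using K(2)[rule_format, OF bal diag_torus diag_regular[OF ok]] diff_op_diag[OF ok bal, of sq f] c nz by simp
  qed
  with K show ?thesis by (intro exI[of _ K] conjI allI impI) simp_all
qed

lemma generic_diag_ok:
  assumes g: "generic_params p a b q t" and c: "c = mon a b q t i j k l" and ij: "i \<noteq> 0 \<or> j \<noteq> 0"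
  shows "diag_ok c t"
proof -
  note nz = generic_nz[OF g]
  have t: "t powi r = mon a b q t 0 0 0 r" for r by (simp add: mon_def)
  show ?thesis
    unfolding diag_ok_def c t using nz mon_nz g ij by (auto simp: mon_mult generic_mon_pz)
qed

lemma eig_eq_0_iff:
  assumes "a \<noteq> 0" "b \<noteq> 0" "c \<noteq> 0" "q \<noteq> 0" "t \<noteq> 0"
  shows "eig m n l a b c q t = 0 \<longleftrightarrow>
    (\<exists>i\<in>{1..n}. a * c * q ^ l i * t ^ (n - i) \<in> pz \<or> b * c * q ^ (m - l i) * t ^ (i - 1) \<in> pz)"
  using assms by (auto simp: eig_def theta_eq_0_iff)

text \<open>A zero \<open>v\<close> of the factor of the box \<open>(i, j)\<close> in
  \<open>C0 \<kappa> (t powi (int n - 1) * u * v) q t p\<close>.\<close>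

definition dzero :: "nat \<Rightarrow> complex \<Rightarrow> complex \<Rightarrow> complex \<Rightarrow> nat \<Rightarrow> nat \<Rightarrow> complex" where
  "dzero n u q t i j = 1 / (u * q ^ (j - 1) * t ^ (n - i))"

lemma sq_dzero:
  assumes "sq\<^sup>2 = q" "u \<noteq> 0" "q \<noteq> 0" "t \<noteq> 0" "1 \<le> j"
  shows "sq * dzero n u q t i (Suc j) = dzero n (sq * u) q t i j"
proof -
  have "sq \<noteq> 0" using assms by auto
  moreover have "q ^ j = sq\<^sup>2 * q ^ (j - 1)" using assms by (cases j) auto
  ultimately show ?thesis using assms by (simp add: dzero_def power2_eq_square field_simps)
qed

text \<open>The functional equation can be divided by \<open>eig\<close>, which does not vanish at the zeros in question.\<close>

lemma diag_zeros_step: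
  assumes g: "generic_params p a b q t" and l: "l \<in> partitions_in m n" and h: "h \<in> interp_space m n l a b q t"
    and i: "i \<in> {1..n}" and j: "1 \<le> j"
    and sq: "sq\<^sup>2 = q" and u: "u = a \<and> j \<le> l i \<or> u = b \<and> j \<le> compl_part m n l i"
    and IH: "\<And>f. j \<noteq> 1 \<Longrightarrow> f \<in> interp_space m n l (sq * a) (sq * b) q t \<Longrightarrow>
      f (diag n (sq * dzero n u q t i j) t) = 0"
  shows "h (diag n (dzero n u q t i j) t) = 0"
proof (cases "h (full_pt m n l a b q t) = 0")
  case True
  have "u \<noteq> 0" using u generic_nz[OF g] by auto
  then have "dzero n u q t i j \<noteq> 0" using generic_nz[OF g] by (simp add: dzero_def)
  then show ?thesis using interp_space_determined[OF g l h True diag_torus] generic_nz[OF g] by blast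
next
  case False
  note nz = generic_nz[OF g]
  let ?c = "dzero n u q t i j"
  have c_nz: "?c \<noteq> 0" using u nz by (auto simp: dzero_def)
  obtain f where f: "f \<in> interp_space m n l (sq * a) (sq * b) q t" "f (full_pt m n l (sq * a) (sq * b) q t) \<noteq> 0"
    using interp_space_nontrivial[OF generic_sqrt(1)[OF g sq] l] by blast
  obtain K where K: "K \<noteq> 0"
    "\<forall>c. diag_ok c t \<longrightarrow> K * eig m n l a b c q t * h (diag n c t) =
      (\<Prod>i\<in>{1..n}. th (a * b * q ^ m * t ^ (i - 1)) * th (a * c * t ^ (n - i)) * th (b * c * t ^ (n - i))) *
      f (diag n (sq * c) t)"
    using diag_functional_equation[OF g sq l f h False] by (elim exE conjE)
  have qt: "q ^ r = mon a b q t 0 0 (int r) 0" "t ^ r = mon a b q t 0 0 0 (int r)" for r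
    by (simp_all add: mon_def)
  have cm: "?c = mon a b q t (if u = a then -1 else 0) (if u = a then 0 else -1) (1 - int j) (int i - int n)"
  proof -
    have "u = mon a b q t (if u = a then 1 else 0) (if u = a then 0 else 1) 0 0" using u by (auto simp: mon_basis)
    then have "?c = mon a b q t 0 0 0 0 / (mon a b q t (if u = a then 1 else 0) (if u = a then 0 else 1) 0 0 *
        q ^ (j - 1) * t ^ (n - i))"
      by (simp add: dzero_def)
    then show ?thesis unfolding qt using nz i j by (simp add: mon_mult mon_inverse of_nat_diff)
  qed
  have ok: "diag_ok ?c t" by (rule generic_diag_ok[OF g cm]) auto
  have ab: "a \<noteq> b"
    using generic_mon_pz[OF g, of 1 "-1" 0 0] nz by (auto simp: mon_def)
  \<comment> \<open>A zero of \<open>eig\<close> here would force the part in question,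
    \<open>l i\<close> or \<open>compl_part m n l i\<close>, to equal \<open>j - 1\<close>, while it
    is at least \<open>j\<close>.\<close>
  have E: "eig m n l a b ?c q t \<noteq> 0"
  proof
    assume "eig m n l a b ?c q t = 0"
    then obtain r where r: "r \<in> {1..n}"
      "a * ?c * q ^ l r * t ^ (n - r) \<in> pz \<or> b * ?c * q ^ (m - l r) * t ^ (r - 1) \<in> pz"
      using eig_eq_0_iff nz c_nz by auto
    have lr: "l r \<le> m" by (rule partitions_le[OF l])
    have 1: "a * ?c * q ^ l r * t ^ (n - r) = mon a b q t 1 0 0 0 * ?c * q ^ l r * t ^ (n - r)"
      "b * ?c * q ^ (m - l r) * t ^ (r - 1) = mon a b q t 0 1 0 0 * ?c * q ^ (m - l r) * t ^ (r - 1)"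
      by (simp_all add: mon_basis)
    from r(2) have "u = a \<and> 1 - int j + int (l r) = 0 \<and> i = r \<or>
        u = b \<and> 1 - int j + (int m - int (l r)) = 0 \<and> int i - int n + (int r - 1) = 0"
      unfolding 1 unfolding cm qt using nz g u r(1) i j ab lr
      by (auto simp: mon_mult generic_mon_pz of_nat_diff)
    then show False
    proof (elim disjE conjE)
      assume "u = a" "1 - int j + int (l r) = 0" "i = r"
      then show False using u ab by auto
    next
      assume *: "u = b" "1 - int j + (int m - int (l r)) = 0" "int i - int n + (int r - 1) = 0"
      then have "n + 1 - i = r" using i by simp
      then have "compl_part m n l i = m - l r" using i by (simp add: compl_part_def)
      then have "j \<le> m - l r" using u *(1) ab by simp
      then show False using * lr by simp
    qed
  qed
  \<comment> \<open>For the first column the explicit product vanishes; for later columns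
    \<open>f\<close> does, because the factor \<open>sq\<close> moves the box one column
    back.\<close>
  have Z: "(\<Prod>i\<in>{1..n}. th (a * b * q ^ m * t ^ (i - 1)) * th (a * ?c * t ^ (n - i)) * th (b * ?c * t ^ (n - i))) *
      f (diag n (sq * ?c) t) = 0"
  proof (cases "j = 1")
    case True
    then have "a * ?c * t ^ (n - i) = 1 \<or> b * ?c * t ^ (n - i) = 1"
      using u nz by (auto simp: dzero_def)
    then have "th (a * ?c * t ^ (n - i)) = 0 \<or> th (b * ?c * t ^ (n - i)) = 0" by (metis theta_1)
    then show ?thesis using i by (auto intro!: prod_zero bexI[of _ i])
  next
    case j1: False
    then show ?thesis using IH[OF j1 f(1)] by simp
  qed
  have "K * eig m n l a b ?c q t * h (diag n ?c t) = 0"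
    using K(2)[rule_format, OF ok] unfolding Z .
  then show ?thesis using E K(1) by simp
qed

text \<open>Induction along a row: by \<open>sq_dzero\<close>, column \<open>j + 1\<close> for
  \<open>a\<close>, \<open>b\<close> becomes column \<open>j\<close> for \<open>sq * a\<close>,
  \<open>sq * b\<close>. The parameters therefore vary in the induction.\<close>

lemma diag_zeros:
  assumes g: "generic_params p a b q t" and l: "l \<in> partitions_in m n" and h: "h \<in> interp_space m n l a b q t"
    and i: "i \<in> {1..n}" and j: "1 \<le> j"
  shows "j \<le> l i \<Longrightarrow> h (diag n (dzero n a q t i j) t) = 0"
    and "j \<le> compl_part m n l i \<Longrightarrow> h (diag n (dzero n b q t i j) t) = 0"
proof -
  define sq where "sq = csqrt q"
  have sq: "sq\<^sup>2 = q" by (simp add: sq_def)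
  have "(j \<le> l i \<longrightarrow> h (diag n (dzero n a q t i j) t) = 0) \<and>
    (j \<le> compl_part m n l i \<longrightarrow> h (diag n (dzero n b q t i j) t) = 0)"
    using j g h
  proof (induction j arbitrary: a b h rule: dec_induct)
    case base
    then show ?case using diag_zeros_step[OF base(1) l base(2) i _ sq, of 1] by auto
  next
    case (step j)
    note nz = generic_nz[OF step.prems(1)]
    have IH: "(j \<le> l i \<longrightarrow> f (diag n (dzero n (sq * a) q t i j) t) = 0) \<and>
        (j \<le> compl_part m n l i \<longrightarrow> f (diag n (dzero n (sq * b) q t i j) t) = 0)"
      if "f \<in> interp_space m n l (sq * a) (sq * b) q t" for f
      using step.IH[OF generic_sqrt(1)[OF step.prems(1) sq] that] .
    have "h (diag n (dzero n a q t i (Suc j)) t) = 0" if "Suc j \<le> l i"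
      by (rule diag_zeros_step[OF step.prems(1) l step.prems(2) i _ sq])
        (use that IH nz step.hyps in \<open>auto simp: sq_dzero[OF sq]\<close>)
    moreover have "h (diag n (dzero n b q t i (Suc j)) t) = 0" if "Suc j \<le> compl_part m n l i"
      by (rule diag_zeros_step[OF step.prems(1) l step.prems(2) i _ sq])
        (use that IH nz step.hyps in \<open>auto simp: sq_dzero[OF sq]\<close>)
    ultimately show ?case by blast
  qed
  then show "j \<le> l i \<Longrightarrow> h (diag n (dzero n a q t i j) t) = 0"
    "j \<le> compl_part m n l i \<Longrightarrow> h (diag n (dzero n b q t i j) t) = 0" by auto
qed

end

subsection \<open>Nonvanishing on the principal specialization\<close>

text \<open>Monomials with a fifth quantity \<open>v\<close>, the position on the principal
  specialization.\<close>

definition mon5 :: "complex \<Rightarrow> complex \<Rightarrow> complex \<Rightarrow> complex \<Rightarrow> complex \<Rightarrow> int \<Rightarrow> int \<Rightarrow> int \<Rightarrow> int \<Rightarrow> int \<Rightarrow> complex" where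
  "mon5 v a b q t e i j k l = v powi e * mon a b q t i j k l"

context
  fixes v a b q t :: complex
  assumes nz: "v \<noteq> 0" "a \<noteq> 0" "b \<noteq> 0" "q \<noteq> 0" "t \<noteq> 0"
begin

lemma mon5_nz: "mon5 v a b q t e i j k l \<noteq> 0"
  using nz mon_nz by (simp add: mon5_def)

lemma mon5_mult: "mon5 v a b q t e i j k l * mon5 v a b q t e' i' j' k' l' =
    mon5 v a b q t (e + e') (i + i') (j + j') (k + k') (l + l')"
  using nz mon_mult[of a b q t i j k l i' j' k' l'] by (simp add: mon5_def power_int_add mult_ac)

lemma mon5_divide: "mon5 v a b q t e i j k l / mon5 v a b q t e' i' j' k' l' =
    mon5 v a b q t (e - e') (i - i') (j - j') (k - k') (l - l')"
  using nz by (simp add: mon5_def power_int_diff flip: mon_divide)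

lemma mon5_powi: "mon5 v a b q t e i j k l powi r =
    mon5 v a b q t (e * r) (i * r) (j * r) (k * r) (l * r)"
  using nz by (simp add: mon5_def power_int_mult_distrib power_int_mult mon_powi)

lemma mon5_absorb:
  "a * mon5 v a b q t e i j k l = mon5 v a b q t e (i + 1) j k l"
  "b * mon5 v a b q t e i j k l = mon5 v a b q t e i (j + 1) k l"
  "t * mon5 v a b q t e i j k l = mon5 v a b q t e i j k (l + 1)"
  using nz by (simp_all add: mon5_def mon_def power_int_add mult_ac)

end

context nome
begin

text \<open>Independence of \<open>v\<close> from the four parameters modulo powers of
  \<open>p\<close>; together with \<open>generic_params\<close> it gives genericity of all five,
  \<open>generic5_pz\<close>.\<close>

definition generic_over :: "complex \<Rightarrow> complex \<Rightarrow> complex \<Rightarrow> complex \<Rightarrow> complex \<Rightarrow> bool" where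
  "generic_over v a b q t \<longleftrightarrow> v \<noteq> 0 \<and> (\<forall>e i j k l. mon5 v a b q t e i j k l \<in> pz \<longrightarrow> e = 0)"

lemma generic5_pz:
  assumes "generic_params p a b q t" "generic_over v a b q t"
  shows "mon5 v a b q t e i j k l \<in> pz \<longleftrightarrow> e = 0 \<and> i = 0 \<and> j = 0 \<and> k = 0 \<and> l = 0"
proof -
  have "mon5 v a b q t e i j k l \<in> pz \<longrightarrow> e = 0" using assms(2) unfolding generic_over_def by blast
  then show ?thesis using generic_mon_pz[OF assms(1)] by (auto simp: mon5_def)
qed

text \<open>A relation with \<open>e \<noteq> 0\<close> makes a positive power of \<open>v\<close>
  equal to one of countably many numbers, each of which has finitely many roots.\<close>

lemma countable_not_generic_over:
  assumes g: "generic_params p a b q t"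
  shows "countable {v. \<not> generic_over v a b q t}"
proof (rule countable_subset)
  note nz = generic_nz[OF g]
  define S where "S = (\<lambda>(g, (i, j, k, l), s). if s then g / mon a b q t i j k l else mon a b q t i j k l / g) `
    (pz \<times> (UNIV :: ((int \<times> int \<times> int \<times> int) \<times> bool) set))"
  have "countable S" unfolding S_def by (intro countable_image countable_SIGMA) auto
  then show "countable (insert 0 (\<Union>(r, s)\<in>{0<..} \<times> S. {v. v ^ r = s}))"
    by (intro countable_insert countable_UN countable_SIGMA) (auto intro!: countable_finite finite_nth_roots)
  show "{v. \<not> generic_over v a b q t} \<subseteq> insert 0 (\<Union>(r, s)\<in>{0<..} \<times> S. {v. v ^ r = s})"
  proof
    fix v assume v: "v \<in> {v. \<not> generic_over v a b q t}"
    show "v \<in> insert 0 (\<Union>(r, s)\<in>{0<..} \<times> S. {v. v ^ r = s})"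
    proof (cases "v = 0")
      case False
      then obtain e i j k l where e: "mon5 v a b q t e i j k l \<in> pz" "e \<noteq> 0"
        using v by (auto simp: generic_over_def)
      define g where "g = mon5 v a b q t e i j k l"
      let ?M = "mon a b q t i j k l"
      have M: "?M \<noteq> 0" using nz by (intro mon_nz) auto
      have gp: "g \<in> pz" using e(1) by (simp add: g_def)
      have "\<exists>s\<in>S. v ^ nat \<bar>e\<bar> = s"
      proof (cases "e > 0")
        case True
        then have "v powi e = v ^ nat \<bar>e\<bar>" by (simp add: power_int_def)
        then have "v ^ nat \<bar>e\<bar> = g / ?M" using M by (simp add: mon5_def g_def)
        moreover have "g / ?M \<in> S"
          unfolding S_def using gp by (intro image_eqI[of _ _ "(g, (i, j, k, l), True)"]) auto
        ultimately show ?thesis by blast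
      next
        case False
        then have "v powi e = 1 / v ^ nat \<bar>e\<bar>" using e(2) by (simp add: power_int_def power_inverse divide_inverse)
        then have "g = ?M / v ^ nat \<bar>e\<bar>" by (simp add: mon5_def g_def)
        then have "v ^ nat \<bar>e\<bar> = ?M / g" using M by simp
        moreover have "?M / g \<in> S"
          unfolding S_def using gp by (intro image_eqI[of _ _ "(g, (i, j, k, l), False)"]) auto
        ultimately show ?thesis by blast
      qed
      then obtain s where "s \<in> S" "v ^ nat \<bar>e\<bar> = s" by blast
      then show ?thesis using e(2) by (intro insertI2 UN_I[of "(nat \<bar>e\<bar>, s)"]) auto
    qed simp
  qed
qed

lemma generic_over_exists:
  assumes "generic_params p a b q t"
  obtains v where "generic_over v a b q t"
  using ex_not_countable[OF countable_not_generic_over[OF assms]] by blast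

text \<open>As in \<open>generic_sqrt\<close>, squaring removes the square root of \<open>q\<close>;
  the exponent of \<open>v\<close> is doubled.\<close>

lemma generic_over_sqrt:
  assumes g: "generic_params p a b q t" and v: "generic_over v a b q t" and sq: "sq\<^sup>2 = q"
  shows "generic_over (sq * v) (a / sq) (b / sq) q t"
proof -
  have nz: "v \<noteq> 0" "a \<noteq> 0" "b \<noteq> 0" "q \<noteq> 0" "t \<noteq> 0" "sq \<noteq> 0"
    using generic_nz[OF g] v sq by (auto simp: generic_over_def)
  have s: "sq powi (2 * i) = q powi i" for i using sq nz by (simp add: power_int_mult)
  have "(mon5 (sq * v) (a / sq) (b / sq) q t e i j k l)\<^sup>2 = mon5 v a b q t (2 * e) (2 * i) (2 * j) (2 * k + e - i - j) (2 * l)"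
    for e i j k l
    using nz
    by (simp add: mon5_def mon_def power_int_divide_distrib power_int_mult_distrib power_int_diff power_int_add mult_ac)
      (simp add: s[symmetric] power_int_mult mult_ac power2_eq_square power_int_add field_simps)
  then have "e = 0" if "mon5 (sq * v) (a / sq) (b / sq) q t e i j k l \<in> pz" for e i j k l
    using pz_power2[OF that] generic5_pz[OF g v] by auto
  then show ?thesis using nz by (auto simp: generic_over_def)
qed

lemma generic_over_diag_ok:
  assumes g: "generic_params p a b q t" and v: "generic_over v a b q t"
  shows "diag_ok v t"
proof -
  have nz: "v \<noteq> 0" "a \<noteq> 0" "b \<noteq> 0" "q \<noteq> 0" "t \<noteq> 0"
    using generic_nz[OF g] v by (auto simp: generic_over_def)
  have "v * v * t powi k = mon5 v a b q t 2 0 0 0 k" "t powi k = mon5 v a b q t 0 0 0 0 k" for k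
    by (simp_all add: mon5_def mon_def power2_eq_square)
  then show ?thesis using nz by (simp add: diag_ok_def generic5_pz[OF g v])
qed

lemma generic_over_eig:
  assumes g: "generic_params p a b q t" and c: "generic_over c a b q t \<or> generic_over (1 / (c * t ^ r)) a b q t"
  shows "c \<noteq> 0 \<Longrightarrow> eig m n l a b c q t \<noteq> 0"
proof
  assume c0: "c \<noteq> 0" and "eig m n l a b c q t = 0"
  have nz: "a \<noteq> 0" "b \<noteq> 0" "q \<noteq> 0" "t \<noteq> 0"
    using generic_nz[OF g] by auto
  from \<open>eig m n l a b c q t = 0\<close> obtain i where i: "a * c * q ^ l i * t ^ (n - i) \<in> pz \<or> b * c * q ^ (m - l i) * t ^ (i - 1) \<in> pz"
    using eig_eq_0_iff nz c0 by auto
  have no: False if x: "u * c * q ^ r1 * t ^ r2 \<in> pz" and u: "u = mon a b q t i1 j1 0 0" for u r1 r2 i1 j1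
    using c
  proof
    assume v: "generic_over c a b q t"
    have "u * c * q ^ r1 * t ^ r2 = mon5 c a b q t 1 i1 j1 (int r1) (int r2)"
      using nz by (simp add: u mon5_def mon_def)
    then show False using x generic5_pz[OF g v] by simp
  next
    assume v: "generic_over (1 / (c * t ^ r)) a b q t"
    have "u * c * q ^ r1 * t ^ r2 = mon5 (1 / (c * t ^ r)) a b q t (-1) i1 j1 (int r1) (int r2 - int r)"
      using nz c0 by (simp add: u mon5_def mon_def power_int_diff power_int_minus field_simps)
    then show False using x generic5_pz[OF g v] by simp
  qed
  show False using i no[of a _ _ 1 0] no[of b _ _ 0 1] by (auto simp: mon_basis)
qed

text \<open>All coordinates move at once; the tensor formula reduces this to compositions with
  functions of one variable.\<close>

lemma holomorphic_diag:
  assumes f: "f \<in> BC_theta m n p" and t: "t \<noteq> 0"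
  shows "(\<lambda>v. f (diag n v t)) holomorphic_on - {0}"
proof -
  obtain A where A: "good_set A" "card A = Suc m" using BC1_grid_exists by blast
  have "(\<lambda>v. tensor n (\<lambda>_. A) f (diag n v t)) holomorphic_on - {0}"
    unfolding tensor_def
  proof (intro holomorphic_on_sum holomorphic_on_mult holomorphic_on_const holomorphic_on_prod)
    fix y i assume y: "y \<in> PiE {1..n} (\<lambda>_. A)" and i: "i \<in> {1..n}"
    have L: "lagr A (y i) holomorphic_on - {0}"
      by (rule BC1_holo[OF lagr_BC1[OF A PiE_mem[OF y i]]])
    have "(\<lambda>v. v * t ^ (n - i)) holomorphic_on - {0}" by (intro holomorphic_intros)
    moreover have "(\<lambda>v. v * t ^ (n - i)) ` (- {0}) \<subseteq> - {0}" using t by auto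
    ultimately have "(lagr A (y i) \<circ> (\<lambda>v. v * t ^ (n - i))) holomorphic_on - {0}"
      using holomorphic_on_compose_gen[OF _ L] by blast
    then show "(\<lambda>v. lagr A (y i) (diag n v t i)) holomorphic_on - {0}"
      using i by (simp add: diag_def o_def)
  qed
  then show ?thesis
    by (rule holomorphic_transform)
      (use sep_BC1_eq_tensor[OF BC_theta_sep[OF f], of "\<lambda>_. A"] A diag_torus t in auto)
qed

lemma diag_zero_off_countable:
  assumes f: "f \<in> BC_theta m n p" and t: "t \<noteq> 0" and B: "countable B"
    and zero: "\<And>v. v \<noteq> 0 \<Longrightarrow> v \<notin> B \<Longrightarrow> f (diag n v t) = 0" and "v \<noteq> 0"
  shows "f (diag n v t) = 0"
  by (rule continuous_eq_off_countable[where g = "\<lambda>_. 0", OF holomorphic_on_imp_continuous_on[OF holomorphic_diag[OF f t]] _ B zero])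
    (use assms in auto)

section \<open>Spreading zeros from the principal specialization\<close>

lemma row_regular:
  assumes g: "generic_params p a b q t" and v: "generic_over v a b q t" and n: "1 \<le> n"
  shows "diff_op_regular n p ((diag n v t)(1 := v * q ^ j * t ^ (n - 1)))"
proof -
  have nz: "v \<noteq> 0" "a \<noteq> 0" "b \<noteq> 0" "q \<noteq> 0" "t \<noteq> 0"
    using generic_nz[OF g] v by (auto simp: generic_over_def)
  let ?x = "(diag n v t)(1 := v * q ^ j * t ^ (n - 1))"
  have x: "?x i = mon5 v a b q t 1 0 0 (if i = 1 then int j else 0) (int n - int i)" if "i \<in> {1..n}" for i
    using that n by (auto simp: diag_def mon5_def mon_def power_int_of_nat[symmetric] of_nat_diff simp del: power_int_of_nat)
  have xt: "?x \<in> torus n" using torus_upd[OF diag_torus[of v t n], of 1] nz n by simp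
  have "?x \<in> reg_off {} n"
    unfolding reg_off_def bad_def
  proof (intro CollectI conjI ballI impI xt)
    fix i assume i: "i \<in> {1..n}"
    show "?x i * ?x i \<notin> pz" unfolding x[OF i] by (simp add: mon5_mult[OF nz] generic5_pz[OF g v])
    fix k assume k: "k \<in> {1..n}" "i \<noteq> k"
    show "?x i \<notin> {z. ?x k * z \<in> pz \<or> ?x k / z \<in> pz}"
      unfolding x[OF i] x[OF k(1)] using k
      by (simp add: mon5_mult[OF nz] mon5_divide[OF nz] generic5_pz[OF g v])
  qed simp
  then show ?thesis using reg_off_empty_iff by blast
qed

text \<open>The sign pattern that raises the power of \<open>q\<close> in the first coordinate from
  \<open>j\<close> to \<open>j + 1\<close>; the pattern of minus signs leaves it at
  \<open>j\<close>.\<close>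

definition row_signs :: "nat \<Rightarrow> nat \<Rightarrow> int" where
  "row_signs n = (\<lambda>i\<in>{1..n}. if i = 1 then 1 else -1)"

text \<open>Every theta argument is a monomial with nonzero exponent vector, up to a factor
  \<open>p\<close> in those containing \<open>d\<close>, which the balancing condition
  determines.\<close>

lemma dcoeff_row_nz:
  assumes g: "generic_params p a b q t" and v: "generic_over v a b q t" and n: "2 \<le> n"
    and c: "c = 1 / (v * t ^ (n - 2))" and bal: "balanced m n a b c d q t"
  shows "dcoeff n a b c d t (row_signs n) ((diag n v t)(1 := v * q ^ j * t ^ (n - 1))) \<noteq> 0"
proof -
  have nz: "v \<noteq> 0" "a \<noteq> 0" "b \<noteq> 0" "q \<noteq> 0" "t \<noteq> 0"
    using generic_nz[OF g] v by (auto simp: generic_over_def)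
  let ?x = "(diag n v t)(1 := v * q ^ j * t ^ (n - 1))"
  let ?s = "row_signs n"
  have x: "?x i = mon5 v a b q t 1 0 0 (if i = 1 then int j else 0) (int n - int i)" if "i \<in> {1..n}" for i
    using that n by (auto simp: diag_def mon5_def mon_def power_int_of_nat[symmetric] of_nat_diff simp del: power_int_of_nat)
  have s: "?s i = (if i = 1 then 1 else -1)" if "i \<in> {1..n}" for i using that by (simp add: row_signs_def)
  have cm: "c = mon5 v a b q t (-1) 0 0 0 (2 - int n)"
  proof -
    have "t powi (2 - int n) = t powi (- int (n - 2))" using n by simp
    also have "\<dots> = 1 / t ^ (n - 2)" by (simp only: powi_neg_nat)
    finally show ?thesis using nz by (simp add: c mon5_def mon_def power_int_minus divide_inverse)
  qed
  have dm: "d = p * mon5 v a b q t 1 (-1) (-1) (- int m) (-1)"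
  proof -
    let ?M = "mon5 v a b q t (-1) 1 1 (int m) 1" and ?M' = "mon5 v a b q t 1 (-1) (-1) (- int m) (-1)"
    have "q ^ m * t powi (int n - 1) = mon5 v a b q t 0 0 0 (int m) (int n - 1)"
      by (simp add: mon5_def mon_def)
    then have "a * (b * (c * mon5 v a b q t 0 0 0 (int m) (int n - 1))) * d = p"
      using bal by (simp add: balanced_def mult_ac)
    then have "?M * d = p"
      unfolding cm mon5_mult[OF nz] mon5_absorb[OF nz] by (simp add: add.commute)
    moreover have "?M * ?M' = 1"
      unfolding mon5_mult[OF nz] by (simp add: mon5_def)
    ultimately show ?thesis by (metis mult.assoc mult.commute mult.left_neutral)
  qed
  have pzp: "th (p * mon5 v a b q t e i j k l) \<noteq> 0" if "\<not> (e = 0 \<and> i = 0 \<and> j = 0 \<and> k = 0 \<and> l = 0)" for e i j k l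
    using that mon5_nz[OF nz] generic5_pz[OF g v] by (subst theta_eq_0_iff) auto
  have pzn: "th (mon5 v a b q t e i j k l) \<noteq> 0" if "\<not> (e = 0 \<and> i = 0 \<and> j = 0 \<and> k = 0 \<and> l = 0)" for e i j k l
    using that mon5_nz[OF nz] generic5_pz[OF g v] by (subst theta_eq_0_iff) auto
  have single: "th (a * ?x i powi ?s i) * th (b * ?x i powi ?s i) * th (c * ?x i powi ?s i) *
      th (d * ?x i powi ?s i) / th (?x i powi (2 * ?s i)) \<noteq> 0" if i: "i \<in> {1..n}" for i
    unfolding x[OF i] s[OF i] unfolding cm dm mult.assoc mon5_powi[OF nz] mon5_mult[OF nz] mon5_absorb[OF nz]
    using i n by (auto intro!: pzp pzn)
  have pair: "th (t * ?x i powi ?s i * ?x k powi ?s k) / th (?x i powi ?s i * ?x k powi ?s k) \<noteq> 0"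
    if "1 \<le> i" "i < k" "k \<le> n" for i k
  proof -
    have ik: "i \<in> {1..n}" "k \<in> {1..n}" "k \<noteq> 1" using that by auto
    show ?thesis
      unfolding x[OF ik(1)] s[OF ik(1)] x[OF ik(2)] s[OF ik(2)] unfolding mult.assoc mon5_powi[OF nz] mon5_mult[OF nz] mon5_absorb[OF nz]
      using that n by (auto intro!: pzn)
  qed
  have "(\<Prod>(i, k)\<in>{(i, k). 1 \<le> i \<and> i < k \<and> k \<le> n}. th (t * ?x i powi ?s i * ?x k powi ?s k) /
      th (?x i powi ?s i * ?x k powi ?s k)) \<noteq> 0"
    using pair by (subst prod_zero_iff[OF finite_index_pairs]) auto
  moreover have "(\<Prod>i\<in>{1..n}. th (a * ?x i powi ?s i) * th (b * ?x i powi ?s i) * th (c * ?x i powi ?s i) *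
      th (d * ?x i powi ?s i) / th (?x i powi (2 * ?s i))) \<noteq> 0"
    using single by (subst prod_zero_iff) blast+
  ultimately show ?thesis unfolding dcoeff_def by (rule no_zero_divisors[rotated])
qed


text \<open>With \<open>c = 1 / x\<^sub>2\<close> only two terms of the operator survive at a point \<open>(v q\<^sup>j t\<^sup>n\<^sup>-\<^sup>1, v t\<^sup>n\<^sup>-\<^sup>2, \<dots>, v)\<close>;
  this propagates vanishing from \<open>j\<close> to \<open>j + 1\<close>.\<close>

lemma row_vanishing:
  assumes l: "l \<in> partitions_in m n" and n: "2 \<le> n"
    and "generic_params p a b q t" "f \<in> interp_space m n l a b q t"
    and "\<And>v. v \<noteq> 0 \<Longrightarrow> f (diag n v t) = 0" and "generic_over v a b q t"
  shows "f ((diag n v t)(1 := v * q ^ j * t ^ (n - 1))) = 0"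
  using assms(3-)
proof (induction j arbitrary: a b f v)
  case 0
  have "(diag n v t)(1 := v * q ^ 0 * t ^ (n - 1)) = diag n v t" using n by (auto simp: diag_def fun_eq_iff)
  then show ?case using 0 by (simp add: generic_over_def)
next
  case (Suc j)
  note g = Suc.prems(1) and f = Suc.prems(2) and fz = Suc.prems(3) and v = Suc.prems(4)
  have nz: "v \<noteq> 0" "a \<noteq> 0" "b \<noteq> 0" "q \<noteq> 0" "t \<noteq> 0"
    using generic_nz[OF g] v by (auto simp: generic_over_def)
  let ?y = "(diag n v t)(1 := v * q ^ Suc j * t ^ (n - 1))"
  have yt: "?y \<in> torus n" using torus_upd[OF diag_torus[of v t n], of 1] nz n by simp
  show ?case
  proof (cases "f (full_pt m n l a b q t) = 0")
    case True
    then show ?thesis using interp_space_determined[OF g l f _ yt] by blast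
  next
    case False
    define sq where "sq = csqrt q"
    have sq: "sq\<^sup>2 = q" by (simp add: sq_def)
    have sq0: "sq \<noteq> 0" using sq nz by auto
    \<comment> \<open>Here \<open>f\<close> is the function to which the operator is applied: with
      parameters \<open>a / sq\<close>, \<open>b / sq\<close> its image is proportional to a
      function \<open>h\<close> for these parameters.\<close>
    define a0 where "a0 = a / sq"
    define b0 where "b0 = b / sq"
    define w where "w = sq * v"
    have ab: "sq * a0 = a" "sq * b0 = b" using sq0 by (simp_all add: a0_def b0_def)
    have g0: "generic_params p a0 b0 q t" unfolding a0_def b0_def by (rule generic_sqrt(2)[OF g sq])
    have w: "generic_over w a0 b0 q t" unfolding a0_def b0_def w_def by (rule generic_over_sqrt[OF g v sq])
    have nz0: "w \<noteq> 0" "a0 \<noteq> 0" "b0 \<noteq> 0" using nz sq0 by (simp_all add: w_def a0_def b0_def)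
    obtain h where h: "h \<in> interp_space m n l a0 b0 q t" "h (full_pt m n l a0 b0 q t) \<noteq> 0"
      using interp_space_nontrivial[OF g0 l] by blast
    have f': "f \<in> interp_space m n l (sq * a0) (sq * b0) q t" "f (full_pt m n l (sq * a0) (sq * b0) q t) \<noteq> 0"
      using f False ab by simp_all
    obtain K where K: "K \<noteq> 0"
      "\<forall>c. diag_ok c t \<longrightarrow> K * eig m n l a0 b0 c q t * h (diag n c t) =
        (\<Prod>i\<in>{1..n}. th (a0 * b0 * q ^ m * t ^ (i - 1)) * th (a0 * c * t ^ (n - i)) * th (b0 * c * t ^ (n - i))) *
        f (diag n (sq * c) t)"
      "\<forall>c d x. balanced m n a0 b0 c d q t \<longrightarrow> x \<in> torus n \<longrightarrow> diff_op_regular n p x \<longrightarrow>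
        diff_op n a0 b0 c d sq t p f x = K * eig m n l a0 b0 c q t * h x"
      using diag_functional_equation[OF g0 sq l f' h] by (elim exE conjE)
    \<comment> \<open>The functional equation passes the vanishing on the principal specialization
      from \<open>f\<close> to \<open>h\<close>, so the induction hypothesis is available for
      \<open>h\<close> as well.\<close>
    have hz: "h (diag n u t) = 0" if "u \<noteq> 0" for u
    proof (rule diag_zero_off_countable[OF interp_spaceD(1)[OF h(1)] nz(5) countable_not_generic_over[OF g0] _ that])
      fix c assume "c \<noteq> 0" "c \<notin> {v. \<not> generic_over v a0 b0 q t}"
      then have c: "generic_over c a0 b0 q t" "c \<noteq> 0" by auto
      have "f (diag n (sq * c) t) = 0" using fz c sq0 by simp
      then have "K * eig m n l a0 b0 c q t * h (diag n c t) = 0"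
        using K(2)[rule_format, OF generic_over_diag_ok[OF g0 c(1)]] by simp
      moreover have "eig m n l a0 b0 c q t \<noteq> 0" using generic_over_eig[OF g0] c by blast
      ultimately show "h (diag n c t) = 0" using K(1) by simp
    qed
    let ?x = "(diag n w t)(1 := w * q ^ j * t ^ (n - 1))"
    have xt: "?x \<in> torus n" using torus_upd[OF diag_torus[of w t n], of 1] nz nz0 n by simp
    have hx: "h ?x = 0" by (rule Suc.IH[OF g0 h(1) hz w])
    \<comment> \<open>The reciprocal of the second coordinate; it forces the signs from the second
      place on to be \<open>-1\<close>.\<close>
    define c where "c = 1 / (w * t ^ (n - 2))"
    have c0: "c \<noteq> 0" using nz nz0 by (simp add: c_def)
    obtain d where bal: "balanced m n a0 b0 c d q t" using balanced_exists[of a0 b0 c q t] nz nz0 c0 by blast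
    have "diff_op n a0 b0 c d sq t p f ?x = K * eig m n l a0 b0 c q t * h ?x"
      by (rule K(3)[rule_format, OF bal xt row_regular[OF g0 w]]) (use n in simp)
    then have D0: "diff_op n a0 b0 c d sq t p f ?x = 0" using hx by simp
    have "dcoeff n a0 b0 c d t \<sigma> ?x * f (shift_pt n sq \<sigma> ?x) = 0" if \<sigma>: "\<sigma> \<in> signs n - {row_signs n}" for \<sigma>
    proof (cases "dcoeff n a0 b0 c d t \<sigma> ?x = 0")
      case nzd: False
      have s: "\<sigma> i = 1 \<or> \<sigma> i = -1" if "i \<in> {1..n}" for i using signs_cases[of \<sigma> n i] \<sigma> that by blast
      have minus: "\<sigma> i = -1" if i: "2 \<le> i" "i \<le> n" for i
        using i
      proof (induction i rule: dec_induct)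
        case base
        have "\<sigma> 2 \<noteq> 1"
        proof
          assume "\<sigma> 2 = 1"
          moreover have "c * ?x 2 = 1" using n nz nz0 by (simp add: c_def diag_def)
          ultimately show False using dcoeff_nz_single(3)[OF nzd, of 2] n by simp
        qed
        then show ?case using s[of 2] n by auto
      next
        case (step i)
        have "\<sigma> (Suc i) \<noteq> 1"
        proof
          assume si: "\<sigma> (Suc i) = 1"
          have "n - i = Suc (n - Suc i)" using step by simp
          then have "?x i = t * ?x (Suc i)" "?x (Suc i) \<noteq> 0" using step nz nz0 by (auto simp: diag_def)
          then have "t * ?x i powi \<sigma> i * ?x (Suc i) powi \<sigma> (Suc i) = 1"
            using si step nz by (simp add: field_simps)
          then show False using dcoeff_nz_pair[OF nzd, of i "Suc i"] step by simp
        qed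
        then show ?case using s[of "Suc i"] step by auto
      qed
      have "\<sigma> 1 \<noteq> 1"
      proof
        assume "\<sigma> 1 = 1"
        then have "\<sigma> i = row_signs n i" for i
          using minus[of i] \<sigma> by (cases "i = 1"; cases "i \<in> {1..n}")
            (auto simp: row_signs_def signs_def PiE_def extensional_def)
        then show False using \<sigma> by auto
      qed
      then have s1: "\<sigma> 1 = -1" using s[of 1] n by auto
      have all_minus: "\<sigma> i = -1" if "i \<in> {1..n}" for i using minus[of i] s1 that by (cases "i = 1") auto
      \<comment> \<open>With all signs \<open>-1\<close> the shift undoes \<open>w = sq * v\<close>,
        and the induction hypothesis for \<open>f\<close> itself disposes of the term.\<close>
      have E: "shift_pt n sq \<sigma> ?x = (diag n v t)(1 := v * q ^ j * t ^ (n - 1))"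
        using all_minus sq0 n by (auto simp: shift_pt_def diag_def w_def fun_eq_iff)
      have "f ((diag n v t)(1 := v * q ^ j * t ^ (n - 1))) = 0" by (rule Suc.IH[OF g f fz v])
      then show ?thesis by (simp only: E mult_zero_right)
    qed simp
    then have "(\<Sum>\<sigma>\<in>signs n - {row_signs n}. dcoeff n a0 b0 c d t \<sigma> ?x * f (shift_pt n sq \<sigma> ?x)) = 0"
      by (intro sum.neutral ballI)
    moreover have rs: "row_signs n \<in> signs n" by (auto simp: row_signs_def signs_def)
    ultimately have "diff_op n a0 b0 c d sq t p f ?x =
        dcoeff n a0 b0 c d t (row_signs n) ?x * f (shift_pt n sq (row_signs n) ?x)"
      unfolding diff_op_dcoeff by (subst sum.remove[OF finite_signs rs]) simp
    then have "f (shift_pt n sq (row_signs n) ?x) = 0"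
      using D0 dcoeff_row_nz[OF g0 w n c_def bal, of j] by simp
    moreover have "shift_pt n sq (row_signs n) ?x = ?y"
      using sq0 sq[symmetric] n
      by (auto simp: shift_pt_def diag_def w_def row_signs_def fun_eq_iff power2_eq_square)
    ultimately show ?thesis by (simp only:)
  qed
qed

text \<open>For \<open>n = 1\<close> the line is the principal specialization itself. Otherwise
  \<open>row_vanishing\<close> supplies \<open>m + 1\<close> inequivalent zeros in the first
  coordinate, more than degree \<open>m\<close> allows.\<close>

lemma diag_line_vanishing:
  assumes l: "l \<in> partitions_in m n" and n: "1 \<le> n"
    and g: "generic_params p a b q t" and f: "f \<in> interp_space m n l a b q t"
    and zero: "\<And>v. v \<noteq> 0 \<Longrightarrow> f (diag n v t) = 0" and v: "generic_over v a b q t" and w: "w \<noteq> 0"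
  shows "f ((diag n v t)(1 := w)) = 0"
proof (cases "n = 1")
  case True
  then have "(diag n v t)(1 := w) = diag n w t" by (auto simp: diag_def fun_eq_iff)
  then show ?thesis using zero[OF w] by simp
next
  case False
  then have n2: "2 \<le> n" using n by simp
  have nz: "v \<noteq> 0" "a \<noteq> 0" "b \<noteq> 0" "q \<noteq> 0" "t \<noteq> 0"
    using generic_nz[OF g] v by (auto simp: generic_over_def)
  define x where "x j = v * q ^ j * t ^ (n - 1)" for j
  have x: "x j = mon5 v a b q t 1 0 0 (int j) (int (n - 1))" for j
    by (simp add: x_def mon5_def mon_def mult.assoc)
  have ratio: "x i / x j \<notin> pz" if "i \<noteq> j" for i j
    unfolding x mon5_divide[OF nz] generic5_pz[OF g v] using that by simp
  have prod: "x i * x j \<notin> pz" for i j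
    unfolding x mon5_mult[OF nz] generic5_pz[OF g v] by simp
  have x0: "x j \<noteq> 0" for j using nz by (simp add: x_def)
  have inj: "inj_on x {0..m}"
    by (rule inj_onI) (metis ratio one_in_pz x0 divide_self)
  have xt: "diag n v t \<in> torus n" using diag_torus nz by blast
  show ?thesis
  proof (rule BC1_determined[where A = "x ` {0..m}" and h = "\<lambda>w. f ((diag n v t)(1 := w))" and m = m, OF _ _ _ _ w])
    show "good_set (x ` {0..m})" using prod x0 by (auto simp: good_set_def) (metis ratio)
    show "card (x ` {0..m}) = Suc m" using inj by (simp add: card_image)
    show "(\<lambda>w. f ((diag n v t)(1 := w))) \<in> BC1 m"
      using sep_BC1D[OF BC_theta_sep[OF interp_spaceD(1)[OF f]] xt, of 1] n by simp
    fix y assume "y \<in> x ` {0..m}"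
    then obtain j where y: "y = v * q ^ j * t ^ (n - 1)" by (auto simp: x_def)
    show "f ((diag n v t)(1 := y)) = 0" unfolding y by (rule row_vanishing[OF l n2 g f zero v])
  qed
qed

text \<open>The recursion on \<open>m + n\<close> once more. If \<open>l n = 0\<close>, the
  restriction to last coordinate \<open>a\<close> vanishes on its own principal specialization,
  since these points lie, after a cyclic permutation, on the lines of
  \<open>diag_line_vanishing\<close>. If \<open>l n > 0\<close>, the divisor is nonzero for all but
  countably many \<open>v\<close>, and the zeros pass to the quotient.\<close>

lemma diag_zero_imp_zero:
  "generic_params p a b q t \<Longrightarrow> l \<in> partitions_in m n \<Longrightarrow> f \<in> interp_space m n l a b q t \<Longrightarrow>
    (\<And>v. v \<noteq> 0 \<Longrightarrow> f (diag n v t) = 0) \<Longrightarrow> x \<in> torus n \<Longrightarrow> f x = 0"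
proof (induction "m + n" arbitrary: m n a l f x rule: less_induct)
  case less
  note g = less.prems(1) and l = less.prems(2) and f = less.prems(3) and zero = less.prems(4) and x = less.prems(5)
  note nz = generic_nz[OF g]
  consider "m = 0" | "n = 0" | m' n' where "m = Suc m'" "n = Suc n'"
    by (metis old.nat.exhaust)
  then show ?case
  proof cases
    case 1
    then have "f x = f (diag n 1 t)"
      using BC_theta_0_const[of f n x "diag n 1 t"] interp_spaceD(1)[OF f] x diag_torus[of 1 t n] nz by simp
    then show ?thesis using zero[of 1] by simp
  next
    case 2
    then have "x = diag n 1 t" using x by (auto simp: torus_def diag_def fun_eq_iff)
    then show ?thesis using zero[of 1] by simp
  next
    case (3 m' n')
    show ?thesis
    proof (cases "l n = 0")
      case True
      have l': "l \<in> partitions_in (Suc m') n'" using l True 3 partitions_SucI by simp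
      let ?r = "\<lambda>x\<in>torus n'. f (x(Suc n' := a))"
      have r: "?r \<in> interp_space (Suc m') n' l (a * t) b q t"
        using interp_space_restrict[OF g l'] f 3 by simp
      have rz: "?r (diag n' v t) = 0" if "v \<noteq> 0" for v
      proof (rule diag_zero_off_countable[OF interp_spaceD(1)[OF r] _ countable_not_generic_over[OF g] _ that])
        fix v assume "v \<noteq> 0" "v \<notin> {v. \<not> generic_over v a b q t}"
        then have v: "generic_over v a b q t" "v \<noteq> 0" by auto
        \<comment> \<open>The cycle moving the replaced first coordinate to the last place.\<close>
        define \<pi> where "\<pi> i = (if i \<in> {1..n} then if i = n then 1 else Suc i else i)" for i
        have \<pi>: "\<pi> permutes {1..n}"
        proof (rule bij_imp_permutes)
          show "bij_betw \<pi> {1..n} {1..n}"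
            by (rule bij_betw_byWitness[where f' = "\<lambda>i. if i = 1 then n else i - 1"]) (use 3 in \<open>auto simp: \<pi>_def\<close>)
        qed (auto simp: \<pi>_def)
        let ?y = "(diag n v t)(1 := a)"
        have yt: "?y \<in> torus n" using torus_upd[OF diag_torus[of v t n], of 1] v nz 3 by simp
        have "(diag n' v t)(Suc n' := a) = ?y \<circ> \<pi>"
          using 3 by (auto simp: fun_eq_iff diag_def \<pi>_def)
        then have "f ((diag n' v t)(Suc n' := a)) = f ?y"
          using BC_theta_sym[OF interp_spaceD(1)[OF f] yt \<pi>] by simp
        also have "\<dots> = 0" by (rule diag_line_vanishing[OF l _ g f zero v(1)]) (use 3 nz in auto)
        finally show "?r (diag n' v t) = 0" using diag_torus[of v t n'] v nz by simp
      qed (use nz in auto)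
      have "f (full_pt m n l a b q t) = ?r (full_pt (Suc m') n' l (a * t) b q t)"
        using full_pt_Suc[of l n' m' a b q t] True 3 full_pt_torus[OF generic_mult(2)[OF g]] by simp
      also have "\<dots> = 0"
        by (rule less.hyps[OF _ generic_mult(2)[OF g] l' r rz full_pt_torus[OF generic_mult(2)[OF g]]]) (use 3 in simp)
      finally show ?thesis using interp_space_determined[OF g l f _ x] by blast
    next
      case False
      let ?l = "decr_part l"
      have l': "?l \<in> partitions_in m' (Suc n')" using decr_part_in l 3 by simp
      have ll: "incr_part (Suc n') ?l = l" using incr_decr_part[OF l] False 3 by simp
      have f': "f \<in> interp_space (Suc m') (Suc n') (incr_part (Suc n') ?l) a b q t" using f ll 3 by simp
      obtain h where h: "h \<in> interp_space m' (Suc n') ?l (a * q) b q t"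
        "\<And>x. x \<in> torus (Suc n') \<Longrightarrow> f x = (\<Prod>i\<in>{1..Suc n'}. thpm a (x i)) * h x"
        using interp_space_divide[OF g l' f'] by blast
      let ?B = "\<Union>i\<in>{1..Suc n'}. (\<lambda>z. z / t ^ (Suc n' - i)) ` bad a"
      have hz: "h (diag (Suc n') v t) = 0" if "v \<noteq> 0" for v
      proof (rule diag_zero_off_countable[OF interp_spaceD(1)[OF h(1)] _ _ _ that, where B = ?B])
        show "countable ?B" using nz by (intro countable_UN countable_image) auto
        fix v assume v: "v \<noteq> 0" "v \<notin> ?B"
        have "thpm a (diag (Suc n') v t i) \<noteq> 0" if i: "i \<in> {1..Suc n'}" for i
        proof -
          have "v * t ^ (Suc n' - i) \<notin> bad a"
          proof
            assume "v * t ^ (Suc n' - i) \<in> bad a"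
            then have "v \<in> (\<lambda>z. z / t ^ (Suc n' - i)) ` bad a" using nz by (intro image_eqI) auto
            then show False using v(2) i by blast
          qed
          then show ?thesis using thpm_eq_0_bad nz v(1) i by (simp add: diag_def)
        qed
        then have "(\<Prod>i\<in>{1..Suc n'}. thpm a (diag (Suc n') v t i)) \<noteq> 0" by simp
        moreover have "f (diag (Suc n') v t) = 0" using zero[OF v(1)] 3 by simp
        ultimately show "h (diag (Suc n') v t) = 0"
          using h(2)[OF diag_torus[of v t]] v nz by simp
      qed (use nz in auto)
      have "h x = 0"
        by (rule less.hyps[OF _ generic_mult(1)[OF g] l' h(1) hz]) (use 3 x in auto)
      then show ?thesis using h(2) x 3 by simp
    qed
  qed
qed

end

subsection \<open>Normalization\<close>

lemma prod_rev: "(\<Prod>i\<in>{1..n}. g (n + 1 - i)) = (\<Prod>i\<in>{1..n::nat}. g i)"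
  using prod.atLeastAtMost_rev[of g 1 n] by simp

lemma diagram_eq_Sigma:
  assumes "l \<in> partitions_in m n"
  shows "diagram l = Sigma {1..n} (\<lambda>i. {1..l i})"
proof -
  have "i \<le> n" if "1 \<le> i" "1 \<le> j" "j \<le> l i" for i j
    using partitions_outside[OF assms, of i] that by (cases "i \<le> n") auto
  then show ?thesis unfolding diagram_def by auto
qed

lemma finite_diagram: "l \<in> partitions_in m n \<Longrightarrow> finite (diagram l)"
  by (simp add: diagram_eq_Sigma)

context nome
begin

text \<open>The two diagrams fill the rectangle; the number of boxes is the exponent of the
  multiplier in \<open>nfun_p\<close>.\<close>

lemma card_diagram_compl:
  assumes l: "l \<in> partitions_in m n"
  shows "card (diagram l) + card (diagram (compl_part m n l)) = m * n"
proof -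
  have "card (diagram l) = (\<Sum>i\<in>{1..n}. l i)" by (simp add: diagram_eq_Sigma[OF l])
  moreover have "card (diagram (compl_part m n l)) = (\<Sum>i\<in>{1..n}. compl_part m n l i)"
    by (simp add: diagram_eq_Sigma[OF compl_part_in[OF l]])
  moreover have "(\<Sum>i\<in>{1..n}. compl_part m n l i) = (\<Sum>i\<in>{1..n}. m - l (n + 1 - i))"
    by (intro sum.cong) (auto simp: compl_part_def)
  moreover have "(\<Sum>i\<in>{1..n}. m - l (n + 1 - i)) = (\<Sum>i\<in>{1..n}. m - l i)"
    using sum.atLeastAtMost_rev[of "\<lambda>i. m - l i" 1 n] by simp
  moreover have "(\<Sum>i\<in>{1..n}. l i) + (\<Sum>i\<in>{1..n}. m - l i) = (\<Sum>i\<in>{1..n}. m)"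
    unfolding sum.distrib[symmetric] using partitions_le[OF l] by (intro sum.cong) auto
  ultimately show ?thesis by (simp add: mult.commute)
qed

lemma sep_BC1_p_all:
  assumes f: "sep_BC1 m n f" and x: "x \<in> torus n"
  shows "f (\<lambda>i\<in>{1..n}. p * x i) = f x * (\<Prod>i\<in>{1..n}. 1 / (p * (x i)\<^sup>2) ^ m)"
proof -
  have "f (\<lambda>i\<in>{1..n}. if i \<in> S then p * x i else x i) = f x * (\<Prod>i\<in>S. 1 / (p * (x i)\<^sup>2) ^ m)"
    if "finite S" "S \<subseteq> {1..n}" for S
    using that
  proof (induction S rule: finite_induct)
    case empty
    have "(\<lambda>i\<in>{1..n}. x i) = x" using x by (auto simp: torus_def PiE_def extensional_restrict)
    then show ?case by simp
  next
    case (insert j S)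
    let ?y = "\<lambda>i\<in>{1..n}. if i \<in> S then p * x i else x i"
    have y: "?y \<in> torus n" using torus_nz[OF x] by (intro torusI) auto
    have j: "j \<in> {1..n}" using insert by auto
    have 1: "(\<lambda>i\<in>{1..n}. if i \<in> insert j S then p * x i else x i) = ?y(j := p * x j)"
      using j by (auto simp: fun_eq_iff)
    have 2: "f (?y(j := p * x j)) = f (?y(j := x j)) / (p * (x j)\<^sup>2) ^ m"
      using BC1_p[OF sep_BC1D[OF f y j]] torus_nz[OF x j] by simp
    have 3: "?y(j := x j) = ?y" using insert.hyps j by (auto simp: fun_eq_iff)
    have 4: "f ?y = f x * (\<Prod>i\<in>S. 1 / (p * (x i)\<^sup>2) ^ m)" using insert.IH insert.prems by blast
    show ?case unfolding 1 2 3 4 using insert.hyps by simp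
  qed
  from this[of "{1..n}"] show ?thesis by (simp cong: restrict_cong)
qed

text \<open>The value prescribed by the normalization in \<open>is_interp_theta\<close>, as a
  function of \<open>v\<close>.\<close>

definition nfun :: "nat \<Rightarrow> nat \<Rightarrow> (nat \<Rightarrow> nat) \<Rightarrow> complex \<Rightarrow> complex \<Rightarrow> complex \<Rightarrow> complex \<Rightarrow> complex \<Rightarrow> complex" where
  "nfun m n l a b q t v = C0 l (t powi (int n - 1) * a * v) q t p * C0 l (a / v) q t p *
        C0 (compl_part m n l) (t powi (int n - 1) * b * v) q t p *
        C0 (compl_part m n l) (b / v) q t p"

text \<open>The factors of \<open>nfun\<close> are indexed by \<open>s < 4\<close>, one value for each of its four \<open>C0\<close>, and the boxes of a diagram.\<close>

definition box_sgn :: "nat \<Rightarrow> int" where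
  "box_sgn s = (if even s then 1 else -1)"

definition box_mon :: "nat \<Rightarrow> complex \<Rightarrow> complex \<Rightarrow> complex \<Rightarrow> complex \<Rightarrow> nat \<Rightarrow> nat \<times> nat \<Rightarrow> complex" where
  "box_mon n a b q t s ij = mon a b q t (if s < 2 then 1 else 0) (if s < 2 then 0 else 1) (int (snd ij) - 1)
    (if even s then int n - int (fst ij) else 1 - int (fst ij))"

definition box_set :: "nat \<Rightarrow> nat \<Rightarrow> (nat \<Rightarrow> nat) \<Rightarrow> nat \<Rightarrow> (nat \<times> nat) set" where
  "box_set m n l s = (if s < 2 then diagram l else diagram (compl_part m n l))"

lemma nfun_eq_prod:
  assumes "a \<noteq> 0" "b \<noteq> 0" "q \<noteq> 0" "t \<noteq> 0"
  shows "nfun m n l a b q t v =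
    (\<Prod>s\<in>{0, 1, 2, 3}. \<Prod>ij\<in>box_set m n l s. th (box_mon n a b q t s ij * v powi box_sgn s))"
proof -
  have 1: "C0 \<kappa> (t powi (int n - 1) * u * v) q t p =
      (\<Prod>ij\<in>diagram \<kappa>. th (q powi (int (snd ij) - 1) * u * t powi (int n - int (fst ij)) * v))" for \<kappa> u
    unfolding C0_def
  proof (rule prod.cong[OF refl], safe)
    fix i j
    have "t powi (1 - int i) * t powi (int n - 1) = t powi (int n - int i)"
      using assms(4) by (simp add: power_int_add[symmetric])
    then show "th (q powi (int j - 1) * t powi (1 - int i) * (t powi (int n - 1) * u * v)) =
        th (q powi (int (snd (i, j)) - 1) * u * t powi (int n - int (fst (i, j))) * v)"
      by (simp add: mult_ac flip: mult.assoc[of "t powi (1 - int i)"])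
  qed
  have 2: "C0 \<kappa> (u / v) q t p =
      (\<Prod>ij\<in>diagram \<kappa>. th (q powi (int (snd ij) - 1) * u * t powi (1 - int (fst ij)) * inverse v))" for \<kappa> u
    unfolding C0_def by (intro prod.cong) (auto simp: divide_inverse mult_ac)
  show ?thesis
    unfolding nfun_def 1 2
    by (simp add: box_set_def box_mon_def box_sgn_def mon_def mult_ac)
qed

lemma finite_box_set: "l \<in> partitions_in m n \<Longrightarrow> finite (box_set m n l s)"
  using finite_diagram finite_diagram[OF compl_part_in] by (simp add: box_set_def)

text \<open>A common zero of two factors in \<open>v\<close>, or of two in \<open>1 / v\<close>,
  makes the quotient of their monomials a power of \<open>p\<close>, and the exponents recover the
  box. For one factor of each kind the product would be a power of \<open>p\<close>, which the
  exponents of \<open>a\<close> and \<open>b\<close> exclude.\<close>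

lemma nfun_simple_zeros:
  assumes g: "generic_params p a b q t" and l: "l \<in> partitions_in m n"
  shows "simple_zeros (nfun m n l a b q t)"
proof -
  note nz = generic_nz[OF g]
  let ?\<alpha> = "box_mon n a b q t"
  have \<alpha>: "?\<alpha> s ij \<noteq> 0" for s ij using nz mon_nz by (simp add: box_mon_def)
  have "simple_zeros (\<lambda>v. \<Prod>(s, ij)\<in>Sigma {0, 1, 2, 3} (box_set m n l). th (?\<alpha> s ij * v powi box_sgn s))"
    unfolding case_prod_beta
  proof (rule simple_zeros_prod)
    show "finite (Sigma {0, 1, 2, 3} (box_set m n l))" using finite_box_set[OF l] by (intro finite_SigmaI) auto
    fix x assume "x \<in> Sigma {0, 1, 2, 3} (box_set m n l)"
    show "simple_zeros (\<lambda>v. th (?\<alpha> (fst x) (snd x) * v powi box_sgn (fst x)))"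
      using simple_zeros_theta_mult[OF \<alpha>] simple_zeros_theta_divide[OF \<alpha>]
      by (simp add: box_sgn_def divide_inverse)
  next
    fix x y z assume x: "x \<in> Sigma {0, 1, 2, 3} (box_set m n l)" and y: "y \<in> Sigma {0, 1, 2, 3} (box_set m n l)"
      and xy: "x \<noteq> y" and z: "z \<noteq> 0" and zero: "th (?\<alpha> (fst x) (snd x) * z powi box_sgn (fst x)) = 0"
      "th (?\<alpha> (fst y) (snd y) * z powi box_sgn (fst y)) = 0"
    obtain s i j where sx: "x = (s, (i, j))" by (metis prod.collapse)
    obtain s' i' j' where sy: "y = (s', (i', j'))" by (metis prod.collapse)
    have s: "s \<in> {0, 1, 2, 3}" "s' \<in> {0, 1, 2, 3}" using x y sx sy by auto
    have pz: "?\<alpha> s (i, j) * z powi box_sgn s \<in> pz" "?\<alpha> s' (i', j') * z powi box_sgn s' \<in> pz"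
      using zero \<alpha> z by (simp_all add: sx sy theta_eq_0_iff)
    show False
    proof (cases "even s = even s'")
      case True
      then have sg: "box_sgn s = box_sgn s'" by (simp add: box_sgn_def)
      have "?\<alpha> s (i, j) / ?\<alpha> s' (i', j') \<in> pz"
        using pz_divide[OF pz] z unfolding sg by simp
      then have "i = i' \<and> j = j' \<and> (s < 2) = (s' < 2)"
        unfolding box_mon_def using nz g True by (auto simp: mon_divide generic_mon_pz split: if_splits)
      moreover from this have "s = s'" using True s by auto
      ultimately show False using xy sx sy by simp
    next
      case False
      then have sg: "z powi box_sgn s * z powi box_sgn s' = 1" using z by (auto simp: box_sgn_def)
      have "(?\<alpha> s (i, j) * ?\<alpha> s' (i', j')) * (z powi box_sgn s * z powi box_sgn s') \<in> pz"
        using pz_mult[OF pz] by (simp only: mult_ac)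
      then have "?\<alpha> s (i, j) * ?\<alpha> s' (i', j') \<in> pz" unfolding sg by simp
      then show False
        unfolding box_mon_def using nz g by (auto simp: mon_mult generic_mon_pz split: if_splits)
    qed
  qed
  moreover have "nfun m n l a b q t = (\<lambda>v. \<Prod>(s, ij)\<in>Sigma {0, 1, 2, 3} (box_set m n l). th (?\<alpha> s ij * v powi box_sgn s))"
    unfolding fun_eq_iff nfun_eq_prod[OF nz[THEN conjunct1] nz[THEN conjunct2, THEN conjunct1]
        nz[THEN conjunct2, THEN conjunct2, THEN conjunct1] nz[THEN conjunct2, THEN conjunct2, THEN conjunct2]]
    by (intro allI prod.Sigma) (use finite_box_set[OF l] in auto)
  ultimately show ?thesis by (simp only:)
qed

text \<open>The factors \<open>s\<close> and \<open>Suc s\<close> of a box are paired for even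
  \<open>s\<close>: their monomials differ by \<open>t powi (int n - 1)\<close>, so the multiplier
  of a pair is the same for every box.\<close>

lemma nfun_p:
  assumes g: "generic_params p a b q t" and l: "l \<in> partitions_in m n" and v: "v \<noteq> 0"
  shows "nfun m n l a b q t (p * v) = nfun m n l a b q t v * (1 / (p * v\<^sup>2 * t powi (int n - 1))) ^ (m * n)"
proof -
  have nz: "a \<noteq> 0" "b \<noteq> 0" "q \<noteq> 0" "t \<noteq> 0" using generic_nz[OF g] by auto
  let ?\<alpha> = "box_mon n a b q t" and ?k = "1 / (p * v\<^sup>2 * t powi (int n - 1))"
  have \<alpha>: "?\<alpha> s ij \<noteq> 0" for s ij using nz mon_nz by (simp add: box_mon_def)
  have ratio: "?\<alpha> (Suc s) ij = ?\<alpha> s ij / t powi (int n - 1)" if "even s" for s ij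
  proof -
    have "t powi (int n - 1) = mon a b q t 0 0 0 (int n - 1)" by (simp add: mon_def)
    moreover have "(Suc s < 2) = (s < 2)" using that by presburger
    ultimately show ?thesis using nz that by (simp add: box_mon_def mon_divide)
  qed
  have pair: "th (?\<alpha> s ij * (p * v)) * th (?\<alpha> (Suc s) ij * inverse (p * v)) =
      th (?\<alpha> s ij * v) * th (?\<alpha> (Suc s) ij * inverse v) * ?k" if "even s" for s ij
  proof -
    have "th (?\<alpha> s ij * (p * v)) = - th (?\<alpha> s ij * v) / (?\<alpha> s ij * v)"
      using theta_p_mult[of "?\<alpha> s ij * v"] \<alpha> v by (simp add: mult_ac)
    moreover have "th (?\<alpha> (Suc s) ij * inverse (p * v)) = - (?\<alpha> (Suc s) ij / v / p) * th (?\<alpha> (Suc s) ij * inverse v)"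
      using theta_div_p[of "?\<alpha> (Suc s) ij / v"] \<alpha> v by (simp add: divide_inverse mult_ac)
    ultimately have "th (?\<alpha> s ij * (p * v)) * th (?\<alpha> (Suc s) ij * inverse (p * v)) =
        (- th (?\<alpha> s ij * v) / (?\<alpha> s ij * v)) * (- (?\<alpha> s ij / t powi (int n - 1) / v / p) * th (?\<alpha> (Suc s) ij * inverse v))"
      by (simp only: ratio[OF that])
    also have "\<dots> = th (?\<alpha> s ij * v) * th (?\<alpha> (Suc s) ij * inverse v) * ?k"
      using \<alpha>[of s ij] v nz by (simp add: field_simps power2_eq_square)
    finally show ?thesis .
  qed
  have N: "nfun m n l a b q t w = (\<Prod>ij\<in>diagram l. th (?\<alpha> 0 ij * w) * th (?\<alpha> (Suc 0) ij * inverse w)) *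
      (\<Prod>ij\<in>diagram (compl_part m n l). th (?\<alpha> 2 ij * w) * th (?\<alpha> (Suc 2) ij * inverse w))" for w
    unfolding nfun_eq_prod[OF nz] by (simp add: box_set_def box_sgn_def prod.distrib mult_ac)
  have e: "even (0::nat)" "even (2::nat)" by auto
  have "nfun m n l a b q t (p * v) = nfun m n l a b q t v * (?k ^ card (diagram l) * ?k ^ card (diagram (compl_part m n l)))"
    unfolding N pair[OF e(1)] pair[OF e(2)] prod.distrib[of _ "\<lambda>_. ?k"] by (simp only: prod_constant mult_ac)
  then show ?thesis unfolding power_add[symmetric] card_diagram_compl[OF l] .
qed

text \<open>The multiplier agrees with that of \<open>nfun_p\<close> because the product of all
  \<open>t ^ (n - i) * t ^ (n - i)\<close> equals that of all
  \<open>t ^ (n - i) * t ^ (i - 1)\<close>.\<close>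

lemma diag_p:
  assumes f: "f \<in> BC_theta m n p" and t: "t \<noteq> 0" and v: "v \<noteq> 0"
  shows "f (diag n (p * v) t) = f (diag n v t) * (1 / (p * v\<^sup>2 * t powi (int n - 1))) ^ (m * n)"
proof -
  have "diag n (p * v) t = (\<lambda>i\<in>{1..n}. p * diag n v t i)" by (auto simp: diag_def fun_eq_iff)
  then have "f (diag n (p * v) t) = f (diag n v t) * (\<Prod>i\<in>{1..n}. 1 / (p * (diag n v t i)\<^sup>2) ^ m)"
    using sep_BC1_p_all[OF BC_theta_sep[OF f] diag_torus[OF v t]] by simp
  also have "(\<Prod>i\<in>{1..n}. 1 / (p * (diag n v t i)\<^sup>2) ^ m) = (\<Prod>i\<in>{1..n}. 1 / (p * v\<^sup>2 * (t ^ (n - i) * t ^ (n - i)))) ^ m"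
    unfolding prod_power_distrib by (intro prod.cong) (auto simp: diag_def power_mult_distrib power2_eq_square power_one_over mult_ac)
  also have "(\<Prod>i\<in>{1..n}. 1 / (p * v\<^sup>2 * (t ^ (n - i) * t ^ (n - i)))) = (\<Prod>i\<in>{1..n}. 1 / (p * v\<^sup>2 * t powi (int n - 1)))"
  proof -
    have rev: "(\<Prod>i\<in>{1..n}. 1 / t ^ (i - 1)) = (\<Prod>i\<in>{1..n}. 1 / t ^ (n - i))"
      using prod_rev[of "\<lambda>i. 1 / t ^ (n - i)" n] by simp
    have "(\<Prod>i\<in>{1..n}. 1 / (p * v\<^sup>2 * (t ^ (n - i) * t ^ (n - i)))) =
        (\<Prod>i\<in>{1..n}. 1 / (p * v\<^sup>2)) * (\<Prod>i\<in>{1..n}. 1 / t ^ (n - i)) * (\<Prod>i\<in>{1..n}. 1 / t ^ (n - i))"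
      unfolding prod.distrib[symmetric] by (intro prod.cong) auto
    also have "\<dots> = (\<Prod>i\<in>{1..n}. 1 / (p * v\<^sup>2)) * (\<Prod>i\<in>{1..n}. 1 / t ^ (n - i)) * (\<Prod>i\<in>{1..n}. 1 / t ^ (i - 1))"
      by (simp only: rev)
    also have "\<dots> = (\<Prod>i\<in>{1..n}. 1 / (p * v\<^sup>2) * (1 / t ^ (n - i)) * (1 / t ^ (i - 1)))"
      by (simp only: prod.distrib)
    also have "\<dots> = (\<Prod>i\<in>{1..n}. 1 / (p * v\<^sup>2 * t powi (int n - 1)))"
    proof (rule prod.cong[OF refl])
      fix i assume i: "i \<in> {1..n}"
      have "int n - 1 = int ((n - i) + (i - 1))" using i by simp
      then have "t powi (int n - 1) = t ^ (n - i) * t ^ (i - 1)" by (simp only: power_int_of_nat power_add)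
      then show "1 / (p * v\<^sup>2) * (1 / t ^ (n - i)) * (1 / t ^ (i - 1)) = 1 / (p * v\<^sup>2 * t powi (int n - 1))" by simp
    qed
    finally show ?thesis .
  qed
  finally show ?thesis by (simp add: power_mult[symmetric] mult.commute[of m n])
qed

text \<open>Inverting all coordinates and reversing their order gives a progression of the same kind
  with another start. This yields the zeros attached to factors in \<open>1 / v\<close> from those
  attached to factors in \<open>v\<close>.\<close>

lemma diag_reflect:
  assumes f: "f \<in> BC_theta m n p" and t: "t \<noteq> 0" and v: "v \<noteq> 0" and n: "1 \<le> n"
  shows "f (diag n (1 / (v * t ^ (n - 1))) t) = f (diag n v t)"
proof -
  define \<sigma> :: "nat \<Rightarrow> int" where "\<sigma> = (\<lambda>i\<in>{1..n}. -1)"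
  have \<sigma>: "\<sigma> \<in> signs n" by (auto simp: \<sigma>_def signs_def)
  define \<pi> where "\<pi> i = (if i \<in> {1..n} then n + 1 - i else i)" for i
  have \<pi>: "\<pi> permutes {1..n}"
  proof (rule bij_imp_permutes)
    show "bij_betw \<pi> {1..n} {1..n}"
      by (rule bij_betw_byWitness[where f' = \<pi>]) (auto simp: \<pi>_def)
  qed (auto simp: \<pi>_def)
  have dt: "diag n v t \<in> torus n" using diag_torus v t by blast
  have "sgn_act n \<sigma> (diag n v t) \<circ> \<pi> = diag n (1 / (v * t ^ (n - 1))) t"
  proof (rule ext)
    fix i
    show "(sgn_act n \<sigma> (diag n v t) \<circ> \<pi>) i = diag n (1 / (v * t ^ (n - 1))) t i"
    proof (cases "i \<in> {1..n}")
      case True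
      have "t ^ (n - 1) = t ^ (n - i) * t ^ (i - 1)" using True by (simp flip: power_add)
      moreover have "n + 1 - i \<in> {1..n}" "n - (n + 1 - i) = i - 1" "\<pi> i = n + 1 - i" using True by (auto simp: \<pi>_def)
      ultimately show ?thesis
        using True v t unfolding comp_def by (simp only: sgn_act_def \<sigma>_def diag_def restrict_apply' power_int_minus1_right) (simp add: field_simps)
    qed (auto simp: sgn_act_def \<pi>_def diag_def)
  qed
  then show ?thesis
    using BC_theta_sym[OF f sgn_act_torus[OF dt] \<pi>] sep_BC1_flip[OF BC_theta_sep[OF f] dt \<sigma>] by metis
qed

lemma diag_p_powi_zero:
  assumes f: "f \<in> BC_theta m n p" and t: "t \<noteq> 0" and v: "v \<noteq> 0" and zero: "f (diag n v t) = 0"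
  shows "f (diag n (p powi k * v) t) = 0"
proof (induction k rule: int_induct[where k = 0])
  case base
  then show ?case using zero by simp
next
  case (step1 i)
  have eq: "p powi (i + 1) * v = p * (p powi i * v)" by (simp add: power_int_add mult_ac)
  have nz: "p powi i * v \<noteq> 0" using v by simp
  show ?case unfolding eq diag_p[OF f t nz] step1(2) by simp
next
  case (step2 i)
  have eq: "p powi i * v = p * (p powi (i - 1) * v)" by (simp add: power_int_diff)
  have nz: "p powi (i - 1) * v \<noteq> 0" using v by simp
  show ?case using step2(2) v t unfolding eq diag_p[OF f t nz] by simp
qed

text \<open>Modulo powers of \<open>p\<close> each zero of \<open>nfun\<close> is a point
  \<open>dzero\<close>, for even \<open>s\<close>, or the reflection of one, for odd
  \<open>s\<close>.\<close>

lemma nfun_zero_imp: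
  assumes g: "generic_params p a b q t" and l: "l \<in> partitions_in m n" and f: "f \<in> interp_space m n l a b q t"
    and v: "v \<noteq> 0" and zero: "nfun m n l a b q t v = 0"
  shows "f (diag n v t) = 0"
proof -
  have nz: "a \<noteq> 0" "b \<noteq> 0" "q \<noteq> 0" "t \<noteq> 0" using generic_nz[OF g] by auto
  let ?\<alpha> = "box_mon n a b q t"
  have \<alpha>: "?\<alpha> s ij \<noteq> 0" for s ij using nz mon_nz by (simp add: box_mon_def)
  note fB = interp_spaceD(1)[OF f]
  obtain s ij where s: "s \<in> {0, 1, 2, 3::nat}" "ij \<in> box_set m n l s" "th (?\<alpha> s ij * v powi box_sgn s) = 0"
    using zero finite_box_set[OF l] unfolding nfun_eq_prod[OF nz] by (auto simp: prod_zero_iff)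
  obtain i j where ij: "ij = (i, j)" by fastforce
  define u where "u = (if s < 2 then a else b)"
  have u: "u \<noteq> 0" using nz by (simp add: u_def)
  have box: "i \<in> {1..n}" "1 \<le> j" "s < 2 \<Longrightarrow> j \<le> l i" "\<not> s < 2 \<Longrightarrow> j \<le> compl_part m n l i"
    using s(2) unfolding ij box_set_def
    by (auto simp: diagram_eq_Sigma[OF l] diagram_eq_Sigma[OF compl_part_in[OF l]] split: if_splits)
  have z0: "f (diag n (dzero n u q t i j) t) = 0"
    using diag_zeros[OF g l f box(1,2)] box(3,4) by (auto simp: u_def)
  have dz: "dzero n u q t i j \<noteq> 0" using u nz by (simp add: dzero_def)
  have pw: "q powi (int j - 1) = q ^ (j - 1)" "t powi (int n - int i) = t ^ (n - i)"
    using box(1,2) by (simp_all add: power_int_of_nat[symmetric] of_nat_diff del: power_int_of_nat)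
  have pz: "?\<alpha> s (i, j) * v powi box_sgn s \<in> pz" using s(3) \<alpha> v by (simp add: ij theta_eq_0_iff)
  then obtain k where k: "?\<alpha> s (i, j) * v powi box_sgn s = p powi k" by (auto simp: pz_def)
  show ?thesis
  proof (cases "even s")
    case True
    have "?\<alpha> s (i, j) = u * q ^ (j - 1) * t ^ (n - i)"
      using True by (simp add: box_mon_def mon_def u_def pw)
    then have "v = p powi k * dzero n u q t i j"
      using k True u nz by (simp add: box_sgn_def dzero_def field_simps)
    then show ?thesis using diag_p_powi_zero[OF fB nz(4) dz z0] by simp
  next
    case False
    have "t powi (1 - int i) * t ^ (n - 1) = t powi (1 - int i) * t powi (int n - 1)"
      using box(1) by (simp add: power_int_of_nat[symmetric] of_nat_diff del: power_int_of_nat)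
    also have "\<dots> = t ^ (n - i)" using nz by (simp add: power_int_add[symmetric] pw)
    finally have tt: "t powi (1 - int i) * t ^ (n - 1) = t ^ (n - i)" .
    \<comment> \<open>The zero in \<open>v\<close> of the factor of this box in
      \<open>u / v\<close>; its reflection is \<open>dzero n u q t i j\<close>.\<close>
    define w where "w = u * q ^ (j - 1) * t powi (1 - int i)"
    have w0: "w \<noteq> 0" using u nz by (simp add: w_def)
    have "w * t ^ (n - 1) = u * q ^ (j - 1) * t ^ (n - i)"
      unfolding w_def mult.assoc tt ..
    then have "f (diag n w t) = 0"
      using diag_reflect[OF fB nz(4) w0] z0 box(1) by (simp add: dzero_def)
    moreover have "?\<alpha> s (i, j) = w"
      using False by (simp add: box_mon_def mon_def u_def w_def pw)
    then have "v = p powi (- k) * w"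
      using k False v by (simp add: box_sgn_def power_int_minus field_simps)
    ultimately show ?thesis using diag_p_powi_zero[OF fB nz(4) w0] by simp
  qed
qed

lemma eventually_eq_imp_eq:
  fixes f h :: "complex \<Rightarrow> complex"
  assumes "isCont f w" "isCont h w" "eventually (\<lambda>z. f z = h z) (at w)"
  shows "f w = h w"
proof -
  have "eventually (\<lambda>z. h z = f z) (at w)" using assms(3) by eventually_elim simp
  then have "(f \<longlongrightarrow> h w) (at w)"
    by (rule Lim_transform_eventually[OF assms(2)[unfolded isCont_def]])
  then show ?thesis using assms(1) unfolding isCont_def by (intro tendsto_unique[of "at w"]) auto
qed

lemma diag_proportional:
  assumes g: "generic_params p a b q t" and l: "l \<in> partitions_in m n" and f: "f \<in> interp_space m n l a b q t"
  shows "\<exists>C. \<forall>v. v \<noteq> 0 \<longrightarrow> f (diag n v t) = C * nfun m n l a b q t v"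
proof -
  have nz: "a \<noteq> 0" "b \<noteq> 0" "q \<noteq> 0" "t \<noteq> 0" using generic_nz[OF g] by auto
  note fB = interp_spaceD(1)[OF f]
  let ?N = "nfun m n l a b q t"
  have sz: "simple_zeros ?N" by (rule nfun_simple_zeros[OF g l])
  obtain h where h: "h holomorphic_on - {0}" "\<And>z. z \<noteq> 0 \<Longrightarrow> f (diag n z t) = ?N z * h z"
    using simple_zeros_divide[OF sz holomorphic_diag[OF fB nz(4)]] nfun_zero_imp[OF g l f] by metis
  \<comment> \<open>Both functions have the same multiplier, which cancels where \<open>?N\<close>
    is nonzero; at zeros of \<open>?N\<close> the equality follows by continuity.\<close>
  have "h (p * v) = h v" if v: "v \<noteq> 0" for v
  proof (rule eventually_eq_imp_eq[where f = "\<lambda>z. h (p * z)" and h = h])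
    show "isCont h v" by (rule holo_punctured_isCont[OF h(1) v])
    have "isCont h (p * v)" by (rule holo_punctured_isCont[OF h(1)]) (use v in simp)
    then show "isCont (\<lambda>z. h (p * z)) v"
      by (intro isCont_o2[where f = "\<lambda>z. p * z" and g = h]) (auto intro!: continuous_intros)
    have "eventually (\<lambda>z. ?N z \<noteq> 0) (at v)" using sz v by (simp add: simple_zeros_def)
    moreover have "eventually (\<lambda>z. z \<noteq> 0) (at v)"
      using t1_space_nhds[OF v] by (auto simp: eventually_at_filter elim: eventually_mono)
    ultimately show "eventually (\<lambda>z. h (p * z) = h z) (at v)"
    proof eventually_elim
      case (elim z)
      let ?k = "(1 / (p * z\<^sup>2 * t powi (int n - 1))) ^ (m * n)"
      have "?N z * ?k * h (p * z) = ?N z * h z * ?k"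
      proof -
        have "?N z * ?k * h (p * z) = f (diag n (p * z) t)"
          using h(2)[of "p * z"] elim(2) unfolding nfun_p[OF g l elim(2)] by simp
        then show ?thesis unfolding diag_p[OF fB nz(4) elim(2)] h(2)[OF elim(2)] .
      qed
      moreover have "?k \<noteq> 0"
      proof (rule power_not_zero)
        show "1 / (p * z\<^sup>2 * t powi (int n - 1)) \<noteq> 0" using elim nz by simp
      qed
      ultimately have "(?N z * ?k) * h (p * z) = (?N z * ?k) * h z" by (simp only: mult_ac)
      then show ?case using \<open>?k \<noteq> 0\<close> elim(1) mult_cancel_left mult_eq_0_iff by metis
    qed
  qed
  then obtain C where C: "\<And>z. z \<noteq> 0 \<Longrightarrow> h z = C" using periodic_const[OF h(1)] by blast
  show ?thesis using h(2) C by (intro exI[of _ C]) (simp add: mult.commute)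
qed

lemma is_interp_theta_iff:
  "is_interp_theta m n l a b q t p f \<longleftrightarrow>
    f \<in> interp_space m n l a b q t \<and> (\<forall>v. v \<noteq> 0 \<longrightarrow> f (diag n v t) = nfun m n l a b q t v)"
  unfolding is_interp_theta_def interp_space_def node_set_def diag_def nfun_def by auto

text \<open>Dividing by the constant of \<open>diag_proportional\<close> normalizes any nonzero
  member of the line; that constant is nonzero by \<open>diag_zero_imp_zero\<close>, which also
  gives uniqueness. Hence the definite description denotes.\<close>

lemma is_interp_theta_interp_theta:
  assumes g: "generic_params p a b q t" and l: "l \<in> partitions_in m n"
  shows "is_interp_theta m n l a b q t p (interp_theta m n l a b q t p)"
proof -
  have "\<exists>!f. is_interp_theta m n l a b q t p f"
  proof (rule ex_ex1I)
    obtain f where f: "f \<in> interp_space m n l a b q t" "f (full_pt m n l a b q t) \<noteq> 0"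
      using interp_space_nontrivial[OF g l] by blast
    obtain C where C: "\<And>v. v \<noteq> 0 \<Longrightarrow> f (diag n v t) = C * nfun m n l a b q t v"
      using diag_proportional[OF g l f(1)] by blast
    have "C \<noteq> 0"
      using diag_zero_imp_zero[OF g l f(1) _ full_pt_torus[OF g]] C f(2) by (metis mult_zero_left)
    then have "is_interp_theta m n l a b q t p (\<lambda>x\<in>torus n. 1 / C * f x)"
      unfolding is_interp_theta_iff
      using interp_space_scale[OF g f(1), of "1 / C"] C diag_torus generic_nz[OF g] by auto
    then show "\<exists>f. is_interp_theta m n l a b q t p f" by blast
  next
    fix f h assume f: "is_interp_theta m n l a b q t p f" and h: "is_interp_theta m n l a b q t p h"
    have sp: "f \<in> interp_space m n l a b q t" "h \<in> interp_space m n l a b q t"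
      using f h by (auto simp: is_interp_theta_iff)
    have "(\<lambda>x\<in>torus n. f x - 1 * h x) x = 0" if "x \<in> torus n" for x
      by (rule diag_zero_imp_zero[OF g l interp_space_diff[OF g sp] _ that])
        (use f h diag_torus generic_nz[OF g] in \<open>auto simp: is_interp_theta_iff\<close>)
    then have "f x = h x" if "x \<in> torus n" for x using that by simp
    then show "f = h"
      using BC_theta_ext[OF interp_spaceD(1)[OF sp(1)]] BC_theta_ext[OF interp_spaceD(1)[OF sp(2)]]
      by (intro extensionalityI) auto
  qed
  then show ?thesis unfolding interp_theta_def by (rule theI')
qed

section \<open>Comparison of the constants\<close>

lemma prod_shift:
  fixes T :: "nat \<Rightarrow> 'a::comm_monoid_mult"
  shows "(\<Prod>j\<in>{1..L}. T j) * T 0 = (\<Prod>j\<in>{1..L}. T (j - 1)) * T L"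
proof (induction L)
  case (Suc L)
  have "(\<Prod>j\<in>{1..Suc L}. T j) * T 0 = ((\<Prod>j\<in>{1..L}. T j) * T 0) * T (Suc L)" by (simp add: mult_ac)
  also have "\<dots> = ((\<Prod>j\<in>{1..L}. T (j - 1)) * T L) * T (Suc L)" unfolding Suc ..
  finally show ?case by simp
qed simp

text \<open>Multiplying the argument by \<open>q\<close> moves each row of theta factors one place
  on, so only the first and the last factor of a row are exchanged.\<close>

lemma C0_shift:
  assumes l: "l \<in> partitions_in m n" and q: "q \<noteq> 0"
  shows "C0 l (q * x) q t p * (\<Prod>i\<in>{1..n}. th (t powi (1 - int i) * x)) =
    C0 l x q t p * (\<Prod>i\<in>{1..n}. th (q ^ l i * (t powi (1 - int i) * x)))"
proof -
  have C0: "C0 l y q t p = (\<Prod>i\<in>{1..n}. \<Prod>j\<in>{1..l i}. th (q powi (int j - 1) * t powi (1 - int i) * y))" for y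
    unfolding C0_def diagram_eq_Sigma[OF l] by (subst prod.Sigma) auto
  show ?thesis
    unfolding C0 prod.distrib[symmetric]
  proof (rule prod.cong[OF refl])
    fix i
    define T where "T j = th (q ^ j * (t powi (1 - int i) * x))" for j
    have 1: "(\<Prod>j\<in>{1..l i}. th (q powi (int j - 1) * t powi (1 - int i) * (q * x))) = (\<Prod>j\<in>{1..l i}. T j)"
    proof (rule prod.cong[OF refl])
      fix j assume "j \<in> {1..l i}"
      then obtain k where "j = Suc k" by (cases j) auto
      then show "th (q powi (int j - 1) * t powi (1 - int i) * (q * x)) = T j" by (simp add: T_def mult_ac)
    qed
    have 2: "(\<Prod>j\<in>{1..l i}. th (q powi (int j - 1) * t powi (1 - int i) * x)) = (\<Prod>j\<in>{1..l i}. T (j - 1))"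
    proof (rule prod.cong[OF refl])
      fix j assume "j \<in> {1..l i}"
      then obtain k where "j = Suc k" by (cases j) auto
      then show "th (q powi (int j - 1) * t powi (1 - int i) * x) = T (j - 1)" by (simp add: T_def mult_ac)
    qed
    show "(\<Prod>j\<in>{1..l i}. th (q powi (int j - 1) * t powi (1 - int i) * (q * x))) * th (t powi (1 - int i) * x) =
        (\<Prod>j\<in>{1..l i}. th (q powi (int j - 1) * t powi (1 - int i) * x)) * th (q ^ l i * (t powi (1 - int i) * x))"
      unfolding 1 2 using prod_shift[of T "l i"] by (simp add: T_def)
  qed
qed

text \<open>In the products with \<open>u * c\<close> the two factors \<open>sq\<close> combine to
  \<open>q\<close>, so \<open>C0_shift\<close> applies; in those with \<open>u / c\<close> they
  cancel. The rows of the complement are read backwards to match \<open>eig\<close>.\<close>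

lemma nfun_shift:
  assumes g: "generic_params p a b q t" and l: "l \<in> partitions_in m n" and sq: "sq\<^sup>2 = q" and c: "c \<noteq> 0"
  shows "(\<Prod>i\<in>{1..n}. th (a * c * t ^ (n - i)) * th (b * c * t ^ (n - i))) * nfun m n l (sq * a) (sq * b) q t (sq * c) =
    eig m n l a b c q t * nfun m n l a b q t c"
proof -
  have nz: "a \<noteq> 0" "b \<noteq> 0" "q \<noteq> 0" "t \<noteq> 0" using generic_nz[OF g] by auto
  have sq0: "sq \<noteq> 0" using sq nz by auto
  let ?\<kappa> = "compl_part m n l"
  have \<kappa>: "?\<kappa> \<in> partitions_in m n" by (rule compl_part_in[OF l])
  define Y where "Y u = t powi (int n - 1) * u * c" for u
  have tY: "t powi (1 - int i) * Y u = u * c * t ^ (n - i)" if i: "i \<in> {1..n}" for i u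
  proof -
    have "t powi (1 - int i) * t powi (int n - 1) = t powi (int n - int i)"
      using nz by (simp add: power_int_add[symmetric])
    also have "\<dots> = t ^ (n - i)" using i by (simp add: power_int_of_nat[symmetric] of_nat_diff del: power_int_of_nat)
    finally show ?thesis by (simp add: Y_def mult_ac flip: mult.assoc[of "t powi (1 - int i)"])
  qed
  have shift: "C0 \<mu> (q * Y u) q t p * (\<Prod>i\<in>{1..n}. th (u * c * t ^ (n - i))) =
      C0 \<mu> (Y u) q t p * (\<Prod>i\<in>{1..n}. th (u * c * q ^ \<mu> i * t ^ (n - i)))" if "\<mu> \<in> partitions_in m n" for \<mu> u
  proof -
    have "(\<Prod>i\<in>{1..n}. th (t powi (1 - int i) * Y u)) = (\<Prod>i\<in>{1..n}. th (u * c * t ^ (n - i)))"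
      by (intro prod.cong) (simp_all add: tY)
    moreover have "(\<Prod>i\<in>{1..n}. th (q ^ \<mu> i * (t powi (1 - int i) * Y u))) = (\<Prod>i\<in>{1..n}. th (u * c * q ^ \<mu> i * t ^ (n - i)))"
    proof (rule prod.cong[OF refl])
      fix i assume "i \<in> {1..n}"
      then show "th (q ^ \<mu> i * (t powi (1 - int i) * Y u)) = th (u * c * q ^ \<mu> i * t ^ (n - i))"
        unfolding tY[OF \<open>i \<in> {1..n}\<close>] by (simp only: mult_ac)
    qed
    ultimately show ?thesis using C0_shift[OF that nz(3), of "Y u" t] by simp
  qed
  have rev: "(\<Prod>i\<in>{1..n}. th (b * c * q ^ ?\<kappa> i * t ^ (n - i))) = (\<Prod>i\<in>{1..n}. th (b * c * q ^ (m - l i) * t ^ (i - 1)))"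
  proof -
    have "(\<Prod>i\<in>{1..n}. th (b * c * q ^ ?\<kappa> i * t ^ (n - i))) =
        (\<Prod>i\<in>{1..n}. (\<lambda>i. th (b * c * q ^ (m - l i) * t ^ (i - 1))) (n + 1 - i))"
      by (intro prod.cong) (auto simp: compl_part_def)
    also have "\<dots> = (\<Prod>i\<in>{1..n}. th (b * c * q ^ (m - l i) * t ^ (i - 1)))" by (rule prod_rev)
    finally show ?thesis .
  qed
  have arg: "t powi (int n - 1) * (sq * u) * (sq * c) = q * Y u" "(sq * u) / (sq * c) = u / c" for u
    using sq0 by (simp_all add: Y_def sq[symmetric] power2_eq_square mult_ac)
  let ?A = "\<Prod>i\<in>{1..n}. th (a * c * t ^ (n - i))" and ?B = "\<Prod>i\<in>{1..n}. th (b * c * t ^ (n - i))"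
  have "(\<Prod>i\<in>{1..n}. th (a * c * t ^ (n - i)) * th (b * c * t ^ (n - i))) * nfun m n l (sq * a) (sq * b) q t (sq * c) =
      (C0 l (q * Y a) q t p * ?A) * (C0 ?\<kappa> (q * Y b) q t p * ?B) * (C0 l (a / c) q t p * C0 ?\<kappa> (b / c) q t p)"
    unfolding nfun_def arg prod.distrib by (simp only: mult_ac)
  also have "\<dots> = eig m n l a b c q t * nfun m n l a b q t c"
    unfolding shift[OF l] shift[OF \<kappa>] rev unfolding nfun_def eig_def prod.distrib Y_def by (simp only: mult_ac)
  finally show ?thesis .
qed

lemma nfun_generic_nz:
  assumes g: "generic_params p a b q t" and l: "l \<in> partitions_in m n" and c: "generic_over c a b q t"
  shows "nfun m n l a b q t c \<noteq> 0"
proof -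
  have nz: "a \<noteq> 0" "b \<noteq> 0" "q \<noteq> 0" "t \<noteq> 0" "c \<noteq> 0"
    using generic_nz[OF g] c by (auto simp: generic_over_def)
  have "th (box_mon n a b q t s ij * c powi box_sgn s) \<noteq> 0" for s ij
  proof -
    have "box_mon n a b q t s ij * c powi box_sgn s = mon5 c a b q t (box_sgn s) (if s < 2 then 1 else 0)
      (if s < 2 then 0 else 1) (int (snd ij) - 1) (if even s then int n - int (fst ij) else 1 - int (fst ij))"
      by (simp add: box_mon_def mon5_def mult.commute)
    moreover have "box_sgn s \<noteq> 0" by (simp add: box_sgn_def)
    moreover have "box_mon n a b q t s ij * c powi box_sgn s \<noteq> 0" using nz mon_nz by (simp add: box_mon_def)
    ultimately show ?thesis using generic5_pz[OF g c] by (simp add: theta_eq_0_iff)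
  qed
  then show ?thesis
    unfolding nfun_eq_prod[OF nz(1-4)] using finite_box_set[OF l] by (simp add: prod_zero_iff)
qed

text \<open>A zero at the full point would make \<open>f\<close> vanish identically, against the
  nonvanishing of the prescribed value at a generic point.\<close>

lemma interp_theta_full_pt_nz:
  assumes g: "generic_params p a b q t" and l: "l \<in> partitions_in m n" and f: "is_interp_theta m n l a b q t p f"
  shows "f (full_pt m n l a b q t) \<noteq> 0"
proof
  assume zero: "f (full_pt m n l a b q t) = 0"
  obtain c where c: "generic_over c a b q t" by (rule generic_over_exists[OF g])
  then have c0: "c \<noteq> 0" by (simp add: generic_over_def)
  have "f (diag n c t) = 0"
  proof (rule interp_space_determined[where f = f, OF g l])
    show "f \<in> interp_space m n l a b q t" using f by (simp add: is_interp_theta_iff)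
  qed (use zero diag_torus[OF c0] generic_nz[OF g] in simp_all)
  then show False using nfun_generic_nz[OF g l c] f c0 by (simp add: is_interp_theta_iff)
qed

text \<open>Only the constant \<open>K\<close> is left. At one generic point of the principal
  specialization both sides of the functional equation are explicit, and by
  \<open>nfun_shift\<close> everything but the product in \<open>a * b\<close> cancels.\<close>

lemma diff_op_interp_theta:
  assumes sq: "sq\<^sup>2 = q" and g: "generic_params p a b q t" and l: "l \<in> partitions_in m n"
    and bal: "balanced m n a b c d q t" and x: "x \<in> torus n" "diff_op_regular n p x"
  shows "diff_op n a b c d sq t p (interp_theta m n l (sq * a) (sq * b) q t p) x =
    (\<Prod>i\<in>{1..n}. th (a * b * q ^ m * t ^ (n - i)) * th (a * c * q ^ l i * t ^ (n - i)) *
      th (b * c * q ^ (m - l i) * t ^ (i - 1))) * interp_theta m n l a b q t p x"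
proof -
  have g1: "generic_params p (sq * a) (sq * b) q t" by (rule generic_sqrt(1)[OF g sq])
  have sq0: "sq \<noteq> 0" using sq generic_nz[OF g] by auto
  let ?f = "interp_theta m n l (sq * a) (sq * b) q t p" and ?h = "interp_theta m n l a b q t p"
  have fi: "is_interp_theta m n l (sq * a) (sq * b) q t p ?f" by (rule is_interp_theta_interp_theta[OF g1 l])
  have hi: "is_interp_theta m n l a b q t p ?h" by (rule is_interp_theta_interp_theta[OF g l])
  have f: "?f \<in> interp_space m n l (sq * a) (sq * b) q t" "\<And>v. v \<noteq> 0 \<Longrightarrow> ?f (diag n v t) = nfun m n l (sq * a) (sq * b) q t v"
    using fi by (auto simp: is_interp_theta_iff)
  have h: "?h \<in> interp_space m n l a b q t" "\<And>v. v \<noteq> 0 \<Longrightarrow> ?h (diag n v t) = nfun m n l a b q t v"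
    using hi by (auto simp: is_interp_theta_iff)
  let ?T = "\<Prod>i\<in>{1..n}. th (a * b * q ^ m * t ^ (i - 1))"
  obtain K where K: "K \<noteq> 0"
      "\<forall>c. diag_ok c t \<longrightarrow> K * eig m n l a b c q t * ?h (diag n c t) =
        (\<Prod>i\<in>{1..n}. th (a * b * q ^ m * t ^ (i - 1)) * th (a * c * t ^ (n - i)) * th (b * c * t ^ (n - i))) *
        ?f (diag n (sq * c) t)"
      "\<forall>c d x. balanced m n a b c d q t \<longrightarrow> x \<in> torus n \<longrightarrow> diff_op_regular n p x \<longrightarrow>
        diff_op n a b c d sq t p ?f x = K * eig m n l a b c q t * ?h x"
    using diag_functional_equation[OF g sq l f(1) interp_theta_full_pt_nz[OF g1 l fi] h(1)
        interp_theta_full_pt_nz[OF g l hi]] by (elim exE conjE)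
  have "K = ?T"
  proof -
    obtain e where e: "generic_over e a b q t" by (rule generic_over_exists[OF g])
    then have e0: "e \<noteq> 0" by (simp add: generic_over_def)
    have "K * (eig m n l a b e q t * nfun m n l a b q t e) =
        (\<Prod>i\<in>{1..n}. th (a * b * q ^ m * t ^ (i - 1)) * th (a * e * t ^ (n - i)) * th (b * e * t ^ (n - i))) *
        nfun m n l (sq * a) (sq * b) q t (sq * e)"
      using K(2)[rule_format, OF generic_over_diag_ok[OF g e]] f(2)[of "sq * e"] h(2)[OF e0] e0 sq0 by (simp add: mult.assoc)
    also have "\<dots> = ?T * ((\<Prod>i\<in>{1..n}. th (a * e * t ^ (n - i)) * th (b * e * t ^ (n - i))) * nfun m n l (sq * a) (sq * b) q t (sq * e))"
      by (simp only: prod.distrib mult.assoc)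
    also have "\<dots> = ?T * (eig m n l a b e q t * nfun m n l a b q t e)"
      unfolding nfun_shift[OF g l sq e0] ..
    finally show ?thesis
      using generic_over_eig[OF g] e e0 nfun_generic_nz[OF g l e] by simp
  qed
  moreover have "?T = (\<Prod>i\<in>{1..n}. th (a * b * q ^ m * t ^ (n - i)))"
    using prod_rev[of "\<lambda>i. th (a * b * q ^ m * t ^ (n - i))" n] by simp
  moreover have "diff_op n a b c d sq t p ?f x = K * eig m n l a b c q t * ?h x"
    by (rule K(3)[rule_format, OF bal x])
  ultimately show ?thesis by (simp only: eig_def prod.distrib mult.assoc)
qed

end

theorem theorem3p1:
  fixes p q sq t a b c d :: complex and m n :: nat and l :: "nat \<Rightarrow> nat"
  assumes "0 < norm p" and "norm p < 1"
    and "sq\<^sup>2 = q"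
    and "generic_params p a b q t"
    and "l \<in> partitions_in m n"
    and "c \<noteq> 0" and "d \<noteq> 0"
    and "q ^ m * t powi (int n - 1) * a * b * c * d = p"
  shows "\<forall>x\<in>torus n. diff_op_regular n p x \<longrightarrow>
    diff_op n a b c d sq t p (interp_theta m n l (sq * a) (sq * b) q t p) x =
      (\<Prod>i\<in>{1..n}.
        theta (a * b * q ^ m * t ^ (n - i)) p *
        theta (a * c * q ^ l i * t ^ (n - i)) p *
        theta (b * c * q ^ (m - l i) * t ^ (i - 1)) p) *
      interp_theta m n l a b q t p x"
proof -
  interpret nome p using assms(1,2) by unfold_locales
  show ?thesis
    using diff_op_interp_theta[OF assms(3,4,5)] assms(6-8) by (auto simp: balanced_def)
qed

end
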